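(* Let $X$ be a compact connected abelian group of finite dimension $d\geqslant 1$ and let $\theta:X\to X$ be an ergodic (continuous group) automorphism. Let $\mathbb{K}_1,\dots,\mathbb{K}_k$ be the algebraic number fields, $\xi_j\in\mathbb{K}_j$ the elements, and $T_j$ the sets of finite places of $\mathbb{K}_j$ attached to $(X,\theta)$ as described in the context, so that no $\xi_j$ is a root of unity, $|\xi_j|_v=1$ for all $v\in T_j$, and $\mathsf{F}_\theta(n)=\prod_{j=1}^k|\xi_j^n-1|_{T_j}^{-1}$ for all $n\geqslant 1$. Let $P_j^\infty$ be the set of infinite places of $\mathbb{K}_j$ and let $S_j$ be the set of finite places of $\mathbb{K}_j$ not in $T_j$, so that by the Artin product formula \[ \mathsf{F}_\theta(n)=\prod_{j=1}^{k}|\xi_j^n-1|_{P_j^\infty\cup S_j}\qquad(n\geqslant 1). \] Suppose that this last product involves only finitely many places (that is, every $S_j$ is finite) and that $|\xi_j|_v\neq 1$ for all $v\in P_j^\infty$ and all $j=1,\dots,k$. Then $\zeta_\theta$ is either rational or has a natural boundary at its circle of convergence, and the latter occurs if and only if $|\xi_j|_v=1$ for some $j$ with $1\leqslant j\leqslant k$ and some $v\in S_j$.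
   Context: For an automorphism $\theta$ of $X$, $\mathsf{F}_\theta(n)=|\{x\in X:\theta^n x=x\}|$ and $\zeta_\theta(z)=\exp\sum_{n\geqslant 1}\frac{\mathsf{F}_\theta(n)}{n}z^n$. A compact connected abelian group has dimension $d$ if its Pontryagin dual $\widehat X$ is isomorphic to a subgroup of $\mathbb{Q}^d$ of rank $d$. For a number field $\mathbb{K}$ the absolute values $|\cdot|_v$ are normalized so that the Artin product formula holds: $|x|_v=(\text{size of the residue field})^{-\mathrm{ord}_v(x)}$ for finite $v$, the usual absolute value for real $v$, and the square of the usual absolute value for complex $v$. For a set $S$ of places, $|x|_S=\prod_{v\in S}|x|_v$. Attached data. Regard $\widehat X$ as a module over $\mathbb{Z}[t^{\pm1}]$, with $t$ acting as the dual automorphism $\widehat\theta$. Then $\mathbb{Q}\otimes_{\mathbb{Z}}\widehat X$ is a $\mathbb{Q}[t^{\pm1}]$-module of $\mathbb{Q}$-dimension $d$; the fields $\mathbb{K}_1,\dots,\mathbb{K}_k$ are its composition factors $\mathbb{Q}[t^{\pm 1}]/(f_j)$ (listed with multiplicity), and $\xi_j\in\mathbb{K}_j$ is the image of $t$, so $\mathbb{K}_j=\mathbb{Q}(\xi_j)$. By a known theorem (R. Miles), for ergodic $\theta$ no $\xi_j$ is a root of unity, and there are sets $T_j$ of finite places of $\mathbb{K}_j$ with $|\xi_j|_v=1$ for all $v\in T_j$ such that $\mathsf{F}_\theta(n)=\prod_{j=1}^k|\xi_j^n-1|_{T_j}^{-1}$ for all $n\geqslant1$ (in particular these numbers are finite).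 A power series has a natural boundary at its circle of convergence if it has no analytic continuation to any connected open set properly containing its open disc of convergence (equivalently, every point of the circle of convergence is a singularity). *)

theory Defs
  imports
    "HOL-Complex_Analysis.Complex_Analysis"
    "HOL-Probability.Probability"
    "HOL-Algebra.Free_Abelian_Groups"
    "HOL-Library.Function_Algebras"
begin

definition top_group_automorphism ::
    "('a::topological_ab_group_add \<Rightarrow> 'a) \<Rightarrow> bool" where
  "top_group_automorphism \<theta> \<longleftrightarrow>
     (\<forall>x y. \<theta> (x + y) = \<theta> x + \<theta> y) \<and> homeomorphism UNIV UNIV \<theta> (inv_into UNIV \<theta>)"

definition haar_prob_measure :: "'a::topological_ab_group_add measure \<Rightarrow> bool" where
  "haar_prob_measure \<mu> \<longleftrightarrow>
     prob_space \<mu> \<and> sets \<mu> = sets borel \<and>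
     (\<forall>A\<in>sets borel. emeasure \<mu> A = (SUP C\<in>{C. compact C \<and> C \<subseteq> A}. emeasure \<mu> C)) \<and>
     (\<forall>a. \<forall>A\<in>sets borel. emeasure \<mu> ((+) a ` A) = emeasure \<mu> A)"

definition ergodic :: "'a measure \<Rightarrow> ('a \<Rightarrow> 'a) \<Rightarrow> bool" where
  "ergodic \<mu> \<theta> \<longleftrightarrow>
     (\<forall>A\<in>sets \<mu>. \<theta> -` A \<inter> space \<mu> = A \<longrightarrow> emeasure \<mu> A = 0 \<or> emeasure \<mu> A = 1)"

definition periodic_points :: "('a \<Rightarrow> 'a) \<Rightarrow> nat \<Rightarrow> 'a set" where
  "periodic_points \<theta> n = {x. (\<theta> ^^ n) x = x}"

definition dyn_zeta :: "('a \<Rightarrow> 'a) \<Rightarrow> complex fps" where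
  "dyn_zeta \<theta> = fps_exp 1 oo
     Abs_fps (\<lambda>n. if n = 0 then 0 else of_nat (card (periodic_points \<theta> n)) / of_nat n)"

definition rational_fps :: "complex fps \<Rightarrow> bool" where
  "rational_fps f \<longleftrightarrow> (\<exists>p q. q \<noteq> 0 \<and> f * fps_of_poly q = fps_of_poly p)"

text \<open>A circle of convergence is only available if the radius of convergence is
  positive and finite, so this is part of the definition.\<close>

definition has_natural_boundary :: "complex fps \<Rightarrow> bool" where
  "has_natural_boundary f \<longleftrightarrow>
     0 < fps_conv_radius f \<and> fps_conv_radius f < \<infinity> \<and>
     \<not> (\<exists>U g. open U \<and> connected U \<and> eball 0 (fps_conv_radius f) \<subset> U \<and>
          g holomorphic_on U \<and> (\<forall>z\<in>eball 0 (fps_conv_radius f). g z = eval_fps f z))"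

definition pontryagin_dual :: "('a::topological_ab_group_add \<Rightarrow> complex) monoid" where
  "pontryagin_dual =
     \<lparr>carrier = {\<gamma>. continuous_on UNIV \<gamma> \<and> (\<forall>x. cmod (\<gamma> x) = 1) \<and>
                    (\<forall>x y. \<gamma> (x + y) = \<gamma> x * \<gamma> y)},
      monoid.mult = (\<lambda>\<gamma> \<delta> x. \<gamma> x * \<delta> x),
      one = (\<lambda>x. 1)\<rparr>"

definition additive_group :: "'b::ab_group_add set \<Rightarrow> 'b monoid" where
  "additive_group A = \<lparr>carrier = A, monoid.mult = (+), one = 0\<rparr>"

text \<open>The space \<open>\<rat>\<^sup>d\<close> consists of the functions \<open>nat \<Rightarrow> rat\<close> that vanish from \<open>d\<close> on.
  The rank of a subgroup is the dimension of its rational span.\<close>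

definition rat_space :: "nat \<Rightarrow> (nat \<Rightarrow> rat) set" where
  "rat_space d = {x. \<forall>i\<ge>d. x i = 0}"

definition rat_rank :: "(nat \<Rightarrow> rat) set \<Rightarrow> nat" where
  "rat_rank H = vector_space.dim (\<lambda>c x i. c * x i) H"

definition has_group_dim :: "'a::topological_ab_group_add itself \<Rightarrow> nat \<Rightarrow> bool" where
  "has_group_dim _ d \<longleftrightarrow>
     (\<exists>H. subgroup H (additive_group (rat_space d)) \<and> rat_rank H = d \<and>
          (pontryagin_dual :: ('a \<Rightarrow> complex) monoid) \<cong> additive_group H)"

text \<open>The tensor product over the integers of \<open>\<rat>\<close> and an abelian group \<open>G\<close> is the free abelian
  group on \<open>\<rat> \<times> G\<close> modulo the subgroup generated by the biadditivity relations.\<close>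

definition rat_tensor_relations ::
    "('g, 'm) monoid_scheme \<Rightarrow> ((rat \<times> 'g) \<Rightarrow>\<^sub>0 int) set" where
  "rat_tensor_relations G =
     generate (free_Abelian_group (UNIV \<times> carrier G))
       ({frag_of (r + s, g) - frag_of (r, g) - frag_of (s, g) | r s g. g \<in> carrier G} \<union>
        {frag_of (r, g \<otimes>\<^bsub>G\<^esub> h) - frag_of (r, g) - frag_of (r, h) | r g h.
           g \<in> carrier G \<and> h \<in> carrier G})"

definition rat_tensor ::
    "('g, 'm) monoid_scheme \<Rightarrow> ((rat \<times> 'g) \<Rightarrow>\<^sub>0 int) set monoid" where
  "rat_tensor G = free_Abelian_group (UNIV \<times> carrier G) Mod rat_tensor_relations G"

text \<open>For an endomorphism \<open>\<alpha>\<close> of \<open>G\<close> this is the endomorphism of \<open>\<rat> \<otimes> G\<close> that maps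
  \<open>r \<otimes> g\<close> to \<open>(c * r) \<otimes> \<alpha> g\<close>. The cosets in the union all coincide, as
  the lifted map preserves the relations.\<close>

definition rat_tensor_map ::
    "('g, 'm) monoid_scheme \<Rightarrow> rat \<Rightarrow> ('g \<Rightarrow> 'g) \<Rightarrow>
     ((rat \<times> 'g) \<Rightarrow>\<^sub>0 int) set \<Rightarrow> ((rat \<times> 'g) \<Rightarrow>\<^sub>0 int) set" where
  "rat_tensor_map G c \<alpha> C =
     (\<Union>x\<in>C. rat_tensor_relations G #>\<^bsub>free_Abelian_group (UNIV \<times> carrier G)\<^esub>
        frag_extend (\<lambda>(r, g). frag_of (c * r, \<alpha> g)) x)"

text \<open>A \<open>\<rat>[t\<^sup>\<plusminus>\<^sup>1]\<close>-submodule of \<open>\<rat> \<otimes> G\<close>, where \<open>t\<close> acts as the automorphism \<open>\<alpha>\<close> of \<open>G\<close> and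
  \<open>\<beta>\<close> is the inverse of \<open>\<alpha>\<close>.\<close>

definition laurent_submodule ::
    "('g, 'm) monoid_scheme \<Rightarrow> ('g \<Rightarrow> 'g) \<Rightarrow> ('g \<Rightarrow> 'g) \<Rightarrow>
     ((rat \<times> 'g) \<Rightarrow>\<^sub>0 int) set set \<Rightarrow> bool" where
  "laurent_submodule G \<alpha> \<beta> W \<longleftrightarrow>
     subgroup W (rat_tensor G) \<and>
     (\<forall>w\<in>W. (\<forall>c. rat_tensor_map G c id w \<in> W) \<and>
             rat_tensor_map G 1 \<alpha> w \<in> W \<and> rat_tensor_map G 1 \<beta> w \<in> W)"

text \<open>The field \<open>\<rat>(\<xi>)\<close> inside an ambient field of characteristic zero.\<close>

definition rat_adjoin :: "'k::field_char_0 \<Rightarrow> 'k set" where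
  "rat_adjoin \<xi> = {poly (map_poly of_rat p) \<xi> / poly (map_poly of_rat q) \<xi> | p q. True}"

text \<open>There is a chain \<open>0 = V 0 \<subseteq> \<dots> \<subseteq> V k = \<rat> \<otimes> G\<close> of submodules such that
  \<open>V (j + 1) / V j\<close> is isomorphic as a \<open>\<rat>[t\<^sup>\<plusminus>\<^sup>1]\<close>-module to the number field \<open>\<rat>(\<xi> j)\<close> on which \<open>t\<close> acts as
  multiplication by \<open>\<xi> j\<close>, that is, to \<open>\<rat>[t\<^sup>\<plusminus>\<^sup>1]/(f)\<close> for the minimal polynomial \<open>f\<close> of \<open>\<xi> j\<close>,
  with \<open>\<xi> j\<close> corresponding to the image of \<open>t\<close>.\<close>

definition composition_factor_generators ::
    "('g, 'm) monoid_scheme \<Rightarrow> ('g \<Rightarrow> 'g) \<Rightarrow> ('g \<Rightarrow> 'g) \<Rightarrow>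
     nat \<Rightarrow> (nat \<Rightarrow> 'k::field_char_0) \<Rightarrow> bool" where
  "composition_factor_generators G \<alpha> \<beta> k \<xi> \<longleftrightarrow>
     (\<exists>V. V 0 = {\<one>\<^bsub>rat_tensor G\<^esub>} \<and> V k = carrier (rat_tensor G) \<and>
        (\<forall>j\<le>k. laurent_submodule G \<alpha> \<beta> (V j)) \<and>
        (\<forall>j<k. V j \<subseteq> V (Suc j) \<and> algebraic (\<xi> j) \<and>
           (\<exists>\<phi>\<in>iso ((rat_tensor G)\<lparr>carrier := V (Suc j)\<rparr> Mod V j)
                    (additive_group (rat_adjoin (\<xi> j))).
              \<forall>w\<in>V (Suc j).
                (\<forall>c. \<phi> (V j #>\<^bsub>rat_tensor G\<^esub> rat_tensor_map G c id w) =
                     of_rat c * \<phi> (V j #>\<^bsub>rat_tensor G\<^esub> w)) \<and>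
                \<phi> (V j #>\<^bsub>rat_tensor G\<^esub> rat_tensor_map G 1 \<alpha> w) =
                     \<xi> j * \<phi> (V j #>\<^bsub>rat_tensor G\<^esub> w))))"

text \<open>The fields and elements attached to \<open>(X, \<theta>)\<close>: \<open>t\<close> acts on the dual as \<open>\<gamma> \<mapsto> \<gamma> \<circ> \<theta>\<close>.\<close>

definition attached_generators ::
    "('a::topological_ab_group_add \<Rightarrow> 'a) \<Rightarrow> nat \<Rightarrow> (nat \<Rightarrow> 'k::field_char_0) \<Rightarrow> bool" where
  "attached_generators \<theta> k \<xi> \<longleftrightarrow>
     composition_factor_generators pontryagin_dual (\<lambda>\<gamma>. \<gamma> \<circ> \<theta>) (\<lambda>\<gamma>. \<gamma> \<circ> inv_into UNIV \<theta>) k \<xi>"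

text \<open>Let \<open>K\<close> be a subfield of an ambient field. A place of \<open>K\<close> is represented by its normalized absolute value
  \<open>|\<cdot>|\<^sub>v\<close>, extended by \<open>0\<close> outside \<open>K\<close>, so that equal places are equal functions. In particular,
  two conjugate complex embeddings yield a single infinite place.\<close>

definition complex_embeddings :: "'k::field_char_0 set \<Rightarrow> ('k \<Rightarrow> complex) set" where
  "complex_embeddings K =
     {\<sigma>. \<sigma> 1 = 1 \<and> (\<forall>x\<in>K. \<forall>y\<in>K. \<sigma> (x + y) = \<sigma> x + \<sigma> y \<and> \<sigma> (x * y) = \<sigma> x * \<sigma> y)}"

definition infinite_places :: "'k::field_char_0 set \<Rightarrow> ('k \<Rightarrow> real) set" where
  "infinite_places K =
     {(\<lambda>x. if x \<notin> K then 0
           else if \<sigma> ` K \<subseteq> \<real> then cmod (\<sigma> x) else (cmod (\<sigma> x))\<^sup>2) | \<sigma>. \<sigma> \<in> complex_embeddings K}"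

text \<open>The finite places of a number field correspond to its normalized discrete valuations
  \<open>ord\<^sub>v : K\<^sup>\<times> \<rightarrow> \<int>\<close>; the value of \<open>ord\<close> at \<open>0\<close> is irrelevant.\<close>

definition discrete_valuation :: "'k::field_char_0 set \<Rightarrow> ('k \<Rightarrow> int) \<Rightarrow> bool" where
  "discrete_valuation K ord \<longleftrightarrow>
     ord ` (K - {0}) = UNIV \<and>
     (\<forall>x\<in>K - {0}. \<forall>y\<in>K - {0}. ord (x * y) = ord x + ord y) \<and>
     (\<forall>x\<in>K - {0}. \<forall>y\<in>K - {0}. x + y \<noteq> 0 \<longrightarrow> min (ord x) (ord y) \<le> ord (x + y))"

definition valuation_ring :: "'k::field_char_0 set \<Rightarrow> ('k \<Rightarrow> int) \<Rightarrow> 'k set" where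
  "valuation_ring K ord = {x\<in>K. x = 0 \<or> 0 \<le> ord x}"

definition valuation_ideal :: "'k::field_char_0 set \<Rightarrow> ('k \<Rightarrow> int) \<Rightarrow> 'k set" where
  "valuation_ideal K ord = {x\<in>K. x = 0 \<or> 0 < ord x}"

definition residue_field_size :: "'k::field_char_0 set \<Rightarrow> ('k \<Rightarrow> int) \<Rightarrow> nat" where
  "residue_field_size K ord =
     card (valuation_ring K ord //
       {(x, y). x \<in> valuation_ring K ord \<and> y \<in> valuation_ring K ord \<and>
                x - y \<in> valuation_ideal K ord})"

definition finite_places :: "'k::field_char_0 set \<Rightarrow> ('k \<Rightarrow> real) set" where
  "finite_places K =
     {(\<lambda>x. if x \<in> K \<and> x \<noteq> 0 then real (residue_field_size K ord) powi (- ord x) else 0) | ord.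
        discrete_valuation K ord}"

text \<open>The product \<open>|x|\<^sub>S\<close>. For \<open>x \<noteq> 0\<close> in a number field only finitely many factors differ from
  \<open>1\<close>, so that it is meaningful for an infinite set \<open>S\<close> of places as well.\<close>

definition places_abs :: "('k \<Rightarrow> real) set \<Rightarrow> 'k \<Rightarrow> real" where
  "places_abs S x = (\<Prod>v\<in>{v\<in>S. v x \<noteq> 1}. v x)"

end

theory Submission
  imports "Jordan_Normal_Form.Char_Poly" "HOL-Number_Theory.Number_Theory" Defs
begin

text \<open>By the product formula the number of periodic points is
  \<open>F n = R\<^sup>n (\<Prod>\<tau>. 1 - \<tau>\<^sup>n) f n\<close>, where \<open>R > 0\<close>, the finitely many \<open>\<tau>\<close> come from the conjugates of the \<open>\<xi> j\<close> and
  satisfy \<open>\<bar>\<tau>\<bar> < 1\<close>, and \<open>f n\<close> is the product of the factors \<open>v (\<xi> j ^ n - 1)\<close> over the places \<open>v \<in> S j\<close>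
  with \<open>v (\<xi> j) = 1\<close>. If there are no such places, expanding the product shows that the zeta function is a
  product of factors \<open>(1 - \<omega> z)\<^sup>\<plusminus>\<^sup>1\<close>. Otherwise fix a residue characteristic \<open>q\<close> of such a place. For all large \<open>e\<close>
  there are shifts \<open>W = q\<^sup>e D\<^sup>K\<close> with \<open>q\<close> prime to \<open>D\<close> such that \<open>f (n + W)\<close> and \<open>f n\<close> almost agree unless \<open>q\<^sup>e\<^sup>+\<^sup>1\<close> divides
  \<open>n\<close> or \<open>n + W\<close>, while \<open>f (n + W)\<close> is almost at least \<open>2 f n\<close> for a positive proportion of the \<open>n\<close> divisible by
  \<open>q\<^sup>e\<^sup>+\<^sup>1\<close>. Hence, for every \<open>c\<close> of order \<open>q\<^sup>e\<^sup>+\<^sup>1\<close>, the Abel means of \<open>f n c\<^sup>n\<close> do not tend to \<open>0\<close>.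
  A continuation of the zeta function \<open>\<zeta>\<close> to a point of the circle of radius \<open>1 / R\<close> would be a continuation of
  \<open>z \<zeta>' / \<zeta> = (\<Sum>n. F n z\<^sup>n)\<close> to almost all points nearby, and these means would tend to \<open>0\<close> at such points \<open>c / R\<close>.

  The product formula rests on \<open>ord\<^sub>p (N x) = (\<Sum>v. d\<^sub>v v x)\<close>, the sum ranging over the valuations \<open>v\<close> above \<open>p\<close>,
  with residue degrees \<open>d\<^sub>v\<close>.
  Both sides measure how multiplication by \<open>x\<close> changes the determinant of a basis of the lattice of all elements that
  are integral at these \<open>v\<close>: the left hand side directly, the right hand side by the Chinese remainder theorem.\<close>

text \<open>Two obstacles shape the proof. Several places may share the residue characteristic q,
  and their factors are correlated, so no single place can be isolated. Instead all of them are
  moved together: the shift W carries exactly e factors q and therefore acts on each of them in the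
  same direction, while the power D ^ K makes the shift negligible at the remaining places. The
  increments f (n + W) - f n are then concentrated, up to an error, on the two classes Q | n and Q |
  n + W with Q = q ^ (e + 1). On these classes c ^ n is constant, equal to 1 and to some w \<noteq>
  1 of modulus 1, and the increments are almost nonnegative on the first and almost nonpositive on
  the second. Contributions X and - w Y with X, Y almost nonnegative cannot cancel while X stays
  away from 0. On the arithmetic side p-adic completions are avoided: a subring of the complex
  numbers, maximal among those that omit 1 / p, provides places above p through the embeddings of K.
  At the outset it is not known that these are all the places above p; the norm formula itself rules
  out any further one.\<close>

section \<open>Rational numbers at a prime\<close>

text \<open>The localization Z_(p) of the integers at the prime p, that is, the ring of p-integral
  rational numbers.\<close>

definition loc_int :: "nat \<Rightarrow> rat set" where
  "loc_int p = {of_int a / of_int b | a b. \<not> int p dvd b}"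

text \<open>The p-adic valuation. At 0 it takes the default value 0, so 0 is kept apart in
  \<open>loc_int_iff\<close>.\<close>

definition rat_val :: "nat \<Rightarrow> rat \<Rightarrow> int" where
  "rat_val p q = int (multiplicity (int p) (fst (quotient_of q))) -
                 int (multiplicity (int p) (snd (quotient_of q)))"

text \<open>Cross-multiplication turns the comparison with the reduced fraction into an identity of
  integers, where multiplicities add. Afterwards any representing fraction may be used.\<close>

lemma rat_val_frac:
  assumes p: "prime p" and ab: "a \<noteq> 0" "b \<noteq> 0"
  shows "rat_val p (of_int a / of_int b) = int (multiplicity (int p) a) - int (multiplicity (int p) b)"
proof -
  obtain a' b' where q: "quotient_of (of_int a / of_int b) = (a', b')" by (cases "quotient_of (of_int a / of_int b)")
  have b': "b' > 0" "of_int a / of_int b = (of_int a' / of_int b' :: rat)"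
    using quotient_of_denom_pos[OF q] quotient_of_div[OF q] by auto
  then have "(of_int (a * b') :: rat) = of_int (a' * b)" using ab by (simp add: field_simps)
  then have e: "a * b' = a' * b" by (simp only: of_int_eq_iff)
  then have a': "a' \<noteq> 0" using ab b' by auto
  have "prime_elem (int p)" using p by (intro prime_imp_prime_elem) simp
  then have "multiplicity (int p) a + multiplicity (int p) b' = multiplicity (int p) a' + multiplicity (int p) b"
    using e ab a' b' by (simp flip: prime_elem_multiplicity_mult_distrib)
  then show ?thesis unfolding rat_val_def q by simp
qed

lemma rat_frac_exists:
  assumes "q \<noteq> (0::rat)" obtains a b where "a \<noteq> 0" "b \<noteq> 0" "q = of_int a / of_int b"
proof -
  obtain a b where "quotient_of q = (a, b)" by (cases "quotient_of q")
  then have "b > 0" "q = of_int a / of_int b" using quotient_of_denom_pos quotient_of_div by blast+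
  then show ?thesis using that assms by fastforce
qed

lemma rat_val_mult:
  assumes p: "prime p" and "q \<noteq> 0" "r \<noteq> 0"
  shows "rat_val p (q * r) = rat_val p q + rat_val p r"
proof -
  obtain a b c d where *: "a \<noteq> 0" "b \<noteq> 0" "q = of_int a / of_int b" "c \<noteq> 0" "d \<noteq> 0" "r = of_int c / of_int d"
    using rat_frac_exists assms by metis
  have "prime_elem (int p)" using p by (intro prime_imp_prime_elem) simp
  moreover have "q * r = of_int (a * c) / of_int (b * d)" using * by simp
  ultimately show ?thesis using * p
    using rat_val_frac[OF p, of "a * c" "b * d"] rat_val_frac[OF p, of a b] rat_val_frac[OF p, of c d]
    by (simp add: prime_elem_multiplicity_mult_distrib del: of_int_mult)
qed

lemma rat_val_1 [simp]: "rat_val p 1 = 0"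
  unfolding rat_val_def by simp

lemma rat_val_p: "prime p \<Longrightarrow> rat_val p (of_nat p) = 1"
  using rat_val_frac[of p "int p" 1] by (simp add: multiplicity_self not_prime_unit prime_gt_0_nat)

lemma rat_val_power: "prime p \<Longrightarrow> q \<noteq> 0 \<Longrightarrow> rat_val p (q ^ n) = int n * rat_val p q"
  by (induction n) (simp_all add: rat_val_mult algebra_simps)

lemma rat_val_inverse: "prime p \<Longrightarrow> q \<noteq> 0 \<Longrightarrow> rat_val p (inverse q) = - rat_val p q"
  using rat_val_mult[of p q "inverse q"] by simp

lemma rat_val_minus: "prime p \<Longrightarrow> rat_val p (- q) = rat_val p q"
  unfolding rat_val_def
  by (cases "quotient_of q") (simp add: rat_uminus_code, metis multiplicity_normalize_right abs_minus_cancel normalize_int_def)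

lemma loc_int_iff:
  assumes p: "prime p" shows "q \<in> loc_int p \<longleftrightarrow> q = 0 \<or> rat_val p q \<ge> 0"
proof (cases "q = 0")
  case True
  have "\<not> int p dvd 1" using p by (metis int_dvd_int_iff nat_dvd_1_iff_1 not_prime_1 of_nat_1)
  then have "0 \<in> loc_int p" unfolding loc_int_def by (intro CollectI exI[of _ 0] exI[of _ 1]) simp
  then show ?thesis using True by simp
next
  case False
  have pu: "\<not> is_unit (int p)" using p by (metis prime_nat_int_transfer not_prime_unit)
  show ?thesis
  proof
    assume "q \<in> loc_int p"
    then obtain a b where ab: "q = of_int a / of_int b" "\<not> int p dvd b" unfolding loc_int_def by blast
    have nz: "a \<noteq> 0" "b \<noteq> 0" using False ab(1) by (metis div_0 div_by_0 of_int_0)+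
    have "multiplicity (int p) b = 0" using ab(2) by (rule not_dvd_imp_multiplicity_0)
    then show "q = 0 \<or> rat_val p q \<ge> 0" using rat_val_frac[OF p nz] ab by simp
  next
    assume "q = 0 \<or> rat_val p q \<ge> 0"
    then have v: "rat_val p q \<ge> 0" using False by simp
    obtain a b where ab: "quotient_of q = (a, b)" by (cases "quotient_of q")
    have *: "b > 0" "q = of_int a / of_int b" "coprime a b"
      using quotient_of_denom_pos[OF ab] quotient_of_div[OF ab] quotient_of_coprime[OF ab] by auto
    have "\<not> int p dvd b"
    proof
      assume pb: "int p dvd b"
      then have "\<not> int p dvd a" using *(3) pu by (meson coprime_common_divisor)
      then have "multiplicity (int p) a = 0" by (rule not_dvd_imp_multiplicity_0)
      moreover have "multiplicity (int p) b > 0" using pb *(1) pu multiplicity_gt_zero_iff[of b "int p"] by simp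
      ultimately show False using v ab unfolding rat_val_def by simp
    qed
    then show "q \<in> loc_int p" unfolding loc_int_def by (intro CollectI exI[of _ a] exI[of _ b] conjI *(2))
  qed
qed

lemma loc_int_add: "prime p \<Longrightarrow> q \<in> loc_int p \<Longrightarrow> r \<in> loc_int p \<Longrightarrow> q + r \<in> loc_int p"
proof -
  assume p: "prime p" and q: "q \<in> loc_int p" and r: "r \<in> loc_int p"
  obtain a b where ab: "q = of_int a / of_int b" "\<not> int p dvd b" using q unfolding loc_int_def by blast
  obtain c d where cd: "r = of_int c / of_int d" "\<not> int p dvd d" using r unfolding loc_int_def by blast
  note * = ab cd
  have nz: "b \<noteq> 0" "d \<noteq> 0" using *(2,4) dvd_0_right by metis+
  have "q + r = of_int (a * d + c * b) / of_int (b * d)"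
    using add_frac_eq[of "of_int b :: rat" "of_int d" "of_int a" "of_int c"] nz
    unfolding *(1,3) by (simp only: of_int_add of_int_mult of_int_eq_0_iff simp_thms)
  moreover have "\<not> int p dvd b * d" using *(2,4) p prime_dvd_mult_iff[of "int p" b d] by simp
  ultimately show "q + r \<in> loc_int p" unfolding loc_int_def by (intro CollectI exI conjI)
qed

lemma loc_int_mult: "prime p \<Longrightarrow> q \<in> loc_int p \<Longrightarrow> r \<in> loc_int p \<Longrightarrow> q * r \<in> loc_int p"
  using rat_val_mult[of p q r] loc_int_iff[of p q] loc_int_iff[of p r] loc_int_iff[of p "q * r"]
  by (smt (verit) mult_eq_0_iff)

lemma loc_int_uminus: "prime p \<Longrightarrow> q \<in> loc_int p \<Longrightarrow> - q \<in> loc_int p"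
  using loc_int_iff[of p q] loc_int_iff[of p "- q"] rat_val_minus[of p q] by simp

lemma loc_int_diff: "prime p \<Longrightarrow> q \<in> loc_int p \<Longrightarrow> r \<in> loc_int p \<Longrightarrow> q - r \<in> loc_int p"
  using loc_int_add[of p q "- r"] loc_int_uminus by simp

lemma loc_int_of_int: "prime p \<Longrightarrow> of_int a \<in> loc_int p"
  unfolding loc_int_def by (rule CollectI, rule exI[of _ a], rule exI[of _ 1])
    (metis div_by_1 int_dvd_int_iff nat_dvd_1_iff_1 not_prime_1 of_int_1 of_nat_1)

lemma loc_int_of_nat: "prime p \<Longrightarrow> of_nat a \<in> loc_int p"
  using loc_int_of_int[of p "int a"] by simp

lemma loc_int_0: "prime p \<Longrightarrow> 0 \<in> loc_int p" and loc_int_1: "prime p \<Longrightarrow> 1 \<in> loc_int p"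
  using loc_int_of_int[of p 0] loc_int_of_int[of p 1] by auto

lemma loc_int_sum: "prime p \<Longrightarrow> (\<And>i. i \<in> A \<Longrightarrow> h i \<in> loc_int p) \<Longrightarrow> sum h A \<in> loc_int p"
  by (induction A rule: infinite_finite_induct) (auto simp: loc_int_0 loc_int_add)

lemma loc_int_prod: "prime p \<Longrightarrow> (\<And>i. i \<in> A \<Longrightarrow> h i \<in> loc_int p) \<Longrightarrow> prod h A \<in> loc_int p"
  by (induction A rule: infinite_finite_induct) (auto simp: loc_int_1 loc_int_mult)

text \<open>The maximal ideal of the local ring is generated by p: an element of valuation at least
  1 can be divided by p.\<close>

lemma loc_int_unit:
  assumes p: "prime p" and "q \<in> loc_int p" "\<not> (\<exists>r\<in>loc_int p. q = of_nat p * r)"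
  shows "q \<noteq> 0" "rat_val p q = 0" "inverse q \<in> loc_int p"
proof -
  show q: "q \<noteq> 0" using assms loc_int_0 by (metis mult_zero_right)
  have p0: "(of_nat p :: rat) \<noteq> 0" using p by auto
  have "\<not> rat_val p q \<ge> 1"
  proof
    assume "rat_val p q \<ge> 1"
    then have "rat_val p (q * inverse (of_nat p)) \<ge> 0"
      using rat_val_mult[OF p q, of "inverse (of_nat p)"] rat_val_inverse[OF p p0] rat_val_p[OF p] p0 by simp
    then have "q * inverse (of_nat p) \<in> loc_int p" using loc_int_iff[OF p] by blast
    moreover have "q = of_nat p * (q * inverse (of_nat p))" using p0 by simp
    ultimately show False using assms(3) by blast
  qed
  then show "rat_val p q = 0" using assms(2) loc_int_iff[OF p] q by force
  then show "inverse q \<in> loc_int p" using loc_int_iff[OF p] rat_val_inverse[OF p q] by simp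
qed

lemma loc_int_p_not_unit:
  assumes p: "prime p" and "r \<in> loc_int p" shows "of_nat p * r \<noteq> 1"
proof
  assume *: "of_nat p * r = 1"
  then have "r \<noteq> 0" by auto
  then have "rat_val p (of_nat p * r) = 1 + rat_val p r" using rat_val_mult[OF p, of "of_nat p" r] rat_val_p[OF p] p by auto
  then show False using * assms loc_int_iff[OF p] \<open>r \<noteq> 0\<close> by simp
qed

text \<open>An inverse of the denominator modulo p provides the residue n. That the residue classes
  are those of 0, ..., p - 1 enters the count in \<open>residue_size\<close>.\<close>

lemma loc_int_residue:
  assumes p: "prime p" and q: "q \<in> loc_int p"
  obtains n r where "n < p" "r \<in> loc_int p" "q = of_nat n + of_nat p * r"
proof -
  obtain a b where ab: "q = of_int a / of_int b" "\<not> int p dvd b" using q unfolding loc_int_def by blast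
  have "coprime b (int p)" using ab(2) p by (metis coprime_commute prime_imp_coprime prime_nat_int_transfer)
  then obtain c where c: "[b * c = 1] (mod int p)" using cong_solve_coprime_int by blast
  define n where "n = nat ((a * c) mod int p)"
  have p0: "p > 0" using p prime_gt_0_nat by blast
  have n: "int n = (a * c) mod int p" "n < p" unfolding n_def using p0 by (auto simp: nat_less_iff)
  have "[b * int n = b * (a * c)] (mod int p)" using n by (metis cong_mod_left cong_refl cong_scalar_left)
  also have "b * (a * c) = a * (b * c)" by simp
  also have "[a * (b * c) = a * 1] (mod int p)" using c by (rule cong_scalar_left)
  finally have "int p dvd a - b * int n" by (simp add: cong_iff_dvd_diff dvd_diff_commute)
  then obtain k where k: "a - b * int n = int p * k" by blast
  have "b \<noteq> 0" using ab by auto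
  have "q = of_nat n + of_nat p * (of_int k / of_int b)"
  proof -
    have "a = b * int n + int p * k" using k by (simp add: algebra_simps)
    then have "(of_int a :: rat) = of_int (b * int n + int p * k)" by (rule arg_cong)
    then have "(of_int a :: rat) = of_int b * of_nat n + of_nat p * of_int k" by simp
    then show ?thesis using \<open>b \<noteq> 0\<close> unfolding ab(1) by (simp add: add_divide_distrib)
  qed
  moreover have "of_int k / of_int b \<in> loc_int p" unfolding loc_int_def using ab by blast
  ultimately show ?thesis using that n by blast
qed

lemma multiplicity_int_nat:
  assumes "c \<noteq> 0" "prime p"
  shows "multiplicity p (nat \<bar>c\<bar>) = multiplicity (int p) c"
proof -
  have *: "p ^ k dvd nat \<bar>c\<bar> \<longleftrightarrow> int p ^ k dvd c" for k
    by (metis dvd_abs_iff nat_dvd_iff abs_ge_zero int_dvd_int_iff nat_0_le of_nat_power)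
  have "\<not> is_unit (int p)" using assms(2) by (metis prime_nat_int_transfer not_prime_unit)
  then show ?thesis using assms
    using power_dvd_iff_le_multiplicity[of c "int p" "Suc (multiplicity (int p) c)"] multiplicity_dvd[of "int p" c]
    by (intro multiplicity_eqI) (simp_all only: *, simp)
qed

text \<open>Unique factorization of numerator and denominator; this is the product formula of the
  rationals. \<open>P\<close> may be any finite set of primes that contains those occurring in
  q.\<close>

lemma abs_rat_eq_prod_rat_val:
  assumes q: "q \<noteq> 0" and P: "finite P" "\<And>p. p \<in> P \<Longrightarrow> prime p" "\<And>p. prime p \<Longrightarrow> rat_val p q \<noteq> 0 \<Longrightarrow> p \<in> P"
  shows "\<bar>of_rat q :: real\<bar> = (\<Prod>p\<in>P. real p powi rat_val p q)"
proof -
  obtain a b where ab: "a \<noteq> 0" "b \<noteq> 0" "q = of_int a / of_int b" using rat_frac_exists[OF q] .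
  \<comment> \<open>The fraction a / b need not be reduced, so primes outside \<open>P\<close> may
    divide both a and b; their contributions cancel at the end.\<close>
  define P' where "P' = P \<union> prime_factors (nat \<bar>a\<bar>) \<union> prime_factors (nat \<bar>b\<bar>)"
  have P': "finite P'" "\<And>p. p \<in> P' \<Longrightarrow> prime p" "P \<subseteq> P'" unfolding P'_def using P by auto
  have nat: "real (nat \<bar>c\<bar>) = (\<Prod>p\<in>P'. real p ^ multiplicity (int p) c)" if "c \<noteq> 0" "prime_factors (nat \<bar>c\<bar>) \<subseteq> P'" for c
  proof -
    have "nat \<bar>c\<bar> = (\<Prod>p\<in>prime_factors (nat \<bar>c\<bar>). p ^ multiplicity p (nat \<bar>c\<bar>))"
      by (rule prime_factorization_nat) (use that in simp)
    also have "\<dots> = (\<Prod>p\<in>P'. p ^ multiplicity p (nat \<bar>c\<bar>))"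
      using that P' by (intro prod.mono_neutral_left) (auto simp: prime_factors_multiplicity)
    also have "\<dots> = (\<Prod>p\<in>P'. p ^ multiplicity (int p) c)"
      using multiplicity_int_nat[OF that(1)] P' by (intro prod.cong refl) simp
    finally have "real (nat \<bar>c\<bar>) = real (\<Prod>p\<in>P'. p ^ multiplicity (int p) c)" by (rule arg_cong)
    then show ?thesis by (simp only: of_nat_prod of_nat_power)
  qed
  have "\<bar>of_rat q :: real\<bar> = real (nat \<bar>a\<bar>) / real (nat \<bar>b\<bar>)"
    unfolding ab(3) of_rat_divide of_rat_of_int_eq by (simp add: abs_divide)
  also have "\<dots> = (\<Prod>p\<in>P'. real p powi rat_val p q)"
  proof -
    have "real p ^ multiplicity (int p) a / real p ^ multiplicity (int p) b = real p powi rat_val p q" if "p \<in> P'" for p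
    proof -
      have "real p \<noteq> 0" using prime_gt_0_nat[OF P'(2)[OF that]] by simp
      then show ?thesis unfolding ab(3) rat_val_frac[OF P'(2)[OF that] ab(1,2)]
        by (subst power_int_diff) simp_all
    qed
    then have "(\<Prod>p\<in>P'. real p powi rat_val p q) =
        (\<Prod>p\<in>P'. real p ^ multiplicity (int p) a) / (\<Prod>p\<in>P'. real p ^ multiplicity (int p) b)"
      unfolding prod_dividef[symmetric] by (intro prod.cong) simp_all
    moreover have "prime_factors (nat \<bar>a\<bar>) \<subseteq> P'" "prime_factors (nat \<bar>b\<bar>) \<subseteq> P'" unfolding P'_def by blast+
    ultimately show ?thesis using nat[of a] nat[of b] ab(1,2) by simp
  qed
  also have "\<dots> = (\<Prod>p\<in>P. real p powi rat_val p q)"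
  proof (rule prod.mono_neutral_right)
    show "\<forall>i\<in>P' - P. real i powi rat_val i q = 1"
    proof
      fix i assume "i \<in> P' - P"
      then have "rat_val i q = 0" using P(3)[of i] P'(2)[of i] by blast
      then show "real i powi rat_val i q = 1" by simp
    qed
  qed (use P' in auto)
  finally show ?thesis .
qed

section \<open>Subrings of fields that are maximal without the inverse of a prime\<close>

text \<open>A valuation ring of the field \<open>'c\<close> lying over Z_(p). For the complex
  numbers such a ring does the work of a p-adic completion and its algebraic closure.\<close>

locale padic_valuation_ring =
  fixes p :: nat and W :: "'c::field_char_0 set"
  assumes p: "prime p" and one: "1 \<in> W" and diff: "x \<in> W \<Longrightarrow> y \<in> W \<Longrightarrow> x - y \<in> W"
    and mult: "x \<in> W \<Longrightarrow> y \<in> W \<Longrightarrow> x * y \<in> W"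
    and val: "x \<in> W \<or> inverse x \<in> W"
    and inv_p: "inverse (of_nat p) \<notin> W"

definition is_subring :: "'c::comm_ring_1 set \<Rightarrow> bool" where
  "is_subring A \<longleftrightarrow> 1 \<in> A \<and> (\<forall>x\<in>A. \<forall>y\<in>A. x - y \<in> A \<and> x * y \<in> A)"

lemma is_subringD:
  assumes "is_subring A"
  shows is_subring_1: "1 \<in> A" and is_subring_diff: "x \<in> A \<Longrightarrow> y \<in> A \<Longrightarrow> x - y \<in> A"
    and is_subring_mult: "x \<in> A \<Longrightarrow> y \<in> A \<Longrightarrow> x * y \<in> A"
  using assms unfolding is_subring_def by blast+

lemma is_subring_0: "is_subring A \<Longrightarrow> 0 \<in> A"
  using is_subring_diff[of A 1 1] is_subring_1[of A] by simp

lemma is_subring_uminus: "is_subring A \<Longrightarrow> x \<in> A \<Longrightarrow> - x \<in> A"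
  using is_subring_diff[of A 0 x] is_subring_0[of A] by simp

lemma is_subring_add: "is_subring A \<Longrightarrow> x \<in> A \<Longrightarrow> y \<in> A \<Longrightarrow> x + y \<in> A"
  using is_subring_diff[of A x "- y"] is_subring_uminus[of A y] by simp

lemma is_subring_power: "is_subring A \<Longrightarrow> x \<in> A \<Longrightarrow> x ^ n \<in> A"
  by (induction n) (simp_all add: is_subring_1 is_subring_mult)

lemma is_subring_of_nat: "is_subring A \<Longrightarrow> of_nat n \<in> A"
  by (induction n) (simp_all add: is_subring_0 is_subring_1 is_subring_add)

lemmas is_subring_simps = is_subring_1 is_subring_diff is_subring_mult is_subring_0 is_subring_uminus
  is_subring_add is_subring_power is_subring_of_nat

lemma is_subring_sum: "is_subring A \<Longrightarrow> (\<And>i. i \<in> I \<Longrightarrow> h i \<in> A) \<Longrightarrow> sum h I \<in> A"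
  by (induction I rule: infinite_finite_induct) (simp_all add: is_subring_simps)

lemma is_subring_adjoin:
  assumes "is_subring A"
  shows "is_subring {poly P x | P. \<forall>i. Polynomial.coeff P i \<in> A}"
  unfolding is_subring_def
proof (intro conjI ballI)
  show "1 \<in> {poly P x | P. \<forall>i. Polynomial.coeff P i \<in> A}"
    using is_subring_simps[OF assms] by (intro CollectI exI[of _ 1]) (auto simp: Polynomial.coeff_1)
  fix u v assume "u \<in> {poly P x | P. \<forall>i. Polynomial.coeff P i \<in> A}" "v \<in> {poly P x | P. \<forall>i. Polynomial.coeff P i \<in> A}"
  then obtain P Q where *: "u = poly P x" "v = poly Q x" "\<forall>i. Polynomial.coeff P i \<in> A" "\<forall>i. Polynomial.coeff Q i \<in> A" by auto
  show "u - v \<in> {poly P x | P. \<forall>i. Polynomial.coeff P i \<in> A}"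
    using * is_subring_simps[OF assms] by (intro CollectI exI[of _ "P - Q"]) auto
  show "u * v \<in> {poly P x | P. \<forall>i. Polynomial.coeff P i \<in> A}"
    using * is_subring_simps[OF assms] by (intro CollectI exI[of _ "P * Q"])
      (auto simp: Polynomial.coeff_mult intro!: is_subring_sum[OF assms])
qed

text \<open>Zorn's lemma yields a subring maximal among those omitting 1 / p. If x and 1 / x were
  both missing from it, adjoining either of them would produce 1 / p; playing the two resulting
  expressions against each other lowers their degrees until a contradiction is reached.\<close>

lemma exists_padic_valuation_ring:
  assumes p: "prime p"
  obtains W :: "'c::field_char_0 set" where "padic_valuation_ring p W"
proof -
  define \<pi> where "\<pi> = (of_nat p :: 'c)"
  have \<pi>0: "\<pi> \<noteq> 0" unfolding \<pi>_def using p by auto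
  define \<A> where "\<A> = {A :: 'c set. is_subring A \<and> inverse \<pi> \<notin> A}"
  have "(\<int> :: 'c set) \<in> \<A>"
  proof -
    have "inverse \<pi> \<notin> \<int>"
    proof
      assume "inverse \<pi> \<in> \<int>"
      then obtain k where k: "inverse \<pi> = of_int k" by (auto elim: Ints_cases)
      then have "of_int (k * int p) = (1::'c)" using \<pi>0 unfolding \<pi>_def by (metis left_inverse of_int_mult of_int_of_nat_eq)
      then have "k * int p = 1" by (metis of_int_1 of_int_eq_iff)
      then show False using p by (metis int_dvd_int_iff dvd_triv_right nat_dvd_1_iff_1 not_prime_1 of_nat_1)
    qed
    then show ?thesis unfolding \<A>_def is_subring_def by auto
  qed
  then have ne: "\<A> \<noteq> {}" by blast
  have "\<exists>M\<in>\<A>. \<forall>X\<in>\<A>. M \<subseteq> X \<longrightarrow> X = M"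
  proof (rule subset_Zorn_nonempty[OF ne])
    fix C assume C: "C \<noteq> {}" "subset.chain \<A> C"
    have CA: "C \<subseteq> \<A>" and ch: "\<And>X Y. X \<in> C \<Longrightarrow> Y \<in> C \<Longrightarrow> X \<subseteq> Y \<or> Y \<subseteq> X"
      using C(2) unfolding subset_chain_def by blast+
    have "is_subring (\<Union>C)" unfolding is_subring_def
    proof (intro conjI ballI)
      show "1 \<in> \<Union>C" using C(1) CA unfolding \<A>_def is_subring_def by fastforce
      fix x y assume "x \<in> \<Union>C" "y \<in> \<Union>C"
      then obtain X where X: "X \<in> C" "x \<in> X" "y \<in> X" using ch by blast
      then have "is_subring X" using CA unfolding \<A>_def by blast
      then show "x - y \<in> \<Union>C" "x * y \<in> \<Union>C" using X is_subring_diff[of X x y] is_subring_mult[of X x y] by blast+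
    qed
    then show "\<Union>C \<in> \<A>" using CA unfolding \<A>_def by blast
  qed
  then obtain A where A: "is_subring A" "inverse \<pi> \<notin> A"
    and max: "\<And>X. is_subring X \<Longrightarrow> inverse \<pi> \<notin> X \<Longrightarrow> A \<subseteq> X \<Longrightarrow> X = A"
    unfolding \<A>_def by blast
  note As = is_subring_simps[OF A(1)]
  have \<pi>A: "\<pi> \<in> A" unfolding \<pi>_def by (rule As)
  \<comment> \<open>Every power of u = 1 - \<pi> a is 1 modulo \<open>\<pi>\<close>, so inverting u
    cannot create 1 / \<pi>; by maximality the inverse of u already lies in
    \<open>A\<close>.\<close>
  have unit: "1 - \<pi> * a \<noteq> 0 \<and> inverse (1 - \<pi> * a) \<in> A" if a: "a \<in> A" for a
  proof -
    define u where "u = 1 - \<pi> * a"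
    have u0: "u \<noteq> 0"
    proof
      assume "u = 0"
      then have "\<pi> * a = 1" unfolding u_def by (metis eq_iff_diff_eq_0)
      then have "inverse \<pi> = a" by (rule inverse_unique)
      then show False using A(2) a by simp
    qed
    have uA: "u \<in> A" unfolding u_def using As \<pi>A a by auto
    define B where "B = {b * inverse u ^ k | b k. b \<in> A}"
    have "is_subring B" unfolding is_subring_def
    proof (intro conjI ballI)
      show "1 \<in> B" unfolding B_def using As(1) by (intro CollectI exI[of _ 1] exI[of _ 0]) simp
      fix x y assume "x \<in> B" "y \<in> B"
      from \<open>x \<in> B\<close> obtain b k where x: "b \<in> A" "x = b * inverse u ^ k" unfolding B_def by blast
      from \<open>y \<in> B\<close> obtain c l where y: "c \<in> A" "y = c * inverse u ^ l" unfolding B_def by blast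
      note * = x(1) y(1) x(2) y(2)
      have "x - y = (b * u ^ l - c * u ^ k) * inverse u ^ (k + l)"
      proof -
        have 1: "u ^ n * inverse u ^ n = 1" for n
          using u0 by (simp add: power_mult_distrib[symmetric])
        have "(b * u ^ l - c * u ^ k) * inverse u ^ (k + l)
            = b * inverse u ^ k * (u ^ l * inverse u ^ l) - c * inverse u ^ l * (u ^ k * inverse u ^ k)"
          by (simp add: power_add algebra_simps)
        then show ?thesis unfolding 1 *(3,4) by simp
      qed
      moreover have "b * u ^ l - c * u ^ k \<in> A" by (intro As(2,3,7) uA *(1,2))
      ultimately show "x - y \<in> B" unfolding B_def
        by (intro CollectI exI[of _ "b * u ^ l - c * u ^ k"] exI[of _ "k + l"] conjI)
      have "x * y = (b * c) * inverse u ^ (k + l)" unfolding *(3,4) by (simp only: power_add mult_ac)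
      moreover have "b * c \<in> A" by (intro As(3) *(1,2))
      ultimately show "x * y \<in> B" unfolding B_def
        by (intro CollectI exI[of _ "b * c"] exI[of _ "k + l"] conjI)
    qed
    moreover have "inverse \<pi> \<notin> B"
    proof
      assume "inverse \<pi> \<in> B"
      then obtain b k where bk: "b \<in> A" "inverse \<pi> = b * inverse u ^ k" unfolding B_def by blast
      have "\<pi> * inverse \<pi> * u ^ k = \<pi> * b * (inverse u ^ k * u ^ k)" unfolding bk(2) by (simp only: mult_ac)
      moreover have "inverse u ^ k * u ^ k = 1" using u0 by (simp add: power_mult_distrib[symmetric])
      ultimately have e: "u ^ k = \<pi> * b" using \<pi>0 by simp
      have "\<exists>c\<in>A. u ^ k = 1 - \<pi> * c"
      proof (induction k)
        case 0 then show ?case using As(4) by (intro bexI[of _ 0]) auto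
      next
        case (Suc k)
        then obtain c where c: "c \<in> A" "u ^ k = 1 - \<pi> * c" by blast
        have "u ^ Suc k = u * (1 - \<pi> * c)" using c by simp
        also have "\<dots> = 1 - \<pi> * (c + a - a * (\<pi> * c))" unfolding u_def by (simp add: algebra_simps)
        finally have "u ^ Suc k = 1 - \<pi> * (c + a - a * (\<pi> * c))" .
        moreover have "c + a - a * (\<pi> * c) \<in> A" by (intro As(2,3,6) a c(1) \<pi>A)
        ultimately show ?case by (intro bexI)
      qed
      then obtain c where c: "c \<in> A" "u ^ k = 1 - \<pi> * c" by blast
      then have "\<pi> * b = 1 - \<pi> * c" using e by (simp only:)
      then have "\<pi> * (b + c) = 1" by (simp only: distrib_left) simp
      then have "inverse \<pi> = b + c" by (rule inverse_unique)
      moreover have "b + c \<in> A" by (intro As(6) c(1) bk(1))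
      ultimately show False using A(2) by simp
    qed
    moreover have "A \<subseteq> B"
    proof
      fix b assume "b \<in> A"
      then show "b \<in> B" unfolding B_def by (intro CollectI exI[of _ b] exI[of _ 0]) simp
    qed
    ultimately have "B = A" by (rule max)
    moreover have "inverse u \<in> B" unfolding B_def using As(1) by (intro CollectI exI[of _ 1]) simp
    ultimately show ?thesis using u0 unfolding u_def by simp
  qed
  \<comment> \<open>\<open>rel x n\<close> says that 1 / \<pi> is a polynomial expression in x of
    degree at most n over \<open>A\<close>.\<close>
  define rel where "rel x n \<longleftrightarrow> (\<exists>a. (\<forall>i. a i \<in> A) \<and> 1 = \<pi> * (\<Sum>i\<le>n. a i * x ^ i))" for x n
  \<comment> \<open>Since 1 - \<pi> (b 0) is a unit, the relation for 1 / x, multiplied by x ^ n,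
    expresses x ^ n through smaller powers; substitution removes the top term of the relation for
    x.\<close>
  have lower: "rel x (n - 1)" if "rel x n" "rel (inverse x) m" "m \<le> n" "n \<ge> 1" "x \<noteq> 0" for x n m
  proof -
    note rel = that(1,2)
    obtain a b where a: "\<forall>i. a i \<in> A" "1 = \<pi> * (\<Sum>i\<le>n. a i * x ^ i)"
      and b: "\<forall>i. b i \<in> A" "1 = \<pi> * (\<Sum>i\<le>m. b i * inverse x ^ i)" using rel unfolding rel_def by blast
    define u where "u = inverse (1 - \<pi> * b 0)"
    have u: "u \<in> A" "u * (1 - \<pi> * b 0) = 1" unfolding u_def using unit[of "b 0"] b by auto
    have "1 - \<pi> * b 0 = \<pi> * (\<Sum>i\<in>{1..m}. b i * inverse x ^ i)"
    proof -
      have "{..m} = insert 0 {1..m}" by auto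
      then have "(\<Sum>i\<le>m. b i * inverse x ^ i) = b 0 + (\<Sum>i\<in>{1..m}. b i * inverse x ^ i)" by simp
      then show ?thesis using b(2) by (simp add: algebra_simps)
    qed
    then have "x ^ n * 1 = x ^ n * (u * (\<pi> * (\<Sum>i\<in>{1..m}. b i * inverse x ^ i)))" using u by simp
    also have "\<dots> = (\<Sum>i\<in>{1..m}. (\<pi> * u * b i) * x ^ (n - i))"
      unfolding sum_distrib_left
    proof (rule sum.cong)
      fix i assume "i \<in> {1..m}"
      then have "x ^ (n - i) = x ^ n * inverse x ^ i"
        using that by (subst power_diff) (simp_all add: divide_inverse power_inverse)
      then show "x ^ n * (u * (\<pi> * (b i * inverse x ^ i))) = (\<pi> * u * b i) * x ^ (n - i)"
        by (simp only: mult_ac)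
    qed simp
    also have "\<dots> = (\<Sum>j\<in>{n-m..n-1}. (\<pi> * u * b (n - j)) * x ^ j)"
      by (rule sum.reindex_bij_witness[of _ "\<lambda>j. n - j" "\<lambda>i. n - i"]) (use that in auto)
    also have "\<dots> = (\<Sum>j\<le>n-1. (if j \<ge> n - m then \<pi> * u * b (n - j) else 0) * x ^ j)"
      by (rule sum.mono_neutral_cong_left) auto
    finally have xn: "x ^ n = (\<Sum>j\<le>n-1. (if j \<ge> n - m then \<pi> * u * b (n - j) else 0) * x ^ j)" by simp
    define a' where "a' j = a j + a n * (if j \<ge> n - m then \<pi> * u * b (n - j) else 0)" for j
    have "{..n} = insert n {..n-1}" using that by auto
    then have "(\<Sum>i\<le>n. a i * x ^ i) = a n * x ^ n + (\<Sum>i\<le>n-1. a i * x ^ i)" using that by (simp add: sum.insert_if)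
    also have "\<dots> = (\<Sum>i\<le>n-1. a' i * x ^ i)"
      unfolding xn a'_def by (simp add: sum_distrib_left sum.distrib[symmetric] algebra_simps)
    finally have "1 = \<pi> * (\<Sum>i\<le>n-1. a' i * x ^ i)" using a by simp
    moreover have "\<forall>i. a' i \<in> A" unfolding a'_def using a b u \<pi>A As by auto
    ultimately show ?thesis unfolding rel_def by blast
  qed
  have rel0: "\<not> rel x 0" for x
  proof
    assume "rel x 0"
    then obtain a where a: "\<forall>i. a i \<in> A" "1 = \<pi> * (\<Sum>i\<le>0. a i * x ^ i)" unfolding rel_def by blast
    then have "\<pi> * a 0 = 1" by (simp only: atMost_0 sum.insert finite.emptyI) simp
    then have "inverse \<pi> = a 0" by (rule inverse_unique)
    then show False using A(2) a(1) by simp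
  qed
  \<comment> \<open>Descent on n + m: the larger of the two degrees is lowered, and by
    \<open>rel0\<close> neither of them can be 0.\<close>
  have no: "\<not> (rel x n \<and> rel (inverse x) m)" if "x \<noteq> 0" for x n m
    using that
  proof (induction "n + m" arbitrary: n m x rule: less_induct)
    case less
    show ?case
    proof
      assume *: "rel x n \<and> rel (inverse x) m"
      have nm: "n \<noteq> 0" "m \<noteq> 0" using * rel0 by metis+
      show False
      proof (cases "m \<le> n")
        case True
        have "rel x (n - 1)" using lower[of x n m] * True nm less.prems by simp
        then show False using less.hyps[of "n - 1" m x] less.prems * nm by auto
      next
        case False
        have "rel (inverse x) (m - 1)" using lower[of "inverse x" m n] * False nm less.prems by simp
        moreover have "m - 1 + n < n + m" using nm by linarith
        ultimately show False using less.hyps[of n "m - 1" "inverse x"] less.hyps[of "m - 1" n "inverse x"] less.prems * by (simp add: add.commute)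
      qed
    qed
  qed
  have adj: "\<exists>n. rel x n" if "x \<notin> A" for x
  proof -
    define B where "B = {poly P x | P. \<forall>i. Polynomial.coeff P i \<in> A}"
    have "is_subring B" unfolding B_def using A(1) by (rule is_subring_adjoin)
    moreover have "A \<subseteq> B"
    proof
      fix a assume "a \<in> A"
      then show "a \<in> B" unfolding B_def using As(4) by (intro CollectI exI[of _ "[:a:]"]) (auto simp: Polynomial.coeff_pCons split: nat.splits)
    qed
    moreover have "x \<in> B" unfolding B_def using As(1,4)
      by (intro CollectI exI[of _ "[:0,1:]"]) (auto simp: Polynomial.coeff_pCons split: nat.splits)
    ultimately have "inverse \<pi> \<in> B" using max that by blast
    then obtain P where P: "inverse \<pi> = poly P x" "\<forall>i. Polynomial.coeff P i \<in> A" unfolding B_def by blast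
    then have "1 = \<pi> * (\<Sum>i\<le>Polynomial.degree P. Polynomial.coeff P i * x ^ i)"
      using \<pi>0 right_inverse[of \<pi>] unfolding poly_altdef by metis
    then show ?thesis unfolding rel_def using P(2) by blast
  qed
  have "x \<in> A \<or> inverse x \<in> A" for x
  proof (cases "x = 0")
    case True then show ?thesis using As(4) by simp
  next
    case False then show ?thesis using no[OF False] adj by blast
  qed
  then have "padic_valuation_ring p A"
    using p As A(2) unfolding \<pi>_def by unfold_locales auto
  then show ?thesis by (rule that)
qed

context padic_valuation_ring
begin

lemma subring: "is_subring W"
  unfolding is_subring_def using one diff mult by blast

lemmas W_simps = is_subring_simps[OF subring]

lemma W_int: "of_int k \<in> W"
  using W_simps(8)[of "nat k"] W_simps(5)[OF W_simps(8)[of "nat (- k)"]] by (cases "k \<ge> 0") auto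

lemma p_nonzero: "(of_nat p :: 'c) \<noteq> 0"
  using p by auto

text \<open>Either p / b or b / p lies in \<open>W\<close>. With a Bezout relation u b + v p = 1 the
  first puts 1 / b into \<open>W\<close>, while the second would put 1 / p into it.\<close>

lemma inverse_int_in_W:
  assumes "\<not> int p dvd b" shows "inverse (of_int b) \<in> W"
proof -
  have b0: "(of_int b :: 'c) \<noteq> 0" using assms by (metis dvd_0_right of_int_eq_0_iff)
  have "coprime b (int p)" using assms p by (metis coprime_commute prime_imp_coprime prime_nat_int_transfer)
  then obtain u v where uv: "u * b + v * int p = 1" using bezout_int[of b "int p"] by (metis coprime_imp_gcd_eq_1)
  have e: "of_int u * of_int b + of_int v * of_nat p = (1::'c)"
    using arg_cong[OF uv, of "of_int :: int \<Rightarrow> 'c"] by simp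
  have "of_nat p * inverse (of_int b) \<in> W \<or> inverse (of_nat p * inverse (of_int b)) \<in> W" by (rule val)
  then show ?thesis
  proof
    assume *: "of_nat p * inverse (of_int b) \<in> W"
    have "inverse (of_int b) = (of_int u * of_int b + of_int v * of_nat p) * inverse (of_int b :: 'c)" using e by simp
    also have "\<dots> = of_int u + of_int v * (of_nat p * inverse (of_int b))" using b0 by (simp add: distrib_right)
    finally show ?thesis using W_simps(6)[OF W_int[of u] W_simps(3)[OF W_int[of v] *]] by simp
  next
    assume *: "inverse (of_nat p * inverse (of_int b)) \<in> W"
    have "inverse (of_nat p) = (of_int u * of_int b + of_int v * of_nat p) * inverse (of_nat p :: 'c)" using e by simp
    also have "\<dots> = of_int u * (inverse (of_nat p * inverse (of_int b))) + of_int v" using p_nonzero by (simp add: algebra_simps)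
    finally have "inverse (of_nat p) \<in> W" using W_simps(6)[OF W_simps(3)[OF W_int[of u] *] W_int[of v]] by simp
    then show ?thesis using inv_p by simp
  qed
qed

lemma of_rat_in_W_iff: "of_rat q \<in> W \<longleftrightarrow> q \<in> loc_int p"
proof
  assume "q \<in> loc_int p"
  then obtain a b where "q = of_int a / of_int b" "\<not> int p dvd b" unfolding loc_int_def by blast
  then have "of_rat q = of_int a * (inverse (of_int b) :: 'c)" by (simp add: divide_inverse of_rat_mult of_rat_inverse)
  then show "of_rat q \<in> W" using W_simps(3)[OF W_int inverse_int_in_W] \<open>\<not> int p dvd b\<close> by simp
next
  assume q: "of_rat q \<in> W"
  show "q \<in> loc_int p"
  proof (rule ccontr)
    assume nq: "q \<notin> loc_int p"
    then have q0: "q \<noteq> 0" "rat_val p q < 0" using loc_int_iff[OF p, of q] by auto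
    have pr: "(of_nat p :: rat) \<noteq> 0" using p by auto
    \<comment> \<open>Multiplying q, of negative valuation, by the p-integral number r = 1 / (p q)
      gives 1 / p, which \<open>W\<close> omits.\<close>
    define r where "r = inverse q * inverse (of_nat p)"
    have "rat_val p r \<ge> 0" unfolding r_def using q0 rat_val_mult[OF p, of "inverse q" "inverse (of_nat p)"]
        rat_val_inverse[OF p q0(1)] rat_val_inverse[OF p pr] rat_val_p[OF p] pr by simp
    then have "r \<in> loc_int p" using loc_int_iff[OF p] by blast
    then obtain a b where "r = of_int a / of_int b" "\<not> int p dvd b" unfolding loc_int_def by blast
    then have "of_rat r = of_int a * (inverse (of_int b) :: 'c)" by (simp add: divide_inverse of_rat_mult of_rat_inverse)
    then have r: "of_rat r \<in> W" using W_simps(3)[OF W_int inverse_int_in_W] \<open>\<not> int p dvd b\<close> by simp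
    have "q * r = inverse (of_nat p)" unfolding r_def using q0 by simp
    then have "(of_rat q :: 'c) * of_rat r = inverse (of_nat p)"
      by (metis of_rat_mult of_rat_inverse of_rat_of_nat_eq)
    then show False using W_simps(3)[OF q r] inv_p by simp
  qed
qed

end

section \<open>Number fields and their conjugates\<close>

definition ev :: "'a::field_char_0 \<Rightarrow> rat poly \<Rightarrow> 'a" where
  "ev x g = poly (map_poly of_rat g) x"

lemma ev_simps [simp]: "ev x (g + h) = ev x g + ev x h" "ev x (g - h) = ev x g - ev x h"
  "ev x (g * h) = ev x g * ev x h" "ev x 0 = 0" "ev x 1 = 1" "ev x [:c:] = of_rat c"
  "ev x (- g) = - ev x g" "ev x (Polynomial.smult c g) = of_rat c * ev x g"
  "ev x [:0, 1:] = x"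
proof -
  interpret map_poly_comm_ring_hom "of_rat :: rat \<Rightarrow> 'a" ..
  show "ev x (g + h) = ev x g + ev x h" "ev x (g - h) = ev x g - ev x h"
    "ev x (g * h) = ev x g * ev x h" "ev x 0 = 0" "ev x 1 = 1" "ev x [:c:] = of_rat c"
    "ev x (- g) = - ev x g" "ev x (Polynomial.smult c g) = of_rat c * ev x g"
    "ev x [:0, 1:] = x"
    unfolding ev_def by (simp_all add: hom_distribs)
qed

lemma ev_power [simp]: "ev x (g ^ n) = ev x g ^ n"
  by (induction n) auto

lemma ev_altdef:
  assumes "Polynomial.degree g < n"
  shows "ev x g = (\<Sum>i<n. of_rat (Polynomial.coeff g i) * x ^ i)"
proof -
  have "ev x g = (\<Sum>i\<le>Polynomial.degree g. of_rat (Polynomial.coeff g i) * x ^ i)"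
    unfolding ev_def by (simp add: poly_altdef)
  also have "\<dots> = (\<Sum>i<n. of_rat (Polynomial.coeff g i) * x ^ i)"
    by (rule sum.mono_neutral_left) (use assms in \<open>auto simp: Polynomial.coeff_eq_0\<close>)
  finally show ?thesis .
qed

text \<open>An element of least degree among the nonzero elements of the ideal generated by g and h
  divides every element of that ideal.\<close>

lemma rat_poly_bezout:
  fixes g h :: "rat poly"
  obtains u v w where "w = u * g + v * h" "w dvd g" "w dvd h"
proof (cases "g = 0 \<and> h = 0")
  case True then show ?thesis using that[of 0 0 0] by simp
next
  case False
  define J where "J = {u * g + v * h | u v. u * g + v * h \<noteq> 0}"
  have "g \<in> J \<or> h \<in> J" unfolding J_def using False
    by (metis (mono_tags, lifting) add.left_neutral add.right_neutral mem_Collect_eq mult_1 mult_zero_left)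
  then obtain w where w: "w \<in> J" "\<And>y. y \<in> J \<Longrightarrow> Polynomial.degree w \<le> Polynomial.degree y"
    using ex_has_least_nat[of "\<lambda>x. x \<in> J" _ Polynomial.degree] by metis
  then obtain u v where uv: "w = u * g + v * h" "w \<noteq> 0" unfolding J_def by blast
  have dv: "w dvd x" if "x = u' * g + v' * h" for x u' v'
  proof (rule ccontr)
    assume nd: "\<not> w dvd x"
    have "x mod w = (u' - (x div w) * u) * g + (v' - (x div w) * v) * h"
      unfolding that uv(1)[symmetric] minus_div_mult_eq_mod[symmetric]
      by (simp add: that[symmetric]) (simp add: that uv(1) algebra_simps)
    moreover have "x mod w \<noteq> 0" using nd by (simp add: dvd_eq_mod_eq_0)
    ultimately have "x mod w \<in> J" unfolding J_def by auto
    then have "Polynomial.degree w \<le> Polynomial.degree (x mod w)" by (rule w(2))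
    moreover have "Polynomial.degree (x mod w) < Polynomial.degree w"
      using degree_mod_less[OF uv(2), of x] \<open>x mod w \<noteq> 0\<close> by auto
    ultimately show False by simp
  qed
  show ?thesis by (rule that[OF uv(1)]) (use dv[of g 1 0] dv[of h 0 1] in auto)
qed

text \<open>\<open>f\<close> is the minimal polynomial of \<open>\<xi>\<close>. Its irreducibility
  is encoded in \<open>ev_0_iff\<close>: the multiples of \<open>f\<close> are the kernel of a
  homomorphism to a field.\<close>

locale number_field =
  fixes \<xi> :: "'k::field_char_0" and f :: "rat poly"
  assumes monic: "Polynomial.lead_coeff f = 1" and ev_0_iff: "ev \<xi> g = 0 \<longleftrightarrow> f dvd g"
begin

definition K :: "'k set" where "K = range (ev \<xi>)"
abbreviation d where "d \<equiv> Polynomial.degree f"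

lemma f_nonzero: "f \<noteq> 0" using monic by auto

lemma ev_f: "ev \<xi> f = 0" by (simp add: ev_0_iff)

lemma d_pos: "d > 0"
proof (rule ccontr)
  assume "\<not> d > 0"
  then have "is_unit f" using f_nonzero by (simp add: is_unit_iff_degree)
  then have "f dvd 1" .
  then have "ev \<xi> 1 = 0" using ev_0_iff by blast
  then show False by simp
qed

lemma coprime_f:
  assumes "\<not> f dvd g" obtains u v where "u * f + v * g = 1"
proof -
  obtain u v w where w: "w = u * f + v * g" "w dvd f" "w dvd g" using rat_poly_bezout by blast
  obtain r where r: "f = w * r" using w(2) by blast
  have "ev \<xi> w * ev \<xi> r = 0" using ev_f unfolding r by simp
  then have "f dvd w \<or> f dvd r" by (simp add: ev_0_iff)
  moreover have "\<not> f dvd w" using w(3) assms by (metis dvd_trans)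
  ultimately obtain s where s: "r = f * s" by blast
  have "f * (w * s) = w * r" unfolding s by (simp only: mult_ac)
  also have "\<dots> = f * 1" using r by simp
  finally have "f * (w * s) = f * 1" .
  then have ws: "w * s = 1" using f_nonzero mult_left_cancel by blast
  have "(s * u) * f + (s * v) * g = w * s" unfolding w(1) by (simp add: algebra_simps)
  then show ?thesis using ws that by metis
qed

text \<open>A Bezout relation excludes common roots of \<open>f\<close> and g unless
  \<open>f\<close> divides g. So all roots of \<open>f\<close>, in any field of characteristic 0,
  satisfy the same rational equations, and sending \<open>\<xi>\<close> to one of them is well
  defined.\<close>

lemma ev_root_0_iff:
  fixes \<rho> :: "'c::field_char_0"
  assumes "ev \<rho> f = 0" shows "ev \<rho> g = 0 \<longleftrightarrow> f dvd g"
proof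
  assume "f dvd g" then show "ev \<rho> g = 0" using assms by (auto elim!: dvdE)
next
  assume g: "ev \<rho> g = 0"
  show "f dvd g"
  proof (rule ccontr)
    assume "\<not> f dvd g"
    then obtain u v where "u * f + v * g = 1" by (rule coprime_f)
    then have "ev \<rho> (u * f + v * g) = 1" by simp
    then show False using g assms by simp
  qed
qed

lemma K_add: "x \<in> K \<Longrightarrow> y \<in> K \<Longrightarrow> x + y \<in> K"
  unfolding K_def by (auto simp flip: ev_simps)
lemma K_diff: "x \<in> K \<Longrightarrow> y \<in> K \<Longrightarrow> x - y \<in> K"
  unfolding K_def by (auto simp flip: ev_simps)
lemma K_mult: "x \<in> K \<Longrightarrow> y \<in> K \<Longrightarrow> x * y \<in> K"
  unfolding K_def by (auto simp flip: ev_simps)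
lemma K_rat: "of_rat q \<in> K"
  unfolding K_def by (metis ev_simps(6) rangeI)
lemma K_0: "0 \<in> K" and K_1: "1 \<in> K"
  using K_rat[of 0] K_rat[of 1] by auto
lemma K_nat: "of_nat n \<in> K"
  using K_rat[of "of_nat n"] by simp
lemma K_uminus: "x \<in> K \<Longrightarrow> - x \<in> K"
  using K_diff[OF K_0] by simp
lemma K_power: "x \<in> K \<Longrightarrow> x ^ n \<in> K"
  by (induction n) (simp_all add: K_1 K_mult)
lemma K_sum: "(\<And>i. i \<in> A \<Longrightarrow> h i \<in> K) \<Longrightarrow> sum h A \<in> K"
  by (induction A rule: infinite_finite_induct) (simp_all add: K_0 K_add)
lemma K_gen: "\<xi> \<in> K"
  unfolding K_def by (metis ev_simps(9) rangeI)

lemma K_inverse: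
  assumes "x \<in> K" shows "inverse x \<in> K"
proof (cases "x = 0")
  case True then show ?thesis using K_0 by simp
next
  case False
  obtain g where g: "x = ev \<xi> g" using assms unfolding K_def by blast
  then obtain u v where "u * f + v * g = 1" using False ev_0_iff coprime_f by metis
  then have "ev \<xi> (u * f + v * g) = 1" by simp
  then have "x * ev \<xi> v = 1" using ev_f g by (simp add: mult.commute)
  then have "inverse x = ev \<xi> v" by (rule inverse_unique)
  then show ?thesis unfolding K_def by simp
qed

lemma K_divide: "x \<in> K \<Longrightarrow> y \<in> K \<Longrightarrow> x / y \<in> K"
  by (simp add: divide_inverse K_mult K_inverse)

lemmas K_intros = K_add K_diff K_mult K_rat K_0 K_1 K_nat K_uminus K_power K_sum K_gen K_inverse K_divide

lemma K_eq_rat_adjoin: "K = rat_adjoin \<xi>"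
proof
  show "K \<subseteq> rat_adjoin \<xi>"
  proof
    fix x assume "x \<in> K"
    then obtain g where g: "x = ev \<xi> g" unfolding K_def by blast
    show "x \<in> rat_adjoin \<xi>" unfolding rat_adjoin_def
      by (intro CollectI exI[of _ g] exI[of _ 1]) (simp add: g ev_def)
  qed
  show "rat_adjoin \<xi> \<subseteq> K"
  proof
    fix x assume "x \<in> rat_adjoin \<xi>"
    then obtain g h where "x = ev \<xi> g / ev \<xi> h" unfolding rat_adjoin_def ev_def by blast
    then show "x \<in> K" using K_divide unfolding K_def by simp
  qed
qed

text \<open>The coordinates of x in the power basis 1, \<xi>, ..., \<xi> ^ (d - 1), stored as a
  polynomial of degree less than d.\<close>

definition co :: "'k \<Rightarrow> rat poly" where "co x = (SOME g. ev \<xi> g = x) mod f"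

lemma ev_mod: "ev \<xi> (g mod f) = ev \<xi> g"
proof -
  have "ev \<xi> g = ev \<xi> (g div f * f + g mod f)" by simp
  then show ?thesis using ev_f by (simp only: ev_simps) simp
qed

lemma degree_co: "Polynomial.degree (co x) < d"
  unfolding co_def using degree_mod_less[OF f_nonzero] d_pos by (metis degree_0)

lemma ev_co: "x \<in> K \<Longrightarrow> ev \<xi> (co x) = x"
  unfolding co_def ev_mod K_def by (metis (mono_tags) rangeE someI)

lemma co_unique:
  assumes "Polynomial.degree g < d" "ev \<xi> g = x" shows "co x = g"
proof -
  have "x \<in> K" unfolding K_def using assms by blast
  then have "ev \<xi> (co x - g) = 0" using ev_co assms by simp
  then have "f dvd co x - g" using ev_0_iff by blast
  moreover have "Polynomial.degree (co x - g) < d" using degree_co assms by (simp add: degree_diff_less)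
  ultimately have "co x - g = 0" using dvd_imp_degree_le not_le by blast
  then show ?thesis by simp
qed

lemma co_add: "x \<in> K \<Longrightarrow> y \<in> K \<Longrightarrow> co (x + y) = co x + co y"
  by (rule co_unique) (use degree_co ev_co in \<open>auto intro: degree_add_less\<close>)

lemma co_smult: "x \<in> K \<Longrightarrow> co (of_rat c * x) = Polynomial.smult c (co x)"
  by (rule co_unique) (use degree_co ev_co d_pos in \<open>auto intro: le_less_trans[OF degree_smult_le]\<close>)

lemma co_0: "co 0 = 0"
  by (rule co_unique) (use d_pos in auto)

lemma co_sum: "(\<And>i. i \<in> A \<Longrightarrow> h i \<in> K) \<Longrightarrow> co (\<Sum>i\<in>A. h i) = (\<Sum>i\<in>A. co (h i))"
  by (induction A rule: infinite_finite_induct) (simp_all add: co_0 co_add K_sum)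

definition Z :: "complex set" where "Z = {\<rho>. ev \<rho> f = 0}"

text \<open>On \<open>K\<close> this is the embedding into the complex numbers that sends
  \<open>\<xi>\<close> to the root \<rho>.\<close>

definition \<sigma> :: "complex \<Rightarrow> 'k \<Rightarrow> complex" where "\<sigma> \<rho> x = ev \<rho> (co x)"

lemma sigma_ev:
  assumes "\<rho> \<in> Z" shows "\<sigma> \<rho> (ev \<xi> g) = ev \<rho> g"
proof -
  have "ev \<xi> (co (ev \<xi> g) - g) = 0" using ev_co[of "ev \<xi> g"] unfolding K_def by simp
  then have "f dvd co (ev \<xi> g) - g" using ev_0_iff by blast
  then have "ev \<rho> (co (ev \<xi> g) - g) = 0" using ev_root_0_iff assms unfolding Z_def by blast
  then show ?thesis unfolding \<sigma>_def by simp
qed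

lemma sigma_simps:
  assumes "\<rho> \<in> Z"
  shows "x \<in> K \<Longrightarrow> y \<in> K \<Longrightarrow> \<sigma> \<rho> (x + y) = \<sigma> \<rho> x + \<sigma> \<rho> y"
    "x \<in> K \<Longrightarrow> y \<in> K \<Longrightarrow> \<sigma> \<rho> (x - y) = \<sigma> \<rho> x - \<sigma> \<rho> y"
    "x \<in> K \<Longrightarrow> y \<in> K \<Longrightarrow> \<sigma> \<rho> (x * y) = \<sigma> \<rho> x * \<sigma> \<rho> y"
    "\<sigma> \<rho> (of_rat q) = of_rat q" "\<sigma> \<rho> 1 = 1" "\<sigma> \<rho> 0 = 0" "\<sigma> \<rho> \<xi> = \<rho>"
    "x \<in> K \<Longrightarrow> \<sigma> \<rho> (x ^ n) = \<sigma> \<rho> x ^ n"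
proof -
  show "x \<in> K \<Longrightarrow> y \<in> K \<Longrightarrow> \<sigma> \<rho> (x + y) = \<sigma> \<rho> x + \<sigma> \<rho> y"
    "x \<in> K \<Longrightarrow> y \<in> K \<Longrightarrow> \<sigma> \<rho> (x - y) = \<sigma> \<rho> x - \<sigma> \<rho> y"
    "x \<in> K \<Longrightarrow> y \<in> K \<Longrightarrow> \<sigma> \<rho> (x * y) = \<sigma> \<rho> x * \<sigma> \<rho> y"
    "x \<in> K \<Longrightarrow> \<sigma> \<rho> (x ^ n) = \<sigma> \<rho> x ^ n"
    unfolding K_def using sigma_ev[OF assms] by (auto simp flip: ev_simps ev_power)
  show "\<sigma> \<rho> (of_rat q) = of_rat q" using sigma_ev[OF assms, of "[:q:]"] by simp
  show "\<sigma> \<rho> 1 = 1" using sigma_ev[OF assms, of 1] by simp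
  show "\<sigma> \<rho> 0 = 0" using sigma_ev[OF assms, of 0] by simp
  show "\<sigma> \<rho> \<xi> = \<rho>" using sigma_ev[OF assms, of "[:0,1:]"] by simp
qed

lemma sigma_eq_0_iff: "\<rho> \<in> Z \<Longrightarrow> x \<in> K \<Longrightarrow> \<sigma> \<rho> x = 0 \<longleftrightarrow> x = 0"
  unfolding K_def using sigma_ev[of \<rho>] ev_root_0_iff[of \<rho>] ev_0_iff unfolding Z_def by auto

lemma sigma_inverse: "\<rho> \<in> Z \<Longrightarrow> x \<in> K \<Longrightarrow> \<sigma> \<rho> (inverse x) = inverse (\<sigma> \<rho> x)"
proof (cases "x = 0")
  case False
  assume *: "\<rho> \<in> Z" "x \<in> K"
  have "\<sigma> \<rho> x * \<sigma> \<rho> (inverse x) = \<sigma> \<rho> (x * inverse x)" using * K_inverse sigma_simps by simp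
  also have "\<dots> = 1" using False sigma_simps * by simp
  finally show ?thesis by (metis inverse_unique)
qed (auto simp: sigma_simps)

text \<open>In characteristic 0 the derivative of \<open>f\<close> is nonzero and of smaller degree,
  so the minimal polynomial cannot divide it. Hence there are d distinct conjugates.\<close>

lemma ev_pderiv_nonzero:
  assumes "\<rho> \<in> Z" shows "ev \<rho> (pderiv f) \<noteq> 0"
proof
  assume "ev \<rho> (pderiv f) = 0"
  then have "f dvd pderiv f" using ev_root_0_iff assms unfolding Z_def by blast
  moreover have "pderiv f \<noteq> 0" using d_pos by (simp add: pderiv_eq_0_iff)
  ultimately have "d \<le> Polynomial.degree (pderiv f)" by (rule dvd_imp_degree_le)
  then show False using d_pos degree_pderiv[of f] by simp
qed

definition fC :: "complex poly" where "fC = map_poly of_rat f"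

lemma fC: "fC \<noteq> 0" "Polynomial.degree fC = d" "Polynomial.lead_coeff fC = 1" "poly fC z = ev z f"
  "poly (pderiv fC) z = ev z (pderiv f)" "Z = {z. poly fC z = 0}"
  unfolding fC_def ev_def Z_def using monic f_nonzero by (auto simp: hom_distribs)

lemma rsquarefree_fC: "rsquarefree fC"
  unfolding rsquarefree_roots using fC ev_pderiv_nonzero by auto

lemma finite_Z: "finite Z" and card_Z: "card Z = d"
  using fC poly_roots_finite[OF fC(1)] rsquarefree_card_degree[OF fC(1)] rsquarefree_fC by auto

lemma fC_prod: "fC = (\<Prod>\<rho>\<in>Z. [:- \<rho>, 1:])"
  using complex_poly_decompose_rsquarefree[OF rsquarefree_fC] fC by simp

end

lemma number_field_exists:
  fixes \<xi> :: "'k::field_char_0"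
  assumes "algebraic \<xi>"
  obtains f where "number_field \<xi> f"
proof -
  obtain P where P: "\<And>i. Polynomial.coeff P i \<in> \<int>" "P \<noteq> 0" "poly P \<xi> = 0" using assms unfolding algebraic_def by blast
  define c where "c i = (SOME k::int. Polynomial.coeff P i = of_int k)" for i
  have c: "Polynomial.coeff P i = of_int (c i)" for i
    unfolding c_def using P(1)[of i] by (metis (mono_tags, lifting) Ints_cases someI_ex)
  define g where "g = Abs_poly (\<lambda>i. of_int (c i) :: rat)"
  have "Polynomial.coeff g = (\<lambda>i. of_int (c i))" unfolding g_def
  proof (rule coeff_Abs_poly)
    fix i assume "i > Polynomial.degree P"
    then show "of_int (c i) = (0::rat)" using c[of i] Polynomial.coeff_eq_0[of P i] by simp
  qed
  then have gP: "map_poly of_rat g = P" by (intro poly_eqI) (simp add: coeff_map_poly c)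
  then have "ev \<xi> g = 0" "g \<noteq> 0" using P unfolding ev_def by auto
  then obtain h where h: "ev \<xi> h = 0 \<and> h \<noteq> 0" "\<And>y. ev \<xi> y = 0 \<and> y \<noteq> 0 \<Longrightarrow> Polynomial.degree h \<le> Polynomial.degree y"
    using ex_has_least_nat[of "\<lambda>x. ev \<xi> x = 0 \<and> x \<noteq> 0" g Polynomial.degree] by blast
  define f where "f = Polynomial.smult (inverse (Polynomial.lead_coeff h)) h"
  have hf: "f dvd y \<longleftrightarrow> h dvd y" for y unfolding f_def using h(1) by (simp add: smult_dvd_iff)
  have "number_field \<xi> f"
  proof
    show "Polynomial.lead_coeff f = 1" unfolding f_def using h(1) by simp
    fix y
    show "ev \<xi> y = 0 \<longleftrightarrow> f dvd y" unfolding hf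
    proof
      assume "h dvd y" then show "ev \<xi> y = 0" using h(1) by (auto elim!: dvdE)
    next
      assume y: "ev \<xi> y = 0"
      have "ev \<xi> (y div h * h + y mod h) = 0" using y by simp
      then have "ev \<xi> (y mod h) = 0" using h(1) by (simp only: ev_simps) simp
      then have "y mod h = 0" using h(2)[of "y mod h"] degree_mod_less[of h y] h(1) by force
      then show "h dvd y" by (simp add: dvd_eq_mod_eq_0)
    qed
  qed
  then show ?thesis by (rule that)
qed

section \<open>Normalized discrete valuations of K\<close>

context number_field
begin

lemma K_power_int: "x \<in> K \<Longrightarrow> x powi k \<in> K"
  unfolding power_int_def by (auto intro: K_intros)

text \<open>With the irrelevant values set to \<open>0\<close>, every finite place comes from exactly one valuation.\<close>

definition DV :: "('k \<Rightarrow> int) set" where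
  "DV = {v. discrete_valuation K v \<and> (\<forall>x. x \<notin> K \<or> x = 0 \<longrightarrow> v x = 0)}"

text \<open>Counts 0 as having infinite valuation, so that closure under addition needs no case
  distinction; the stored value at 0 is only a default.\<close>

definition vge :: "('k \<Rightarrow> int) \<Rightarrow> int \<Rightarrow> 'k \<Rightarrow> bool" where
  "vge v a x \<longleftrightarrow> x = 0 \<or> v x \<ge> a"

context
  fixes v assumes v: "v \<in> DV"
begin

lemma v_mult: "x \<in> K \<Longrightarrow> y \<in> K \<Longrightarrow> x \<noteq> 0 \<Longrightarrow> y \<noteq> 0 \<Longrightarrow> v (x * y) = v x + v y"
  using v unfolding DV_def discrete_valuation_def by simp

lemma v_add: "x \<in> K \<Longrightarrow> y \<in> K \<Longrightarrow> x \<noteq> 0 \<Longrightarrow> y \<noteq> 0 \<Longrightarrow> x + y \<noteq> 0 \<Longrightarrow> min (v x) (v y) \<le> v (x + y)"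
  using v unfolding DV_def discrete_valuation_def by simp

lemma v_surj: obtains x where "x \<in> K" "x \<noteq> 0" "v x = k"
proof -
  have "k \<in> v ` (K - {0})" using v unfolding DV_def discrete_valuation_def by simp
  then show ?thesis using that by auto
qed

lemma v_1: "v 1 = 0"
  using v_mult[of 1 1] K_1 by simp

lemma v_minus_1: "v (- 1) = 0"
  using v_mult[of "- 1" "- 1"] K_uminus[OF K_1] v_1 by simp

lemma v_minus: "x \<in> K \<Longrightarrow> v (- x) = v x"
  using v_mult[of "- 1" x] K_uminus[OF K_1] v_minus_1 by (cases "x = 0") auto

lemma v_inverse: "x \<in> K \<Longrightarrow> x \<noteq> 0 \<Longrightarrow> v (inverse x) = - v x"
  using v_mult[of x "inverse x"] v_1 K_inverse by simp

lemma v_divide: "x \<in> K \<Longrightarrow> y \<in> K \<Longrightarrow> x \<noteq> 0 \<Longrightarrow> y \<noteq> 0 \<Longrightarrow> v (x / y) = v x - v y"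
  using v_mult[of x "inverse y"] v_inverse K_inverse by (simp add: divide_inverse)

lemma v_power: "x \<in> K \<Longrightarrow> x \<noteq> 0 \<Longrightarrow> v (x ^ n) = int n * v x"
  by (induction n) (simp_all add: v_1 v_mult K_power algebra_simps)

lemma v_power_int: "x \<in> K \<Longrightarrow> x \<noteq> 0 \<Longrightarrow> v (x powi k) = k * v x"
  unfolding power_int_def by (auto simp: v_power v_inverse K_power K_inverse)

lemma vge_0: "vge v a 0" unfolding vge_def by simp

lemma vge_mono: "vge v a x \<Longrightarrow> b \<le> a \<Longrightarrow> vge v b x" unfolding vge_def by auto

lemma vge_add: "x \<in> K \<Longrightarrow> y \<in> K \<Longrightarrow> vge v a x \<Longrightarrow> vge v a y \<Longrightarrow> vge v a (x + y)"
  using v_add[of x y] unfolding vge_def by (cases "x = 0 \<or> y = 0 \<or> x + y = 0") auto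

lemma vge_minus: "x \<in> K \<Longrightarrow> vge v a x \<Longrightarrow> vge v a (- x)"
  unfolding vge_def by (auto simp: v_minus)

lemma vge_diff: "x \<in> K \<Longrightarrow> y \<in> K \<Longrightarrow> vge v a x \<Longrightarrow> vge v a y \<Longrightarrow> vge v a (x - y)"
  using vge_add[of x "- y"] vge_minus K_uminus by simp

lemma vge_mult: "x \<in> K \<Longrightarrow> y \<in> K \<Longrightarrow> vge v a x \<Longrightarrow> vge v b y \<Longrightarrow> vge v (a + b) (x * y)"
  using v_mult[of x y] unfolding vge_def by (cases "x = 0 \<or> y = 0") auto

lemma vge_sum: "(\<And>i. i \<in> I \<Longrightarrow> h i \<in> K) \<Longrightarrow> (\<And>i. i \<in> I \<Longrightarrow> vge v a (h i)) \<Longrightarrow> vge v a (\<Sum>i\<in>I. h i)"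
  by (induction I rule: infinite_finite_induct) (simp_all add: vge_0 vge_add K_sum)

lemma vge_1: "vge v 0 1" unfolding vge_def by (simp add: v_1)

lemma vge_nat: "vge v 0 (of_nat n)"
  by (induction n) (simp_all add: vge_0 vge_1 vge_add K_nat K_1)

lemma vge_int: "vge v 0 (of_int k)"
  using vge_nat[of "nat k"] vge_minus[OF K_nat vge_nat[of "nat (- k)"]] by (cases "k \<ge> 0") auto

text \<open>The reverse bound comes from the ultrametric inequality for x = (x + y) - y.\<close>

lemma v_add_eq:
  assumes "x \<in> K" "y \<in> K" "x \<noteq> 0" "vge v (v x + 1) y"
  shows "x + y \<noteq> 0" "v (x + y) = v x"
proof -
  show nz: "x + y \<noteq> 0"
  proof
    assume "x + y = 0"
    then have "y = - x" by (simp add: eq_neg_iff_add_eq_0 add.commute)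
    then show False using assms v_minus[of x] unfolding vge_def by auto
  qed
  have "vge v (v x) (x + y)" using vge_add[of x y "v x"] assms unfolding vge_def by auto
  then have 1: "v (x + y) \<ge> v x" using nz unfolding vge_def by simp
  have "\<not> v (x + y) \<ge> v x + 1"
  proof
    assume "v (x + y) \<ge> v x + 1"
    then have "vge v (v x + 1) (x + y - y)" using vge_diff[of "x + y" y] assms K_add unfolding vge_def by blast
    then show False using assms(3) unfolding vge_def by simp
  qed
  then show "v (x + y) = v x" using 1 by simp
qed

lemma v_of_nat_nonneg: "v (of_nat n) \<ge> 0"
  using vge_nat[of n] v unfolding vge_def DV_def by auto

lemma K_bounded_below: obtains B where "\<And>i. i < d \<Longrightarrow> vge v B (\<xi> ^ i)" "B \<le> 0"
proof -
  have "vge v (- int d * \<bar>v \<xi>\<bar>) (\<xi> ^ i)" if "i < d" for i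
  proof (cases "\<xi> = 0")
    case True then show ?thesis using v_1 unfolding vge_def by (cases i) auto
  next
    case False
    have "- int d * \<bar>v \<xi>\<bar> \<le> - (int i * \<bar>v \<xi>\<bar>)" using that by (simp add: mult_right_mono)
    also have "\<dots> \<le> int i * v \<xi>"
      using mult_left_mono[OF abs_ge_minus_self, of "int i" "v \<xi>"] by (simp add: minus_le_iff)
    finally show ?thesis using v_power[OF K_gen False] unfolding vge_def by simp
  qed
  then show ?thesis using that[of "- int d * \<bar>v \<xi>\<bar>"] by simp
qed

lemma ev_co_sum: "x \<in> K \<Longrightarrow> x = (\<Sum>i<d. of_rat (Polynomial.coeff (co x) i) * \<xi> ^ i)"
  using ev_altdef[OF degree_co, of \<xi> x] ev_co by simp

text \<open>A valuation vanishing at all primes is nonnegative on the rationals, hence bounded below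
  on their span by finitely many powers of \<xi>, that is, on \<open>K\<close>. This contradicts
  surjectivity.\<close>

lemma exists_residue_char: obtains p where "prime p" "v (of_nat p) > 0"
proof (rule ccontr)
  note found = that
  assume contra: "\<not> thesis"
  have pr: "v (of_nat q) = 0" if q: "prime q" for q
  proof (rule ccontr)
    assume "v (of_nat q) \<noteq> 0"
    then have "v (of_nat q) > 0" using v_of_nat_nonneg[of q] by simp
    then show False using found[OF q] contra by simp
  qed
  have nat: "v (of_nat n) = 0" if "n > 0" for n
    using that
  proof (induction n rule: less_induct)
    case (less n)
    show ?case
    proof (cases "n = 1")
      case True then show ?thesis using v_1 by simp
    next
      case False
      then obtain q where q: "prime q" "q dvd n" using prime_factor_nat by blast
      then obtain m where m: "n = q * m" by blast
      have "m > 0" "m < n" using m less.prems prime_gt_1_nat[OF q(1)] by auto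
      then have "v (of_nat m) = 0" using less.IH by blast
      moreover have "v (of_nat n) = v (of_nat q) + v (of_nat m)"
        unfolding m of_nat_mult using \<open>m > 0\<close> prime_gt_0_nat[OF q(1)] by (intro v_mult K_nat) auto
      ultimately show ?thesis using pr[OF q(1)] by simp
    qed
  qed
  have int: "vge v 0 (of_int k) \<and> (k \<noteq> 0 \<longrightarrow> v (of_int k) = 0)" for k
  proof (cases "k > 0")
    case True then show ?thesis using vge_int[of k] nat[of "nat k"] by simp
  next
    case False
    then show ?thesis using vge_int[of k] nat[of "nat (- k)"] v_minus[OF K_nat[of "nat (- k)"]]
      by (cases "k = 0") simp_all
  qed
  have rat: "vge v 0 (of_rat q)" for q
  proof (cases "q = 0")
    case False
    then obtain a b where ab: "a \<noteq> 0" "b \<noteq> 0" "q = of_int a / of_int b" by (rule rat_frac_exists)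
    have ik: "(of_int k :: 'k) \<in> K" for k using K_rat[of "of_int k"] by simp
    have "v (of_rat q) = v (of_int a / of_int b)" unfolding ab(3) by (simp add: of_rat_divide)
    also have "\<dots> = 0" using v_divide[OF ik ik, of a b] ab int by simp
    finally show ?thesis unfolding vge_def by simp
  qed (simp add: vge_0)
  obtain B where B: "\<And>i. i < d \<Longrightarrow> vge v B (\<xi> ^ i)" "B \<le> 0" using K_bounded_below by blast
  have all: "vge v B x" if "x \<in> K" for x
  proof -
    have "vge v B (of_rat c * \<xi> ^ i)" if "i < d" for c i
      using vge_mult[OF K_rat K_power[OF K_gen] rat B(1)[OF that], of c] by simp
    then have "vge v B (\<Sum>i<d. of_rat (Polynomial.coeff (co x) i) * \<xi> ^ i)"
      by (intro vge_sum) (auto intro: K_intros)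
    then show ?thesis using ev_co_sum[OF that] by simp
  qed
  obtain x where "x \<in> K" "x \<noteq> 0" "v x = B - 1" using v_surj by blast
  then show False using all[of x] unfolding vge_def by simp
qed

lemma residue_char_unique:
  assumes "prime p" "v (of_nat p) > 0" "\<not> p dvd n" shows "v (of_nat n) = 0"
proof (rule ccontr)
  assume "v (of_nat n) \<noteq> 0"
  then have n: "v (of_nat n) > 0" using v_of_nat_nonneg[of n] by simp
  have "coprime (int n) (int p)" using prime_imp_coprime[OF assms(1,3)] by (simp add: coprime_commute)
  then obtain a b where ab: "a * int n + b * int p = 1" using bezout_int[of "int n" "int p"] by (metis coprime_imp_gcd_eq_1)
  have ik: "(of_int k :: 'k) \<in> K" for k using K_rat[of "of_int k"] by simp
  have "of_int a * of_nat n + of_int b * of_nat p = (1::'k)"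
    using arg_cong[OF ab, of "of_int :: int \<Rightarrow> 'k"] by simp
  moreover have "vge v 1 (of_int a * of_nat n)" "vge v 1 (of_int b * of_nat p)"
    using vge_mult[OF ik K_nat vge_int, of 1 n] vge_mult[OF ik K_nat vge_int, of 1 p] n assms(2) unfolding vge_def by auto
  ultimately have "vge v 1 1" using vge_add[of "of_int a * of_nat n" "of_int b * of_nat p" 1] ik by (simp add: K_mult K_nat)
  then show False using v_1 unfolding vge_def by simp
qed

lemma v_of_int_unit:
  assumes "prime p" "v (of_nat p) > 0" "\<not> int p dvd b" shows "v (of_int b) = 0"
proof -
  have "\<not> p dvd nat \<bar>b\<bar>" using assms(3) by (metis dvd_abs_iff abs_ge_zero int_dvd_int_iff nat_0_le)
  then have "v (of_nat (nat \<bar>b\<bar>)) = 0" using residue_char_unique assms by blast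
  then show ?thesis using v_minus[OF K_nat[of "nat \<bar>b\<bar>"]] by (cases "b \<ge> 0") auto
qed

lemma vge_loc_int:
  assumes p: "prime p" "v (of_nat p) > 0" and q: "q \<in> loc_int p"
  shows "vge v 0 (of_rat q)"
proof -
  have ik: "(of_int k :: 'k) \<in> K" for k using K_rat[of "of_int k"] by simp
  obtain a b where ab: "q = of_int a / of_int b" "\<not> int p dvd b" using q unfolding loc_int_def by blast
  have b: "b \<noteq> 0" "v (of_int b) = 0" using v_of_int_unit[OF p ab(2)] ab(2) by auto
  have "of_rat q = of_int a * inverse (of_int b :: 'k)" unfolding ab(1) by (simp add: of_rat_divide divide_inverse of_rat_mult of_rat_inverse)
  moreover have "vge v (0 + 0) (of_int a * inverse (of_int b))"
    by (rule vge_mult[OF ik K_inverse[OF ik] vge_int]) (use b v_inverse[OF ik, of b] in \<open>simp add: vge_def\<close>)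
  ultimately show ?thesis by simp
qed

text \<open>The sum is (u ^ k - 1) / (u - 1) for u \<noteq> 1. This decides whether passing from
  \<xi> ^ n - 1 to \<xi> ^ (k n) - 1 changes the value at v: it does for k = p, and it does not for
  k prime to p.\<close>

lemma geometric_sum_val:
  assumes u: "u \<in> K" and u1: "vge v 1 (u - 1)"
  shows "vge v 1 ((\<Sum>i<k. u ^ i) - of_nat k)"
proof -
  have u0: "vge v 0 u" using vge_add[of "u - 1" 1 0] u K_diff[OF u K_1] K_1 vge_1 vge_mono[OF u1, of 0] by simp
  have pw: "vge v 0 (u ^ i)" for i
  proof (induction i)
    case (Suc i) then show ?case using vge_mult[OF u K_power[OF u] u0 Suc] by simp
  qed (simp add: vge_1)
  have "vge v 1 (u ^ i - 1)" for i
  proof -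
    have "vge v 0 (\<Sum>j<i. u ^ j)" by (intro vge_sum pw) (use u K_power in auto)
    then have "vge v (1 + 0) ((u - 1) * (\<Sum>j<i. u ^ j))"
      using u1 u by (intro vge_mult) (auto intro: K_intros)
    then show ?thesis by (simp add: power_diff_1_eq)
  qed
  then have "vge v 1 (\<Sum>i<k. u ^ i - 1)" using u by (intro vge_sum) (auto intro: K_intros)
  then show ?thesis by (simp add: sum_subtractf)
qed

end

text \<open>The d + 1 powers of x lie in a rational vector space of dimension d.\<close>

lemma algebraic_relation:
  assumes x: "x \<in> K"
  obtains g where "g \<noteq> 0" "Polynomial.degree g \<le> d" "ev x g = 0"
\<comment> \<open>A repeated power is a relation by itself; otherwise the powers form a set with d +
  1 elements, to which linear dependence of sets applies.\<close>
proof (cases "inj_on (\<lambda>i. x ^ i) {..d}")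
  case False
  then obtain i j where ij: "i \<le> d" "j \<le> d" "i \<noteq> j" "x ^ i = x ^ j" unfolding inj_on_def by auto
  define g :: "rat poly" where "g = Polynomial.monom 1 i - Polynomial.monom 1 j"
  have "Polynomial.coeff g i = 1" unfolding g_def using ij by simp
  then have "g \<noteq> 0" by auto
  moreover have "Polynomial.degree g \<le> d" unfolding g_def
    using ij by (intro degree_diff_le) (auto intro: order.trans[OF degree_monom_le])
  moreover have "ev x (Polynomial.monom 1 n) = x ^ n" for n
    unfolding ev_def by (simp add: map_poly_monom poly_monom)
  then have "ev x g = 0" unfolding g_def using ij by simp
  ultimately show ?thesis using that by blast
next
  case True
  interpret vs: vector_space "\<lambda>q y. of_rat q * (y::'k)"
    by unfold_locales (auto simp: algebra_simps of_rat_add of_rat_mult)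
  define S where "S = (\<lambda>i. x ^ i) ` {..d}"
  define T where "T = (\<lambda>i. \<xi> ^ i) ` {..<d}"
  have "K \<subseteq> vs.span T"
  proof
    fix y assume "y \<in> K"
    then have "y = (\<Sum>i<d. of_rat (Polynomial.coeff (co y) i) * \<xi> ^ i)"
      using ev_altdef[OF degree_co, of \<xi> y] ev_co by simp
    also have "\<dots> \<in> vs.span T"
      by (intro vs.span_sum vs.span_scale vs.span_base) (auto simp: T_def)
    finally show "y \<in> vs.span T" .
  qed
  then have "S \<subseteq> vs.span T" unfolding S_def using K_power[OF x] by auto
  moreover have "card S = Suc d" unfolding S_def using True by (simp add: card_image)
  moreover have "card T \<le> d" unfolding T_def using card_image_le[of "{..<d}" "\<lambda>i. \<xi> ^ i"] by simp
  ultimately have "vs.dependent S" using vs.independent_span_bound[of T S] unfolding T_def by fastforce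
  moreover have "finite S" unfolding S_def by simp
  ultimately obtain u where u: "\<exists>y\<in>S. u y \<noteq> 0" "(\<Sum>y\<in>S. of_rat (u y) * y) = 0"
    using vs.dependent_finite by auto
  define g where "g = (\<Sum>i\<le>d. Polynomial.monom (u (x ^ i)) i)"
  have cg: "Polynomial.coeff g i = (if i \<le> d then u (x ^ i) else 0)" for i
    unfolding g_def by (simp add: coeff_sum)
  obtain i where "i \<le> d" "u (x ^ i) \<noteq> 0" using u(1) unfolding S_def by auto
  then have "g \<noteq> 0" using cg[of i] by auto
  moreover have dg: "Polynomial.degree g \<le> d" by (intro degree_le) (simp add: cg)
  moreover have "ev x g = 0"
  proof -
    have "ev x g = (\<Sum>i<Suc d. of_rat (Polynomial.coeff g i) * x ^ i)" using dg by (intro ev_altdef) simp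
    also have "\<dots> = (\<Sum>i\<le>d. of_rat (u (x ^ i)) * x ^ i)" unfolding lessThan_Suc_atMost by (simp add: cg)
    also have "\<dots> = (\<Sum>y\<in>S. of_rat (u y) * y)" unfolding S_def using True by (simp add: sum.reindex)
    finally show ?thesis using u by simp
  qed
  ultimately show ?thesis using that by blast
qed

end

section \<open>From a valuation ring of K above p to a discrete valuation\<close>

lemma finite_preorder_max:
  assumes "finite I" "I \<noteq> {}" "\<And>i. i \<in> I \<Longrightarrow> R i i"
    and "\<And>i j k. i \<in> I \<Longrightarrow> j \<in> I \<Longrightarrow> k \<in> I \<Longrightarrow> R i j \<Longrightarrow> R j k \<Longrightarrow> R i k"
    and "\<And>i j. i \<in> I \<Longrightarrow> j \<in> I \<Longrightarrow> R i j \<or> R j i"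
  obtains m where "m \<in> I" "\<And>i. i \<in> I \<Longrightarrow> R i m"
proof -
  have "\<exists>m\<in>J. \<forall>i\<in>J. R i m" if "finite J" "J \<noteq> {}" "J \<subseteq> I" for J
    using that
  proof (induction J rule: finite_ne_induct)
    case (singleton x) then show ?case using assms(3) by auto
  next
    case (insert x F)
    then obtain m where m: "m \<in> F" "\<forall>i\<in>F. R i m" by auto
    show ?case
    proof (cases "R x m")
      case True then show ?thesis using m by auto
    next
      case False
      then have mx: "R m x" using assms(5)[of x m] m insert by auto
      have "R i x" if "i \<in> insert x F" for i
      proof (cases "i = x")
        case True then show ?thesis using assms(3) insert by auto
      next
        case False
        then have "i \<in> F" using that by simp
        then show ?thesis using assms(4)[of i m x] m mx insert by auto
      qed
      then show ?thesis by auto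
    qed
  qed
  from this[OF assms(1,2) subset_refl] show ?thesis using that by blast
qed

text \<open>A valuation ring of \<open>K\<close> lying over Z_(p), given without a value group. The
  aim is a normalized discrete valuation whose valuation ring is contained in
  \<open>B\<close>.\<close>

locale local_subring = number_field +
  fixes p :: nat and B :: "'a set"
  assumes p: "prime p" and B_K: "B \<subseteq> K" and B_sub: "is_subring B"
    and B_val: "x \<in> K \<Longrightarrow> x \<in> B \<or> inverse x \<in> B"
    and B_rat: "of_rat q \<in> B \<longleftrightarrow> q \<in> loc_int p"
begin

lemmas B_simps = is_subring_simps[OF B_sub]

definition U where "U x \<longleftrightarrow> x \<in> K \<and> x \<noteq> 0 \<and> x \<in> B \<and> inverse x \<in> B"

lemma U_1: "U 1" unfolding U_def using K_1 B_simps by simp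
lemma U_mult: "U x \<Longrightarrow> U y \<Longrightarrow> U (x * y)" unfolding U_def using K_mult B_simps(3) by simp
lemma U_inverse: "U x \<Longrightarrow> U (inverse x)" unfolding U_def using K_inverse by simp
lemma U_power: "U x \<Longrightarrow> U (x ^ n)" by (induction n) (simp_all add: U_1 U_mult)

abbreviation \<pi> :: 'a where "\<pi> \<equiv> of_nat p"

lemma pi_nonzero: "\<pi> \<noteq> 0" using p by auto
lemma pi_K: "\<pi> \<in> K" by (rule K_nat)
lemma pi_B: "\<pi> \<in> B" by (rule B_simps(8))

lemma inverse_pi: "inverse \<pi> \<notin> B"
proof
  assume "inverse \<pi> \<in> B"
  then have "of_rat (inverse (of_nat p)) \<in> B" by (simp add: of_rat_inverse)
  then have "inverse (of_nat p) \<in> loc_int p" using B_rat by blast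
  then have "of_nat p * inverse (of_nat p) \<noteq> (1::rat)" by (rule loc_int_p_not_unit[OF p])
  then show False using p by simp
qed

lemma U_pi_powi: assumes "U (\<pi> powi k)" shows "k = 0"
proof -
  have no: "\<not> U (\<pi> ^ n)" if "n > 0" for n
  proof
    assume "U (\<pi> ^ n)"
    then have i: "inverse (\<pi> ^ n) \<in> B" unfolding U_def by simp
    have "inverse \<pi> = \<pi> ^ (n - 1) * inverse (\<pi> ^ n)"
      using that pi_nonzero by (cases n) (simp_all add: field_simps)
    also have "\<dots> \<in> B" by (rule B_simps(3)[OF B_simps(7)[OF pi_B] i])
    finally show False using inverse_pi by simp
  qed
  show ?thesis
  proof (rule ccontr)
    assume "k \<noteq> 0"
    then consider "k > 0" | "k < 0" by linarith
    then show False
    proof cases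
      case 1 then show False using no[of "nat k"] assms unfolding power_int_def by simp
    next
      case 2 then show False using no[of "nat (- k)"] U_inverse[OF assms] unfolding power_int_def
        by (simp add: power_inverse)
    qed
  qed
qed

lemma U_rat:
  assumes "q \<noteq> 0" shows "U (of_rat q * \<pi> powi (- rat_val p q))"
proof -
  define r where "r = q * of_nat p powi (- rat_val p q)"
  have pr: "(of_nat p :: rat) \<noteq> 0" using p by auto
  have powi: "rat_val p (of_nat p powi k) = k" for k
    unfolding power_int_def using rat_val_power[OF p pr] rat_val_p[OF p] rat_val_inverse[OF p, of "of_nat p ^ nat (-k)"] pr
    by (auto simp: power_inverse)
  have r: "r \<noteq> 0" "rat_val p r = 0" unfolding r_def using assms pr rat_val_mult[OF p assms, of "of_nat p powi (- rat_val p q)"] powi by auto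
  then have "r \<in> loc_int p" "inverse r \<in> loc_int p" using loc_int_iff[OF p] rat_val_inverse[OF p r(1)] by auto
  then have "of_rat r \<in> B" "of_rat (inverse r) \<in> B" using B_rat by blast+
  then have "U (of_rat r)" unfolding U_def using K_rat r by (simp add: of_rat_inverse)
  moreover have "of_rat (of_nat p powi k :: rat) = \<pi> powi k" for k
    unfolding power_int_def by (simp add: of_rat_power of_rat_inverse)
  ultimately show ?thesis unfolding r_def by (simp add: of_rat_mult)
qed

text \<open>If x + y is a unit and y / x lies in \<open>B\<close>, then 1 / x = (1 + y / x) / (x +
  y) lies in \<open>B\<close> as well; the case of x / y is symmetric.\<close>

lemma nonunit_sum:
  assumes "finite J" "\<And>i. i \<in> J \<Longrightarrow> t i \<in> B" "\<And>i. i \<in> J \<Longrightarrow> \<not> U (t i)"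
  shows "(\<Sum>i\<in>J. t i) \<in> B \<and> \<not> U (\<Sum>i\<in>J. t i)"
  using assms
proof (induction J rule: finite_induct)
  case empty then show ?case using B_simps unfolding U_def by simp
next
  case (insert j J)
  define x y where "x = t j" and "y = (\<Sum>i\<in>J. t i)"
  have xy: "x \<in> B" "\<not> U x" "y \<in> B" "\<not> U y" unfolding x_def y_def using insert by auto
  then have xyK: "x \<in> K" "y \<in> K" using B_K by auto
  have "\<not> U (x + y)"
  proof
    assume u: "U (x + y)"
    define e where "e = inverse (x + y)"
    have e: "e \<in> B" "(x + y) * e = 1" using u unfolding e_def U_def by auto
    have nz: "x \<noteq> 0" "y \<noteq> 0" using u xy by auto
    consider "y * inverse x \<in> B" | "x * inverse y \<in> B"
      using B_val[of "y * inverse x"] xyK K_mult K_inverse nz by (auto simp: mult.commute)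
    then show False
    proof cases
      case 1
      have "inverse x = (1 + y * inverse x) * e" using e(2) nz by (simp add: field_simps)
      also have "\<dots> \<in> B" by (intro B_simps(3,6,1) 1 e)
      finally show False using xy xyK nz unfolding U_def by simp
    next
      case 2
      have "inverse y = (1 + x * inverse y) * e" using e(2) nz by (simp add: field_simps)
      also have "\<dots> \<in> B" by (intro B_simps(3,6,1) 2 e)
      finally show False using xy xyK nz unfolding U_def by simp
    qed
  qed
  then show ?case using insert xy B_simps(6)[OF xy(1,3)] unfolding x_def y_def by simp
qed

lemma power_unit_exists:
  assumes x: "x \<in> K" "x \<noteq> 0"
  obtains j k where "1 \<le> j" "j \<le> d" "U (x ^ j * \<pi> powi k)"
proof -
  note result = that
  obtain g where g: "g \<noteq> 0" "Polynomial.degree g \<le> d" "ev x g = 0" using algebraic_relation[OF x(1)] by blast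
  define I where "I = {i. i \<le> d \<and> Polynomial.coeff g i \<noteq> 0}"
  define t where "t i = of_rat (Polynomial.coeff g i) * x ^ i" for i
  have fI: "finite I" unfolding I_def by simp
  have neI: "I \<noteq> {}"
  proof -
    have "Polynomial.degree g \<in> I" unfolding I_def using g(1,2) by simp
    then show ?thesis by blast
  qed
  have t: "t i \<in> K" "t i \<noteq> 0" if "i \<in> I" for i
    unfolding t_def using that x by (auto simp: I_def intro!: K_intros)
  have "0 = (\<Sum>i<Suc d. t i)" unfolding t_def using g ev_altdef[of g "Suc d" x] by simp
  also have "\<dots> = (\<Sum>i\<in>I. t i)" by (rule sum.mono_neutral_right) (auto simp: I_def t_def)
  finally have sum0: "(\<Sum>i\<in>I. t i) = 0" by simp
  \<comment> \<open>\<open>t m\<close> is a term of least valuation: divisibility in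
    \<open>B\<close> is a total preorder on the terms.\<close>
  obtain m where m: "m \<in> I" "\<And>i. i \<in> I \<Longrightarrow> t i * inverse (t m) \<in> B"
  proof (rule finite_preorder_max[OF fI neI, of "\<lambda>i j. t i * inverse (t j) \<in> B"])
    show "t i * inverse (t i) \<in> B" if "i \<in> I" for i using t[OF that] B_simps by simp
    show "t i * inverse (t k) \<in> B" if "i \<in> I" "j \<in> I" "k \<in> I" "t i * inverse (t j) \<in> B" "t j * inverse (t k) \<in> B" for i j k
    proof -
      have "t i * inverse (t k) = (t i * inverse (t j)) * (t j * inverse (t k))"
        using t(2)[OF that(2)] by (simp add: field_simps)
      then show ?thesis using B_simps(3)[OF that(4,5)] by (simp only:)
    qed
    show "t i * inverse (t j) \<in> B \<or> t j * inverse (t i) \<in> B" if "i \<in> I" "j \<in> I" for i j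
      using B_val[of "t i * inverse (t j)"] t that by (auto simp: K_mult K_inverse mult.commute)
  qed blast
  \<comment> \<open>The quotients of the other terms by \<open>t m\<close> add up to -1, which is a
    unit, so by \<open>nonunit_sum\<close> one of them is a unit.\<close>
  have "\<exists>i\<in>I - {m}. U (t i * inverse (t m))"
  proof (rule ccontr)
    assume "\<not> ?thesis"
    then have "\<not> U (\<Sum>i\<in>I - {m}. t i * inverse (t m))"
      using nonunit_sum[of "I - {m}" "\<lambda>i. t i * inverse (t m)"] fI m(2) by simp
    moreover have "(\<Sum>i\<in>I - {m}. t i * inverse (t m)) = - 1"
    proof -
      have "(\<Sum>i\<in>I. t i * inverse (t m)) = 0" using sum0 by (simp add: sum_distrib_right[symmetric])
      then show ?thesis using t[OF m(1)] sum.remove[OF fI m(1), of "\<lambda>i. t i * inverse (t m)"]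
        by (simp add: eq_neg_iff_add_eq_0 add.commute)
    qed
    moreover have "U (- 1)" unfolding U_def using K_uminus[OF K_1] B_simps(5)[OF B_simps(1)] by simp
    ultimately show False by simp
  qed
  then obtain i where i: "i \<in> I" "i \<noteq> m" "U (t i * inverse (t m))" by blast
  \<comment> \<open>The quotient is a rational multiple of x ^ (b - a), and the rational factor is a
    power of p up to a unit.\<close>
  have main: thesis if ab: "a \<in> I" "b \<in> I" "a < b" "U (t b * inverse (t a))" for a b
  proof -
    define q where "q = Polynomial.coeff g b / Polynomial.coeff g a"
    have q: "q \<noteq> 0" unfolding q_def using ab unfolding I_def by auto
    have "t b * inverse (t a) = of_rat q * x ^ (b - a)"
    proof -
      have "x ^ b = x ^ (b - a) * x ^ a" using ab by (simp add: power_add[symmetric])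
      then show ?thesis unfolding t_def q_def using x by (simp add: of_rat_divide field_simps)
    qed
    then have u1: "U (of_rat q * x ^ (b - a))" using ab by simp
    have "U (of_rat q * x ^ (b - a) * inverse (of_rat q * \<pi> powi (- rat_val p q)))"
      by (intro U_mult U_inverse U_rat q u1)
    also have "of_rat q * x ^ (b - a) * inverse (of_rat q * \<pi> powi (- rat_val p q)) = x ^ (b - a) * \<pi> powi (rat_val p q)"
      using q pi_nonzero by (simp add: power_int_minus field_simps)
    finally have "U (x ^ (b - a) * \<pi> powi (rat_val p q))" .
    then show thesis by (rule result[rotated 2]) (use ab(1,2,3) in \<open>auto simp: I_def\<close>)
  qed
  show thesis
  proof (cases "m < i")
    case True then show ?thesis using main[OF m(1) i(1)] i(3) by simp
  next
    case False
    have "t m * inverse (t i) = inverse (t i * inverse (t m))" by (simp add: mult.commute)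
    then have "U (t m * inverse (t i))" using U_inverse[OF i(3)] by (simp add: mult.commute)
    then show ?thesis using main[OF i(1) m(1)] i False by simp
  qed
qed

text \<open>A nontrivial relation between the first \<open>d + 1\<close> powers of \<open>x\<close> has two terms that are equal up to a unit of \<open>B\<close>.
  Hence \<open>x ^ j\<close> is a power of \<open>p\<close> up to a unit for some \<open>j \<in> {1..d}\<close>, and so is \<open>x ^ fact d\<close>.\<close>

definition w :: "'a \<Rightarrow> int" where "w x = (SOME k. U (x ^ fact d * \<pi> powi (- k)))"

lemma w: assumes "x \<in> K" "x \<noteq> 0" shows "U (x ^ fact d * \<pi> powi (- w x))"
proof -
  obtain j k where jk: "1 \<le> j" "j \<le> d" "U (x ^ j * \<pi> powi k)" using power_unit_exists[OF assms] by blast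
  then have "j dvd fact d" by (simp add: dvd_fact)
  then obtain n where n: "fact d = j * n" by blast
  have "U ((x ^ j * \<pi> powi k) ^ n)" using jk(3) by (rule U_power)
  also have "(x ^ j * \<pi> powi k) ^ n = x ^ fact d * \<pi> powi (- (- (k * int n)))"
    unfolding n power_mult by (simp add: power_mult_distrib power_int_power')
  finally show ?thesis unfolding w_def by (rule someI)
qed

lemma w_unique:
  assumes "x \<in> K" "x \<noteq> 0" "U (x ^ fact d * \<pi> powi (- k))" shows "w x = k"
proof -
  have "U (x ^ fact d * \<pi> powi (- k) * inverse (x ^ fact d * \<pi> powi (- w x)))"
    by (intro U_mult U_inverse assms w)
  also have "x ^ fact d * \<pi> powi (- k) * inverse (x ^ fact d * \<pi> powi (- w x)) = \<pi> powi (w x - k)"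
    using assms pi_nonzero by (simp add: power_int_minus power_int_diff field_simps)
  finally have "w x - k = 0" by (rule U_pi_powi)
  then show ?thesis by simp
qed

lemma w_mult: assumes "x \<in> K" "x \<noteq> 0" "y \<in> K" "y \<noteq> 0" shows "w (x * y) = w x + w y"
proof (rule w_unique)
  have "U ((x ^ fact d * \<pi> powi (- w x)) * (y ^ fact d * \<pi> powi (- w y)))" by (intro U_mult w assms)
  also have "(x ^ fact d * \<pi> powi (- w x)) * (y ^ fact d * \<pi> powi (- w y)) = (x * y) ^ fact d * \<pi> powi (- (w x + w y))"
    using power_int_add[of \<pi> "- w x" "- w y"] pi_nonzero by (simp add: power_mult_distrib)
  finally show "U ((x * y) ^ fact d * \<pi> powi (- (w x + w y)))" .
qed (use assms K_mult in auto)

text \<open>Thus \<open>w\<close> is \<open>fact d\<close> times an extension of the p-adic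
  valuation with value 1 at p; the factor keeps the values integral.\<close>

lemma w_pi: "w \<pi> = fact d"
proof (rule w_unique)
  have "\<pi> ^ fact d * \<pi> powi (- fact d) = 1"
    using pi_nonzero by (simp add: power_int_minus flip: power_int_of_nat)
  then show "U (\<pi> ^ fact d * \<pi> powi (- fact d))" using U_1 by simp
qed (use pi_K pi_nonzero in auto)

lemma w_1: "w 1 = 0" using w_mult[of 1 1] K_1 by simp

lemma w_inverse: assumes "x \<in> K" "x \<noteq> 0" shows "w (inverse x) = - w x"
  using w_mult[of x "inverse x"] assms K_inverse w_1 by simp

lemma w_power: assumes "x \<in> K" "x \<noteq> 0" shows "w (x ^ n) = int n * w x"
  using assms by (induction n) (simp_all add: w_1 w_mult K_power algebra_simps)

lemma w_power_int: assumes "x \<in> K" "x \<noteq> 0" shows "w (x powi k) = k * w x"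
  using assms unfolding power_int_def by (auto simp: w_power w_inverse K_inverse)

text \<open>If x were not in \<open>B\<close>, both x ^ N and 1 / x would be, with N = fact d, and
  then so would x = x ^ N (1 / x) ^ (N - 1).\<close>

lemma w_nonneg_imp: assumes "x \<in> K" "x \<noteq> 0" "w x \<ge> 0" shows "x \<in> B"
proof (rule ccontr)
  assume nx: "x \<notin> B"
  then have ix: "inverse x \<in> B" using B_val assms by blast
  have "x ^ fact d = (x ^ fact d * \<pi> powi (- w x)) * \<pi> ^ nat (w x)"
  proof -
    have "\<pi> ^ nat (w x) = \<pi> powi w x" using assms(3) by (simp add: power_int_def)
    then show ?thesis using pi_nonzero by (simp add: power_int_minus)
  qed
  also have "\<dots> \<in> B" using w[OF assms(1,2)] unfolding U_def by (intro B_simps(3)[OF _ B_simps(7)[OF pi_B]]) blast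
  finally have xd: "x ^ fact d \<in> B" .
  have "x = x ^ fact d * inverse x ^ (fact d - 1)"
  proof -
    have "x ^ fact d = x * x ^ (fact d - 1)" using fact_gt_zero[of d] by (metis Suc_pred' power_Suc fact_gt_zero)
    then show ?thesis using assms by (simp add: power_mult_distrib[symmetric] mult.assoc)
  qed
  then have "x \<in> B" using B_simps(3)[OF xd B_simps(7)[OF ix]] by metis
  then show False using nx by simp
qed

lemma w_nonneg: assumes "x \<in> B" "x \<noteq> 0" shows "w x \<ge> 0"
proof (rule ccontr)
  assume n: "\<not> w x \<ge> 0"
  have xK: "x \<in> K" using assms B_K by blast
  define y where "y = x ^ (fact d) * \<pi> ^ (nat (- w x) - 1)"
  have yB: "y \<in> B" unfolding y_def by (intro B_simps(3,7) assms pi_B)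
  have u: "U (x ^ fact d * \<pi> powi (- w x))" using w xK assms by blast
  have "x ^ fact d * \<pi> powi (- w x) = y * \<pi>"
  proof -
    have "nat (- w x) = Suc (nat (- w x) - 1)" using n by simp
    then have "\<pi> powi (- w x) = \<pi> ^ (nat (- w x) - 1) * \<pi>" unfolding power_int_def using n
      by (metis power_Suc2 neg_0_le_iff_le linorder_le_cases not_le)
    then show ?thesis unfolding y_def by simp
  qed
  then have "inverse (y * \<pi>) \<in> B" using u unfolding U_def by simp
  then have "y * inverse (y * \<pi>) \<in> B" using yB B_simps(3) by blast
  moreover have "y \<noteq> 0" unfolding y_def using assms pi_nonzero by simp
  then have "y * inverse (y * \<pi>) = inverse \<pi>" by simp
  ultimately show False using inverse_pi by (simp only:)
qed

text \<open>The values of \<open>w\<close> form a nonzero subgroup of the integers; division by its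
  least positive element g makes the valuation surjective, as \<open>discrete_valuation\<close>
  requires.\<close>

lemma exists_place:
  obtains v where "v \<in> DV" "v \<pi> > 0" "\<And>x. x \<in> K \<Longrightarrow> vge v 0 x \<Longrightarrow> x \<in> B"
proof -
  define G where "G = {k. k > 0 \<and> (\<exists>x\<in>K. x \<noteq> 0 \<and> w x = int k)}"
  have "fact d \<in> G" unfolding G_def using w_pi pi_K pi_nonzero by (intro CollectI conjI bexI[of _ \<pi>]) auto
  then obtain g where g: "g \<in> G" "\<And>k. k \<in> G \<Longrightarrow> g \<le> k"
    using LeastI[of "\<lambda>k. k \<in> G"] Least_le[of "\<lambda>k. k \<in> G"] by blast
  obtain y where y: "y \<in> K" "y \<noteq> 0" "w y = int g" using g unfolding G_def by blast
  have g0: "g > 0" using g unfolding G_def by simp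
  have dv: "int g dvd w x" if "x \<in> K" "x \<noteq> 0" for x
  proof (rule ccontr)
    assume nd: "\<not> int g dvd w x"
    define r where "r = w x mod int g"
    have "r \<noteq> 0" unfolding r_def using nd by (simp add: dvd_eq_mod_eq_0)
    then have r: "0 < r" "r < int g" unfolding r_def
      using g0 pos_mod_sign[of "int g" "w x"] pos_mod_bound[of "int g" "w x"] by linarith+
    have "w (x * inverse y powi (w x div int g)) = w x + (w x div int g) * (- int g)"
      using that y K_inverse K_power_int by (simp add: w_mult w_power_int w_inverse)
    also have "\<dots> = r" unfolding r_def using minus_div_mult_eq_mod[of "w x" "int g"] by simp
    finally have wr: "w (x * inverse y powi (w x div int g)) = r" .
    have "x * inverse y powi (w x div int g) \<in> K" "x * inverse y powi (w x div int g) \<noteq> 0"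
      using that y by (simp_all add: K_mult K_inverse K_power_int)
    then have "nat r \<in> G" unfolding G_def using r(1) wr
      by (intro CollectI conjI bexI[of _ "x * inverse y powi (w x div int g)"]) simp_all
    then show False using g(2)[of "nat r"] r by simp
  qed
  define v where "v x = (if x \<in> K \<and> x \<noteq> 0 then w x div int g else 0)" for x
  have wv: "w x = v x * int g" if "x \<in> K" "x \<noteq> 0" for x unfolding v_def using dv[OF that] that by simp
  have "discrete_valuation K v" unfolding discrete_valuation_def
  proof (intro conjI ballI impI)
    show "v ` (K - {0}) = UNIV"
    proof (intro equalityI subsetI)
      fix k :: int
      have "v (y powi k) = k" unfolding v_def using w_power_int[OF y(1,2), of k] y g0 K_power_int by simp
      then show "k \<in> v ` (K - {0})" using K_power_int[OF y(1), of k] y(2) by (intro image_eqI[of _ _ "y powi k"]) auto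
    qed simp
    fix x z assume xz: "x \<in> K - {0}" "z \<in> K - {0}"
    then have "v (x * z) * int g = (v x + v z) * int g"
      using wv[of "x * z"] wv[of x] wv[of z] w_mult[of x z] K_mult by (simp add: distrib_right)
    then show "v (x * z) = v x + v z" using g0 by simp
    assume s: "x + z \<noteq> 0"
    have le: "w a \<le> w (a + b)" if "a \<in> K" "a \<noteq> 0" "b \<in> K" "b \<noteq> 0" "a + b \<noteq> 0" "w a \<le> w b" for a b
    proof -
      have "w (b * inverse a) = w b - w a" using w_mult[of b "inverse a"] w_inverse[of a] that K_inverse[of a] by simp
      then have "b * inverse a \<in> B" using that K_mult[OF that(3) K_inverse[OF that(1)]] by (intro w_nonneg_imp) simp_all
      then have 1: "1 + b * inverse a \<in> B" using B_simps by simp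
      have e: "a + b = a * (1 + b * inverse a)" using that by (simp add: field_simps)
      then have nz: "1 + b * inverse a \<noteq> 0" using that by auto
      have "w (a + b) = w a + w (1 + b * inverse a)" unfolding e
        by (rule w_mult) (use that nz in \<open>auto intro!: K_intros\<close>)
      then show ?thesis using w_nonneg[OF 1 nz] by simp
    qed
    have "min (w x) (w z) \<le> w (x + z)"
    proof (cases "w x \<le> w z")
      case True
      then have "w x \<le> w (x + z)" using le[of x z] xz s by simp
      then show ?thesis by simp
    next
      case False
      then have "w z \<le> w (z + x)" using le[of z x] xz s by (simp add: add.commute[of z x])
      then show ?thesis by (simp add: add.commute)
    qed
    then have "min (v x) (v z) * int g \<le> v (x + z) * int g"
      using wv[of x] wv[of z] wv[of "x + z"] xz s K_add[of x z] g0
      by (simp add: min_def split: if_splits)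
    then show "min (v x) (v z) \<le> v (x + z)" using g0 by (simp add: mult_le_cancel_right)
  qed
  then have "v \<in> DV" unfolding DV_def v_def by auto
  moreover have "v \<pi> > 0"
  proof -
    have "0 < v \<pi> * int g" using wv[OF pi_K pi_nonzero] w_pi fact_gt_zero[of d, where 'a = int] by simp
    then show ?thesis using g0 by (simp add: zero_less_mult_iff)
  qed
  moreover have "x \<in> B" if "x \<in> K" "vge v 0 x" for x
  proof (cases "x = 0")
    case True then show ?thesis using B_simps by simp
  next
    case False
    then have "w x \<ge> 0" using wv[OF that(1) False] that(2) unfolding vge_def by simp
    then show ?thesis using w_nonneg_imp that False by blast
  qed
  ultimately show ?thesis by (rule that)
qed

end

context number_field
begin

text \<open>The preimage of \<open>W\<close> under the embedding \<sigma> \<rho> is a valuation ring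
  of \<open>K\<close> over Z_(p).\<close>

lemma exists_place_above:
  assumes W: "padic_valuation_ring p W" and \<rho>: "\<rho> \<in> Z"
  obtains v where "v \<in> DV" "v (of_nat p) > 0" "\<And>x. x \<in> K \<Longrightarrow> vge v 0 x \<Longrightarrow> \<sigma> \<rho> x \<in> W"
proof -
  interpret W: padic_valuation_ring p W by (rule W)
  interpret local_subring \<xi> f p "{x \<in> K. \<sigma> \<rho> x \<in> W}"
  proof
    show "prime p" by (rule W.p)
    show "{x \<in> K. \<sigma> \<rho> x \<in> W} \<subseteq> K" by blast
    show "is_subring {x \<in> K. \<sigma> \<rho> x \<in> W}"
      unfolding is_subring_def by (auto simp: K_1 K_diff K_mult sigma_simps[OF \<rho>] W.one W.diff W.mult)
    show "x \<in> {x \<in> K. \<sigma> \<rho> x \<in> W} \<or> inverse x \<in> {x \<in> K. \<sigma> \<rho> x \<in> W}" if "x \<in> K" for x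
      using W.val[of "\<sigma> \<rho> x"] that K_inverse sigma_inverse[OF \<rho> that] by simp
    show "of_rat q \<in> {x \<in> K. \<sigma> \<rho> x \<in> W} \<longleftrightarrow> q \<in> loc_int p" for q
      using K_rat W.of_rat_in_W_iff sigma_simps[OF \<rho>] by simp
  qed
  obtain v where "v \<in> DV" "v (of_nat p) > 0" "\<And>x. x \<in> K \<Longrightarrow> vge v 0 x \<Longrightarrow> x \<in> {x \<in> K. \<sigma> \<rho> x \<in> W}"
    using exists_place by blast
  then show ?thesis using that by blast
qed

end

section \<open>Independence of valuations and weak approximation\<close>

context number_field
begin

text \<open>The assumption makes u vanish wherever v does, so u is determined by its value at an
  element y with v y = 1. This value is nonnegative and divides 1.\<close>

lemma DV_eqI:
  assumes v: "v \<in> DV" and u: "u \<in> DV" and le: "\<And>x. x \<in> K \<Longrightarrow> x \<noteq> 0 \<Longrightarrow> v x \<ge> 0 \<Longrightarrow> u x \<ge> 0"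
  shows "v = u"
proof -
  have zero: "u x = 0" if x: "x \<in> K" "x \<noteq> 0" "v x = 0" for x
  proof -
    have "u x \<ge> 0" using le[of x] x by simp
    moreover have "u (inverse x) \<ge> 0" using le[of "inverse x"] x K_inverse[of x] v_inverse[OF v x(1,2)] by simp
    ultimately show ?thesis using v_inverse[OF u x(1,2)] by simp
  qed
  obtain y where y: "y \<in> K" "y \<noteq> 0" "v y = 1" using v_surj[OF v] by blast
  have eq: "u x = v x * u y" if x: "x \<in> K" "x \<noteq> 0" for x
  proof -
    have yp: "y powi (- v x) \<in> K" "y powi (- v x) \<noteq> 0" using y K_power_int by auto
    have "v (x * y powi (- v x)) = 0" using v_mult[OF v x(1) yp(1) x(2) yp(2)] v_power_int[OF v y(1,2), of "- v x"] y(3) by simp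
    then have "u (x * y powi (- v x)) = 0" using zero[of "x * y powi (- v x)"] x yp K_mult by simp
    then show ?thesis using v_mult[OF u x(1) yp(1) x(2) yp(2)] v_power_int[OF u y(1,2), of "- v x"] by simp
  qed
  obtain z where z: "z \<in> K" "z \<noteq> 0" "u z = 1" using v_surj[OF u] by blast
  have "u y \<ge> 0" using le[OF y(1,2)] y(3) by simp
  moreover have "u y dvd 1" using eq[OF z(1,2)] z(3) by (metis dvd_triv_right)
  ultimately have "u y = 1" by (metis abs_of_nonneg zdvd1_eq)
  then have "v x = u x" for x
    using eq[of x] v u unfolding DV_def by (cases "x \<in> K \<and> x \<noteq> 0") auto
  then show ?thesis by blast
qed

lemma DV_separate:
  assumes v: "v \<in> DV" and u: "u \<in> DV" and ne: "v \<noteq> u"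
  obtains z where "z \<in> K" "z \<noteq> 0" "v z > 0" "u z < 0"
proof -
  have *: "\<exists>x\<in>K. x \<noteq> 0 \<and> v x \<ge> 0 \<and> u x < 0" if "v \<in> DV" "u \<in> DV" "v \<noteq> u" for v u
  proof (rule ccontr)
    assume "\<not> ?thesis"
    then have "u x \<ge> 0" if "x \<in> K" "x \<noteq> 0" "v x \<ge> 0" for x using that by (meson not_less)
    then show False using DV_eqI[OF that(1,2)] that(3) by blast
  qed
  obtain x where x: "x \<in> K" "x \<noteq> 0" "v x \<ge> 0" "u x < 0" using *[OF v u ne] by blast
  obtain y where y: "y \<in> K" "y \<noteq> 0" "u y \<ge> 0" "v y < 0" using *[OF u v] ne by blast
  show ?thesis
    by (rule that[of "x / y"])
      (use v_divide[OF v x(1) y(1) x(2) y(2)] v_divide[OF u x(1) y(1) x(2) y(2)] x y K_divide in auto)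
qed

lemma v_one_plus_power:
  assumes v: "v \<in> DV" and z: "z \<in> K" "z \<noteq> 0" and N: "N > 0"
  shows "v z > 0 \<Longrightarrow> 1 + z ^ N \<noteq> 0 \<and> v (1 + z ^ N) = 0"
    and "v z < 0 \<Longrightarrow> 1 + z ^ N \<noteq> 0 \<and> v (1 + z ^ N) = int N * v z"
proof -
  have zn: "v (z ^ N) = int N * v z" "z ^ N \<in> K" "z ^ N \<noteq> 0" using v_power[OF v z] z K_power by auto
  show "1 + z ^ N \<noteq> 0 \<and> v (1 + z ^ N) = 0" if "v z > 0"
  proof -
    have "int N * v z > 0" using that N by simp
    then have "vge v (v 1 + 1) (z ^ N)" unfolding vge_def using zn v_1[OF v] by simp
    from v_add_eq[OF v K_1 zn(2) _ this] show ?thesis using v_1[OF v] by simp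
  qed
  show "1 + z ^ N \<noteq> 0 \<and> v (1 + z ^ N) = int N * v z" if "v z < 0"
  proof -
    have "int N * v z < 0" using that N by (simp add: mult_pos_neg)
    then have "vge v (v (z ^ N) + 1) 1" unfolding vge_def using zn v_1[OF v] by simp
    from v_add_eq[OF v zn(2) K_1 zn(3) this] show ?thesis using zn by (simp add: add.commute)
  qed
qed

text \<open>Let z separate v from \<open>V\<close>, and let y separate v from a further place u. If
  z has value 0 at u, then z ^ N y separates v from both. If its value at u is positive, z ^ N is
  replaced by 1 + z ^ N, which is a unit at u and at v but keeps the poles of z ^ N at
  \<open>V\<close>.\<close>

lemma DV_separate_finite:
  assumes v: "v \<in> DV" and V: "finite V" "V \<subseteq> DV" "v \<notin> V"
  shows "\<exists>z\<in>K. z \<noteq> 0 \<and> v z > 0 \<and> (\<forall>u\<in>V. u z < 0)"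
  using V
proof (induction V rule: finite_induct)
  case empty
  obtain z where "z \<in> K" "z \<noteq> 0" "v z = 1" using v_surj[OF v] by blast
  then show ?case by auto
next
  case (insert u V)
  then obtain z where z: "z \<in> K" "z \<noteq> 0" "v z > 0" "\<forall>w\<in>V. w z < 0" by auto
  have uD: "u \<in> DV" "v \<noteq> u" using insert by auto
  obtain y where y: "y \<in> K" "y \<noteq> 0" "v y > 0" "u y < 0" using DV_separate[OF v uD] by blast
  \<comment> \<open>N exceeds every absolute value of w y with w in \<open>V\<close>, so that the
    poles of z ^ N there outweigh y.\<close>
  define N where "N = nat (1 + (\<Sum>w\<in>V. \<bar>w y\<bar>))"
  have Nn: "int N = 1 + (\<Sum>w\<in>V. \<bar>w y\<bar>)" unfolding N_def by (simp add: sum_nonneg)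
  have N: "N > 0"
  proof -
    have "0 \<le> (\<Sum>w\<in>V. \<bar>w y\<bar>)" by (rule sum_nonneg) simp
    then show ?thesis using Nn by linarith
  qed
  have big: "int N * w z + w y < 0" if "w \<in> V" for w
  proof -
    have "\<bar>w y\<bar> \<le> (\<Sum>w\<in>V. \<bar>w y\<bar>)" using insert(1) that by (intro member_le_sum) auto
    then have "w y < int N" using Nn by linarith
    moreover have "int N * w z \<le> int N * (- 1)" using z(4) that by (intro mult_left_mono) auto
    ultimately show ?thesis by simp
  qed
  consider "u z < 0" | "u z = 0" | "u z > 0" by linarith
  then show ?case
  proof cases
    case 1 then show ?thesis using z by auto
  next
    case 2
    define x where "x = z ^ N * y"
    have x: "x \<in> K" "x \<noteq> 0" unfolding x_def using z y K_mult K_power by auto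
    have val: "w x = int N * w z + w y" if "w \<in> DV" for w
      unfolding x_def using v_mult[OF that K_power[OF z(1)] y(1)] v_power[OF that z(1,2)] z y by simp
    have "int N * v z > 0" using N z(3) by simp
    then have "v x > 0" using val[OF v] y(3) by simp
    moreover have "u x < 0" using val[OF uD(1)] y(4) 2 by simp
    moreover have "w x < 0" if "w \<in> V" for w using val[of w] big[OF that] insert(4) that by auto
    ultimately show ?thesis using x by auto
  next
    case 3
    define s where "s = 1 + z ^ N"
    define x where "x = s * y"
    have sK: "s \<in> K" "s \<noteq> 0" unfolding s_def using v_one_plus_power(1)[OF v z(1,2) N z(3)] K_add[OF K_1 K_power[OF z(1)]] by simp_all
    have x: "x \<in> K" "x \<noteq> 0" unfolding x_def using sK y K_mult by auto
    have val: "w x = w s + w y" if "w \<in> DV" for w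
      unfolding x_def using v_mult[OF that sK(1) y(1) sK(2) y(2)] .
    have "v x > 0" using val[OF v] y(3) v_one_plus_power(1)[OF v z(1,2) N z(3)] unfolding s_def by simp
    moreover have "u x < 0" using val[OF uD(1)] y(4) v_one_plus_power(1)[OF uD(1) z(1,2) N 3] unfolding s_def by simp
    moreover have "w x < 0" if "w \<in> V" for w
    proof -
      have "w \<in> DV" "w z < 0" using that insert(4) z(4) by auto
      then show ?thesis using val[of w] big[OF that] v_one_plus_power(2)[of w z N] z N unfolding s_def by simp
    qed
    ultimately show ?thesis using x by auto
  qed
qed

text \<open>With z positive at v and negative at the other places, 1 / (1 + z ^ n) is close to 1 at
  v and close to 0 elsewhere in \<open>V\<close>.\<close>

lemma weak_approximation:
  assumes V: "finite V" "V \<subseteq> DV" "v \<in> V"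
  obtains a where "a \<in> K" "vge v (int N) (a - 1)" "\<And>u. u \<in> V \<Longrightarrow> u \<noteq> v \<Longrightarrow> vge u (int N) a"
proof -
  have v: "v \<in> DV" using V by blast
  obtain z where z: "z \<in> K" "z \<noteq> 0" "v z > 0" "\<forall>u\<in>V - {v}. u z < 0"
  proof -
    have "finite (V - {v})" "V - {v} \<subseteq> DV" "v \<notin> V - {v}" using V by auto
    from DV_separate_finite[OF v this] show ?thesis using that by blast
  qed
  have "Suc N > 0 \<and> Suc N \<ge> N" by simp
  then obtain n where n: "n > 0" "n \<ge> N" by blast
  define s where "s = 1 + z ^ n"
  have s: "s \<noteq> 0" "v s = 0" "s \<in> K" unfolding s_def using v_one_plus_power(1)[OF v z(1,2) n(1) z(3)] K_add[OF K_1 K_power[OF z(1)]]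
    by simp_all
  show ?thesis
  proof (rule that[of "inverse s"])
    show "inverse s \<in> K" using s K_inverse by simp
    have "inverse s - 1 = - (z ^ n * inverse s)" using s(1) unfolding s_def by (simp add: field_simps)
    moreover have "v (z ^ n * inverse s) = int n * v z"
      using v_mult[OF v K_power[OF z(1)] K_inverse[OF s(3)]] z s v_inverse[OF v s(3,1)] v_power[OF v z(1,2)] by simp
    moreover have "int n * v z \<ge> int n * 1" using z(3) by (intro mult_left_mono) auto
    ultimately show "vge v (int N) (inverse s - 1)"
      using vge_minus[OF v, of "z ^ n * inverse s" "int N"] K_mult[OF K_power[OF z(1)] K_inverse[OF s(3)]] n(2)
      unfolding vge_def by simp
    fix u assume u: "u \<in> V" "u \<noteq> v"
    then have uD: "u \<in> DV" "u z < 0" using V z by auto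
    have "u s = int n * u z" unfolding s_def using v_one_plus_power(2)[OF uD(1) z(1,2) n(1) uD(2)] by simp
    moreover have "int n * u z \<le> int n * (- 1)" using uD(2) by (intro mult_left_mono) auto
    ultimately show "vge u (int N) (inverse s)" using v_inverse[OF uD(1) s(3,1)] n(2) unfolding vge_def by simp
  qed
qed

section \<open>Determinants of families in K and the norm\<close>

definition cmat :: "(nat \<Rightarrow> 'k) \<Rightarrow> rat mat" where
  "cmat b = Matrix.mat d d (\<lambda>(i, j). Polynomial.coeff (co (b i)) j)"

text \<open>The determinant of a family in \<open>K\<close> relative to the power basis; it is
  nonzero exactly if the family is a rational basis.\<close>

definition Dt :: "(nat \<Rightarrow> 'k) \<Rightarrow> rat" where "Dt b = Determinant.det (cmat b)"

definition lin :: "(nat \<Rightarrow> rat) \<Rightarrow> (nat \<Rightarrow> 'k) \<Rightarrow> 'k" where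
  "lin c b = (\<Sum>i<d. of_rat (c i) * b i)"

lemma lin_K: "(\<And>i. i < d \<Longrightarrow> b i \<in> K) \<Longrightarrow> lin c b \<in> K"
  unfolding lin_def by (intro K_sum K_mult K_rat) simp

lemma coeff_co_lin:
  assumes "\<And>i. i < d \<Longrightarrow> b i \<in> K"
  shows "Polynomial.coeff (co (lin c b)) j = (\<Sum>i<d. c i * Polynomial.coeff (co (b i)) j)"
proof -
  have "co (lin c b) = (\<Sum>i<d. co (of_rat (c i) * b i))" unfolding lin_def
    by (rule co_sum) (use assms in \<open>auto intro: K_intros\<close>)
  also have "\<dots> = (\<Sum>i<d. Polynomial.smult (c i) (co (b i)))" using assms co_smult by (intro sum.cong) auto
  finally show ?thesis by (simp add: coeff_sum)
qed

lemma co_inject: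
  assumes "x \<in> K" "y \<in> K" "\<And>j. j < d \<Longrightarrow> Polynomial.coeff (co x) j = Polynomial.coeff (co y) j"
  shows "x = y"
proof -
  have "Polynomial.coeff (co x) j = Polynomial.coeff (co y) j" for j
    using assms(3)[of j] degree_co[of x] degree_co[of y] by (cases "j < d") (auto simp: Polynomial.coeff_eq_0)
  then have "co x = co y" by (intro poly_eqI)
  then show ?thesis using ev_co assms by metis
qed

lemma cmat_carrier: "cmat b \<in> carrier_mat d d" unfolding cmat_def by simp

lemma Dt_change:
  assumes "\<And>i. i < d \<Longrightarrow> b i \<in> K" "\<And>i. i < d \<Longrightarrow> b' i = lin (C i) b"
  shows "Dt b' = Determinant.det (Matrix.mat d d (\<lambda>(i, j). C i j)) * Dt b"
proof -
  have "cmat b' = Matrix.mat d d (\<lambda>(i, j). C i j) * cmat b"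
  proof (rule eq_matI)
    fix i j assume "i < dim_row (Matrix.mat d d (\<lambda>(i, j). C i j) * cmat b)" "j < dim_col (Matrix.mat d d (\<lambda>(i, j). C i j) * cmat b)"
    then have ij: "i < d" "j < d" unfolding cmat_def by auto
    have "cmat b' $$ (i, j) = (\<Sum>k<d. C i k * Polynomial.coeff (co (b k)) j)"
      unfolding cmat_def using ij assms(2)[OF ij(1)] coeff_co_lin[OF assms(1)] by simp
    also have "\<dots> = (Matrix.mat d d (\<lambda>(i, j). C i j) * cmat b) $$ (i, j)"
      using ij unfolding cmat_def by (simp add: scalar_prod_def lessThan_atLeast0)
    finally show "cmat b' $$ (i, j) = (Matrix.mat d d (\<lambda>(i, j). C i j) * cmat b) $$ (i, j)" .
  qed (auto simp: cmat_def)
  then show ?thesis unfolding Dt_def using det_mult[OF _ cmat_carrier, of "Matrix.mat d d (\<lambda>(i, j). C i j)"] by simp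
qed

text \<open>In the Leibniz formula a permutation other than the identity moves an index besides k,
  and the corresponding row is a unit vector.\<close>

lemma det_replace_row:
  assumes k: "k < n"
  shows "Determinant.det (Matrix.mat n n (\<lambda>(i, j). if i = k then c j else if i = j then 1 else 0)) = (c k :: rat)"
proof -
  define A where "A = Matrix.mat n n (\<lambda>(i, j). if i = k then c j else if i = j then 1 else (0::rat))"
  have A: "A \<in> carrier_mat n n" unfolding A_def by simp
  have "Determinant.det A = (\<Sum>\<pi>\<in>{\<pi>. \<pi> permutes {0..<n}}. signof \<pi> * (\<Prod>i=0..<n. A $$ (i, \<pi> i)))" by (rule det_def'[OF A])
  also have "\<dots> = (\<Sum>\<pi>\<in>{id}. signof \<pi> * (\<Prod>i=0..<n. A $$ (i, \<pi> i)))"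
  proof (rule sum.mono_neutral_right)
    show "\<forall>\<pi>\<in>{\<pi>. \<pi> permutes {0..<n}} - {id}. signof \<pi> * (\<Prod>i=0..<n. A $$ (i, \<pi> i)) = 0"
    proof
      fix \<pi> assume "\<pi> \<in> {\<pi>. \<pi> permutes {0..<n}} - {id}"
      then have \<pi>: "\<pi> permutes {0..<n}" "\<pi> \<noteq> id" by auto
      have "\<exists>i<n. i \<noteq> k \<and> \<pi> i \<noteq> i"
      proof (rule ccontr)
        assume "\<not> ?thesis"
        then have fix1: "\<pi> i = i" if "i \<noteq> k" for i
          using \<pi>(1) that by (cases "i < n") (auto simp: permutes_def)
        have "\<pi> k = k"
        proof (rule ccontr)
          assume nk: "\<pi> k \<noteq> k"
          then have "\<pi> (\<pi> k) = \<pi> k" using fix1 by blast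
          then show False using nk permutes_inj[OF \<pi>(1)] by (auto dest: injD)
        qed
        then have "\<pi> = id" using fix1 by (metis eq_id_iff)
        then show False using \<pi>(2) by simp
      qed
      then obtain i where i: "i < n" "i \<noteq> k" "\<pi> i \<noteq> i" by blast
      have "\<pi> i < n" using permutes_in_image[OF \<pi>(1), of i] i by simp
      then have "A $$ (i, \<pi> i) = 0" unfolding A_def using i by simp
      then have "(\<Prod>i=0..<n. A $$ (i, \<pi> i)) = 0" using i by (intro prod_zero) auto
      then show "signof \<pi> * (\<Prod>i=0..<n. A $$ (i, \<pi> i)) = 0" by simp
    qed
  qed (auto simp: permutes_id finite_permutations)
  also have "\<dots> = (\<Prod>i=0..<n. A $$ (i, i))" by simp
  also have "\<dots> = (\<Prod>i=0..<n. if i = k then c k else 1)" unfolding A_def by (intro prod.cong) auto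
  also have "\<dots> = c k" using k by simp
  finally show ?thesis unfolding A_def .
qed

lemma lin_unit: "k < d \<Longrightarrow> lin (\<lambda>j. if k = j then 1 else 0) b = b k"
proof -
  assume k: "k < d"
  have "lin (\<lambda>j. if k = j then 1 else 0) b = (\<Sum>i<d. if i = k then b i else 0)" unfolding lin_def by (intro sum.cong) auto
  then show ?thesis using k by simp
qed

text \<open>A form of Cramer's rule: the determinant detects the k-th coordinate. The exchange
  arguments for lattices rest on it.\<close>

lemma Dt_replace:
  assumes "\<And>i. i < d \<Longrightarrow> b i \<in> K" "k < d"
  shows "Dt (b(k := lin c b)) = c k * Dt b"
proof -
  have "Dt (b(k := lin c b)) = Determinant.det (Matrix.mat d d
      (\<lambda>(i, j). if i = k then c j else if i = j then 1 else 0)) * Dt b"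
  proof (rule Dt_change)
    show "b i \<in> K" if "i < d" for i using assms(1) that .
    show "(b(k := lin c b)) i = lin (\<lambda>j. if i = k then c j else if i = j then 1 else 0) b" if "i < d" for i
      using that lin_unit[OF that, of b] by (cases "i = k") simp_all
  qed
  then show ?thesis unfolding det_replace_row[OF assms(2)] .
qed

lemma lin_exists:
  assumes "\<And>i. i < d \<Longrightarrow> b i \<in> K" "Dt b \<noteq> 0" "y \<in> K"
  obtains c where "y = lin c b"
proof -
  define B where "B = adj_mat (cmat b)"
  have B: "B \<in> carrier_mat d d" "B * cmat b = Dt b \<cdot>\<^sub>m 1\<^sub>m d"
    unfolding B_def Dt_def using adj_mat[OF cmat_carrier] by blast+
  have ent: "(\<Sum>i<d. B $$ (k, i) * cmat b $$ (i, j)) = (if k = j then Dt b else 0)" if k: "k < d" and j: "j < d" for k j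
  proof -
    have "(B * cmat b) $$ (k, j) = (\<Sum>i<d. B $$ (k, i) * cmat b $$ (i, j))"
      using k j B(1) cmat_carrier[of b] by (simp add: scalar_prod_def lessThan_atLeast0 carrier_matD)
    moreover have "(B * cmat b) $$ (k, j) = (if k = j then Dt b else 0)"
      unfolding B(2) using k j by (cases "k = j") simp_all
    ultimately show ?thesis by simp
  qed
  define r where "r k = Polynomial.coeff (co y) k" for k
  define c where "c j = (\<Sum>k<d. r k * B $$ (k, j)) / Dt b" for j
  have "y = lin c b"
  proof (rule co_inject[OF assms(3) lin_K[OF assms(1)]])
    fix j assume j: "j < d"
    have "Polynomial.coeff (co (lin c b)) j = (\<Sum>i<d. c i * cmat b $$ (i, j))"
    proof -
      have "Polynomial.coeff (co (lin c b)) j = (\<Sum>i<d. c i * Polynomial.coeff (co (b i)) j)"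
        by (rule coeff_co_lin) (rule assms(1))
      then show ?thesis using j by (simp add: cmat_def)
    qed
    also have "\<dots> = (\<Sum>i<d. (\<Sum>k<d. r k * (B $$ (k, i) * cmat b $$ (i, j)))) / Dt b"
      unfolding c_def by (simp add: sum_divide_distrib sum_distrib_right mult.assoc)
    also have "(\<Sum>i<d. (\<Sum>k<d. r k * (B $$ (k, i) * cmat b $$ (i, j)))) = (\<Sum>k<d. r k * (\<Sum>i<d. B $$ (k, i) * cmat b $$ (i, j)))"
      by (subst sum.swap) (simp only: sum_distrib_left)
    also have "\<dots> = (\<Sum>k<d. if k = j then r k * Dt b else 0)"
      using j by (intro sum.cong) (simp_all add: ent)
    also have "\<dots> / Dt b = r j" using j assms(2) by simp
    finally show "Polynomial.coeff (co y) j = Polynomial.coeff (co (lin c b)) j" unfolding r_def by simp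
  qed simp
  then show ?thesis by (rule that)
qed

text \<open>The norm from \<open>K\<close> to the rationals: the determinant of multiplication by x
  in the power basis.\<close>

definition Nrm :: "'k \<Rightarrow> rat" where "Nrm x = Dt (\<lambda>i. x * \<xi> ^ i)"

lemma lin_co: "x \<in> K \<Longrightarrow> x = lin (Polynomial.coeff (co x)) (\<lambda>i. \<xi> ^ i)"
  unfolding lin_def using ev_altdef[OF degree_co, of \<xi> x] ev_co by simp

lemma Dt_mult:
  assumes "x \<in> K" "\<And>i. i < d \<Longrightarrow> b i \<in> K"
  shows "Dt (\<lambda>i. x * b i) = Nrm x * Dt b"
proof -
  have "Dt (\<lambda>i. x * b i) = Determinant.det (Matrix.mat d d (\<lambda>(i, j). Polynomial.coeff (co (b i)) j)) * Dt (\<lambda>i. x * \<xi> ^ i)"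
  proof (rule Dt_change)
    show "x * \<xi> ^ i \<in> K" for i using assms(1) by (intro K_intros)
    fix i assume "i < d"
    then have "x * b i = x * lin (Polynomial.coeff (co (b i))) (\<lambda>i. \<xi> ^ i)" using lin_co[OF assms(2)] by simp
    then show "x * b i = lin (Polynomial.coeff (co (b i))) (\<lambda>i. x * \<xi> ^ i)"
      unfolding lin_def by (simp add: sum_distrib_left mult_ac)
  qed
  then show ?thesis unfolding Nrm_def Dt_def[of b] cmat_def by simp
qed

text \<open>A kernel vector of the transposed matrix would be the coefficient vector of a nonzero
  polynomial of degree less than d with d roots.\<close>

lemma det_vandermonde_nonzero:
  assumes h: "bij_betw h {..<d} Z"
  shows "Determinant.det (Matrix.mat d d (\<lambda>(k, l). h l ^ k)) \<noteq> 0"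
proof
  define A where "A = Matrix.mat d d (\<lambda>(l, k). h l ^ k)"
  assume "Determinant.det (Matrix.mat d d (\<lambda>(k, l). h l ^ k)) = 0"
  moreover have "transpose_mat (Matrix.mat d d (\<lambda>(k, l). h l ^ k)) = A" unfolding A_def by (intro eq_matI) auto
  ultimately have "Determinant.det A = 0" using Determinant.det_transpose[of "Matrix.mat d d (\<lambda>(k, l). h l ^ k)" d] by simp
  moreover have A: "A \<in> carrier_mat d d" unfolding A_def by simp
  ultimately obtain v where v: "v \<in> carrier_vec d" "v \<noteq> 0\<^sub>v d" "A *\<^sub>v v = 0\<^sub>v d"
    using det_0_iff_vec_prod_zero_field[OF A] by blast
  define q where "q = (\<Sum>k<d. Polynomial.monom (v $ k) k)"
  have cq: "Polynomial.coeff q k = (if k < d then v $ k else 0)" for k unfolding q_def by (simp add: coeff_sum)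
  have dq: "Polynomial.degree q < d" using d_pos by (intro degree_lessI) (auto simp: cq)
  have root: "poly q \<rho> = 0" if "\<rho> \<in> Z" for \<rho>
  proof -
    have "\<rho> \<in> h ` {..<d}" using that bij_betw_imp_surj_on[OF h] by simp
    then obtain l where l: "l < d" "h l = \<rho>" by auto
    have "poly q \<rho> = (\<Sum>k<d. v $ k * \<rho> ^ k)" unfolding q_def by (simp add: poly_sum poly_monom)
    also have "\<dots> = (A *\<^sub>v v) $ l" unfolding A_def using l v(1)
      by (simp add: scalar_prod_def lessThan_atLeast0 mult.commute)
    finally show ?thesis using v(3) l by simp
  qed
  have "q = 0"
  proof (rule ccontr)
    assume "q \<noteq> 0"
    then have "card {x. poly q x = 0} \<le> Polynomial.degree q" using card_poly_roots_bound by blast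
    moreover have "card Z \<le> card {x. poly q x = 0}" using root poly_roots_finite[OF \<open>q \<noteq> 0\<close>] by (intro card_mono) auto
    ultimately show False using card_Z dq by simp
  qed
  then have "v $ k = 0" if "k < d" for k using cq[of k] that by simp
  then have "v = 0\<^sub>v d" using v(1) by (intro eq_vecI) auto
  then show False using v(2) by simp
qed

text \<open>The Vandermonde matrix of the conjugates diagonalizes multiplication by x, with
  eigenvalues \<sigma> \<rho> x.\<close>

lemma Nrm_eq:
  assumes x: "x \<in> K" shows "complex_of_rat (Nrm x) = (\<Prod>\<rho>\<in>Z. \<sigma> \<rho> x)"
proof -
  obtain h where h: "bij_betw h {..<d} Z" using ex_bij_betw_nat_finite[OF finite_Z] unfolding card_Z lessThan_atLeast0 by blast
  then have hZ: "h l \<in> Z" if "l < d" for l using that bij_betwE by blast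
  define V where "V = Matrix.mat d d (\<lambda>(k, l). h l ^ k)"
  define D where "D = Matrix.mat d d (\<lambda>(k, l). if k = l then \<sigma> (h l) x else 0)"
  define M where "M = map_mat complex_of_rat (cmat (\<lambda>i. x * \<xi> ^ i))"
  have car: "V \<in> carrier_mat d d" "D \<in> carrier_mat d d" "M \<in> carrier_mat d d" unfolding V_def D_def M_def cmat_def by auto
  have "M * V = V * D"
  proof (rule eq_matI)
    fix i l assume "i < dim_row (V * D)" "l < dim_col (V * D)"
    then have il: "i < d" "l < d" using car by auto
    have xK: "x * \<xi> ^ i \<in> K" using x by (intro K_intros)
    have "(M * V) $$ (i, l) = (\<Sum>j<d. of_rat (Polynomial.coeff (co (x * \<xi> ^ i)) j) * h l ^ j)"
      unfolding M_def V_def cmat_def using il by (simp add: scalar_prod_def lessThan_atLeast0)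
    also have "\<dots> = \<sigma> (h l) (x * \<xi> ^ i)" unfolding \<sigma>_def by (rule ev_altdef[OF degree_co, symmetric])
    also have "\<dots> = \<sigma> (h l) x * h l ^ i" using sigma_simps[OF hZ[OF il(2)]] x K_gen K_power by simp
    also have "\<dots> = (\<Sum>j<d. if j = l then h l ^ i * \<sigma> (h l) x else 0)" using il by simp
    also have "\<dots> = (\<Sum>j<d. h j ^ i * (if j = l then \<sigma> (h l) x else 0))" by (intro sum.cong) auto
    also have "\<dots> = (V * D) $$ (i, l)"
      unfolding D_def V_def using il by (simp add: scalar_prod_def lessThan_atLeast0)
    finally show "(M * V) $$ (i, l) = (V * D) $$ (i, l)" .
  qed (use car in auto)
  then have "Determinant.det (M * V) = Determinant.det (V * D)" by (rule arg_cong)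
  then have "Determinant.det M * Determinant.det V = Determinant.det V * Determinant.det D"
    by (simp only: det_mult[OF car(3,1)] det_mult[OF car(1,2)])
  moreover have "Determinant.det V \<noteq> 0" unfolding V_def by (rule det_vandermonde_nonzero[OF h])
  ultimately have "Determinant.det M = Determinant.det D" by simp
  also have "Determinant.det D = prod_list (diag_mat D)"
    by (rule det_upper_triangular[OF _ car(2)]) (auto simp: D_def upper_triangular_def)
  also have "\<dots> = (\<Prod>l<d. \<sigma> (h l) x)"
  proof -
    have "diag_mat D = map (\<lambda>l. \<sigma> (h l) x) [0..<d]" unfolding diag_mat_def D_def by simp
    then have "prod_list (diag_mat D) = (\<Prod>l\<in>set [0..<d]. \<sigma> (h l) x)"
      by (simp only: prod.distinct_set_conv_list distinct_upt)
    then show ?thesis by (simp add: lessThan_atLeast0)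
  qed
  also have "\<dots> = (\<Prod>\<rho>\<in>Z. \<sigma> \<rho> x)" using prod.reindex_bij_betw[OF h, of "\<lambda>\<rho>. \<sigma> \<rho> x"] .
  also have "Determinant.det M = of_rat (Nrm x)" unfolding M_def Nrm_def Dt_def by (rule of_rat_hom.hom_det)
  finally show ?thesis .
qed

end

section \<open>Lattices over the p-integral rational numbers\<close>

locale places_above = number_field +
  fixes p :: nat and W :: "complex set" and V :: "('a \<Rightarrow> int) set"
  assumes W: "padic_valuation_ring p W" and finV: "finite V" and V_DV: "V \<subseteq> DV"
    and V_p: "v \<in> V \<Longrightarrow> v (of_nat p) > 0"
    and V_W: "x \<in> K \<Longrightarrow> \<forall>v\<in>V. vge v 0 x \<Longrightarrow> \<rho> \<in> Z \<Longrightarrow> \<sigma> \<rho> x \<in> W"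
begin

sublocale W: padic_valuation_ring p W by (rule W)

lemma p: "prime p" by (rule W.p)

abbreviation \<pi> :: 'a where "\<pi> \<equiv> of_nat p"

lemma pi_nz: "\<pi> \<noteq> 0" using p by auto
lemma pi_rat_nz: "(of_nat p :: rat) \<noteq> 0" using p by auto

lemma vD: "v \<in> V \<Longrightarrow> v \<in> DV" using V_DV by blast

lemma v_pi_power: "v \<in> V \<Longrightarrow> v (\<pi> ^ n) \<ge> int n"
proof -
  assume v: "v \<in> V"
  have "v (\<pi> ^ n) = int n * v \<pi>" by (rule v_power[OF vD[OF v] K_nat pi_nz])
  moreover have "int n * v \<pi> \<ge> int n * 1" using V_p[OF v] by (intro mult_left_mono) auto
  ultimately show ?thesis by simp
qed

text \<open>A fractional ideal of the semilocal ring of elements integral at \<open>V\<close>; no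
  condition is imposed at other places.\<close>

definition M :: "(('a \<Rightarrow> int) \<Rightarrow> int) \<Rightarrow> 'a set" where
  "M a = {x \<in> K. \<forall>v\<in>V. vge v (a v) x}"

definition zmod :: "'a set \<Rightarrow> bool" where
  "zmod N \<longleftrightarrow> N \<subseteq> K \<and> 0 \<in> N \<and> (\<forall>x\<in>N. \<forall>y\<in>N. x + y \<in> N) \<and> (\<forall>c\<in>loc_int p. \<forall>x\<in>N. of_rat c * x \<in> N)"

lemma zmodD:
  assumes "zmod N"
  shows "N \<subseteq> K" "0 \<in> N" "x \<in> N \<Longrightarrow> y \<in> N \<Longrightarrow> x + y \<in> N" "c \<in> loc_int p \<Longrightarrow> x \<in> N \<Longrightarrow> of_rat c * x \<in> N"
  using assms unfolding zmod_def by simp_all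

lemma zmod_diff: assumes "zmod N" "x \<in> N" "y \<in> N" shows "x - y \<in> N"
proof -
  have "of_rat (- 1) * y \<in> N" by (rule zmodD(4)[OF assms(1) _ assms(3)]) (rule loc_int_uminus[OF p loc_int_1[OF p]])
  then show ?thesis using zmodD(3)[OF assms(1,2), of "- y"] by (simp add: of_rat_minus)
qed

lemma zmod_sum: "zmod N \<Longrightarrow> (\<And>i. i \<in> I \<Longrightarrow> h i \<in> N) \<Longrightarrow> sum h I \<in> N"
  by (induction I rule: infinite_finite_induct) (simp_all add: zmodD)

lemma zmod_M: "zmod (M a)"
  unfolding zmod_def
proof (intro conjI ballI)
  show "M a \<subseteq> K" unfolding M_def by blast
  show "0 \<in> M a" unfolding M_def using K_0 vge_0 vD by simp
  fix x y assume "x \<in> M a" "y \<in> M a"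
  then show "x + y \<in> M a" unfolding M_def using K_add vge_add vD by simp
next
  fix c x assume c: "c \<in> loc_int p" and x: "x \<in> M a"
  have "vge v (a v) (of_rat c * x)" if v: "v \<in> V" for v
  proof -
    have "vge v 0 (of_rat c)" by (rule vge_loc_int[OF vD[OF v] p V_p[OF v] c])
    from vge_mult[OF vD[OF v] K_rat _ this, of x "a v"] x v show ?thesis unfolding M_def by simp
  qed
  then show "of_rat c * x \<in> M a" unfolding M_def using x K_mult K_rat unfolding M_def by simp
qed

text \<open>The ring W[1 / p]. It contains the conjugates of all elements of \<open>K\<close> and
  the Lagrange coefficients, so that a fixed power of p clears their denominators.\<close>

definition bdd :: "complex set" where "bdd = {z. \<exists>k. of_nat p ^ k * z \<in> W}"

lemma bdd_subring: "is_subring bdd"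
proof -
  have mono: "of_nat p ^ (k + l) * z \<in> W" if "of_nat p ^ k * z \<in> W" for k l and z :: complex
    using W.W_simps(3)[OF W.W_simps(7)[OF W.W_simps(8)[of p], of l] that] by (simp add: power_add mult_ac)
  show "is_subring bdd" unfolding is_subring_def
  proof (intro conjI ballI)
    show "1 \<in> bdd" unfolding bdd_def using W.W_simps(1) by (auto intro!: exI[of _ 0])
    fix x y assume "x \<in> bdd" "y \<in> bdd"
    then obtain k l where kl: "of_nat p ^ k * x \<in> W" "of_nat p ^ l * y \<in> W" unfolding bdd_def by blast
    have "of_nat p ^ (k + l) * x - of_nat p ^ (l + k) * y \<in> W"
      by (rule W.W_simps(2)[OF mono[OF kl(1)] mono[OF kl(2)]])
    then have "of_nat p ^ (k + l) * (x - y) \<in> W" by (simp add: right_diff_distrib add.commute)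
    then show "x - y \<in> bdd" unfolding bdd_def by blast
    have "of_nat p ^ (k + l) * (x * y) = (of_nat p ^ k * x) * (of_nat p ^ l * y)" by (simp add: power_add)
    then have "of_nat p ^ (k + l) * (x * y) \<in> W" using W.W_simps(3)[OF kl] by (simp only:)
    then show "x * y \<in> bdd" unfolding bdd_def by blast
  qed
qed

lemmas bdd_simps = is_subring_simps[OF bdd_subring]

lemma M_exponent: assumes x: "x \<in> K" obtains n where "\<pi> ^ n * x \<in> M a"
proof -
  define n where "n = nat (\<Sum>v\<in>V. \<bar>a v\<bar> + \<bar>v x\<bar>)"
  have "vge v (a v) (\<pi> ^ n * x)" if v: "v \<in> V" for v
  proof (cases "x = 0")
    case True then show ?thesis unfolding vge_def by simp
  next
    case False
    have "\<bar>a v\<bar> + \<bar>v x\<bar> \<le> (\<Sum>v\<in>V. \<bar>a v\<bar> + \<bar>v x\<bar>)" using finV v by (intro member_le_sum) auto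
    moreover have "0 \<le> (\<Sum>v\<in>V. \<bar>a v\<bar> + \<bar>v x\<bar>)" by (rule sum_nonneg) simp
    ultimately have "\<bar>a v\<bar> + \<bar>v x\<bar> \<le> int n" unfolding n_def by simp
    moreover have "v (\<pi> ^ n * x) = v (\<pi> ^ n) + v x"
      using pi_nz False by (intro v_mult[OF vD[OF v]] K_power K_nat x) auto
    ultimately show ?thesis using v_pi_power[OF v, of n] unfolding vge_def by linarith
  qed
  then have "\<pi> ^ n * x \<in> M a" unfolding M_def using x by (simp add: K_mult K_power K_nat)
  then show ?thesis by (rule that)
qed

lemma sigma_bdd: assumes x: "x \<in> K" and \<rho>: "\<rho> \<in> Z" shows "\<sigma> \<rho> x \<in> bdd"
proof -
  obtain n where "\<pi> ^ n * x \<in> M (\<lambda>_. 0)" using M_exponent[OF x] by blast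
  then have "\<sigma> \<rho> (\<pi> ^ n * x) \<in> W" using V_W \<rho> unfolding M_def by blast
  moreover have "\<sigma> \<rho> \<pi> = of_nat p" using sigma_simps(4)[OF \<rho>, of "of_nat p"] by simp
  ultimately have "of_nat p ^ n * \<sigma> \<rho> x \<in> W" using sigma_simps[OF \<rho>] x K_nat K_power by simp
  then show ?thesis unfolding bdd_def by blast
qed

lemma coeff_linear_prod_bdd:
  assumes "finite A" "A \<subseteq> bdd" shows "Polynomial.coeff (\<Prod>\<rho>\<in>A. [:- \<rho>, 1:]) i \<in> bdd"
  using assms
proof (induction A arbitrary: i rule: finite_induct)
  case empty then show ?case using bdd_simps by (simp add: Polynomial.coeff_1)
next
  case (insert x F)
  have "Polynomial.coeff ([:- x, 1:] * q) i = - x * Polynomial.coeff q i + (if i = 0 then 0 else Polynomial.coeff q (i - 1))" for q :: "complex poly"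
    by (cases i) (simp_all add: Polynomial.coeff_pCons)
  then have "Polynomial.coeff (\<Prod>\<rho>\<in>insert x F. [:- \<rho>, 1:]) i =
      - x * Polynomial.coeff (\<Prod>\<rho>\<in>F. [:- \<rho>, 1:]) i + (if i = 0 then 0 else Polynomial.coeff (\<Prod>\<rho>\<in>F. [:- \<rho>, 1:]) (i - 1))" (is "_ = ?r")
    using insert(1,2) by simp
  moreover have "- x \<in> bdd" using insert(4) bdd_simps(5) by simp
  then have "?r \<in> bdd" using insert(3,4) bdd_simps(4)
    by (intro bdd_simps(6) bdd_simps(3)) auto
  ultimately show ?case by (simp only:)
qed

text \<open>Lagrange interpolation expresses the coordinates of \<open>x\<close> through its conjugates, with coefficients
  that do not depend on \<open>x\<close>.\<close>

lemma coordinates_bounded: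
  obtains k where "\<And>x i. x \<in> M (\<lambda>_. 0) \<Longrightarrow> of_nat p ^ k * Polynomial.coeff (co x) i \<in> loc_int p"
proof -
  define L where "L \<rho> = (\<Prod>\<rho>'\<in>Z - {\<rho>}. [:- \<rho>', 1:])" for \<rho>
  have Z_bdd: "Z \<subseteq> bdd" using sigma_bdd[OF K_gen] sigma_simps(7) by auto
  have Lc: "Polynomial.coeff (L \<rho>) i \<in> bdd" for \<rho> i
    unfolding L_def using finite_Z Z_bdd by (intro coeff_linear_prod_bdd) auto
  have Lv: "poly (L \<rho>) \<rho> = ev \<rho> (pderiv f)" if "\<rho> \<in> Z" for \<rho>
  proof -
    have "fC = [:- \<rho>, 1:] * L \<rho>" unfolding fC_prod L_def using finite_Z that by (simp add: prod.remove)
    then have "pderiv fC = pderiv [:- \<rho>, 1:] * L \<rho> + [:- \<rho>, 1:] * pderiv (L \<rho>)"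
      by (simp only: pderiv_mult) (simp add: algebra_simps)
    then have "poly (pderiv fC) \<rho> = poly (L \<rho>) \<rho>" by (simp add: pderiv_pCons)
    then show ?thesis using fC(5) by simp
  qed
  \<comment> \<open>The Lagrange denominators: \<open>L \<rho>\<close> takes at \<rho> the value of
    the derivative of \<open>f\<close>. Their inverses are again conjugates of an element of
    \<open>K\<close>.\<close>
  define e where "e \<rho> = inverse (ev \<rho> (pderiv f))" for \<rho> :: complex
  have eb: "e \<rho> \<in> bdd" if "\<rho> \<in> Z" for \<rho>
  proof -
    have dK: "ev \<xi> (pderiv f) \<in> K" unfolding K_def by simp
    have "e \<rho> = \<sigma> \<rho> (inverse (ev \<xi> (pderiv f)))" unfolding e_def sigma_inverse[OF that dK] sigma_ev[OF that] ..
    then show ?thesis using sigma_bdd[OF K_inverse[OF dK] that] by simp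
  qed
  have interp: "map_poly of_rat (co x) = (\<Sum>\<rho>\<in>Z. Polynomial.smult (\<sigma> \<rho> x * e \<rho>) (L \<rho>))" if x: "x \<in> K" for x
  proof -
    define q where "q = map_poly complex_of_rat (co x) - (\<Sum>\<rho>\<in>Z. Polynomial.smult (\<sigma> \<rho> x * e \<rho>) (L \<rho>))"
    have dL: "Polynomial.degree (L \<rho>) < d" if "\<rho> \<in> Z" for \<rho>
    proof -
      have "Polynomial.degree (L \<rho>) \<le> (\<Sum>\<rho>'\<in>Z - {\<rho>}. Polynomial.degree [:- \<rho>', 1:])"
        unfolding L_def using degree_prod_sum_le[of "Z - {\<rho>}" "\<lambda>\<rho>'. [:- \<rho>', 1:]"] finite_Z by (simp add: o_def)
      also have "\<dots> = card (Z - {\<rho>})" by simp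
      also have "\<dots> < d" using that card_Z finite_Z d_pos by (simp add: card_Diff_singleton)
      finally show ?thesis .
    qed
    have dq: "Polynomial.degree q < d" unfolding q_def
    proof (rule degree_diff_less)
      show "Polynomial.degree (map_poly complex_of_rat (co x)) < d" using degree_co[of x] by (simp add: degree_map_poly)
      show "Polynomial.degree (\<Sum>\<rho>\<in>Z. Polynomial.smult (\<sigma> \<rho> x * e \<rho>) (L \<rho>)) < d"
        using dL d_pos by (intro degree_sum_less) (auto intro: le_less_trans[OF degree_smult_le])
    qed
    have root: "poly q \<rho> = 0" if \<rho>: "\<rho> \<in> Z" for \<rho>
    proof -
      have "poly (L \<rho>') \<rho> = 0" if "\<rho>' \<in> Z - {\<rho>}" for \<rho>'
        unfolding L_def poly_prod using \<rho> that finite_Z by (intro prod_zero) auto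
      then have "(\<Sum>\<rho>'\<in>Z. \<sigma> \<rho>' x * e \<rho>' * poly (L \<rho>') \<rho>) = \<sigma> \<rho> x * e \<rho> * poly (L \<rho>) \<rho>"
        using finite_Z \<rho> by (simp add: sum.remove[OF finite_Z \<rho>])
      also have "\<dots> = \<sigma> \<rho> x" unfolding Lv[OF \<rho>] e_def using ev_pderiv_nonzero[OF \<rho>] by simp
      finally show ?thesis unfolding q_def \<sigma>_def by (simp add: poly_sum ev_def)
    qed
    have "q = 0"
    proof (rule ccontr)
      assume "q \<noteq> 0"
      then have "card {x. poly q x = 0} \<le> Polynomial.degree q" using card_poly_roots_bound by blast
      moreover have "card Z \<le> card {x. poly q x = 0}" using root poly_roots_finite[OF \<open>q \<noteq> 0\<close>] by (intro card_mono) auto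
      ultimately show False using card_Z dq by simp
    qed
    then show ?thesis unfolding q_def by simp
  qed
  have "\<exists>k. of_nat p ^ k * (e \<rho> * Polynomial.coeff (L \<rho>) i) \<in> W" if "\<rho> \<in> Z" for \<rho> i
    using bdd_simps(3)[OF eb[OF that] Lc] unfolding bdd_def by blast
  then obtain k where k: "\<And>\<rho> i. \<rho> \<in> Z \<Longrightarrow> of_nat p ^ k \<rho> i * (e \<rho> * Polynomial.coeff (L \<rho>) i) \<in> W" by metis
  \<comment> \<open>One exponent for all the finitely many pairs of a root and a coordinate.\<close>
  define n where "n = (\<Sum>\<rho>\<in>Z. \<Sum>i<d. k \<rho> i)"
  show ?thesis
  proof (rule that[of n])
    fix x i assume x: "x \<in> M (\<lambda>_. 0)"
    then have xK: "x \<in> K" and xW: "\<And>\<rho>. \<rho> \<in> Z \<Longrightarrow> \<sigma> \<rho> x \<in> W" using V_W unfolding M_def by blast+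
    show "of_nat p ^ n * Polynomial.coeff (co x) i \<in> loc_int p"
    proof (cases "i < d")
      case False
      then have "Polynomial.coeff (co x) i = 0" using degree_co[of x] by (simp add: Polynomial.coeff_eq_0)
      then show ?thesis using loc_int_0[OF p] by simp
    next
      case True
      have "complex_of_rat (of_nat p ^ n * Polynomial.coeff (co x) i) = of_nat p ^ n * Polynomial.coeff (map_poly of_rat (co x)) i"
        by (simp add: of_rat_mult of_rat_power coeff_map_poly)
      also have "\<dots> = (\<Sum>\<rho>\<in>Z. \<sigma> \<rho> x * (of_nat p ^ n * (e \<rho> * Polynomial.coeff (L \<rho>) i)))"
        unfolding interp[OF xK] by (simp add: coeff_sum sum_distrib_left mult_ac)
      also have "\<dots> \<in> W"
      proof (rule is_subring_sum[OF W.subring])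
        fix \<rho> assume \<rho>: "\<rho> \<in> Z"
        have "k \<rho> i \<le> (\<Sum>i<d. k \<rho> i)" using True by (intro member_le_sum) auto
        also have "\<dots> \<le> n" unfolding n_def using finite_Z \<rho> by (intro member_le_sum) auto
        finally have "of_nat p ^ n = of_nat p ^ (n - k \<rho> i) * (of_nat p ^ k \<rho> i :: complex)" by (simp flip: power_add)
        then have "of_nat p ^ n * (e \<rho> * Polynomial.coeff (L \<rho>) i) = of_nat p ^ (n - k \<rho> i) * (of_nat p ^ k \<rho> i * (e \<rho> * Polynomial.coeff (L \<rho>) i))"
          by (simp only: mult.assoc)
        then have "of_nat p ^ n * (e \<rho> * Polynomial.coeff (L \<rho>) i) \<in> W"
          using W.W_simps(3)[OF W.W_simps(7)[OF W.W_simps(8)] k[OF \<rho>]] by (simp only:)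
        then show "\<sigma> \<rho> x * (of_nat p ^ n * (e \<rho> * Polynomial.coeff (L \<rho>) i)) \<in> W"
          using W.W_simps(3) xW[OF \<rho>] by blast
      qed
      finally show ?thesis using W.of_rat_in_W_iff by blast
    qed
  qed
qed

end

section \<open>Bases and indices of lattices\<close>

context places_above
begin

text \<open>A basis over Z_(p). Linear independence is expressed by the determinant, so that
  rational coordinates exist and are unique; only their p-integrality on \<open>N\<close> remains to
  be demanded.\<close>

definition is_basis :: "'a set \<Rightarrow> (nat \<Rightarrow> 'a) \<Rightarrow> bool" where
  "is_basis N b \<longleftrightarrow> (\<forall>i<d. b i \<in> N) \<and> Dt b \<noteq> 0 \<and> (\<forall>x\<in>N. \<exists>c. (\<forall>i. c i \<in> loc_int p) \<and> x = lin c b)"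

lemma lin_cong: "(\<And>i. i < d \<Longrightarrow> c i = c' i) \<Longrightarrow> (\<And>i. i < d \<Longrightarrow> b i = b' i) \<Longrightarrow> lin c b = lin c' b'"
  unfolding lin_def by (intro sum.cong) auto

lemma lin_upd: assumes "k < d" shows "lin c (b(k := y)) = lin (c(k := 0)) b + of_rat (c k) * y"
proof -
  have "lin c (b(k := y)) = of_rat (c k) * y + (\<Sum>i\<in>{..<d} - {k}. of_rat (c i) * b i)"
    unfolding lin_def using assms by (subst sum.remove[of _ k]) (auto intro!: sum.cong)
  moreover have "lin (c(k := 0)) b = (\<Sum>i\<in>{..<d} - {k}. of_rat (c i) * b i)"
    unfolding lin_def using assms by (subst sum.remove[of _ k]) (auto intro!: sum.cong)
  ultimately show ?thesis by simp
qed

lemma lin_in_zmod: "zmod N \<Longrightarrow> (\<And>i. i < d \<Longrightarrow> b i \<in> N) \<Longrightarrow> (\<And>i. i < d \<Longrightarrow> c i \<in> loc_int p) \<Longrightarrow> lin c b \<in> N"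
  unfolding lin_def by (intro zmod_sum zmodD(4)) auto

lemma det_loc_int:
  assumes "A \<in> carrier_mat n n" "\<And>i j. i < n \<Longrightarrow> j < n \<Longrightarrow> A $$ (i, j) \<in> loc_int p"
  shows "Determinant.det A \<in> loc_int p"
  unfolding det_def'[OF assms(1)]
proof (rule loc_int_sum[OF p])
  fix \<tau> assume "\<tau> \<in> {\<tau>. \<tau> permutes {0..<n}}"
  then have "(\<Prod>i=0..<n. A $$ (i, \<tau> i)) \<in> loc_int p"
    using permutes_in_image[of \<tau> "{0..<n}"] by (intro loc_int_prod[OF p] assms(2)) auto
  moreover have "signof \<tau> = (1::rat) \<or> signof \<tau> = (- 1::rat)" by (simp add: sign_def)
  ultimately show "signof \<tau> * (\<Prod>i=0..<n. A $$ (i, \<tau> i)) \<in> loc_int p"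
    using loc_int_uminus[OF p] by auto
qed

lemma basis_K: "zmod N \<Longrightarrow> is_basis N b \<Longrightarrow> i < d \<Longrightarrow> b i \<in> K"
  using zmodD(1) unfolding is_basis_def by blast

text \<open>The matrix expressing \<open>b'\<close> through \<open>b\<close> is p-integral, hence so
  is its determinant.\<close>

lemma basis_le:
  assumes N: "zmod N" "is_basis N b" and b': "\<And>i. i < d \<Longrightarrow> b' i \<in> N" "Dt b' \<noteq> 0"
  shows "rat_val p (Dt b) \<le> rat_val p (Dt b')"
proof -
  have "\<exists>c. (\<forall>j. c j \<in> loc_int p) \<and> b' i = lin c b" if "i < d" for i
    using N(2) b'(1)[OF that] unfolding is_basis_def by blast
  then obtain C where C: "\<And>i j. i < d \<Longrightarrow> C i j \<in> loc_int p" "\<And>i. i < d \<Longrightarrow> b' i = lin (C i) b" by metis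
  define D where "D = Determinant.det (Matrix.mat d d (\<lambda>(i, j). C i j))"
  have "Dt b' = D * Dt b" unfolding D_def by (rule Dt_change) (use basis_K[OF N] C in auto)
  moreover have "D \<in> loc_int p" unfolding D_def by (rule det_loc_int) (use C in auto)
  moreover have "D \<noteq> 0" "Dt b \<noteq> 0" using calculation(1) b'(2) by auto
  ultimately show ?thesis using rat_val_mult[OF p, of D "Dt b"] loc_int_iff[OF p, of D] by simp
qed

text \<open>The value depends only on \<open>N\<close>. For \<open>N' \<subseteq> N\<close> the index of \<open>N'\<close> in \<open>N\<close> is \<open>p ^ (\<kappa> N' - \<kappa> N)\<close>.\<close>

definition \<kappa> :: "'a set \<Rightarrow> int" where "\<kappa> N = rat_val p (Dt (SOME b. is_basis N b))"

lemma kappa: assumes N: "zmod N" "is_basis N b" shows "\<kappa> N = rat_val p (Dt b)"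
proof -
  have s: "is_basis N (SOME b. is_basis N b)" using N(2) by (rule someI[of "is_basis N"])
  show ?thesis unfolding \<kappa>_def
  proof (rule antisym)
    show "rat_val p (Dt (SOME b. is_basis N b)) \<le> rat_val p (Dt b)"
      by (rule basis_le[OF N(1) s]) (use N(2) in \<open>auto simp: is_basis_def\<close>)
    show "rat_val p (Dt b) \<le> rat_val p (Dt (SOME b. is_basis N b))"
      by (rule basis_le[OF N]) (use s in \<open>auto simp: is_basis_def\<close>)
  qed
qed

text \<open>A family in \<open>N\<close> whose determinant has least valuation is a basis: if y in
  \<open>N\<close> had a coordinate that is not p-integral, exchanging y for that basis element
  would lower the valuation. The bound \<open>B\<close> makes the minimum exist.\<close>

lemma basis_exists:
  assumes N: "zmod N" and b0: "\<And>i. i < d \<Longrightarrow> b0 i \<in> N" "Dt b0 \<noteq> 0"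
    and bound: "\<And>b. (\<And>i. i < d \<Longrightarrow> b i \<in> N) \<Longrightarrow> Dt b \<noteq> 0 \<Longrightarrow> B \<le> rat_val p (Dt b)"
  obtains b where "is_basis N b"
proof -
  define P where "P b \<longleftrightarrow> (\<forall>i<d. b i \<in> N) \<and> Dt b \<noteq> 0" for b
  have "P b0" unfolding P_def using b0 by simp
  then obtain b where b: "P b" "\<And>b'. P b' \<Longrightarrow> nat (rat_val p (Dt b) - B) \<le> nat (rat_val p (Dt b') - B)"
    using ex_has_least_nat[of P b0 "\<lambda>b. nat (rat_val p (Dt b) - B)"] by blast
  have ge: "B \<le> rat_val p (Dt b')" if "P b'" for b' using that bound[of b'] unfolding P_def by simp
  have bN: "\<And>i. i < d \<Longrightarrow> b i \<in> N" and bD: "Dt b \<noteq> 0" using b(1) unfolding P_def by auto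
  then have bK: "\<And>i. i < d \<Longrightarrow> b i \<in> K" using zmodD(1)[OF N] by blast
  have "\<exists>c. (\<forall>i. c i \<in> loc_int p) \<and> y = lin c b" if y: "y \<in> N" for y
  proof -
    have "y \<in> K" using y zmodD(1)[OF N] by blast
    then obtain c where c: "y = lin c b" using lin_exists[OF bK bD] by blast
    have "c k \<in> loc_int p" if k: "k < d" for k
    proof (rule ccontr)
      assume nc: "c k \<notin> loc_int p"
      then have ck: "c k \<noteq> 0" "rat_val p (c k) < 0" using loc_int_iff[OF p, of "c k"] by auto
      have e: "Dt (b(k := y)) = c k * Dt b" unfolding c by (rule Dt_replace[OF bK k])
      then have P': "P (b(k := y))" unfolding P_def using bN y ck bD by auto
      from b(2)[OF this] ge[OF this] ge[OF b(1)] show False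
        using rat_val_mult[OF p ck(1) bD] ck(2) unfolding e by linarith
    qed
    then have "\<forall>i. (if i < d then c i else 0) \<in> loc_int p" using loc_int_0[OF p] by simp
    moreover have "y = lin (\<lambda>i. if i < d then c i else 0) b" unfolding c by (rule lin_cong) auto
    ultimately show ?thesis by (intro exI conjI)
  qed
  then have "is_basis N b" unfolding is_basis_def using bN bD by blast
  then show ?thesis by (rule that)
qed

text \<open>Membership in the maximal ideal of Z_(p).\<close>

definition inp :: "rat \<Rightarrow> bool" where "inp c \<longleftrightarrow> (\<exists>r\<in>loc_int p. c = of_nat p * r)"

lemma not_inp_minus_1: "\<not> inp (- 1)"
proof
  assume "inp (- 1)"
  then obtain r where r: "r \<in> loc_int p" "- 1 = of_nat p * r" unfolding inp_def by blast
  then have "of_nat p * (- r) = 1" by simp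
  then show False using loc_int_p_not_unit[OF p loc_int_uminus[OF p r(1)]] by simp
qed

definition extend :: "'a set \<Rightarrow> 'a \<Rightarrow> 'a set" where
  "extend N y = {x + of_rat c * y | x c. x \<in> N \<and> c \<in> loc_int p}"

lemma extendI: "x \<in> N \<Longrightarrow> c \<in> loc_int p \<Longrightarrow> x + of_rat c * y \<in> extend N y"
  unfolding extend_def by blast

lemma extendE: assumes "z \<in> extend N y" obtains x c where "x \<in> N" "c \<in> loc_int p" "z = x + of_rat c * y"
  using assms unfolding extend_def by blast

lemma zmod_extend: assumes N: "zmod N" and y: "y \<in> K" shows "zmod (extend N y)"
  unfolding zmod_def
proof (intro conjI ballI)
  show "extend N y \<subseteq> K"
  proof
    fix z assume "z \<in> extend N y"
    then obtain x c where "x \<in> N" "z = x + of_rat c * y" by (rule extendE)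
    then show "z \<in> K" using zmodD(1)[OF N] y by (auto intro!: K_add K_mult K_rat)
  qed
  show "0 \<in> extend N y" using extendI[OF zmodD(2)[OF N] loc_int_0[OF p]] by simp
next
  fix z z' assume "z \<in> extend N y" "z' \<in> extend N y"
  then obtain x c x' c' where *: "x \<in> N" "c \<in> loc_int p" "z = x + of_rat c * y" "x' \<in> N" "c' \<in> loc_int p" "z' = x' + of_rat c' * y"
    by (elim extendE)
  have "z + z' = (x + x') + of_rat (c + c') * y" using * by (simp add: of_rat_add algebra_simps)
  then show "z + z' \<in> extend N y" using extendI[OF zmodD(3)[OF N *(1,4)] loc_int_add[OF p *(2,5)]] by simp
next
  fix e z assume e: "e \<in> loc_int p" and "z \<in> extend N y"
  then obtain x c where *: "x \<in> N" "c \<in> loc_int p" "z = x + of_rat c * y" by (elim extendE)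
  have "of_rat e * z = of_rat e * x + of_rat (e * c) * y" using * by (simp add: of_rat_mult algebra_simps)
  then show "of_rat e * z \<in> extend N y" using extendI[OF zmodD(4)[OF N e *(1)] loc_int_mult[OF p e *(2)]] by simp
qed

text \<open>Since y is not in \<open>N\<close>, one of the p-integral coordinates of p y is a unit.
  Replacing the corresponding basis element by y divides the determinant by p up to a unit.\<close>

lemma extend_basis:
  assumes N: "zmod N" "is_basis N b" and y: "y \<in> K" "y \<notin> N" "\<pi> * y \<in> N"
  obtains b' where "is_basis (extend N y) b'" "\<kappa> (extend N y) = \<kappa> N - 1"
proof -
  have bK: "\<And>i. i < d \<Longrightarrow> b i \<in> K" using basis_K[OF N] .
  have bN: "\<And>i. i < d \<Longrightarrow> b i \<in> N" and bD: "Dt b \<noteq> 0" using N(2) unfolding is_basis_def by auto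
  obtain c where c: "\<And>i. c i \<in> loc_int p" "\<pi> * y = lin c b" using N(2) y(3) unfolding is_basis_def by blast
  have y_lin: "y = lin (\<lambda>i. c i / of_nat p) b"
  proof -
    have "\<pi> * lin (\<lambda>i. c i / of_nat p) b = lin c b" unfolding lin_def
      using pi_nz by (simp add: sum_distrib_left of_rat_divide)
    then show ?thesis using c(2) pi_nz by (metis mult_left_cancel)
  qed
  have "\<exists>k<d. \<not> inp (c k)"
  proof (rule ccontr)
    assume "\<not> ?thesis"
    then have "c i / of_nat p \<in> loc_int p" if "i < d" for i using that pi_rat_nz unfolding inp_def by auto
    then have "y \<in> N" unfolding y_lin using bN by (intro lin_in_zmod[OF N(1)]) auto
    then show False using y(2) by simp
  qed
  then obtain k where k: "k < d" "\<not> inp (c k)" by blast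
  have ck: "c k \<noteq> 0" "rat_val p (c k) = 0" "inverse (c k) \<in> loc_int p"
    using loc_int_unit[OF p c(1)[of k]] k(2) unfolding inp_def by blast+
  define b' where "b' = b(k := y)"
  have Db': "Dt b' = c k / of_nat p * Dt b" unfolding b'_def by (subst y_lin) (rule Dt_replace[OF bK k(1)])
  have nz: "c k / of_nat p \<noteq> 0" using ck pi_rat_nz by simp
  have val: "rat_val p (Dt b') = rat_val p (Dt b) - 1"
  proof -
    have "rat_val p (c k / of_nat p) = - 1" unfolding divide_inverse
      using rat_val_mult[OF p ck(1), of "inverse (of_nat p)"] rat_val_inverse[OF p pi_rat_nz] rat_val_p[OF p] ck(2) pi_rat_nz by simp
    then show ?thesis unfolding Db' rat_val_mult[OF p nz bD] by simp
  qed
  have basis: "is_basis (extend N y) b'" unfolding is_basis_def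
  proof (intro conjI allI impI ballI)
    show "Dt b' \<noteq> 0" using Db' nz bD by simp
    fix i assume i: "i < d"
    show "b' i \<in> extend N y"
      using extendI[OF bN[OF i] loc_int_0[OF p], of y] extendI[OF zmodD(2)[OF N(1)] loc_int_1[OF p], of y]
      unfolding b'_def by simp
  next
    fix z assume "z \<in> extend N y"
    then obtain x e where z: "x \<in> N" "e \<in> loc_int p" "z = x + of_rat e * y" by (rule extendE)
    obtain g where g: "\<And>i. g i \<in> loc_int p" "x = lin g b" using N(2) z(1) unfolding is_basis_def by blast
    \<comment> \<open>Subtracting s times p y from x removes the k-th coordinate.\<close>
    define s where "s = g k * inverse (c k)"
    define h where "h i = g i - s * c i" for i
    have hk: "h k = 0" unfolding h_def s_def using ck by simp
    have lin_h: "lin h b = x - of_rat s * (\<pi> * y)"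
      unfolding g(2) c(2) lin_def h_def by (simp add: of_rat_diff of_rat_mult algebra_simps sum_subtractf sum_distrib_left)
    define t where "t = h(k := s * of_nat p + e)"
    have "lin t b' = lin (t(k := 0)) b + of_rat (t k) * y" unfolding b'_def by (rule lin_upd[OF k(1)])
    also have "t(k := 0) = h" unfolding t_def using hk by auto
    also have "lin h b + of_rat (t k) * y = z" unfolding lin_h z(3) t_def by (simp add: of_rat_add of_rat_mult algebra_simps)
    finally have "z = lin t b'" by simp
    moreover have s: "s \<in> loc_int p" unfolding s_def by (rule loc_int_mult[OF p g(1) ck(3)])
    have "t i \<in> loc_int p" for i
    proof (cases "i = k")
      case True then show ?thesis unfolding t_def using loc_int_add[OF p loc_int_mult[OF p s loc_int_of_nat[OF p]] z(2)] by simp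
    next
      case False then show ?thesis unfolding t_def h_def using loc_int_diff[OF p g(1) loc_int_mult[OF p s c(1)]] by simp
    qed
    ultimately show "\<exists>c. (\<forall>i. c i \<in> loc_int p) \<and> z = lin c b'" by blast
  qed
  show ?thesis
  proof (rule that[OF basis])
    show "\<kappa> (extend N y) = \<kappa> N - 1"
      using kappa[OF zmod_extend[OF N(1) y(1)] basis] kappa[OF N] val by simp
  qed
qed

definition lcomb :: "nat \<Rightarrow> (nat \<Rightarrow> rat) \<Rightarrow> (nat \<Rightarrow> 'a) \<Rightarrow> 'a" where
  "lcomb n c y = (\<Sum>j<n. of_rat (c j) * y j)"

definition extendn :: "'a set \<Rightarrow> nat \<Rightarrow> (nat \<Rightarrow> 'a) \<Rightarrow> 'a set" where
  "extendn N n y = {x + lcomb n c y | x c. x \<in> N \<and> (\<forall>j. c j \<in> loc_int p)}"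

text \<open>For elements with p y in \<open>N\<close> this is linear independence modulo
  \<open>N\<close> over the field with p elements, written with p-integral coefficients.\<close>

definition indep :: "'a set \<Rightarrow> nat \<Rightarrow> (nat \<Rightarrow> 'a) \<Rightarrow> bool" where
  "indep N n y \<longleftrightarrow> (\<forall>c. (\<forall>j. c j \<in> loc_int p) \<longrightarrow> lcomb n c y \<in> N \<longrightarrow> (\<forall>j<n. inp (c j)))"

lemma extendn_0: "extendn N 0 y = N"
  unfolding extendn_def lcomb_def using loc_int_0[OF p] by auto

lemma extendn_Suc: "extendn N (Suc n) y = extend (extendn N n y) (y n)"
proof (intro equalityI subsetI)
  fix z assume "z \<in> extendn N (Suc n) y"
  then obtain x c where *: "x \<in> N" "\<forall>j. c j \<in> loc_int p" "z = x + lcomb (Suc n) c y" unfolding extendn_def by blast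
  have "x + lcomb n c y \<in> extendn N n y" unfolding extendn_def using * by blast
  from extendI[OF this, of "c n" "y n"] * show "z \<in> extend (extendn N n y) (y n)"
    unfolding lcomb_def by (simp add: add.assoc)
next
  fix z assume "z \<in> extend (extendn N n y) (y n)"
  then obtain w e where w: "w \<in> extendn N n y" "e \<in> loc_int p" "z = w + of_rat e * y n" by (rule extendE)
  obtain x c where *: "x \<in> N" "\<forall>j. c j \<in> loc_int p" "w = x + lcomb n c y" using w(1) unfolding extendn_def by blast
  have "z = x + lcomb (Suc n) (c(n := e)) y" unfolding w(3) *(3) lcomb_def by (simp add: add.assoc)
  moreover have "\<forall>j. (c(n := e)) j \<in> loc_int p" using *(2) w(2) by simp
  ultimately show "z \<in> extendn N (Suc n) y" unfolding extendn_def using *(1) by blast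
qed

lemma indep_Suc: assumes "indep N (Suc n) y" shows "indep N n y"
  unfolding indep_def
proof (intro allI impI)
  fix c j assume c: "\<forall>j. c j \<in> loc_int p" "lcomb n c y \<in> N" and j: "j < n"
  have "lcomb (Suc n) (c(n := 0)) y = lcomb n c y" unfolding lcomb_def by simp
  moreover have "\<forall>j. (c(n := 0)) j \<in> loc_int p" using c loc_int_0[OF p] by simp
  ultimately have "inp ((c(n := 0)) j)" using assms c(2) j unfolding indep_def by (metis less_Suc_eq)
  then show "inp (c j)" using j by simp
qed

lemma extendn_basis:
  assumes N: "zmod N" "is_basis N b" and y: "\<And>j. j < n \<Longrightarrow> y j \<in> K" "\<And>j. j < n \<Longrightarrow> \<pi> * y j \<in> N" "indep N n y"
  shows "zmod (extendn N n y) \<and> (\<exists>b'. is_basis (extendn N n y) b') \<and> \<kappa> (extendn N n y) = \<kappa> N - int n"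
  using y
proof (induction n)
  case 0 then show ?case using N by (auto simp: extendn_0)
next
  case (Suc n)
  have IH: "zmod (extendn N n y)" "\<exists>b'. is_basis (extendn N n y) b'" "\<kappa> (extendn N n y) = \<kappa> N - int n"
    using Suc.IH Suc.prems indep_Suc by auto
  then obtain b' where b': "is_basis (extendn N n y) b'" by blast
  have "N \<subseteq> extendn N n y"
  proof
    fix x assume "x \<in> N"
    moreover have "x = x + lcomb n (\<lambda>_. 0) y" unfolding lcomb_def by simp
    ultimately show "x \<in> extendn N n y" unfolding extendn_def using loc_int_0[OF p] by blast
  qed
  then have py: "\<pi> * y n \<in> extendn N n y" using Suc.prems(2)[of n] by auto
  \<comment> \<open>Otherwise there would be a relation in which y n has the coefficient -1, a
    unit.\<close>
  have ny: "y n \<notin> extendn N n y"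
  proof
    assume "y n \<in> extendn N n y"
    then obtain x c where *: "x \<in> N" "\<forall>j. c j \<in> loc_int p" "y n = x + lcomb n c y" unfolding extendn_def by blast
    have "lcomb (Suc n) (c(n := - 1)) y = lcomb n c y - y n" unfolding lcomb_def by (simp add: of_rat_minus)
    also have "\<dots> = 0 - x" using *(3) by simp
    also have "\<dots> \<in> N" by (rule zmod_diff[OF N(1) zmodD(2)[OF N(1)] *(1)])
    finally have "lcomb (Suc n) (c(n := - 1)) y \<in> N" .
    moreover have "\<forall>j. (c(n := - 1)) j \<in> loc_int p" using *(2) loc_int_uminus[OF p loc_int_1[OF p]] by simp
    ultimately have "inp ((c(n := - 1)) n)" using Suc.prems(3) unfolding indep_def by blast
    then show False using not_inp_minus_1 by simp
  qed
  have yK: "y n \<in> K" using Suc.prems(1) by simp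
  obtain b'' where "is_basis (extend (extendn N n y) (y n)) b''" "\<kappa> (extend (extendn N n y) (y n)) = \<kappa> (extendn N n y) - 1"
    using extend_basis[OF IH(1) b' yK ny py] by blast
  then show ?case unfolding extendn_Suc using zmod_extend[OF IH(1) yK] IH(3) by auto
qed

lemma Nrm_nonzero: assumes "x \<in> K" "x \<noteq> 0" shows "Nrm x \<noteq> 0"
proof
  assume "Nrm x = 0"
  then have "(\<Prod>\<rho>\<in>Z. \<sigma> \<rho> x) = 0" using Nrm_eq[OF assms(1)] by simp
  then show False using sigma_eq_0_iff assms finite_Z by auto
qed

text \<open>By \<open>coordinates_bounded\<close> the coordinates of all elements of
  \<open>M a\<close> have bounded denominators, which bounds the valuations of determinants below. A
  multiple of the power basis by a power of p provides a first family.\<close>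

lemma M_basis_exists: obtains b where "is_basis (M a) b"
proof -
  obtain k where k: "\<And>x i. x \<in> M (\<lambda>_. 0) \<Longrightarrow> of_nat p ^ k * Polynomial.coeff (co x) i \<in> loc_int p"
    using coordinates_bounded by blast
  define m where "m = nat (\<Sum>v\<in>V. \<bar>a v\<bar>)"
  have m: "- a v \<le> int m" if "v \<in> V" for v
  proof -
    have "\<bar>a v\<bar> \<le> (\<Sum>v\<in>V. \<bar>a v\<bar>)" using finV that by (intro member_le_sum) auto
    then show ?thesis unfolding m_def by simp
  qed
  have down: "\<pi> ^ m * x \<in> M (\<lambda>_. 0)" if x: "x \<in> M a" for x
  proof -
    have xK: "x \<in> K" using x unfolding M_def by blast
    have "vge v 0 (\<pi> ^ m * x)" if v: "v \<in> V" for v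
    proof -
      have "vge v (int m) (\<pi> ^ m)" using v_pi_power[OF v, of m] unfolding vge_def by simp
      moreover have "vge v (a v) x" using x v unfolding M_def by blast
      ultimately have "vge v (int m + a v) (\<pi> ^ m * x)" by (intro vge_mult[OF vD[OF v]] K_power K_nat xK)
      then show ?thesis using vge_mono[OF vD[OF v]] m[OF v] by simp
    qed
    then show ?thesis unfolding M_def using xK by (simp add: K_mult K_power K_nat)
  qed
  have co_pi: "co (\<pi> ^ m * x) = Polynomial.smult (of_nat p ^ m) (co x)" if "x \<in> K" for x
    using co_smult[OF that, of "of_nat p ^ m"] by (simp add: of_rat_power)
  have bound: "- int ((k + m) * d) \<le> rat_val p (Dt b)" if b: "\<And>i. i < d \<Longrightarrow> b i \<in> M a" "Dt b \<noteq> 0" for b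
  proof -
    have "of_nat p ^ (k + m) * Polynomial.coeff (co (b i)) j \<in> loc_int p" if "i < d" for i j
    proof -
      have "b i \<in> K" using b(1)[OF that] unfolding M_def by blast
      then show ?thesis using k[OF down[OF b(1)[OF that]], of j] by (simp add: co_pi power_add mult.assoc)
    qed
    then have "Determinant.det (of_nat p ^ (k + m) \<cdot>\<^sub>m cmat b) \<in> loc_int p"
      by (intro det_loc_int[of _ d]) (auto simp: cmat_def)
    then have "(of_nat p ^ (k + m)) ^ d * Dt b \<in> loc_int p"
      unfolding Dt_def using cmat_carrier[of b] by (simp add: carrier_matD)
    then have "of_nat p ^ ((k + m) * d) * Dt b \<in> loc_int p" by (simp only: power_mult)
    then have "rat_val p (of_nat p ^ ((k + m) * d) * Dt b) \<ge> 0"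
      using loc_int_iff[OF p] b(2) pi_rat_nz by simp
    then show ?thesis using rat_val_mult[OF p, of "of_nat p ^ ((k + m) * d)" "Dt b"] b(2) pi_rat_nz
      rat_val_power[OF p pi_rat_nz, of "(k + m) * d"] rat_val_p[OF p] by simp
  qed
  have "\<exists>n. \<pi> ^ n * \<xi> ^ i \<in> M a" for i using M_exponent[OF K_power[OF K_gen]] by metis
  then obtain n where n: "\<And>i. \<pi> ^ n i * \<xi> ^ i \<in> M a" by metis
  define s where "s = (\<Sum>i<d. n i)"
  have b0: "\<pi> ^ s * \<xi> ^ i \<in> M a" if "i < d" for i
  proof -
    have "n i \<le> s" unfolding s_def using that by (intro member_le_sum) auto
    then have "\<pi> ^ s * \<xi> ^ i = of_rat (of_nat p ^ (s - n i)) * (\<pi> ^ n i * \<xi> ^ i)"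
      by (simp add: of_rat_power mult.assoc[symmetric] power_add[symmetric])
    moreover have "of_nat p ^ (s - n i) \<in> loc_int p" using loc_int_of_nat[OF p, of "p ^ (s - n i)"] by simp
    ultimately show ?thesis using zmodD(4)[OF zmod_M _ n] by (simp only:)
  qed
  have "Dt (\<lambda>i. \<pi> ^ s * \<xi> ^ i) \<noteq> 0"
    using Nrm_nonzero[of "\<pi> ^ s"] pi_nz unfolding Nrm_def by (simp add: K_power K_nat)
  obtain b where "is_basis (M a) b"
  proof (rule basis_exists[of "M a" "\<lambda>i. \<pi> ^ s * \<xi> ^ i" "- int ((k + m) * d)"])
    show "zmod (M a)" by (rule zmod_M)
    show "\<pi> ^ s * \<xi> ^ i \<in> M a" if "i < d" for i by (rule b0[OF that])
    show "Dt (\<lambda>i. \<pi> ^ s * \<xi> ^ i) \<noteq> 0" by fact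
    show "- int ((k + m) * d) \<le> rat_val p (Dt b)" if "\<And>i. i < d \<Longrightarrow> b i \<in> M a" "Dt b \<noteq> 0" for b
      by (rule bound[OF that])
  qed
  then show ?thesis by (rule that)
qed

end

section \<open>Residue fields and the valuation of the norm\<close>

context places_above
begin

text \<open>For v in \<open>V\<close> this is the prime ideal at v of the semilocal ring
  \<open>OV\<close>.\<close>

definition Pv :: "('a \<Rightarrow> int) \<Rightarrow> 'a set" where "Pv v = M (\<lambda>u. if u = v then 1 else 0)"

abbreviation OV :: "'a set" where "OV \<equiv> M (\<lambda>_. 0)"

lemma Pv_O: "Pv v \<subseteq> OV"
proof
  fix x assume x: "x \<in> Pv v"
  have "vge u 0 x" if u: "u \<in> V" for u
  proof -
    have "vge u (if u = v then 1 else 0) x" using x u unfolding Pv_def M_def by blast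
    then show ?thesis by (rule vge_mono[OF vD[OF u]]) simp
  qed
  then show "x \<in> OV" using x unfolding Pv_def M_def by blast
qed

lemma O_1: "1 \<in> OV" unfolding M_def using K_1 vge_1 vD by simp

lemma Pv_iff: "v \<in> V \<Longrightarrow> x \<in> OV \<Longrightarrow> x \<in> Pv v \<longleftrightarrow> vge v 1 x"
proof
  assume v: "v \<in> V" and x: "x \<in> Pv v"
  then have "vge v (if v = v then 1 else 0) x" unfolding Pv_def M_def by blast
  then show "vge v 1 x" by simp
qed (simp add: Pv_def M_def)

lemma lcomb_O: "(\<And>j. j < n \<Longrightarrow> u j \<in> OV) \<Longrightarrow> (\<And>j. c j \<in> loc_int p) \<Longrightarrow> lcomb n c u \<in> OV"
  unfolding lcomb_def by (intro zmod_sum[OF zmod_M] zmodD(4)[OF zmod_M]) auto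

text \<open>Adjoining the n elements to \<open>Pv v\<close> lowers \<open>\<kappa>\<close> by n and
  stays inside \<open>OV\<close>. This is the source of the finiteness of the residue field.\<close>

lemma indep_bound:
  assumes v: "v \<in> V" and u: "\<And>j. j < n \<Longrightarrow> u j \<in> OV" "indep (Pv v) n u"
  shows "int n \<le> \<kappa> (Pv v) - \<kappa> OV"
proof -
  obtain b where b: "is_basis (Pv v) b" using M_basis_exists unfolding Pv_def by blast
  obtain b0 where b0: "is_basis OV b0" using M_basis_exists by blast
  have pu: "\<pi> * u j \<in> Pv v" if j: "j < n" for j
  proof -
    have uK: "u j \<in> K" using u(1)[OF j] unfolding M_def by blast
    have "vge w (if w = v then 1 else 0) (\<pi> * u j)" if w: "w \<in> V" for w
    proof -
      have "vge w 1 \<pi>" using V_p[OF w] unfolding vge_def by simp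
      moreover have "vge w 0 (u j)" using u(1)[OF j] w unfolding M_def by blast
      ultimately have "vge w (1 + 0) (\<pi> * u j)" by (rule vge_mult[OF vD[OF w] K_nat uK])
      then show ?thesis by (rule vge_mono[OF vD[OF w]]) simp
    qed
    then show ?thesis unfolding Pv_def M_def using K_mult[OF K_nat uK] by blast
  qed
  have uK: "u j \<in> K" if "j < n" for j using u(1)[OF that] unfolding M_def by blast
  have zP: "zmod (Pv v)" unfolding Pv_def by (rule zmod_M)
  have E: "zmod (extendn (Pv v) n u)" "\<exists>b'. is_basis (extendn (Pv v) n u) b'" "\<kappa> (extendn (Pv v) n u) = \<kappa> (Pv v) - int n"
    using extendn_basis[OF zP b uK pu u(2)] by auto
  then obtain b' where b': "is_basis (extendn (Pv v) n u) b'" by blast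
  have sub: "extendn (Pv v) n u \<subseteq> OV"
  proof
    fix x assume "x \<in> extendn (Pv v) n u"
    then obtain y c where *: "y \<in> Pv v" "\<forall>j. c j \<in> loc_int p" "x = y + lcomb n c u" unfolding extendn_def by blast
    have "lcomb n c u \<in> OV" by (rule lcomb_O) (use u(1) *(2) in auto)
    then show "x \<in> OV" unfolding *(3) using zmodD(3)[OF zmod_M] *(1) Pv_O by blast
  qed
  have "rat_val p (Dt b0) \<le> rat_val p (Dt b')"
    by (rule basis_le[OF zmod_M b0]) (use b' sub in \<open>auto simp: is_basis_def\<close>)
  then show ?thesis using kappa[OF zmod_M b0] kappa[OF E(1) b'] E(3) by simp
qed

lemma inp_iff: "v \<in> V \<Longrightarrow> c \<in> loc_int p \<Longrightarrow> inp c \<longleftrightarrow> vge v 1 (of_rat c)"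
proof
  assume v: "v \<in> V" and c: "c \<in> loc_int p"
  show "vge v 1 (of_rat c)" if i: "inp c"
  proof -
    obtain r where r: "r \<in> loc_int p" "c = of_nat p * r" using i unfolding inp_def by blast
    have "vge v (1 + 0) (\<pi> * of_rat r)"
      by (rule vge_mult[OF vD[OF v] K_nat K_rat _ vge_loc_int[OF vD[OF v] p V_p[OF v] r(1)]])
        (use V_p[OF v] in \<open>simp add: vge_def\<close>)
    then show ?thesis using r(2) by (simp add: of_rat_mult)
  qed
  show "inp c" if g: "vge v 1 (of_rat c)"
  proof (rule ccontr)
    assume "\<not> inp c"
    then have u: "c \<noteq> 0" "inverse c \<in> loc_int p" using loc_int_unit[OF p c] unfolding inp_def by blast+
    have "vge v (1 + 0) (of_rat c * of_rat (inverse c))"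
      by (rule vge_mult[OF vD[OF v] K_rat K_rat g vge_loc_int[OF vD[OF v] p V_p[OF v] u(2)]])
    moreover have "of_rat c * of_rat (inverse c) = (1::'a)" using u(1) by (simp add: of_rat_inverse)
    ultimately show False using v_1[OF vD[OF v]] unfolding vge_def by simp
  qed
qed

text \<open>An independent family of maximal length, which exists by \<open>indep_bound\<close>,
  spans: in a dependence with a further y the coefficient of y is a unit, as otherwise the multiple
  of y could be dropped.\<close>

lemma residue_basis:
  assumes v: "v \<in> V"
  obtains n u where "\<And>j. u j \<in> OV" "indep (Pv v) n u"
    "\<And>y. y \<in> OV \<Longrightarrow> \<exists>c. (\<forall>j. c j \<in> loc_int p) \<and> y - lcomb n c u \<in> Pv v"
proof -
  define Q where "Q n \<longleftrightarrow> (\<exists>u. (\<forall>j. u j \<in> OV) \<and> indep (Pv v) n u)" for n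
  have "Q 0" unfolding Q_def indep_def using O_1 by (intro exI[of _ "\<lambda>_. 1"]) simp
  have bd: "n \<le> nat (\<kappa> (Pv v) - \<kappa> OV)" if "Q n" for n
  proof -
    obtain u where "\<And>j. u j \<in> OV" "indep (Pv v) n u" using \<open>Q n\<close> unfolding Q_def by blast
    then have "int n \<le> \<kappa> (Pv v) - \<kappa> OV" by (intro indep_bound[OF v]) auto
    then show ?thesis by simp
  qed
  define n where "n = (GREATEST n. Q n)"
  have "Q n" unfolding n_def by (rule GreatestI_nat[where P = Q, OF \<open>Q 0\<close> bd])
  have mx: "m \<le> n" if "Q m" for m unfolding n_def by (rule Greatest_le_nat[where P = Q, OF that bd])
  obtain u where u: "\<And>j. u j \<in> OV" "indep (Pv v) n u" using \<open>Q n\<close> unfolding Q_def by blast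
  have zP: "zmod (Pv v)" unfolding Pv_def by (rule zmod_M)
  have "\<exists>c. (\<forall>j. c j \<in> loc_int p) \<and> y - lcomb n c u \<in> Pv v" if y: "y \<in> OV" for y
  proof -
    have "\<not> Q (Suc n)" using mx[of "Suc n"] by auto
    then have "\<not> indep (Pv v) (Suc n) (u(n := y))" unfolding Q_def using u(1) y by (metis fun_upd_apply)
    then obtain c j where c: "\<And>j. c j \<in> loc_int p" "lcomb (Suc n) c (u(n := y)) \<in> Pv v" "j < Suc n" "\<not> inp (c j)"
      unfolding indep_def by blast
    have lc: "lcomb (Suc n) c (u(n := y)) = lcomb n c u + of_rat (c n) * y"
      unfolding lcomb_def by simp
    have "\<not> inp (c n)"
    proof
      assume i: "inp (c n)"
      have "vge v (1 + 0) (of_rat (c n) * y)"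
        by (rule vge_mult[OF vD[OF v] K_rat]) (use y v i inp_iff[OF v c(1)] in \<open>auto simp: M_def\<close>)
      moreover have "of_rat (c n) * y \<in> OV" by (rule zmodD(4)[OF zmod_M c(1) y])
      ultimately have "of_rat (c n) * y \<in> Pv v" using Pv_iff[OF v] by simp
      from zmod_diff[OF zP c(2) this] have "lcomb n c u \<in> Pv v" unfolding lc by simp
      then have "\<forall>j<n. inp (c j)" using u(2) c(1) unfolding indep_def by blast
      then show False using c(3,4) i by (metis less_Suc_eq)
    qed
    then have cn: "c n \<noteq> 0" "inverse (c n) \<in> loc_int p" using loc_int_unit[OF p c(1)] unfolding inp_def by blast+
    define e where "e j = - (inverse (c n) * c j)" for j
    have "of_rat (inverse (c n)) * (lcomb n c u + of_rat (c n) * y) = y - lcomb n e u"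
    proof -
      have "lcomb n e u = - (of_rat (inverse (c n)) * lcomb n c u)"
        unfolding lcomb_def e_def by (simp add: of_rat_minus of_rat_mult sum_distrib_left sum_negf mult.assoc)
      moreover have "of_rat (inverse (c n)) * (of_rat (c n) * y) = y" using cn(1) by (simp add: of_rat_inverse)
      ultimately show ?thesis by (simp add: distrib_left)
    qed
    moreover have "of_rat (inverse (c n)) * (lcomb n c u + of_rat (c n) * y) \<in> Pv v"
      using zmodD(4)[OF zP cn(2) c(2)] unfolding lc .
    moreover have "\<forall>j. e j \<in> loc_int p" unfolding e_def using loc_int_uminus[OF p loc_int_mult[OF p cn(2) c(1)]] by simp
    ultimately show ?thesis by (intro exI[of _ e]) simp
  qed
  then show ?thesis using that u by blast
qed

text \<open>x is multiplied by an element close to 1 at v and close to 0 at the rest of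
  \<open>V\<close>; the precision n outweighs the poles of x there.\<close>

lemma approx_in_O:
  assumes v: "v \<in> V" and x: "x \<in> K" and a: "vge v a x"
  obtains y where "y \<in> K" "vge v (a + int N) (y - x)" "vge v a y" "\<And>u. u \<in> V \<Longrightarrow> u \<noteq> v \<Longrightarrow> vge u (b u) y"
proof -
  define n where "n = nat (\<Sum>u\<in>V. \<bar>b u\<bar> + \<bar>u x\<bar>) + N"
  obtain e where e: "e \<in> K" "vge v (int n) (e - 1)" "\<And>u. u \<in> V \<Longrightarrow> u \<noteq> v \<Longrightarrow> vge u (int n) e"
    using weak_approximation[OF finV V_DV v, of n] by blast
  have 1: "vge v (int n + a) ((e - 1) * x)" by (rule vge_mult[OF vD[OF v] K_diff[OF e(1) K_1] x e(2) a])
  have d: "(e - 1) * x = e * x - x" by (simp add: left_diff_distrib)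
  have 2: "vge v (a + int N) (e * x - x)" using vge_mono[OF vD[OF v] 1, of "a + int N"] unfolding d n_def by simp
  have 3: "vge v a (e * x)"
  proof -
    have "vge v a (e * x - x + x)"
      by (rule vge_add[OF vD[OF v] K_diff[OF K_mult[OF e(1) x] x] x vge_mono[OF vD[OF v] 2] a]) simp
    then show ?thesis by simp
  qed
  have 4: "vge u (b u) (e * x)" if u: "u \<in> V" "u \<noteq> v" for u
  proof (cases "x = 0")
    case True then show ?thesis unfolding vge_def by simp
  next
    case False
    have "\<bar>b u\<bar> + \<bar>u x\<bar> \<le> (\<Sum>u\<in>V. \<bar>b u\<bar> + \<bar>u x\<bar>)" using finV u by (intro member_le_sum) auto
    then have le: "b u \<le> int n + u x" unfolding n_def by linarith
    have "vge u (int n + u x) (e * x)"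
      by (rule vge_mult[OF vD[OF u(1)] e(1) x e(3)[OF u]]) (simp add: vge_def)
    then show ?thesis using le by (rule vge_mono[OF vD[OF u(1)]])
  qed
  show ?thesis by (rule that[OF K_mult[OF e(1) x] 2 3 4])
qed

text \<open>Combinations of the residue basis with digits 0, ..., p - 1 represent each residue class
  exactly once.\<close>

lemma residue_size:
  assumes v: "v \<in> V" and u: "\<And>j. u j \<in> OV" "indep (Pv v) n u"
    "\<And>y. y \<in> OV \<Longrightarrow> \<exists>c. (\<forall>j. c j \<in> loc_int p) \<and> y - lcomb n c u \<in> Pv v"
  shows "residue_field_size K v = p ^ n"
proof -
  define R where "R = valuation_ring K v"
  define E where "E = {(x, y). x \<in> R \<and> y \<in> R \<and> x - y \<in> valuation_ideal K v}"
  have Ri: "x \<in> R \<longleftrightarrow> x \<in> K \<and> vge v 0 x" for x unfolding R_def valuation_ring_def vge_def by auto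
  have Ii: "x \<in> valuation_ideal K v \<longleftrightarrow> x \<in> K \<and> vge v 1 x" for x unfolding valuation_ideal_def vge_def by auto
  have Ei: "(x, y) \<in> E \<longleftrightarrow> x \<in> R \<and> y \<in> R \<and> vge v 1 (x - y)" for x y
    unfolding E_def Ii using K_diff by (auto simp: Ri)
  note vv = vD[OF v]
  have eq: "equiv R E"
  proof (rule equivI)
    show "E \<subseteq> R \<times> R" unfolding E_def by auto
    show "refl_on R E" unfolding refl_on_def Ei using vge_0[OF vv] E_def by auto
    show "sym E" unfolding sym_def
    proof (intro allI impI)
      fix x y assume "(x, y) \<in> E"
      then have *: "x \<in> R" "y \<in> R" "vge v 1 (x - y)" unfolding Ei by auto
      have "vge v 1 (- (x - y))" by (rule vge_minus[OF vv _ *(3)]) (use * Ri K_diff in auto)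
      then show "(y, x) \<in> E" unfolding Ei using * by simp
    qed
    show "trans E" unfolding trans_def
    proof (intro allI impI)
      fix x y z assume "(x, y) \<in> E" "(y, z) \<in> E"
      then have *: "x \<in> R" "y \<in> R" "z \<in> R" "vge v 1 (x - y)" "vge v 1 (y - z)" unfolding Ei by auto
      have "vge v 1 ((x - y) + (y - z))" by (rule vge_add[OF vv _ _ *(4,5)]) (use * Ri K_diff in auto)
      then show "(x, z) \<in> E" unfolding Ei using * by simp
    qed
  qed
  define F where "F = {..<n} \<rightarrow>\<^sub>E {..<p}"
  define g where "g h = E `` {lcomb n (\<lambda>j. if j < n then of_nat (h j) else 0) u}" for h :: "nat \<Rightarrow> nat"
  have li: "(if j < n then of_nat (h j) else 0) \<in> loc_int p" for j and h :: "nat \<Rightarrow> nat"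
    using loc_int_of_nat[OF p] loc_int_0[OF p] by simp
  have lcO: "lcomb n (\<lambda>j. if j < n then of_nat (h j) else 0) u \<in> OV" for h :: "nat \<Rightarrow> nat"
    by (rule lcomb_O[OF u(1) li])
  have OR: "x \<in> R" if "x \<in> OV" for x using that v unfolding Ri M_def by auto
  have "bij_betw g F (R // E)" unfolding bij_betw_def
  proof (intro conjI inj_onI)
    fix h h' assume hF: "h \<in> F" "h' \<in> F" and gg: "g h = g h'"
    let ?c = "\<lambda>h j. if j < n then of_nat (h j) else (0::rat)"
    have "(lcomb n (?c h) u, lcomb n (?c h') u) \<in> E"
      using gg eq_equiv_class_iff[OF eq OR[OF lcO] OR[OF lcO]] unfolding g_def by blast
    then have "vge v 1 (lcomb n (?c h) u - lcomb n (?c h') u)" unfolding Ei by blast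
    moreover define e where "e j = ?c h j - ?c h' j" for j
    moreover have "lcomb n (?c h) u - lcomb n (?c h') u = lcomb n e u"
      unfolding lcomb_def e_def by (simp add: sum_subtractf[symmetric] of_rat_diff left_diff_distrib)
    ultimately have "vge v 1 (lcomb n e u)" by simp
    moreover have dl: "e j \<in> loc_int p" for j unfolding e_def by (rule loc_int_diff[OF p li li])
    have eO: "lcomb n e u \<in> OV" by (rule lcomb_O) (use u(1) dl in auto)
    ultimately have "lcomb n e u \<in> Pv v" using Pv_iff[OF v eO] by blast
    then have inp: "\<forall>j<n. inp (e j)" using u(2) dl unfolding indep_def by blast
    have "h j = h' j" if j: "j < n" for j
    proof (rule ccontr)
      assume ne: "h j \<noteq> h' j"
      have lt: "h j < p" "h' j < p" using hF j unfolding F_def by auto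
      define z where "z = int (h j) - int (h' j)"
      have "e j = of_int z" using j unfolding z_def e_def by simp
      then have "inp (of_int z)" using inp j by metis
      then have "vge v 1 (of_int z)"
        using inp_iff[OF v loc_int_of_int[OF p, of z]] by (simp only: of_rat_of_int_eq)
      moreover have "z \<noteq> 0" using ne unfolding z_def by simp
      moreover have "\<not> int p dvd z" unfolding z_def
        using lt ne zdvd_imp_le[of "int p" "int (h j) - int (h' j)"] zdvd_imp_le[of "int p" "int (h' j) - int (h j)"]
          dvd_diff_commute[of "int p" "int (h j)" "int (h' j)"] by linarith
      ultimately show False using v_of_int_unit[OF vv p V_p[OF v], of z] unfolding vge_def by simp
    qed
    then show "h = h'" using hF unfolding F_def by (intro PiE_ext) auto
  next
    show "g ` F = R // E"
    proof (intro equalityI subsetI)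
      fix X assume "X \<in> g ` F"
      then show "X \<in> R // E" unfolding g_def using OR[OF lcO] by (auto intro: quotientI)
    next
      fix X assume "X \<in> R // E"
      then obtain x where x: "x \<in> R" "X = E `` {x}" by (rule quotientE)
      obtain y where y: "y \<in> K" "vge v (0 + int 1) (y - x)" "vge v 0 y" "\<And>w. w \<in> V \<Longrightarrow> w \<noteq> v \<Longrightarrow> vge w 0 y"
        using approx_in_O[OF v, of x 0 1 "\<lambda>_. 0"] x(1) Ri by blast
      then have yO: "y \<in> OV" unfolding M_def by auto
      obtain c where c: "\<And>j. c j \<in> loc_int p" "y - lcomb n c u \<in> Pv v" using u(3)[OF yO] by blast
      have "\<exists>k r. k < p \<and> r \<in> loc_int p \<and> c j = of_nat k + of_nat p * r" for j
        using loc_int_residue[OF p c(1)[of j]] by metis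
      then obtain k r where kr: "\<And>j. k j < p" "\<And>j. r j \<in> loc_int p" "\<And>j. c j = of_nat (k j) + of_nat p * r j" by metis
      define h where "h = restrict k {..<n}"
      have hF: "h \<in> F" unfolding F_def h_def using kr(1) by auto
      define z where "z = lcomb n (\<lambda>j. if j < n then of_nat (h j) else 0) u"
      have zO: "z \<in> OV" unfolding z_def by (rule lcO)
      have rO: "lcomb n r u \<in> OV" by (rule lcomb_O[OF u(1) kr(2)])
      have "lcomb n c u - z = (\<Sum>j<n. of_rat (c j) * u j - of_nat (k j) * u j)"
        unfolding z_def lcomb_def h_def sum_subtractf[symmetric] by (intro sum.cong) auto
      also have "\<dots> = \<pi> * lcomb n r u" unfolding lcomb_def sum_distrib_left
        by (intro sum.cong) (simp_all add: kr(3) of_rat_add of_rat_mult algebra_simps)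
      finally have "lcomb n c u - z = \<pi> * lcomb n r u" .
      moreover have "vge v (1 + 0) (\<pi> * lcomb n r u)"
        by (rule vge_mult[OF vv K_nat]) (use rO v V_p[OF v] in \<open>auto simp: M_def vge_def\<close>)
      ultimately have 1: "vge v 1 (lcomb n c u - z)" by simp
      have cO: "lcomb n c u \<in> OV" by (rule lcomb_O[OF u(1) c(1)])
      have OK: "w \<in> K" if "w \<in> OV" for w using that unfolding M_def by blast
      have 2: "vge v 1 (y - lcomb n c u)" using c(2) Pv_iff[OF v zmod_diff[OF zmod_M yO cO]] by blast
      have xK: "x \<in> K" using x Ri by blast
      have "vge v 1 (- (y - x))" using vge_minus[OF vv K_diff[OF y(1) xK]] y(2) by simp
      then have "vge v 1 ((y - lcomb n c u) + (lcomb n c u - z) + - (y - x))"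
        using 1 2 xK y(1) OK[OF cO] OK[OF zO] by (intro vge_add[OF vv]) (auto intro!: K_add K_diff K_uminus)
      then have "vge v 1 (x - z)" by simp
      then have "(x, z) \<in> E" unfolding Ei using x OR[OF zO] by simp
      then have "X = E `` {z}" using x(2) equiv_class_eq[OF eq] by blast
      then have "X = g h" unfolding g_def z_def .
      then show "X \<in> g ` F" using hF by blast
    qed
  qed
  then have "card (R // E) = card F" by (rule bij_betw_same_card[symmetric])
  also have "\<dots> = p ^ n" unfolding F_def by (simp add: card_PiE)
  finally show ?thesis unfolding residue_field_size_def E_def R_def .
qed

text \<open>The residue degree of v.\<close>

definition fv :: "('a \<Rightarrow> int) \<Rightarrow> nat" where "fv v = (SOME n. residue_field_size K v = p ^ n)"

lemma fv_eq: assumes "residue_field_size K v = p ^ n" shows "fv v = n"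
proof -
  have "residue_field_size K v = p ^ fv v" unfolding fv_def using assms by (rule someI)
  then show ?thesis using assms prime_gt_1_nat[OF p] by simp
qed

text \<open>Multiplication by an element t of \<open>M a\<close> whose valuation at v is exactly
  \<open>a v\<close> carries a residue basis to a basis of \<open>M a\<close> modulo the smaller
  lattice. So \<open>M a\<close> arises from that lattice by as many adjunctions as the residue
  degree.\<close>

lemma kappa_step:
  assumes v: "v \<in> V" shows "\<kappa> (M (a(v := a v + 1))) = \<kappa> (M a) + int (fv v)"
    and "residue_field_size K v = p ^ fv v"
proof -
  obtain n u where u: "\<And>j. u j \<in> OV" "indep (Pv v) n u"
    "\<And>y. y \<in> OV \<Longrightarrow> \<exists>c. (\<forall>j. c j \<in> loc_int p) \<and> y - lcomb n c u \<in> Pv v" by (rule residue_basis[OF v], rule that)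
  have sz: "residue_field_size K v = p ^ n" by (rule residue_size[OF v u(1) u(2) u(3)])
  have fn: "fv v = n" using fv_eq sz by blast
  show "residue_field_size K v = p ^ fv v" using sz fn by simp
  note vv = vD[OF v]
  let ?a = "a(v := a v + 1)"
  obtain x where x: "x \<in> K" "x \<noteq> 0" "v x = a v" using v_surj[OF vv] by blast
  obtain t where t: "t \<in> K" "vge v (a v + int 1) (t - x)" "vge v (a v) t" "\<And>w. w \<in> V \<Longrightarrow> w \<noteq> v \<Longrightarrow> vge w (a w) t"
  proof -
    have "vge v (a v) x" using x(3) unfolding vge_def by simp
    from approx_in_O[OF v x(1) this, where N = 1 and b = a] show ?thesis using that by blast
  qed
  have tv: "t \<noteq> 0" "v t = a v"
  proof -
    have "vge v (v x + 1) (t - x)" using t(2) x(3) by simp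
    from v_add_eq[OF vv x(1) K_diff[OF t(1) x(1)] x(2) this] show "t \<noteq> 0" "v t = a v" using x(3) by simp_all
  qed
  define y where "y j = t * u j" for j
  have uK: "u j \<in> K" for j using u(1) unfolding M_def by blast
  have yM: "y j \<in> M a" for j
  proof -
    have "vge w (a w) (y j)" if w: "w \<in> V" for w
    proof -
      have "vge w (a w) t" using t(3,4) w by (cases "w = v") auto
      moreover have "vge w 0 (u j)" using u(1) w unfolding M_def by blast
      ultimately have "vge w (a w + 0) (t * u j)" by (rule vge_mult[OF vD[OF w] t(1) uK])
      then show ?thesis unfolding y_def by simp
    qed
    then show ?thesis unfolding M_def y_def using K_mult[OF t(1) uK] by blast
  qed
  have lc: "lcomb n c y = t * lcomb n c u" for c unfolding lcomb_def y_def by (simp add: sum_distrib_left mult_ac)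
  have Ma: "w \<in> M ?a \<longleftrightarrow> w \<in> M a \<and> vge v (a v + 1) w" for w
  proof
    assume w: "w \<in> M ?a"
    then have *: "w \<in> K" "\<And>z. z \<in> V \<Longrightarrow> vge z (?a z) w" unfolding M_def by blast+
    have 1: "vge v (a v + 1) w" using *(2)[OF v] by simp
    have "vge z (a z) w" if "z \<in> V" for z
      using *(2)[OF that] vge_mono[OF vv 1, of "a v"] by (cases "z = v") simp_all
    then show "w \<in> M a \<and> vge v (a v + 1) w" using 1 *(1) unfolding M_def by blast
  next
    assume w: "w \<in> M a \<and> vge v (a v + 1) w"
    then have "vge z (?a z) w" if "z \<in> V" for z
      using that unfolding M_def by (cases "z = v") simp_all
    then show "w \<in> M ?a" using w unfolding M_def by blast
  qed
  have ind: "indep (M ?a) n y" unfolding indep_def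
  proof (intro allI impI)
    fix c j assume c: "\<forall>j. c j \<in> loc_int p" "lcomb n c y \<in> M ?a" and j: "j < n"
    have cO: "lcomb n c u \<in> OV" by (rule lcomb_O) (use u(1) c(1) in auto)
    have "vge v (a v + 1) (t * lcomb n c u)" using c(2) unfolding Ma lc by blast
    then have "vge v 1 (lcomb n c u)"
    proof (cases "lcomb n c u = 0")
      case True then show ?thesis unfolding vge_def by simp
    next
      case False
      have "lcomb n c u \<in> K" using cO zmodD(1)[OF zmod_M] by blast
      from v_mult[OF vv t(1) this tv(1) False] show ?thesis
        using \<open>vge v (a v + 1) (t * lcomb n c u)\<close> False tv unfolding vge_def by simp
    qed
    then have "lcomb n c u \<in> Pv v" using Pv_iff[OF v cO] by blast
    then show "inp (c j)" using u(2) c(1) j unfolding indep_def by blast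
  qed
  obtain b where b: "is_basis (M ?a) b" using M_basis_exists by blast
  have py: "\<pi> * y j \<in> M ?a" for j
  proof -
    have yK: "y j \<in> K" using yM unfolding M_def by blast
    have "\<pi> * y j \<in> M a" using zmodD(4)[OF zmod_M loc_int_of_nat[OF p] yM, of p j] by simp
    moreover have "vge v 1 \<pi>" using V_p[OF v] unfolding vge_def by simp
    moreover have "vge v (a v) (y j)" using yM[of j] v unfolding M_def by blast
    ultimately have "\<pi> * y j \<in> M a" "vge v (1 + a v) (\<pi> * y j)" using vge_mult[OF vv K_nat yK] by blast+
    then show ?thesis unfolding Ma by (simp add: add.commute)
  qed
  have E: "\<kappa> (extendn (M ?a) n y) = \<kappa> (M ?a) - int n"
  proof -
    have "y j \<in> K" for j using yM zmodD(1)[OF zmod_M] by blast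
    from extendn_basis[OF zmod_M b this py ind] show ?thesis by blast
  qed
  have "extendn (M ?a) n y = M a"
  proof (intro equalityI subsetI)
    fix z assume "z \<in> extendn (M ?a) n y"
    then obtain w c where *: "w \<in> M ?a" "\<forall>j. c j \<in> loc_int p" "z = w + lcomb n c y" unfolding extendn_def by blast
    have "lcomb n c y \<in> M a" unfolding lcomb_def
      by (rule zmod_sum[OF zmod_M], rule zmodD(4)[OF zmod_M _ yM]) (use *(2) in simp)
    then show "z \<in> M a" unfolding *(3) using zmodD(3)[OF zmod_M] *(1) Ma by blast
  next
    fix z assume z: "z \<in> M a"
    have zK: "z \<in> K" using z unfolding M_def by blast
    have "vge v 0 (z / t)"
    proof (cases "z = 0")
      case True then show ?thesis unfolding vge_def by simp
    next
      case False
      have "v z \<ge> a v" using z v False unfolding M_def vge_def by auto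
      then show ?thesis using v_divide[OF vv zK t(1) False tv(1)] tv unfolding vge_def by simp
    qed
    then obtain s where s: "s \<in> K" "vge v (0 + int 1) (s - z / t)" "vge v 0 s" "\<And>w. w \<in> V \<Longrightarrow> w \<noteq> v \<Longrightarrow> vge w 0 s"
      using approx_in_O[OF v K_divide[OF zK t(1)], of 0 1 "\<lambda>_. 0"] by blast
    then have sO: "s \<in> OV" unfolding M_def by auto
    obtain c where c: "\<And>j. c j \<in> loc_int p" "s - lcomb n c u \<in> Pv v" using u(3)[OF sO] by blast
    have cO: "lcomb n c u \<in> OV" by (rule lcomb_O[OF u(1) c(1)])
    have cK: "lcomb n c u \<in> K" using cO unfolding M_def by blast
    have 1: "vge v 1 (s - lcomb n c u)" using c(2) Pv_iff[OF v zmod_diff[OF zmod_M sO cO]] by blast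
    have "vge v 1 ((s - lcomb n c u) - (s - z / t))"
      by (rule vge_diff[OF vv K_diff[OF s(1) cK] K_diff[OF s(1) K_divide[OF zK t(1)]] 1]) (use s(2) in simp)
    then have "vge v 1 (z / t - lcomb n c u)" by simp
    then have "vge v (a v + 1) (t * (z / t - lcomb n c u))"
      by (rule vge_mult[OF vv t(1) K_diff[OF K_divide[OF zK t(1)] cK] t(3)])
    then have 2: "vge v (a v + 1) (z - lcomb n c y)" unfolding lc using tv(1) by (simp add: right_diff_distrib)
    have cyM: "lcomb n c y \<in> M a" unfolding lcomb_def
      by (rule zmod_sum[OF zmod_M], rule zmodD(4)[OF zmod_M c(1) yM])
    have "z - lcomb n c y \<in> M ?a" unfolding Ma using zmod_diff[OF zmod_M z cyM] 2 by blast
    then have "(z - lcomb n c y) + lcomb n c y \<in> extendn (M ?a) n y" unfolding extendn_def using c(1) by blast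
    then show "z \<in> extendn (M ?a) n y" by simp
  qed
  then show "\<kappa> (M ?a) = \<kappa> (M a) + int (fv v)" using E fn by simp
qed

lemma kappa_shift: assumes v: "v \<in> V" shows "\<kappa> (M (a(v := k))) = \<kappa> (M a) + int (fv v) * (k - a v)"
proof (induction k rule: int_induct[of _ "a v"])
  case base then show ?case by simp
next
  case (step1 i)
  have "\<kappa> (M (a(v := i + 1))) = \<kappa> (M (a(v := i))) + int (fv v)"
    using kappa_step(1)[OF v, of "a(v := i)"] by (simp only: fun_upd_upd fun_upd_same)
  moreover have "int (fv v) * (i + 1 - a v) = int (fv v) * (i - a v) + int (fv v)" by (simp add: algebra_simps)
  ultimately show ?case unfolding step1(2) by linarith
next
  case (step2 i)
  have "\<kappa> (M (a(v := i - 1 + 1))) = \<kappa> (M (a(v := i - 1))) + int (fv v)"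
    using kappa_step(1)[OF v, of "a(v := i - 1)"] by (simp only: fun_upd_upd fun_upd_same)
  then have "\<kappa> (M (a(v := i))) = \<kappa> (M (a(v := i - 1))) + int (fv v)" by (simp only: diff_add_cancel)
  then have "\<kappa> (M (a(v := i - 1))) = \<kappa> (M a) + int (fv v) * (i - a v) - int (fv v)"
    unfolding step2(2) by linarith
  then show ?case by (simp only: right_diff_distrib mult_1_right)
qed

lemma kappa_M: "\<kappa> (M a) = \<kappa> OV + (\<Sum>v\<in>V. int (fv v) * a v)"
proof -
  have "\<kappa> (M (\<lambda>v. if v \<in> A then a v else 0)) = \<kappa> OV + (\<Sum>v\<in>A. int (fv v) * a v)" if "finite A" "A \<subseteq> V" for A
    using that
  proof (induction A rule: finite_induct)
    case (insert v A)
    have "(\<lambda>u. if u \<in> insert v A then a u else 0) = (\<lambda>u. if u \<in> A then a u else 0)(v := a v)" by auto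
    then show ?case using insert kappa_shift[of v "\<lambda>u. if u \<in> A then a u else 0" "a v"] by simp
  qed simp
  from this[OF finV subset_refl] have "\<kappa> (M (\<lambda>v. if v \<in> V then a v else 0)) = \<kappa> OV + (\<Sum>v\<in>V. int (fv v) * a v)" .
  moreover have "M (\<lambda>v. if v \<in> V then a v else 0) = M a" unfolding M_def by auto
  ultimately show ?thesis by simp
qed

theorem rat_val_Nrm:
  assumes x: "x \<in> K" "x \<noteq> 0" shows "rat_val p (Nrm x) = (\<Sum>v\<in>V. int (fv v) * v x)"
proof -
  obtain b where b: "is_basis OV b" using M_basis_exists by blast
  have bK: "b i \<in> K" if "i < d" for i using basis_K[OF zmod_M b that] .
  have Mx: "x * y \<in> M (\<lambda>v. v x)" if "y \<in> OV" for y
  proof -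
    have yK: "y \<in> K" using that unfolding M_def by blast
    have "vge v (v x + 0) (x * y)" if v: "v \<in> V" for v
      by (rule vge_mult[OF vD[OF v] x(1) yK]) (use \<open>y \<in> OV\<close> v in \<open>auto simp: M_def vge_def\<close>)
    then show ?thesis unfolding M_def using K_mult[OF x(1) yK] by simp
  qed
  have bx: "is_basis (M (\<lambda>v. v x)) (\<lambda>i. x * b i)" unfolding is_basis_def
  proof (intro conjI allI impI ballI)
    show "x * b i \<in> M (\<lambda>v. v x)" if "i < d" for i using Mx b that unfolding is_basis_def by blast
    show "Dt (\<lambda>i. x * b i) \<noteq> 0" using Dt_mult[OF x(1) bK] Nrm_nonzero[OF x] b unfolding is_basis_def by simp
    fix z assume z: "z \<in> M (\<lambda>v. v x)"
    have zK: "z \<in> K" using z unfolding M_def by blast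
    have "vge v 0 (z / x)" if v: "v \<in> V" for v
    proof (cases "z = 0")
      case True then show ?thesis unfolding vge_def by simp
    next
      case False
      have "v z \<ge> v x" using z v False unfolding M_def vge_def by auto
      then show ?thesis using v_divide[OF vD[OF v] zK x(1) False x(2)] unfolding vge_def by simp
    qed
    then have "z / x \<in> OV" unfolding M_def using K_divide[OF zK x(1)] by blast
    then obtain c where c: "\<forall>i. c i \<in> loc_int p" "z / x = lin c b" using b unfolding is_basis_def by blast
    have "z = x * lin c b" using c(2) x(2) by (simp add: field_simps)
    then have "z = lin c (\<lambda>i. x * b i)" unfolding lin_def by (simp add: sum_distrib_left mult_ac)
    then show "\<exists>c. (\<forall>i. c i \<in> loc_int p) \<and> z = lin c (\<lambda>i. x * b i)" using c(1) by blast
  qed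
  have "\<kappa> (M (\<lambda>v. v x)) = rat_val p (Nrm x * Dt b)" using kappa[OF zmod_M bx] Dt_mult[OF x(1) bK] by simp
  also have "\<dots> = rat_val p (Nrm x) + \<kappa> OV"
    using rat_val_mult[OF p Nrm_nonzero[OF x]] b kappa[OF zmod_M b] unfolding is_basis_def by simp
  finally show ?thesis using kappa_M[of "\<lambda>v. v x"] by simp
qed

end

section \<open>The product formula\<close>

lemma power_int_sum_eq_prod:
  fixes x :: "'c::field"
  assumes "x \<noteq> 0" shows "x powi (\<Sum>i\<in>A. h i) = (\<Prod>i\<in>A. x powi h i)"
  using assms by (induction A rule: infinite_finite_induct) (simp_all add: power_int_add)

context number_field
begin

definition place :: "('k \<Rightarrow> int) \<Rightarrow> 'k \<Rightarrow> real" where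
  "place v x = (if x \<in> K \<and> x \<noteq> 0 then real (residue_field_size K v) powi (- v x) else 0)"

lemma finite_places_eq: "finite_places K = place ` DV"
proof (intro equalityI subsetI)
  fix P assume "P \<in> finite_places K"
  then obtain v where v: "discrete_valuation K v"
    "P = (\<lambda>x. if x \<in> K \<and> x \<noteq> 0 then real (residue_field_size K v) powi (- v x) else 0)"
    unfolding finite_places_def by blast
  \<comment> \<open>Resetting the irrelevant values to 0 moves the valuation into \<open>DV\<close>
    without changing the place.\<close>
  define v' where "v' x = (if x \<in> K \<and> x \<noteq> 0 then v x else 0)" for x
  have im: "v' ` (K - {0}) = v ` (K - {0})" by (rule image_cong) (auto simp: v'_def)
  have "discrete_valuation K v'"
    using v(1) unfolding discrete_valuation_def im by (auto simp: v'_def K_mult K_add)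
  then have "v' \<in> DV" unfolding DV_def v'_def by auto
  moreover have "valuation_ring K v' = valuation_ring K v" "valuation_ideal K v' = valuation_ideal K v"
    unfolding valuation_ring_def valuation_ideal_def v'_def by auto
  then have "residue_field_size K v' = residue_field_size K v" unfolding residue_field_size_def by simp
  then have "P = place v'" unfolding v(2) place_def v'_def by auto
  ultimately show "P \<in> place ` DV" by blast
next
  fix P assume "P \<in> place ` DV"
  then obtain v where v: "v \<in> DV" "P = place v" by blast
  then have "discrete_valuation K v" unfolding DV_def by blast
  moreover have "P = (\<lambda>x. if x \<in> K \<and> x \<noteq> 0 then real (residue_field_size K v) powi (- v x) else 0)"
    unfolding v(2) place_def by blast
  ultimately show "P \<in> finite_places K" unfolding finite_places_def by blast
qed

definition DVp :: "nat \<Rightarrow> ('k \<Rightarrow> int) set" where "DVp p = {v \<in> DV. v (of_nat p) > 0}"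

text \<open>One place above p for each conjugate, taken from \<open>exists_place_above\<close>,
  suffices.\<close>

lemma vge_above_W:
  assumes W: "padic_valuation_ring p W"
  obtains V0 where "finite V0" "V0 \<subseteq> DVp p"
    "\<And>x \<rho>. x \<in> K \<Longrightarrow> \<forall>v\<in>V0. vge v 0 x \<Longrightarrow> \<rho> \<in> Z \<Longrightarrow> \<sigma> \<rho> x \<in> W"
proof -
  have "\<exists>v. v \<in> DVp p \<and> (\<forall>x\<in>K. vge v 0 x \<longrightarrow> \<sigma> \<rho> x \<in> W)" if "\<rho> \<in> Z" for \<rho>
    using exists_place_above[OF W that] unfolding DVp_def by (metis (mono_tags, lifting) mem_Collect_eq)
  then obtain h where h: "\<And>\<rho>. \<rho> \<in> Z \<Longrightarrow> h \<rho> \<in> DVp p" "\<And>\<rho> x. \<rho> \<in> Z \<Longrightarrow> x \<in> K \<Longrightarrow> vge (h \<rho>) 0 x \<Longrightarrow> \<sigma> \<rho> x \<in> W"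
    by metis
  show ?thesis
  proof (rule that[of "h ` Z"])
    show "finite (h ` Z)" using finite_Z by simp
    show "h ` Z \<subseteq> DVp p" using h(1) by blast
    show "\<sigma> \<rho> x \<in> W" if "x \<in> K" "\<forall>v\<in>h ` Z. vge v 0 x" "\<rho> \<in> Z" for x \<rho>
      using h(2)[OF that(3,1)] that(2,3) by blast
  qed
qed

definition fdeg :: "nat \<Rightarrow> ('k \<Rightarrow> int) \<Rightarrow> nat" where "fdeg p v = (SOME n. residue_field_size K v = p ^ n)"

lemma local_product_formula_finite:
  assumes W: "padic_valuation_ring p W" and V: "finite V" "V \<subseteq> DVp p"
    and V_W: "\<And>x \<rho>. x \<in> K \<Longrightarrow> \<forall>v\<in>V. vge v 0 x \<Longrightarrow> \<rho> \<in> Z \<Longrightarrow> \<sigma> \<rho> x \<in> W"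
  shows "x \<in> K \<Longrightarrow> x \<noteq> 0 \<Longrightarrow> rat_val p (Nrm x) = (\<Sum>v\<in>V. int (fdeg p v) * v x)"
    and "v \<in> V \<Longrightarrow> residue_field_size K v = p ^ fdeg p v"
proof -
  interpret places_above \<xi> f p W V
  proof (intro places_above.intro places_above_axioms.intro)
    show "number_field \<xi> f" by (rule number_field_axioms)
    show "padic_valuation_ring p W" by (rule W)
    show "finite V" by (rule V(1))
    show "V \<subseteq> DV" using V(2) unfolding DVp_def by blast
    show "0 < v (of_nat p)" if "v \<in> V" for v using V(2) that unfolding DVp_def by blast
    show "\<sigma> \<rho> x \<in> W" if "x \<in> K" "\<forall>v\<in>V. vge v 0 x" "\<rho> \<in> Z" for x \<rho> by (rule V_W[OF that])
  qed
  have eq: "fv = fdeg p" unfolding fv_def fdeg_def by simp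
  show "x \<in> K \<Longrightarrow> x \<noteq> 0 \<Longrightarrow> rat_val p (Nrm x) = (\<Sum>v\<in>V. int (fdeg p v) * v x)"
    using rat_val_Nrm unfolding eq by simp
  show "v \<in> V \<Longrightarrow> residue_field_size K v = p ^ fdeg p v" using kappa_step(2) unfolding eq by simp
qed

lemma residue_field_size_ge_2:
  assumes v: "v \<in> DV" and fin: "residue_field_size K v = p ^ n" and p: "prime p"
  shows "n > 0"
proof (rule ccontr)
  define R E where "R = valuation_ring K v"
    and "E = {(x, y). x \<in> valuation_ring K v \<and> y \<in> valuation_ring K v \<and> x - y \<in> valuation_ideal K v}"
  assume "\<not> n > 0"
  then have "card (R // E) = 1" using fin unfolding residue_field_size_def R_def E_def by simp
  then obtain X where X: "R // E = {X}" by (rule card_1_singletonE)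
  have 01: "0 \<in> R" "1 \<in> R" unfolding R_def valuation_ring_def using K_0 K_1 v_1[OF v] by auto
  then have "E `` {0} \<in> R // E" "E `` {1} \<in> R // E" by (auto intro: quotientI)
  then have "E `` {0} = E `` {1}" unfolding X by simp
  moreover have "(1, 1) \<in> E" using 01 K_0 unfolding E_def R_def valuation_ideal_def by simp
  ultimately have "(0, 1) \<in> E" by blast
  then have "- 1 \<in> valuation_ideal K v" unfolding E_def by simp
  then show False unfolding valuation_ideal_def using v_minus_1[OF v] by simp
qed

theorem local_product_formula:
  assumes p: "prime p"
  shows "finite (DVp p)"
    and "x \<in> K \<Longrightarrow> x \<noteq> 0 \<Longrightarrow> rat_val p (Nrm x) = (\<Sum>v\<in>DVp p. int (fdeg p v) * v x)"
    and "v \<in> DVp p \<Longrightarrow> residue_field_size K v = p ^ fdeg p v \<and> fdeg p v > 0"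
proof -
  obtain W :: "complex set" where W: "padic_valuation_ring p W" using exists_padic_valuation_ring[OF p] by blast
  obtain V0 where V0: "finite V0" "V0 \<subseteq> DVp p"
    "\<And>x \<rho>. x \<in> K \<Longrightarrow> \<forall>v\<in>V0. vge v 0 x \<Longrightarrow> \<rho> \<in> Z \<Longrightarrow> \<sigma> \<rho> x \<in> W" by (rule vge_above_W[OF W], rule that)
  have ext: "finite V \<and> V \<subseteq> DVp p \<and> (\<forall>x \<rho>. x \<in> K \<longrightarrow> (\<forall>v\<in>V. vge v 0 x) \<longrightarrow> \<rho> \<in> Z \<longrightarrow> \<sigma> \<rho> x \<in> W)"
    if "V = V0 \<or> (\<exists>v\<in>DVp p. V = insert v V0)" for V
    using that V0 by auto
  have V: "(x \<in> K \<longrightarrow> x \<noteq> 0 \<longrightarrow> rat_val p (Nrm x) = (\<Sum>v\<in>V. int (fdeg p v) * v x)) \<and>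
      (\<forall>v\<in>V. residue_field_size K v = p ^ fdeg p v)" if "V = V0 \<or> (\<exists>v\<in>DVp p. V = insert v V0)" for V x
    using local_product_formula_finite[OF W, of V] ext[OF that] by simp
  have pK: "of_nat p \<in> K" "(of_nat p :: 'k) \<noteq> 0" using K_nat p by auto
  \<comment> \<open>The norm formula for the element p, applied with and without v, would make the
    additional term vanish; yet the value of v at p and the residue degree are positive.\<close>
  have all: "v \<in> V0" if v: "v \<in> DVp p" for v
  proof (rule ccontr)
    assume nv: "v \<notin> V0"
    have 1: "residue_field_size K v = p ^ fdeg p v" using V[of "insert v V0" 0] v by blast
    have vD: "v \<in> DV" "v (of_nat p) > 0" using v unfolding DVp_def by auto
    have "fdeg p v > 0" by (rule residue_field_size_ge_2[OF vD(1) 1 p])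
    then have pos: "int (fdeg p v) * v (of_nat p) > 0" using vD by simp
    have "rat_val p (Nrm (of_nat p)) = (\<Sum>v\<in>V0. int (fdeg p v) * v (of_nat p))" using V[of V0 "of_nat p"] pK by blast
    moreover have "rat_val p (Nrm (of_nat p)) = (\<Sum>v\<in>insert v V0. int (fdeg p v) * v (of_nat p))"
      using V[of "insert v V0" "of_nat p"] pK v by blast
    moreover have "(\<Sum>u\<in>insert v V0. int (fdeg p u) * u (of_nat p)) =
        int (fdeg p v) * v (of_nat p) + (\<Sum>u\<in>V0. int (fdeg p u) * u (of_nat p))"
      using nv V0(1) by simp
    ultimately show False using pos by linarith
  qed
  then have eq: "DVp p = V0" using V0(2) by blast
  show "finite (DVp p)" using eq V0 by simp
  show "x \<in> K \<Longrightarrow> x \<noteq> 0 \<Longrightarrow> rat_val p (Nrm x) = (\<Sum>v\<in>DVp p. int (fdeg p v) * v x)"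
    using V[of V0 x] eq by simp
  show "v \<in> DVp p \<Longrightarrow> residue_field_size K v = p ^ fdeg p v \<and> fdeg p v > 0"
  proof -
    assume v: "v \<in> DVp p"
    have r: "residue_field_size K v = p ^ fdeg p v" using V[of V0 0] v eq by blast
    have vD: "v \<in> DV" using v unfolding DVp_def by simp
    show ?thesis using r residue_field_size_ge_2[OF vD r p] by simp
  qed
qed

lemma residue_prime_unique: "prime p \<Longrightarrow> prime q \<Longrightarrow> v \<in> DVp p \<Longrightarrow> v \<in> DVp q \<Longrightarrow> p = q"
proof (rule ccontr)
  assume *: "prime p" "prime q" "v \<in> DVp p" "v \<in> DVp q" "p \<noteq> q"
  then have "\<not> p dvd q" using primes_dvd_imp_eq by blast
  then have "v (of_nat q) = 0" using residue_char_unique[of v p q] * unfolding DVp_def by simp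
  then show False using *(4) unfolding DVp_def by simp
qed

lemma residue_prime_exists: "v \<in> DV \<Longrightarrow> \<exists>p. prime p \<and> v \<in> DVp p"
proof -
  assume v: "v \<in> DV"
  obtain p where "prime p" "v (of_nat p) > 0" using exists_residue_char[OF v] by blast
  then show ?thesis using v unfolding DVp_def by blast
qed

lemma place_residue_size: assumes "v \<in> DV" shows "real (residue_field_size K v) \<ge> 2"
proof -
  obtain p where p: "prime p" "v \<in> DVp p" using residue_prime_exists[OF assms] by blast
  have r: "residue_field_size K v = p ^ fdeg p v" "fdeg p v > 0" using local_product_formula(3)[OF p] by auto
  have "p ^ 1 \<le> p ^ fdeg p v" using r(2) prime_gt_0_nat[OF p(1)] by (intro power_increasing) auto
  then have "p \<le> p ^ fdeg p v" by simp
  then have "2 \<le> residue_field_size K v" using r(1) prime_ge_2_nat[OF p(1)] by linarith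
  then show ?thesis by linarith
qed

lemma place_eq_1_iff: assumes "v \<in> DV" "x \<in> K" "x \<noteq> 0" shows "place v x = 1 \<longleftrightarrow> v x = 0"
proof -
  have q: "real (residue_field_size K v) > 1" using place_residue_size[OF assms(1)] by simp
  show ?thesis
  proof
    assume "place v x = 1"
    then have e: "real (residue_field_size K v) powi (- v x) = 1" unfolding place_def using assms by simp
    show "v x = 0"
    proof (rule ccontr)
      assume "v x \<noteq> 0"
      then consider "- v x > 0" | "v x > 0" by linarith
      then show False
      proof cases
        case 1
        then have "1 < real (residue_field_size K v) powi (- v x)" using q by (intro one_less_power_int) auto
        then show False using e by simp
      next
        case 2
        then have "1 < real (residue_field_size K v) powi (v x)" using q by (intro one_less_power_int) auto
        then show False using e by (simp add: power_int_minus)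
      qed
    qed
  qed (simp add: place_def assms)
qed

lemma place_inject: assumes "v \<in> DV" "u \<in> DV" "place v = place u" shows "v = u"
proof (rule DV_eqI[OF assms(1,2)])
  fix x assume x: "x \<in> K" "x \<noteq> 0" "v x \<ge> 0"
  have q: "real (residue_field_size K u) > 1" "real (residue_field_size K v) > 1"
    using place_residue_size[OF assms(1)] place_residue_size[OF assms(2)] by auto
  have "place v x = inverse (real (residue_field_size K v) powi (v x))" unfolding place_def using x by (simp add: power_int_minus)
  also have "\<dots> \<le> 1" using one_le_power_int[of "real (residue_field_size K v)" "v x"] q x(3) by (simp add: inverse_le_1_iff)
  finally have le: "place u x \<le> 1" using assms(3) by simp
  show "u x \<ge> 0"
  proof (rule ccontr)
    assume "\<not> u x \<ge> 0"
    then have "1 < real (residue_field_size K u) powi (- u x)" using q by (intro one_less_power_int) auto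
    then show False using le x unfolding place_def by simp
  qed
qed

lemma finite_nonunit_primes_rat: "finite {p. prime p \<and> q \<notin> loc_int p}"
proof (cases "q = 0")
  case True
  then have "q \<in> loc_int p" if "prime p" for p using loc_int_0[OF that] by simp
  then have "{p. prime p \<and> q \<notin> loc_int p} = {}" by blast
  then show ?thesis by (simp only: finite.emptyI)
next
  case False
  then obtain a b where ab: "a \<noteq> 0" "b \<noteq> 0" "q = of_int a / of_int b" by (rule rat_frac_exists)
  have "{p. prime p \<and> q \<notin> loc_int p} \<subseteq> {p. p dvd nat \<bar>b\<bar>}"
  proof
    fix p assume "p \<in> {p. prime p \<and> q \<notin> loc_int p}"
    then have "int p dvd b" using ab(3) unfolding loc_int_def by blast
    then have "int p dvd int (nat \<bar>b\<bar>)" by simp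
    then show "p \<in> {p. p dvd nat \<bar>b\<bar>}" by (simp only: int_dvd_int_iff mem_Collect_eq)
  qed
  then show ?thesis using finite_divisors_nat[of "nat \<bar>b\<bar>"] ab(2) by (auto intro: finite_subset)
qed

text \<open>For all but finitely many p the coefficients of \<open>f\<close> and the coordinates of
  x are p-integral. Then \<xi> is integral at every place above p: at a pole the leading term of the
  equation for \<xi> would dominate all others.\<close>

lemma eventually_integral:
  assumes x: "x \<in> K"
  shows "finite {p. prime p \<and> (\<exists>v\<in>DVp p. \<not> vge v 0 x)}"
proof -
  define P where "P = (\<Union>i<d. {p. prime p \<and> Polynomial.coeff f i \<notin> loc_int p} \<union> {p. prime p \<and> Polynomial.coeff (co x) i \<notin> loc_int p})"
  have fP: "finite P" unfolding P_def using finite_nonunit_primes_rat by simp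
  have "vge v 0 x" if p: "prime p" "p \<notin> P" "v \<in> DVp p" for p v
  proof -
    have v: "v \<in> DV" "v (of_nat p) > 0" using p(3) unfolding DVp_def by auto
    have cf: "vge v 0 (of_rat (Polynomial.coeff f i))" if "i < d" for i
      by (rule vge_loc_int[OF v(1) p(1) v(2)]) (use p(1,2) that in \<open>unfold P_def, blast\<close>)
    have cx: "vge v 0 (of_rat (Polynomial.coeff (co x) i))" if "i < d" for i
      by (rule vge_loc_int[OF v(1) p(1) v(2)]) (use p(1,2) that in \<open>unfold P_def, blast\<close>)
    have xi: "vge v 0 \<xi>"
    proof (rule ccontr)
      assume "\<not> vge v 0 \<xi>"
      then have neg: "\<xi> \<noteq> 0" "v \<xi> < 0" unfolding vge_def by auto
      have "ev \<xi> f = (\<Sum>i<Suc d. of_rat (Polynomial.coeff f i) * \<xi> ^ i)" by (rule ev_altdef) simp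
      then have e: "\<xi> ^ d = - (\<Sum>i<d. of_rat (Polynomial.coeff f i) * \<xi> ^ i)"
        using ev_f monic by (simp add: eq_neg_iff_add_eq_0 add.commute)
      have "vge v (int (d - 1) * v \<xi>) (\<Sum>i<d. of_rat (Polynomial.coeff f i) * \<xi> ^ i)"
      proof (rule vge_sum[OF v(1)])
        fix i assume "i \<in> {..<d}"
        then have i: "i < d" by simp
        show "of_rat (Polynomial.coeff f i) * \<xi> ^ i \<in> K" by (intro K_mult K_rat K_power K_gen)
        have "int (d - 1) * v \<xi> \<le> int i * v \<xi>" using i neg by (intro mult_right_mono_neg) auto
        then have "vge v (int (d - 1) * v \<xi>) (\<xi> ^ i)" using v_power[OF v(1) K_gen neg(1)] unfolding vge_def by simp
        from vge_mult[OF v(1) K_rat K_power[OF K_gen] cf[OF i] this]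
        show "vge v (int (d - 1) * v \<xi>) (of_rat (Polynomial.coeff f i) * \<xi> ^ i)" by simp
      qed
      moreover have "(\<Sum>i<d. of_rat (Polynomial.coeff f i) * \<xi> ^ i) \<in> K"
        by (intro K_sum K_mult K_rat K_power K_gen)
      ultimately have "vge v (int (d - 1) * v \<xi>) (- (\<Sum>i<d. of_rat (Polynomial.coeff f i) * \<xi> ^ i))"
        using vge_minus[OF v(1)] by blast
      then have "vge v (int (d - 1) * v \<xi>) (\<xi> ^ d)" by (simp only: e)
      moreover have "\<xi> ^ d \<noteq> 0" "v (\<xi> ^ d) = int d * v \<xi>" using neg(1) v_power[OF v(1) K_gen neg(1)] by simp_all
      ultimately have "int (d - 1) * v \<xi> \<le> int d * v \<xi>" unfolding vge_def by (simp only: simp_thms)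
      moreover have "int d = int (d - 1) + 1" using d_pos by linarith
      then have "int d * v \<xi> = int (d - 1) * v \<xi> + v \<xi>" by (simp only: distrib_right mult_1)
      ultimately show False using neg(2) by linarith
    qed
    have xin: "vge v 0 (\<xi> ^ i)" for i
    proof (induction i)
      case (Suc i) then show ?case using vge_mult[OF v(1) K_gen K_power[OF K_gen] xi Suc] by simp
    qed (simp add: vge_1[OF v(1)])
    have "vge v 0 (\<Sum>i<d. of_rat (Polynomial.coeff (co x) i) * \<xi> ^ i)"
    proof (rule vge_sum[OF v(1)])
      fix i assume "i \<in> {..<d}"
      then show "vge v 0 (of_rat (Polynomial.coeff (co x) i) * \<xi> ^ i)"
        using vge_mult[OF v(1) K_rat K_power[OF K_gen] cx xin] by simp
    qed (intro K_mult K_rat K_power K_gen)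
    then show ?thesis using ev_co_sum[OF v(1) x] by simp
  qed
  then have "{p. prime p \<and> (\<exists>v\<in>DVp p. \<not> vge v 0 x)} \<subseteq> P" by blast
  then show ?thesis using fP finite_subset by blast
qed

lemma finite_nonunit_places:
  assumes x: "x \<in> K" "x \<noteq> 0"
  shows "finite {v \<in> DV. v x \<noteq> 0}"
proof -
  define P where "P = {p. prime p \<and> (\<exists>v\<in>DVp p. \<not> vge v 0 x)} \<union> {p. prime p \<and> (\<exists>v\<in>DVp p. \<not> vge v 0 (inverse x))}"
  have fP: "finite P" unfolding P_def using eventually_integral x(1) K_inverse by simp
  have "{v \<in> DV. v x \<noteq> 0} \<subseteq> (\<Union>p\<in>{p\<in>P. prime p}. DVp p)"
  proof
    fix v assume "v \<in> {v \<in> DV. v x \<noteq> 0}"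
    then have v: "v \<in> DV" "v x \<noteq> 0" by auto
    obtain p where p: "prime p" "v \<in> DVp p" using residue_prime_exists[OF v(1)] by blast
    have "\<not> vge v 0 x \<or> \<not> vge v 0 (inverse x)" using v_inverse[OF v(1) x] v(2) x unfolding vge_def by auto
    then have "p \<in> P" unfolding P_def using p by blast
    then show "v \<in> (\<Union>p\<in>{p\<in>P. prime p}. DVp p)" using p by blast
  qed
  moreover have "finite (\<Union>p\<in>{p\<in>P. prime p}. DVp p)" using fP local_product_formula(1) by auto
  ultimately show ?thesis by (rule finite_subset)
qed

text \<open>This is the product formula of the rationals for \<open>Nrm x\<close>, with the
  valuation at each p distributed over the places above p by
  \<open>local_product_formula\<close>.\<close>

theorem product_formula:
  assumes x: "x \<in> K" "x \<noteq> 0"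
  shows "(\<Prod>v\<in>{v\<in>DV. v x \<noteq> 0}. place v x) * cmod (\<Prod>\<rho>\<in>Z. \<sigma> \<rho> x) = 1"
proof -
  define A where "A = {v\<in>DV. v x \<noteq> 0}"
  have fA: "finite A" unfolding A_def by (rule finite_nonunit_places[OF x])
  define q where "q = Nrm x"
  have "complex_of_rat q = (\<Prod>\<rho>\<in>Z. \<sigma> \<rho> x)" unfolding q_def by (rule Nrm_eq[OF x(1)])
  moreover have "(\<Prod>\<rho>\<in>Z. \<sigma> \<rho> x) \<noteq> 0" using sigma_eq_0_iff x finite_Z by auto
  ultimately have q0: "q \<noteq> 0" by auto
  define P where "P = {p. prime p \<and> (\<exists>v\<in>A. v \<in> DVp p)}"
  define r where "r v = (SOME p. prime p \<and> v \<in> DVp p)" for v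
  have "P \<subseteq> r ` A"
  proof
    fix p assume "p \<in> P"
    then obtain v where v: "prime p" "v \<in> A" "v \<in> DVp p" unfolding P_def by blast
    have "\<exists>p. prime p \<and> v \<in> DVp p" using v(1,3) by blast
    then have "prime (r v) \<and> v \<in> DVp (r v)" unfolding r_def by (rule someI_ex)
    then have "p = r v" using residue_prime_unique[OF v(1) _ v(3)] by blast
    then show "p \<in> r ` A" using v(2) by (rule image_eqI)
  qed
  then have fP: "finite P" using finite_surj[OF fA] by blast
  have outside: "rat_val p q = 0" if "prime p" "p \<notin> P" for p
  proof -
    have z: "v x = 0" if "v \<in> DVp p" for v using that \<open>prime p\<close> \<open>p \<notin> P\<close> unfolding P_def A_def DVp_def by auto
    show ?thesis unfolding q_def local_product_formula(2)[OF \<open>prime p\<close> x] by (rule sum.neutral) (use z in simp)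
  qed
  have "\<bar>of_rat q :: real\<bar> = (\<Prod>p\<in>P. real p powi rat_val p q)"
  proof (rule abs_rat_eq_prod_rat_val[OF q0 fP])
    show "prime p" if "p \<in> P" for p using that unfolding P_def by simp
    show "p \<in> P" if "prime p" "rat_val p q \<noteq> 0" for p using outside[of p] that by blast
  qed
  also have "\<dots> = (\<Prod>p\<in>P. \<Prod>v\<in>A \<inter> DVp p. inverse (place v x))"
  proof (rule prod.cong)
    fix p assume "p \<in> P"
    then have p: "prime p" unfolding P_def by simp
    have pl: "inverse (place v x) = real p powi (int (fdeg p v) * v x)" if "v \<in> DVp p" for v
    proof -
      have "real (residue_field_size K v) = real p powi int (fdeg p v)" using local_product_formula(3)[OF p that] by simp
      then have "place v x = inverse (real p powi (int (fdeg p v) * v x))"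
        using x unfolding place_def by (simp only: power_int_minus power_int_mult) simp
      then show ?thesis by (simp only: inverse_inverse_eq)
    qed
    have "rat_val p q = (\<Sum>v\<in>DVp p. int (fdeg p v) * v x)" unfolding q_def by (rule local_product_formula(2)[OF p x])
    also have "\<dots> = (\<Sum>v\<in>A \<inter> DVp p. int (fdeg p v) * v x)"
    proof (rule sum.mono_neutral_right[OF local_product_formula(1)[OF p]])
      show "\<forall>v\<in>DVp p - A \<inter> DVp p. int (fdeg p v) * v x = 0" unfolding A_def DVp_def by auto
    qed simp
    finally have "real p powi rat_val p q = (\<Prod>v\<in>A \<inter> DVp p. real p powi (int (fdeg p v) * v x))"
      using prime_gt_0_nat[OF p] power_int_sum_eq_prod[of "real p"] by simp
    also have "\<dots> = (\<Prod>v\<in>A \<inter> DVp p. inverse (place v x))" by (intro prod.cong) (auto simp: pl)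
    finally show "real p powi rat_val p q = (\<Prod>v\<in>A \<inter> DVp p. inverse (place v x))" .
  qed simp
  also have "\<dots> = (\<Prod>v\<in>(\<Union>p\<in>P. A \<inter> DVp p). inverse (place v x))"
  proof (rule prod.UNION_disjoint[symmetric])
    show "\<forall>i\<in>P. \<forall>j\<in>P. i \<noteq> j \<longrightarrow> (A \<inter> DVp i) \<inter> (A \<inter> DVp j) = {}"
    proof (intro ballI impI)
      fix i j assume ij: "i \<in> P" "j \<in> P" "i \<noteq> j"
      then have "prime i" "prime j" unfolding P_def by auto
      then have "v \<notin> DVp j" if "v \<in> DVp i" for v using residue_prime_unique[of i j v] ij(3) that by blast
      then show "(A \<inter> DVp i) \<inter> (A \<inter> DVp j) = {}" by blast
    qed
  qed (use fP fA in simp_all)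
  also have "(\<Union>p\<in>P. A \<inter> DVp p) = A"
    using residue_prime_exists unfolding P_def A_def by blast
  finally have "\<bar>of_rat q :: real\<bar> = inverse (\<Prod>v\<in>A. place v x)" by (simp add: prod_inversef[symmetric] o_def)
  moreover have "cmod (\<Prod>\<rho>\<in>Z. \<sigma> \<rho> x) = \<bar>of_rat q :: real\<bar>"
  proof -
    have "(\<Prod>\<rho>\<in>Z. \<sigma> \<rho> x) = complex_of_rat q" unfolding q_def by (rule Nrm_eq[OF x(1), symmetric])
    also have "\<dots> = complex_of_real (of_rat q)" by (cases q) (simp add: of_rat_rat)
    finally show ?thesis by simp
  qed
  moreover have "(\<Prod>v\<in>A. place v x) \<noteq> 0"
  proof -
    have "place v x \<noteq> 0" if "v \<in> A" for v
      using place_residue_size[of v] that x unfolding place_def A_def by auto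
    then show ?thesis using fA by simp
  qed
  ultimately show ?thesis unfolding A_def by simp
qed

end

section \<open>Sequences of the form \<open>\<bar>\<xi>\<^sup>n - 1\<bar>\<^sub>v\<close>\<close>

text \<open>Here \<open>p\<close> is the residue characteristic of \<open>v\<close> and \<open>m\<close> the order of \<open>\<xi>\<close> in the residue field.\<close>

locale ultrametric_seq =
  fixes p :: nat and a :: "nat \<Rightarrow> real" and m :: nat
  assumes p: "prime p" and m: "m \<ge> 1"
    and a0: "a 0 = 0" and a_pos: "n \<ge> 1 \<Longrightarrow> 0 < a n" and a_le1: "a n \<le> 1"
    and um1: "a (n + k) \<le> max (a n) (a k)" and um2: "a n \<le> max (a (n + k)) (a k)"
    and lt1_iff: "a n < 1 \<longleftrightarrow> m dvd n"
    and contract: "a n < 1 \<Longrightarrow> a (p * n) \<le> a n / 2"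
    and prime_to: "a n < 1 \<Longrightarrow> \<not> p dvd k \<Longrightarrow> a (k * n) = a n"
begin

lemma a_nonneg: "0 \<le> a n"
  using a0 a_pos[of n] by (cases "n = 0") (auto simp: less_imp_le)

lemma mult_le: "a (k * n) \<le> a n"
proof (induction k)
  case 0 then show ?case by (simp add: a0 a_nonneg)
next
  case (Suc k)
  have "a (n + k * n) \<le> max (a n) (a (k * n))" by (rule um1)
  then show ?case using Suc by simp
qed

lemma shift_diff: "\<bar>a (n + k) - a n\<bar> \<le> a k"
  using um1[of n k] um2[of n k] a_nonneg[of n] a_nonneg[of "n + k"] a_nonneg[of k]
  by (auto simp: max_def split: if_splits)

lemma shift_eq: "a k < a n \<Longrightarrow> a (n + k) = a n"
  using um1[of n k] um2[of n k] by (auto simp: max_def split: if_splits)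

lemma pow_contract: "a n < 1 \<Longrightarrow> a (p ^ e * n) \<le> a n / 2 ^ e"
proof (induction e)
  case (Suc e)
  have "a (p ^ e * n) < 1" using mult_le[of "p^e" n] Suc.prems by simp
  from contract[OF this] Suc.IH[OF Suc.prems] show ?case by (simp add: mult.assoc)
qed simp

lemma dvd_pow_contract:
  assumes "a n < 1" "p dvd D"
  shows "a (D ^ K * n) \<le> 1 / 2 ^ K"
proof -
  obtain c where "D = p * c" using assms by blast
  then have "D ^ K * n = c ^ K * (p ^ K * n)" by (simp add: power_mult_distrib mult_ac)
  then have "a (D ^ K * n) \<le> a (p ^ K * n)" by (simp only: mult_le)
  also have "\<dots> \<le> a n / 2 ^ K" using pow_contract assms by blast
  also have "\<dots> \<le> 1 / 2 ^ K" using assms by (simp add: divide_right_mono)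
  finally show ?thesis .
qed

text \<open>The shift p ^ e D has exactly e factors p and is divisible by the order m. Its other
  prime factors remain free, so that D can be adapted to further places.\<close>

context
  fixes e D :: nat
  assumes D: "m dvd p ^ e * D" "\<not> p dvd D"
begin

lemma lt1_D: "a (p ^ e * D) < 1" using D lt1_iff by blast

text \<open>Once m divides n, the value depends only on the power of p in n and decreases with it;
  otherwise it is 1. With fewer than e factors p the value at n strictly exceeds the one at the
  shift, which then has no effect.\<close>

lemma shift_below:
  assumes "\<not> p ^ e dvd n" shows "a (n + p ^ e * D) = a n"
proof (cases "a n < 1")
  case False
  then show ?thesis using shift_eq lt1_D by (metis a_le1 nless_le)
next
  case True
  have "n \<noteq> 0" using assms by (metis dvd_0_right)
  then obtain i n' where n: "n = p ^ i * n'" "\<not> p dvd n'"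
    using p by (metis multiplicity_decompose' not_prime_unit)
  have ie: "i < e" using assms n(1) by (metis dvd_triv_left le_imp_power_dvd dvd_trans not_less)
  have "coprime (p ^ e) n'" using n(2) p by (simp add: prime_imp_coprime)
  then have "gcd (p ^ i * n') (p ^ e) dvd p ^ i"
    by (metis coprime_commute coprime_dvd_mult_left_iff coprime_divisors dvd_refl gcd_dvd1 gcd_dvd2)
  moreover have "m dvd gcd (p ^ i * n' * D) (p ^ e * D)"
    using True lt1_iff n D by (metis dvd_mult2 gcd_greatest)
  ultimately have "m dvd p ^ i * D"
    by (metis gcd_mult_distrib_nat mult.commute mult_dvd_mono dvd_refl dvd_trans)
  then have lt: "a (p ^ i * D) < 1" using lt1_iff by blast
  have "a n = a (D * n)" using prime_to[OF True] D by simp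
  also have "D * n = n' * (p ^ i * D)" using n by simp
  also have "a \<dots> = a (p ^ i * D)" using prime_to[OF lt] n by simp
  finally have an: "a n = a (p ^ i * D)" .
  have "p ^ e * D = p ^ (e - i) * (p ^ i * D)"
    using ie by (simp add: mult.assoc[symmetric] power_add[symmetric])
  then have "a (p ^ e * D) \<le> a n / 2 ^ (e - i)" using pow_contract[OF lt] an by metis
  also have "\<dots> < a n"
  proof -
    have "1 < (2::real) ^ (e - i)" using ie by simp
    then show ?thesis using a_pos[of n] \<open>n \<noteq> 0\<close> by (simp add: divide_less_eq)
  qed
  finally show ?thesis by (rule shift_eq)
qed

lemma exact_value:
  assumes "p ^ e dvd n" "\<not> p ^ Suc e dvd n" "m dvd n"
  shows "a n = a (p ^ e * D)"
proof -
  obtain l where l: "n = p ^ e * l" using assms by blast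
  have pl: "\<not> p dvd l" using assms l by (auto simp: mult_dvd_mono mult.commute)
  have "a n = a (D * n)" using prime_to[of n D] assms lt1_iff D by simp
  also have "D * n = l * (p ^ e * D)" using l by simp
  also have "a \<dots> = a (p ^ e * D)" using prime_to[OF lt1_D pl] .
  finally show ?thesis .
qed

lemma above_value:
  assumes "p ^ Suc e dvd n" "m dvd n"
  shows "a n \<le> a (p ^ e * D) / 2"
proof -
  obtain l where l: "n = p ^ Suc e * l" using assms by blast
  have "a n = a (D * n)" using prime_to[of n D] assms lt1_iff D by simp
  also have "D * n = l * (p * (p ^ e * D))" using l by simp
  also have "a \<dots> \<le> a (p * (p ^ e * D))" by (rule mult_le)
  also have "\<dots> \<le> a (p ^ e * D) / 2" by (rule contract[OF lt1_D])
  finally show ?thesis .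
qed

lemma not_Suc_dvd: "\<not> p ^ Suc e dvd p ^ e * D"
  using D p by (simp add: mult.commute[of p])

lemma dvd_shift_iff: "m dvd n + p ^ e * D \<longleftrightarrow> m dvd n"
  using D by (simp add: dvd_add_left_iff)

lemma shift_equal:
  assumes "\<not> p ^ Suc e dvd n" "\<not> p ^ Suc e dvd n + p ^ e * D"
  shows "a (n + p ^ e * D) = a n"
proof (cases "p ^ e dvd n \<and> m dvd n")
  case True
  then have "p ^ e dvd n + p ^ e * D" "m dvd n + p ^ e * D" using dvd_shift_iff by auto
  then show ?thesis using exact_value assms True by metis
next
  case False
  then show ?thesis
    using shift_below dvd_shift_iff lt1_iff a_le1 by (metis nless_le)
qed

text \<open>The shift leaves exactly e factors p, fewer than in n, so the value grows, at least by a
  factor of 2 if m divides n. If m does not divide n, both values are 1.\<close>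

lemma shift_up:
  assumes "p ^ Suc e dvd n"
  shows "a n \<le> a (n + p ^ e * D)" "m dvd n \<Longrightarrow> a n \<le> a (n + p ^ e * D) / 2"
proof -
  have *: "\<not> p ^ Suc e dvd n + p ^ e * D" "p ^ e dvd n + p ^ e * D"
    using not_Suc_dvd assms by (auto simp: dvd_add_right_iff dest: power_le_dvd[of _ "Suc e" _ e])
  show 2: "a n \<le> a (n + p ^ e * D) / 2" if "m dvd n"
    using above_value[OF assms that] exact_value[OF *(2,1)] dvd_shift_iff that by simp
  show "a n \<le> a (n + p ^ e * D)"
  proof (cases "m dvd n")
    case True then show ?thesis using 2 a_nonneg[of "n + p ^ e * D"] by simp
  next
    case False
    then have "\<not> a (n + p ^ e * D) < 1" using dvd_shift_iff lt1_iff by simp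
    then show ?thesis using a_le1[of n] by linarith
  qed
qed

lemma shift_down:
  assumes "p ^ Suc e dvd n + p ^ e * D"
  shows "a (n + p ^ e * D) \<le> a n"
proof -
  have *: "\<not> p ^ Suc e dvd n" "p ^ e dvd n"
    using not_Suc_dvd assms power_le_dvd[of p "Suc e" "n + p ^ e * D" e]
    by (auto simp: dvd_add_right_iff dvd_add_left_iff)
  show ?thesis
  proof (cases "m dvd n")
    case True
    then have "a (n + p ^ e * D) \<le> a n / 2"
      using above_value[OF assms] exact_value[OF *(2,1)] dvd_shift_iff by simp
    then show ?thesis using a_nonneg[of n] by simp
  next
    case False
    then have "\<not> a n < 1" using lt1_iff by simp
    then show ?thesis using a_le1[of "n + p ^ e * D"] by linarith
  qed
qed

end
end

section \<open>Finite products of ultrametric sequences\<close>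

lemma prod_unit_interval_diff:
  fixes x y :: "'i \<Rightarrow> real"
  assumes "\<And>i. i \<in> I \<Longrightarrow> 0 \<le> x i \<and> x i \<le> 1" "\<And>i. i \<in> I \<Longrightarrow> 0 \<le> y i \<and> y i \<le> 1"
  shows "\<bar>(\<Prod>i\<in>I. x i) - (\<Prod>i\<in>I. y i)\<bar> \<le> (\<Sum>i\<in>I. \<bar>x i - y i\<bar>)"
  using norm_prod_diff[of I x y] assms by fastforce

locale ultrametric_family =
  fixes I :: "'i set" and p :: "'i \<Rightarrow> nat" and a :: "'i \<Rightarrow> nat \<Rightarrow> real" and m :: "'i \<Rightarrow> nat"
  assumes fin: "finite I" and seq: "i \<in> I \<Longrightarrow> ultrametric_seq (p i) (a i) (m i)"
begin

definition f :: "nat \<Rightarrow> real" where "f n = (\<Prod>i\<in>I. a i n)"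

lemma a_bounds: "i \<in> I \<Longrightarrow> 0 \<le> a i n \<and> a i n \<le> 1"
  using seq[of i] ultrametric_seq.a_nonneg ultrametric_seq.a_le1 by blast

lemma f_nonneg: "0 \<le> f n" and f_le1: "f n \<le> 1"
  unfolding f_def using a_bounds by (auto intro!: prod_nonneg prod_le_1)

lemma f_pos: "n \<ge> 1 \<Longrightarrow> 0 < f n"
  unfolding f_def by (intro prod_pos) (rule ultrametric_seq.a_pos[OF seq])

lemma f_shift_diff: "\<bar>f (n + k) - f n\<bar> \<le> (\<Sum>i\<in>I. a i k)"
proof -
  have "\<bar>f (n + k) - f n\<bar> \<le> (\<Sum>i\<in>I. \<bar>a i (n + k) - a i n\<bar>)"
    unfolding f_def by (rule prod_unit_interval_diff) (use a_bounds in auto)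
  also have "\<dots> \<le> (\<Sum>i\<in>I. a i k)"
    by (intro sum_mono) (rule ultrametric_seq.shift_diff[OF seq])
  finally show ?thesis .
qed

text \<open>Since N contains every p i and m i, a shift by a multiple of N ^ (K + 1) changes f by at
  most card I / 2 ^ K. So f stays bounded below along a whole progression of multiples of M.\<close>

lemma f_lower_density:
  assumes "M \<ge> 1"
  obtains V where "V \<ge> 1" "M dvd V" "\<And>t. f (M + t * V) \<ge> f M / 2"
proof -
  define N where "N = M * (\<Prod>i\<in>I. p i * m i)"
  have pm: "p i \<ge> 1" "m i \<ge> 1" if "i \<in> I" for i
    using seq[OF that] ultrametric_seq.m ultrametric_seq.p prime_ge_1_nat by blast+
  have "(\<Prod>i\<in>I. p i * m i) > 0" by (rule prod_pos) (use pm in fastforce)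
  then have N: "N \<ge> 1" unfolding N_def using assms by (simp add: Suc_leI)
  have "f M > 0" using f_pos assms by auto
  obtain K where K: "real (card I) / 2 ^ K < f M / 2"
  proof -
    have "(\<lambda>K. real (card I) * (1/2) ^ K) \<longlonglongrightarrow> real (card I) * 0"
      by (intro tendsto_intros LIMSEQ_realpow_zero) auto
    then have "eventually (\<lambda>K. real (card I) * (1/2) ^ K < f M / 2) sequentially"
      using \<open>f M > 0\<close> by (intro order_tendstoD(2)) auto
    then show ?thesis using that by (auto simp: eventually_sequentially power_one_over)
  qed
  have small: "a i (t * (N ^ K * N)) \<le> 1 / 2 ^ K" if "i \<in> I" for i t
  proof -
    interpret ultrametric_seq "p i" "a i" "m i" using seq that .
    have "p i * m i dvd N" unfolding N_def by (intro dvd_mult dvd_prodI fin that)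
    then have d: "p i dvd N" "m i dvd N"
      by (rule dvd_mult_left, rule dvd_mult_right)
    have "a i (t * (N ^ K * N)) \<le> a i (N ^ K * N)" by (rule mult_le)
    also have "\<dots> \<le> 1 / 2 ^ K" by (rule dvd_pow_contract) (simp_all only: lt1_iff d)
    finally show ?thesis .
  qed
  show ?thesis
  proof
    show "N ^ K * N \<ge> 1" using N by simp
    show "M dvd N ^ K * N" unfolding N_def by simp
    fix t
    have "\<bar>f (M + t * (N ^ K * N)) - f M\<bar> \<le> (\<Sum>i\<in>I. a i (t * (N ^ K * N)))" by (rule f_shift_diff)
    also have "\<dots> \<le> (\<Sum>i\<in>I. 1 / 2 ^ K)" using small by (intro sum_mono) blast
    also have "\<dots> = real (card I) / 2 ^ K" by simp
    finally show "f (M + t * (N ^ K * N)) \<ge> f M / 2" using K by linarith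
  qed
qed

text \<open>In the factorization f = g h the part h from the residue characteristics other than q is
  almost invariant under W for large K. All factors of g obey the same case distinction, decided by
  the divisibility of n and n + W by q ^ (e + 1), so g inherits it.\<close>

lemma f_almost_period:
  assumes i0: "i0 \<in> I" and q: "q = p i0"
    and D: "\<And>i. i \<in> I \<Longrightarrow> m i dvd q ^ e * D" "\<not> q dvd D"
      "\<And>i. i \<in> I \<Longrightarrow> p i \<noteq> q \<Longrightarrow> p i dvd D" and eps: "\<epsilon> > 0"
  obtains K W where "K \<ge> 1" "W = q ^ e * D ^ K"
    "\<And>n. \<not> q ^ Suc e dvd n \<Longrightarrow> \<not> q ^ Suc e dvd n + W \<Longrightarrow> \<bar>f (n + W) - f n\<bar> \<le> \<epsilon>"
    "\<And>n. q ^ Suc e dvd n \<Longrightarrow> f (n + W) - f n \<ge> - \<epsilon>"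
    "\<And>n. q ^ Suc e dvd n \<Longrightarrow> m i0 dvd n \<Longrightarrow> f (n + W) - f n \<ge> f n - \<epsilon>"
    "\<And>n. q ^ Suc e dvd n + W \<Longrightarrow> f (n + W) - f n \<le> \<epsilon>"
proof -
  have q_prime: "prime q" using seq[OF i0] q ultrametric_seq.p by blast
  obtain k where k: "real (card I) / 2 ^ k < \<epsilon>"
  proof -
    have "(\<lambda>K. real (card I) * (1/2) ^ K) \<longlonglongrightarrow> real (card I) * 0"
      by (intro tendsto_intros LIMSEQ_realpow_zero) auto
    then have "eventually (\<lambda>K. real (card I) * (1/2) ^ K < \<epsilon>) sequentially"
      using eps by (intro order_tendstoD(2)) auto
    then show ?thesis using that by (auto simp: eventually_sequentially power_one_over)
  qed
  \<comment> \<open>One factor D is kept for the divisibility of the shift by the orders m i; the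
    other k provide the contraction.\<close>
  define K where "K = Suc k"
  define W where "W = q ^ e * D ^ K"
  define A where "A = {i\<in>I. p i = q}"
  define B where "B = {i\<in>I. p i \<noteq> q}"
  define g h where "g n = (\<Prod>i\<in>A. a i n)" and "h n = (\<Prod>i\<in>B. a i n)" for n
  have AB: "finite A" "finite B" "I = A \<union> B" "A \<inter> B = {}" "A \<subseteq> I" "B \<subseteq> I" "i0 \<in> A"
    using fin i0 q unfolding A_def B_def by auto
  have f: "f n = g n * h n" for n
    unfolding f_def g_def h_def by (subst AB(3), rule prod.union_disjoint) (use AB in auto)
  have gh: "0 \<le> g n" "g n \<le> 1" "0 \<le> h n" "h n \<le> 1" for n
    unfolding g_def h_def using a_bounds AB by (auto intro!: prod_nonneg prod_le_1)
  have hd: "\<bar>h (n + W) - h n\<bar> \<le> \<epsilon>" for n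
  proof -
    have "\<bar>h (n + W) - h n\<bar> \<le> (\<Sum>i\<in>B. \<bar>a i (n + W) - a i n\<bar>)"
      unfolding h_def by (rule prod_unit_interval_diff) (use a_bounds AB in auto)
    also have "\<dots> \<le> (\<Sum>i\<in>B. 1 / 2 ^ k)"
    proof (rule sum_mono)
      fix i assume i: "i \<in> B"
      then have iI: "i \<in> I" "p i \<noteq> q" unfolding B_def by auto
      interpret ultrametric_seq "p i" "a i" "m i" using seq iI by blast
      have "\<bar>a i (n + W) - a i n\<bar> \<le> a i W" by (rule shift_diff)
      also have "a i W \<le> 1 / 2 ^ k"
      proof -
        have "W = D ^ k * (q ^ e * D)" unfolding W_def K_def by simp
        moreover have "a i (D ^ k * (q ^ e * D)) \<le> 1 / 2 ^ k"
          by (rule dvd_pow_contract) (simp_all only: lt1_iff D(1)[OF iI(1)] D(3)[OF iI])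
        ultimately show ?thesis by (simp only:)
      qed
      finally show "\<bar>a i (n + W) - a i n\<bar> \<le> 1 / 2 ^ k" .
    qed
    also have "\<dots> \<le> real (card I) / 2 ^ k"
      using card_mono[OF fin AB(6)] by (simp add: divide_right_mono)
    finally show ?thesis using k by simp
  qed
  have Dk: "\<not> q dvd D ^ K" using D(2) prime_dvd_power[OF q_prime] by blast
  have mD: "m i dvd q ^ e * D ^ K" if "i \<in> I" for i
    using dvd_mult2[OF D(1)[OF that], of "D ^ k"] unfolding K_def by (simp add: mult_ac)
  have gA: "ultrametric_seq q (a i) (m i)" "m i dvd q ^ e * D ^ K" if "i \<in> A" for i
    using seq mD that unfolding A_def by auto
  have bound: "\<bar>x * (v - u)\<bar> \<le> \<epsilon>" if "0 \<le> x" "x \<le> 1" "\<bar>v - u\<bar> \<le> \<epsilon>" for x v u :: real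
    using that eps mult_mono[of x 1 "\<bar>v - u\<bar>" \<epsilon>] by (simp add: abs_mult)
  have split: "f (n + W) - f n = (g (n + W) - g n) * h n + g (n + W) * (h (n + W) - h n)" for n
    unfolding f by (simp add: algebra_simps)
  have bd: "\<bar>g (n + W) * (h (n + W) - h n)\<bar> \<le> \<epsilon>" for n
    by (rule bound[OF _ _ hd]) (use gh in auto)
  show ?thesis
  proof (rule that)
    show "K \<ge> 1" unfolding K_def by simp
    show "W = q ^ e * D ^ K" by (rule W_def)
  next
    fix n assume n: "\<not> q ^ Suc e dvd n" "\<not> q ^ Suc e dvd n + W"
    have "g (n + W) = g n" unfolding g_def W_def
      using ultrametric_seq.shift_equal[OF gA(1) gA(2) Dk] n unfolding W_def by (intro prod.cong) auto
    then show "\<bar>f (n + W) - f n\<bar> \<le> \<epsilon>" using split[of n] bd[of n] by simp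
  next
    fix n assume n: "q ^ Suc e dvd n"
    have le: "a i n \<le> a i (n + W)" if "i \<in> A" for i
      unfolding W_def using ultrametric_seq.shift_up(1)[OF gA(1) gA(2) Dk n] that by auto
    have "g n \<le> g (n + W)" unfolding g_def
      using le a_bounds AB by (intro prod_mono) auto
    then have "(g (n + W) - g n) * h n \<ge> 0" using gh by simp
    then show "f (n + W) - f n \<ge> - \<epsilon>" using split[of n] bd[of n] by linarith
    assume mn: "m i0 dvd n"
    have le2: "a i0 n \<le> a i0 (n + W) / 2"
      unfolding W_def using ultrametric_seq.shift_up(2)[OF gA(1) gA(2) Dk n mn] AB by auto
    have "2 * g n \<le> g (n + W)"
    proof -
      have g0: "g n = a i0 n * (\<Prod>i\<in>A - {i0}. a i n)" for n
        unfolding g_def using AB by (simp add: prod.remove)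
      have "(\<Prod>i\<in>A - {i0}. a i n) \<le> (\<Prod>i\<in>A - {i0}. a i (n + W))"
        using le a_bounds AB by (intro prod_mono) auto
      then have "(2 * a i0 n) * (\<Prod>i\<in>A - {i0}. a i n) \<le> a i0 (n + W) * (\<Prod>i\<in>A - {i0}. a i (n + W))"
        using le2 a_bounds AB by (intro mult_mono) (auto intro!: prod_nonneg)
      then show ?thesis unfolding g0 by simp
    qed
    then have "(g (n + W) - g n) * h n \<ge> g n * h n" using gh by (intro mult_right_mono) auto
    then show "f (n + W) - f n \<ge> f n - \<epsilon>" using split[of n] bd[of n] f[of n] by linarith
  next
    fix n assume n: "q ^ Suc e dvd n + W"
    have le: "a i (n + W) \<le> a i n" if "i \<in> A" for i
      unfolding W_def using ultrametric_seq.shift_down[OF gA(1) gA(2) Dk] n that unfolding W_def by auto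
    have "g (n + W) \<le> g n" unfolding g_def
      using le a_bounds AB by (intro prod_mono) auto
    then have "(g (n + W) - g n) * h n \<le> 0" using gh by (simp add: mult_nonpos_nonneg)
    then show "f (n + W) - f n \<le> \<epsilon>" using split[of n] bd[of n] by linarith
  qed
qed

end

section \<open>Absolute values of \<xi> ^ n - 1 at finite places\<close>

context number_field
begin

lemma place_finite: assumes "P \<in> finite_places K" obtains v where "v \<in> DV" "P = place v"
  using assms unfolding finite_places_eq by blast

lemma place_pos: assumes "v \<in> DV" "x \<in> K" "x \<noteq> 0" shows "place v x > 0"
  using place_residue_size[OF assms(1)] assms unfolding place_def by simp

lemma place_0: "place v 0 = 0" unfolding place_def by simp

lemma place_le_iff:
  assumes v: "v \<in> DV" and x: "x \<in> K" "x \<noteq> 0"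
  shows "vge v a x \<longleftrightarrow> place v x \<le> real (residue_field_size K v) powi (- a)"
proof -
  have q: "real (residue_field_size K v) > 1" using place_residue_size[OF v] by simp
  have "place v x \<le> real (residue_field_size K v) powi (- a) \<longleftrightarrow> - v x \<le> - a"
  proof
    assume "- v x \<le> - a"
    then show "place v x \<le> real (residue_field_size K v) powi (- a)"
      unfolding place_def using x q by (simp add: power_int_increasing)
  next
    assume le: "place v x \<le> real (residue_field_size K v) powi (- a)"
    show "- v x \<le> - a"
    proof (rule ccontr)
      assume "\<not> - v x \<le> - a"
      then have "real (residue_field_size K v) powi (- a) < real (residue_field_size K v) powi (- v x)"
        using q by (intro power_int_strict_increasing) auto
      then show False using le x unfolding place_def by simp
    qed
  qed
  then show ?thesis using x unfolding vge_def by simp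
qed

lemma place_le_1_iff: "v \<in> DV \<Longrightarrow> x \<in> K \<Longrightarrow> vge v 0 x \<longleftrightarrow> place v x \<le> 1"
  using place_le_iff[of v x 0] by (cases "x = 0") (simp_all add: vge_def place_0)

lemma place_mono:
  assumes v: "v \<in> DV" and x: "x \<in> K" "x \<noteq> 0" and y: "y \<in> K" and ge: "vge v (v x) y"
  shows "place v y \<le> place v x"
proof (cases "y = 0")
  case True then show ?thesis using place_pos[OF v x] by (simp add: place_0)
next
  case False
  have "place v x = real (residue_field_size K v) powi (- v x)" unfolding place_def using x by simp
  then show ?thesis using place_le_iff[OF v y False] ge by simp
qed

lemma place_ultrametric:
  assumes v: "v \<in> DV" and x: "x \<in> K" and y: "y \<in> K"
  shows "place v (x + y) \<le> max (place v x) (place v y)"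
proof (cases "x = 0 \<or> y = 0")
  case True then show ?thesis using place_0 by auto
next
  case False
  show ?thesis
  proof (cases "v x \<le> v y")
    case True
    have "vge v (v x) (x + y)" by (rule vge_add[OF v x y]) (use True in \<open>auto simp: vge_def\<close>)
    then have "place v (x + y) \<le> place v x" using place_mono[OF v x _ K_add[OF x y]] False by simp
    then show ?thesis by simp
  next
    case False': False
    have "vge v (v y) (x + y)" by (rule vge_add[OF v x y]) (use False' in \<open>auto simp: vge_def\<close>)
    then have "place v (x + y) \<le> place v y" using place_mono[OF v y _ K_add[OF x y]] False by simp
    then show ?thesis by simp
  qed
qed

lemma place_mult: "v \<in> DV \<Longrightarrow> x \<in> K \<Longrightarrow> y \<in> K \<Longrightarrow> place v (x * y) = place v x * place v y"
proof -
  assume v: "v \<in> DV" and x: "x \<in> K" and y: "y \<in> K"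
  show ?thesis
  proof (cases "x = 0 \<or> y = 0")
    case True then show ?thesis by (auto simp: place_0)
  next
    case False
    then have "x \<noteq> 0" "y \<noteq> 0" by simp_all
    have e: "- v (x * y) = - v x + - v y" using v_mult[OF v x y \<open>x \<noteq> 0\<close> \<open>y \<noteq> 0\<close>] by simp
    have q: "real (residue_field_size K v) \<noteq> 0" using place_residue_size[OF v] by linarith
    have "real (residue_field_size K v) powi (- v (x * y)) =
        real (residue_field_size K v) powi (- v x) * real (residue_field_size K v) powi (- v y)"
      unfolding e by (rule power_int_add) (use q in simp)
    then show ?thesis unfolding place_def using x y K_mult[OF x y] \<open>x \<noteq> 0\<close> \<open>y \<noteq> 0\<close> by simp
  qed
qed

lemma place_minus: "v \<in> DV \<Longrightarrow> x \<in> K \<Longrightarrow> place v (- x) = place v x"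
  unfolding place_def using v_minus[of v x] K_uminus[of x] by simp

text \<open>The residue field is finite, so two powers of \<xi> agree in it, and \<xi> is a unit at
  v, so the smaller power can be cancelled.\<close>

lemma residue_order_exists:
  assumes v: "v \<in> DV" and xi: "\<xi> \<noteq> 0" "v \<xi> = 0"
  obtains m where "m \<ge> 1" "vge v 1 (\<xi> ^ m - 1)"
proof -
  define R E where "R = valuation_ring K v"
    and "E = {(x, y). x \<in> valuation_ring K v \<and> y \<in> valuation_ring K v \<and> x - y \<in> valuation_ideal K v}"
  have xR: "\<xi> ^ i \<in> R" for i unfolding R_def valuation_ring_def using v_power[OF v K_gen xi(1)] xi K_power[OF K_gen] by simp
  \<comment> \<open>An infinite set has cardinality 0, so the lower bound gives finiteness.\<close>
  have "card (R // E) \<ge> 2" using place_residue_size[OF v] unfolding residue_field_size_def R_def E_def by simp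
  then have fin: "finite (R // E)" using card.infinite by fastforce
  have "\<not> inj_on (\<lambda>i. E `` {\<xi> ^ i}) (UNIV :: nat set)"
  proof
    assume "inj_on (\<lambda>i. E `` {\<xi> ^ i}) (UNIV :: nat set)"
    moreover have "finite (range (\<lambda>i. E `` {\<xi> ^ i}))"
      by (rule finite_subset[OF _ fin]) (use xR in \<open>auto intro: quotientI\<close>)
    ultimately show False using finite_imageD infinite_UNIV_nat by blast
  qed
  then obtain i j where ij: "i < j" "E `` {\<xi> ^ i} = E `` {\<xi> ^ j}"
    unfolding inj_on_def by (metis linorder_neqE_nat)
  have "(\<xi> ^ j, \<xi> ^ j) \<in> E" using xR[of j] K_0 unfolding E_def R_def valuation_ideal_def by simp
  then have "(\<xi> ^ i, \<xi> ^ j) \<in> E" using ij(2) by blast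
  then have "vge v 1 (\<xi> ^ i - \<xi> ^ j)" unfolding E_def valuation_ideal_def vge_def by auto
  then have 1: "vge v 1 (- (\<xi> ^ i - \<xi> ^ j))" using vge_minus[OF v K_diff[OF K_power[OF K_gen] K_power[OF K_gen]]] by blast
  have e: "\<xi> ^ (j - i) - 1 = inverse (\<xi> ^ i) * (- (\<xi> ^ i - \<xi> ^ j))"
  proof -
    have "\<xi> ^ j = \<xi> ^ i * \<xi> ^ (j - i)" using ij(1) by (simp flip: power_add)
    then show ?thesis using xi(1) by (simp add: right_diff_distrib)
  qed
  have "vge v 0 (inverse (\<xi> ^ i))"
    using v_inverse[OF v K_power[OF K_gen], of i] v_power[OF v K_gen xi(1), of i] xi unfolding vge_def by simp
  then have "vge v (0 + 1) (inverse (\<xi> ^ i) * (- (\<xi> ^ i - \<xi> ^ j)))"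
    using 1 by (intro vge_mult[OF v]) (auto intro!: K_inverse K_power K_gen K_uminus K_diff simp del: minus_diff_eq)
  then have "vge v 1 (\<xi> ^ (j - i) - 1)" unfolding e by simp
  then show ?thesis using that[of "j - i"] ij(1) by simp
qed

lemma ultrametric_seq_place:
  assumes v: "v \<in> DV" and xi: "\<xi> \<noteq> 0" "v \<xi> = 0" and nru: "\<And>n. n \<ge> 1 \<Longrightarrow> \<xi> ^ n \<noteq> 1"
  obtains p m where "ultrametric_seq p (\<lambda>n. place v (\<xi> ^ n - 1)) m"
proof -
  define a where "a n = place v (\<xi> ^ n - 1)" for n
  obtain p where p: "prime p" "v \<in> DVp p" using residue_prime_exists[OF v] by blast
  have vp: "v (of_nat p) > 0" using p(2) unfolding DVp_def by simp
  have q2: "real (residue_field_size K v) \<ge> 2" by (rule place_residue_size[OF v])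
  have xK: "\<xi> ^ n \<in> K" "\<xi> ^ n - 1 \<in> K" for n by (rule K_power[OF K_gen], rule K_diff[OF K_power[OF K_gen] K_1])
  have xv: "v (\<xi> ^ n) = 0" "vge v 0 (\<xi> ^ n)" "place v (\<xi> ^ n) = 1" for n
  proof -
    show 1: "v (\<xi> ^ n) = 0" using v_power[OF v K_gen xi(1)] xi(2) by simp
    then show "vge v 0 (\<xi> ^ n)" unfolding vge_def by simp
    show "place v (\<xi> ^ n) = 1" using place_eq_1_iff[OF v xK(1)] 1 xi(1) by simp
  qed
  have nz: "\<xi> ^ n - 1 \<noteq> 0" if "n \<ge> 1" for n using nru[OF that] by simp
  have lt1: "a n < 1 \<longleftrightarrow> vge v 1 (\<xi> ^ n - 1)" for n
  proof (cases "\<xi> ^ n - 1 = 0")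
    case True then show ?thesis unfolding a_def by (simp add: place_0 vge_def)
  next
    case False
    have "a n \<le> 1" unfolding a_def using place_le_1_iff[OF v xK(2)] vge_diff[OF v xK(1) K_1 xv(2) vge_1[OF v]] by blast
    moreover have "a n = 1 \<longleftrightarrow> v (\<xi> ^ n - 1) = 0" unfolding a_def by (rule place_eq_1_iff[OF v xK(2) False])
    moreover have "vge v 0 (\<xi> ^ n - 1)" by (rule vge_diff[OF v xK(1) K_1 xv(2) vge_1[OF v]])
    ultimately show ?thesis using False unfolding vge_def by auto
  qed
  have le1: "a n \<le> 1" for n
    unfolding a_def using place_le_1_iff[OF v xK(2)] vge_diff[OF v xK(1) K_1 xv(2) vge_1[OF v]] by blast
  have um1: "a (n + k) \<le> max (a n) (a k)" for n k
  proof -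
    have "\<xi> ^ (n + k) - 1 = \<xi> ^ k * (\<xi> ^ n - 1) + (\<xi> ^ k - 1)" by (simp add: power_add algebra_simps)
    then have "a (n + k) \<le> max (place v (\<xi> ^ k * (\<xi> ^ n - 1))) (a k)"
      unfolding a_def using place_ultrametric[OF v K_mult[OF xK(1)[of k] xK(2)[of n]] xK(2)[of k]] by (simp only:)
    then show ?thesis unfolding a_def using place_mult[OF v xK(1)[of k] xK(2)[of n]] xv(3)[of k] by simp
  qed
  have um2: "a n \<le> max (a (n + k)) (a k)" for n k
  proof -
    have "\<xi> ^ k * (\<xi> ^ n - 1) = (\<xi> ^ (n + k) - 1) + - (\<xi> ^ k - 1)" by (simp add: power_add algebra_simps)
    then have "place v (\<xi> ^ k * (\<xi> ^ n - 1)) \<le> max (a (n + k)) (place v (- (\<xi> ^ k - 1)))"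
      unfolding a_def using place_ultrametric[OF v xK(2)[of "n + k"] K_uminus[OF xK(2)[of k]]] by (simp only:)
    then show ?thesis unfolding a_def
      using place_mult[OF v xK(1)[of k] xK(2)[of n]] xv(3)[of k] place_minus[OF v xK(2)[of k]] by simp
  qed
  \<comment> \<open>By \<open>geometric_sum_val\<close> the second factor is congruent to k if \<xi>
    ^ n is congruent to 1.\<close>
  have geo: "\<xi> ^ (k * n) - 1 = (\<xi> ^ n - 1) * (\<Sum>i<k. (\<xi> ^ n) ^ i)" for k n
    by (subst power_diff_1_eq[symmetric]) (simp add: power_mult[symmetric] mult.commute)
  have sK: "(\<Sum>i<k. (\<xi> ^ n) ^ i) \<in> K" for k n by (intro K_sum K_power K_gen)
  have contract: "a (p * n) \<le> a n / 2" if "a n < 1" for n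
  proof -
    have g: "vge v 1 ((\<Sum>i<p. (\<xi> ^ n) ^ i) - of_nat p)"
      using geometric_sum_val[OF v xK(1)] lt1 that by blast
    have "vge v 1 (of_nat p)" using vp unfolding vge_def by simp
    then have "vge v 1 (((\<Sum>i<p. (\<xi> ^ n) ^ i) - of_nat p) + of_nat p)"
      by (rule vge_add[OF v K_diff[OF sK K_nat] K_nat g])
    then have s1: "vge v 1 (\<Sum>i<p. (\<xi> ^ n) ^ i)" by simp
    \<comment> \<open>The constant 1 / 2 reflects that a residue field has at least two
      elements.\<close>
    have "place v (\<Sum>i<p. (\<xi> ^ n) ^ i) \<le> 1 / 2"
    proof (cases "(\<Sum>i<p. (\<xi> ^ n) ^ i) = 0")
      case True then show ?thesis by (simp add: place_0)
    next
      case False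
      have "place v (\<Sum>i<p. (\<xi> ^ n) ^ i) \<le> real (residue_field_size K v) powi (- 1)"
        using place_le_iff[OF v sK False] s1 by blast
      also have "\<dots> = 1 / real (residue_field_size K v)" by (simp add: power_int_minus divide_inverse)
      also have "\<dots> \<le> 1 / 2" using q2 by (intro divide_left_mono) auto
      finally show ?thesis .
    qed
    then have "place v (\<xi> ^ n - 1) * place v (\<Sum>i<p. (\<xi> ^ n) ^ i) \<le> place v (\<xi> ^ n - 1) * (1 / 2)"
      using place_pos[OF v xK(2)] place_0 by (intro mult_left_mono) (metis less_imp_le order_refl)+
    then show ?thesis unfolding a_def geo place_mult[OF v xK(2) sK] by simp
  qed
  have prime_to: "a (k * n) = a n" if "a n < 1" "\<not> p dvd k" for n k
  proof -
    have g: "vge v 1 ((\<Sum>i<k. (\<xi> ^ n) ^ i) - of_nat k)"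
      using geometric_sum_val[OF v xK(1)] lt1 that by blast
    have k0: "(of_nat k :: 'k) \<noteq> 0" "v (of_nat k) = 0"
    proof -
      have "k \<noteq> 0" using that(2) by (metis dvd_0_right)
      then show "(of_nat k :: 'k) \<noteq> 0" by simp
      show "v (of_nat k) = 0" by (rule residue_char_unique[OF v p(1) vp that(2)])
    qed
    have "vge v (v (of_nat k) + 1) ((\<Sum>i<k. (\<xi> ^ n) ^ i) - of_nat k)" using g k0 by simp
    from v_add_eq[OF v K_nat K_diff[OF sK K_nat] k0(1) this]
    have "(\<Sum>i<k. (\<xi> ^ n) ^ i) \<noteq> 0" "v (\<Sum>i<k. (\<xi> ^ n) ^ i) = 0" using k0 by simp_all
    then have "place v (\<Sum>i<k. (\<xi> ^ n) ^ i) = 1" using place_eq_1_iff[OF v sK] by blast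
    then show ?thesis unfolding a_def geo place_mult[OF v xK(2) sK] by simp
  qed
  obtain m0 where m0: "m0 \<ge> 1" "a m0 < 1" using residue_order_exists[OF v xi] lt1 by blast
  define m where "m = (LEAST m. m \<ge> 1 \<and> a m < 1)"
  have m: "m \<ge> 1" "a m < 1" unfolding m_def using LeastI[of "\<lambda>m. m \<ge> 1 \<and> a m < 1" m0] m0 by auto
  have least: "m \<le> n" if "n \<ge> 1" "a n < 1" for n unfolding m_def using that by (intro Least_le) simp
  have a0: "a 0 = 0" unfolding a_def by (simp add: place_0)
  have mult: "a (k * m) < 1" for k
  proof (induction k)
    case (Suc k)
    have "a (m + k * m) \<le> max (a m) (a (k * m))" by (rule um1)
    then show ?case using Suc m by simp
  qed (simp add: a0)
  have dvd: "a n < 1 \<longleftrightarrow> m dvd n" for n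
  proof
    assume "m dvd n" then show "a n < 1" using mult by (auto elim!: dvdE simp: mult.commute)
  next
    assume n: "a n < 1"
    have "a (n mod m) \<le> max (a (n mod m + (n div m) * m)) (a ((n div m) * m))" by (rule um2)
    then have "a (n mod m) < 1" using n mult[of "n div m"] by simp
    then have "\<not> n mod m \<ge> 1" using least[of "n mod m"] mod_less_divisor[of m n] m(1) by linarith
    then show "m dvd n" by (simp add: dvd_eq_mod_eq_0)
  qed
  have "ultrametric_seq p a m"
  proof
    show "0 < a n" if "n \<ge> 1" for n unfolding a_def by (rule place_pos[OF v xK(2) nz[OF that]])
  qed (fact p(1) m(1) a0 le1 um1 um2 dvd contract prime_to)+
  then show ?thesis using that unfolding a_def by blast
qed

text \<open>The larger of \<xi> ^ n and -1 decides: the value is 1 if \<xi> is integral at v, and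
  the n-th power of the value of \<xi> if v is a pole.\<close>

lemma place_power_minus_1:
  assumes v: "v \<in> DV" and ne: "place v \<xi> \<noteq> 1"
  obtains c where "c \<ge> 1" "\<And>n. n \<ge> 1 \<Longrightarrow> place v (\<xi> ^ n - 1) = c ^ n"
proof -
  have m1: "place v (- 1) = 1" using place_eq_1_iff[OF v K_uminus[OF K_1]] v_minus_1[OF v] by simp
  have q2: "real (residue_field_size K v) \<ge> 2" by (rule place_residue_size[OF v])
  show ?thesis
  proof (cases "\<xi> = 0")
    case True
    have "place v (\<xi> ^ n - 1) = 1 ^ n" if "n \<ge> 1" for n
      using m1 True that by (simp add: power_0_left)
    then show ?thesis using that[of 1] by blast
  next
    case False
    then have nz: "v \<xi> \<noteq> 0" using ne place_eq_1_iff[OF v K_gen] by blast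
    have vn: "v (\<xi> ^ n) = int n * v \<xi>" for n by (rule v_power[OF v K_gen False])
    have xK: "\<xi> ^ n \<in> K" for n by (rule K_power[OF K_gen])
    consider "v \<xi> > 0" | "v \<xi> < 0" using nz by linarith
    then show ?thesis
    proof cases
      case 1
      have "place v (\<xi> ^ n - 1) = 1 ^ n" if n: "n \<ge> 1" for n
      proof -
        have "int n * v \<xi> \<ge> 1 * 1" using n 1 by (intro mult_mono) auto
        then have "vge v (v (- 1) + 1) (\<xi> ^ n)" unfolding vge_def using vn v_minus_1[OF v] by simp
        from v_add_eq[OF v K_uminus[OF K_1] xK _ this]
        have "\<xi> ^ n - 1 \<noteq> 0" "v (\<xi> ^ n - 1) = 0" using v_minus_1[OF v] by simp_all
        then show ?thesis using place_eq_1_iff[OF v K_diff[OF xK K_1]] by simp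
      qed
      then show ?thesis using that[of 1] by blast
    next
      case 2
      define c where "c = real (residue_field_size K v) powi (- v \<xi>)"
      have "c \<ge> 1" unfolding c_def using q2 2 by (intro one_le_power_int) auto
      moreover have "place v (\<xi> ^ n - 1) = c ^ n" if n: "n \<ge> 1" for n
      proof -
        have "int n * v \<xi> \<le> 1 * v \<xi>" using n 2 by (intro mult_right_mono_neg) auto
        then have "v (\<xi> ^ n) + 1 \<le> 0" unfolding vn using 2 by linarith
        then have "vge v (v (\<xi> ^ n) + 1) (- 1)" unfolding vge_def using v_minus_1[OF v] by simp
        from v_add_eq[OF v xK K_uminus[OF K_1] _ this]
        have *: "\<xi> ^ n - 1 \<noteq> 0" "v (\<xi> ^ n - 1) = int n * v \<xi>" using vn False by simp_all
        then have "place v (\<xi> ^ n - 1) = real (residue_field_size K v) powi (- (int n * v \<xi>))"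
          unfolding place_def using K_diff[OF xK K_1] by simp
        also have "- (int n * v \<xi>) = (- v \<xi>) * int n" by simp
        also have "real (residue_field_size K v) powi ((- v \<xi>) * int n) = c ^ n"
          unfolding c_def by (simp only: power_int_mult power_int_of_nat)
        finally show ?thesis .
      qed
      ultimately show ?thesis by (rule that)
    qed
  qed
qed

section \<open>Separating finite and archimedean factors\<close>

lemma places_abs_split:
  assumes x: "x \<in> K" "x \<noteq> 0" and T: "T \<subseteq> finite_places K" and S: "S = finite_places K - T" "finite S"
  shows "inverse (places_abs T x) = cmod (\<Prod>\<rho>\<in>Z. \<sigma> \<rho> x) * (\<Prod>P\<in>S. P x)"
proof -
  define A where "A = {P \<in> finite_places K. P x \<noteq> 1}"
  have inj: "inj_on place DV" using place_inject by (intro inj_onI) blast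
  have A: "A = place ` {v\<in>DV. v x \<noteq> 0}"
    unfolding A_def finite_places_eq using place_eq_1_iff[OF _ x] by blast
  have fA: "finite A" unfolding A using finite_nonunit_places[OF x] by simp
  have "(\<Prod>P\<in>A. P x) = (\<Prod>v\<in>{v\<in>DV. v x \<noteq> 0}. place v x)"
    unfolding A by (subst prod.reindex) (auto intro: inj_on_subset[OF inj])
  then have pf: "(\<Prod>P\<in>A. P x) * cmod (\<Prod>\<rho>\<in>Z. \<sigma> \<rho> x) = 1" using product_formula[OF x] by simp
  have "(\<Prod>P\<in>A. P x) = (\<Prod>P\<in>A \<inter> T. P x) * (\<Prod>P\<in>A \<inter> S. P x)"
  proof -
    have "A = (A \<inter> T) \<union> (A \<inter> S)" unfolding A_def S(1) by blast
    moreover have "(A \<inter> T) \<inter> (A \<inter> S) = {}" unfolding S(1) by blast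
    ultimately show ?thesis using prod.union_disjoint[of "A \<inter> T" "A \<inter> S" "\<lambda>P. P x"] fA by simp
  qed
  moreover have "A \<inter> T = {P \<in> T. P x \<noteq> 1}" unfolding A_def using T by blast
  moreover have "(\<Prod>P\<in>A \<inter> S. P x) = (\<Prod>P\<in>S. P x)"
    by (rule prod.mono_neutral_left[OF S(2)]) (auto simp: A_def S(1))
  ultimately have "places_abs T x * ((\<Prod>P\<in>S. P x) * cmod (\<Prod>\<rho>\<in>Z. \<sigma> \<rho> x)) = 1"
    using pf unfolding places_abs_def by (simp add: mult.assoc)
  then have "inverse (places_abs T x) = (\<Prod>P\<in>S. P x) * cmod (\<Prod>\<rho>\<in>Z. \<sigma> \<rho> x)" by (rule inverse_unique)
  then show ?thesis by (simp add: mult.commute)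
qed

text \<open>The embedding \<sigma> \<rho> yields an infinite place whose value at \<xi> is the
  modulus of \<rho> or its square.\<close>

lemma root_not_unit_modulus:
  assumes inf: "\<And>P. P \<in> infinite_places K \<Longrightarrow> P \<xi> \<noteq> 1" and \<rho>: "\<rho> \<in> Z"
  shows "cmod \<rho> \<noteq> 1"
proof
  assume 1: "cmod \<rho> = 1"
  have emb: "\<sigma> \<rho> \<in> complex_embeddings K"
    unfolding complex_embeddings_def using sigma_simps[OF \<rho>] by simp
  define P where "P x = (if x \<notin> K then 0 else if \<sigma> \<rho> ` K \<subseteq> \<real> then cmod (\<sigma> \<rho> x) else (cmod (\<sigma> \<rho> x))\<^sup>2)" for x
  have "P \<in> infinite_places K" unfolding infinite_places_def P_def using emb by blast
  moreover have "P \<xi> = 1" unfolding P_def using K_gen sigma_simps(7)[OF \<rho>] 1 by simp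
  ultimately show False using inf by blast
qed

text \<open>For a conjugate \<rho> outside the unit disc, \<rho> ^ n is factored out of \<rho> ^ n -
  1, so that only powers of numbers inside the disc remain.\<close>

definition tau :: "complex \<Rightarrow> complex" where "tau \<rho> = (if cmod \<rho> < 1 then \<rho> else inverse \<rho>)"

text \<open>The product of the numbers \<open>1 - s \<tau>\<^sup>n\<close> is real and does not vanish for \<open>0 \<le> s \<le> 1\<close>, hence it is
  positive for \<open>s = 1\<close>.\<close>

lemma conjugate_product_positive:
  assumes nu: "\<And>\<rho>. \<rho> \<in> Z \<Longrightarrow> cmod \<rho> \<noteq> 1" and n: "n \<ge> 1"
  shows "(\<Prod>\<rho>\<in>Z. 1 - tau \<rho> ^ n) = complex_of_real (\<Prod>\<rho>\<in>Z. cmod (1 - tau \<rho> ^ n))"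
proof -
  have t1: "cmod (tau \<rho>) < 1" if "\<rho> \<in> Z" for \<rho>
    using nu[OF that] unfolding tau_def by (auto simp: norm_inverse inverse_less_1_iff)
  have cnj_ev: "cnj (ev \<rho> g) = ev (cnj \<rho>) g" for \<rho> g
  proof -
    have "cnj (of_rat q) = of_rat q" for q by (cases q) (simp add: of_rat_rat)
    then show ?thesis unfolding ev_altdef[OF lessI[of "Polynomial.degree g"]]
      by (simp only: cnj_sum complex_cnj_mult complex_cnj_power)
  qed
  have cZ: "cnj \<rho> \<in> Z" if "\<rho> \<in> Z" for \<rho> using that cnj_ev[of \<rho> f] unfolding Z_def by simp
  have bij: "bij_betw cnj Z Z"
    by (rule bij_betw_byWitness[where f' = cnj]) (use cZ in auto)
  have ct: "tau (cnj \<rho>) = cnj (tau \<rho>)" for \<rho> unfolding tau_def by simp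
  define h where "h s = (\<Prod>\<rho>\<in>Z. 1 - complex_of_real s * tau \<rho> ^ n)" for s
  have real: "Im (h s) = 0" for s
  proof -
    have "cnj (h s) = (\<Prod>\<rho>\<in>Z. 1 - complex_of_real s * tau (cnj \<rho>) ^ n)" unfolding h_def ct by simp
    also have "\<dots> = h s" unfolding h_def by (rule prod.reindex_bij_betw[OF bij])
    finally show ?thesis by (simp add: complex_eq_iff)
  qed
  have nz: "h s \<noteq> 0" if "0 \<le> s" "s \<le> 1" for s
  proof -
    have "1 - complex_of_real s * tau \<rho> ^ n \<noteq> 0" if "\<rho> \<in> Z" for \<rho>
    proof
      assume "1 - complex_of_real s * tau \<rho> ^ n = 0"
      then have "cmod (complex_of_real s * tau \<rho> ^ n) = 1" by simp
      moreover have "cmod (tau \<rho>) ^ n < 1" using t1[OF \<open>\<rho> \<in> Z\<close>] n by (simp add: power_less_one_iff)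
      moreover have "s * cmod (tau \<rho>) ^ n \<le> 1 * cmod (tau \<rho>) ^ n" using \<open>0 \<le> s\<close> \<open>s \<le> 1\<close> by (intro mult_right_mono) auto
      ultimately show False using \<open>0 \<le> s\<close> by (simp add: norm_mult norm_power)
    qed
    then show ?thesis unfolding h_def using finite_Z by simp
  qed
  have "Re (h 1) > 0"
  proof (rule ccontr)
    assume "\<not> Re (h 1) > 0"
    moreover have "continuous_on {0..1} (\<lambda>s. Re (h s))" unfolding h_def by (intro continuous_intros)
    moreover have "Re (h 0) = 1" unfolding h_def by simp
    ultimately obtain s where "0 \<le> s" "s \<le> 1" "Re (h s) = 0"
      using IVT2'[of "\<lambda>s. Re (h s)" 1 0 0] by auto
    then show False using nz[of s] real[of s] by (simp add: complex_eq_iff)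
  qed
  then have "h 1 = complex_of_real (cmod (h 1))" using real[of 1] by (simp add: complex_eq_iff cmod_def)
  then show ?thesis unfolding h_def by (simp add: prod_norm)
qed

text \<open>Freed from absolute values, the archimedean part expands into a finite combination of
  powers w ^ n; this is what makes the zeta function rational when no other factor
  contributes.\<close>

lemma norm_power_minus_1:
  assumes nu: "\<And>\<rho>. \<rho> \<in> Z \<Longrightarrow> cmod \<rho> \<noteq> 1"
  obtains R where "R > 0" "\<And>n. n \<ge> 1 \<Longrightarrow>
    complex_of_real (cmod (\<Prod>\<rho>\<in>Z. \<sigma> \<rho> (\<xi> ^ n - 1))) = complex_of_real R ^ n * (\<Prod>\<rho>\<in>Z. 1 - tau \<rho> ^ n)"
proof -
  define r where "r \<rho> = (if cmod \<rho> < 1 then 1 else cmod \<rho>)" for \<rho> :: complex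
  define R where "R = (\<Prod>\<rho>\<in>Z. r \<rho>)"
  have "R > 0" unfolding R_def r_def by (intro prod_pos) (auto simp: not_less intro: less_le_trans[OF zero_less_one])
  moreover have "complex_of_real (cmod (\<Prod>\<rho>\<in>Z. \<sigma> \<rho> (\<xi> ^ n - 1))) = complex_of_real R ^ n * (\<Prod>\<rho>\<in>Z. 1 - tau \<rho> ^ n)"
    if n: "n \<ge> 1" for n
  proof -
    have "cmod (\<sigma> \<rho> (\<xi> ^ n - 1)) = r \<rho> ^ n * cmod (1 - tau \<rho> ^ n)" if \<rho>: "\<rho> \<in> Z" for \<rho>
    proof -
      have s: "\<sigma> \<rho> (\<xi> ^ n - 1) = \<rho> ^ n - 1" using sigma_simps[OF \<rho>] K_gen K_power K_1 by simp
      show ?thesis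
      proof (cases "cmod \<rho> < 1")
        case True then show ?thesis unfolding s r_def tau_def by (simp add: norm_minus_commute)
      next
        case False
        then have "\<rho> \<noteq> 0" by auto
        then have "\<rho> ^ n - 1 = \<rho> ^ n * (1 - inverse \<rho> ^ n)" by (simp add: field_simps)
        then show ?thesis unfolding s r_def tau_def using False by (simp add: norm_mult norm_power)
      qed
    qed
    then have "cmod (\<Prod>\<rho>\<in>Z. \<sigma> \<rho> (\<xi> ^ n - 1)) = R ^ n * (\<Prod>\<rho>\<in>Z. cmod (1 - tau \<rho> ^ n))"
      unfolding R_def prod_norm[symmetric] by (simp add: prod.distrib prod_power_distrib)
    then show ?thesis using conjugate_product_positive[OF nu n] by simp
  qed
  ultimately show ?thesis by (rule that)
qed

lemma tau_less_1: "\<rho> \<in> Z \<Longrightarrow> cmod \<rho> \<noteq> 1 \<Longrightarrow> cmod (tau \<rho>) < 1"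
  unfolding tau_def by (auto simp: norm_inverse inverse_less_1_iff)

end

text \<open>The places P in \<open>S\<close> with P \<xi> \<noteq> 1 contribute pure powers, which R
  absorbs together with the moduli of the conjugates outside the unit disc.\<close>

theorem factor_sequence:
  fixes \<xi> :: "'k::field_char_0"
  assumes alg: "algebraic \<xi>" and nru: "\<And>n. n \<ge> 1 \<Longrightarrow> \<xi> ^ n \<noteq> 1"
    and T: "T \<subseteq> finite_places (rat_adjoin \<xi>)" and S: "S = finite_places (rat_adjoin \<xi>) - T" "finite S"
    and inf: "\<And>P. P \<in> infinite_places (rat_adjoin \<xi>) \<Longrightarrow> P \<xi> \<noteq> 1"
  shows "\<exists>R Z \<tau>. R > 0 \<and> finite (Z :: complex set) \<and> (\<forall>\<rho>\<in>Z. cmod (\<tau> \<rho>) < 1) \<and>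
      (\<forall>n\<ge>1. complex_of_real (inverse (places_abs T (\<xi> ^ n - 1))) =
        complex_of_real R ^ n * (\<Prod>\<rho>\<in>Z. 1 - \<tau> \<rho> ^ n) * complex_of_real (\<Prod>P\<in>{P\<in>S. P \<xi> = 1}. P (\<xi> ^ n - 1)))"
    and "\<And>P. P \<in> S \<Longrightarrow> P \<xi> = 1 \<Longrightarrow> \<exists>p m. ultrametric_seq p (\<lambda>n. P (\<xi> ^ n - 1)) m"
proof -
  obtain f where f: "number_field \<xi> f" using number_field_exists[OF alg] .
  interpret number_field \<xi> f by (rule f)
  note KK = K_eq_rat_adjoin[symmetric]
  have nu: "cmod \<rho> \<noteq> 1" if "\<rho> \<in> Z" for \<rho> by (rule root_not_unit_modulus[OF _ that]) (use inf KK in simp)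
  obtain R where R: "R > 0" "\<And>n. n \<ge> 1 \<Longrightarrow>
    complex_of_real (cmod (\<Prod>\<rho>\<in>Z. \<sigma> \<rho> (\<xi> ^ n - 1))) = complex_of_real R ^ n * (\<Prod>\<rho>\<in>Z. 1 - tau \<rho> ^ n)"
    by (rule norm_power_minus_1[OF nu]) (assumption, rule that)
  have "\<exists>c. c \<ge> 1 \<and> (\<forall>n\<ge>1. P (\<xi> ^ n - 1) = c ^ n)" if "P \<in> {P\<in>S. P \<xi> \<noteq> 1}" for P
  proof -
    have "P \<in> finite_places K" "P \<xi> \<noteq> 1" using that S(1) KK by auto
    then obtain v where v: "v \<in> DV" "P = place v" by (elim place_finite)
    have "place v \<xi> \<noteq> 1" using v(2) \<open>P \<xi> \<noteq> 1\<close> by (simp only:) simp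
    obtain c where c: "c \<ge> 1" "\<And>n. n \<ge> 1 \<Longrightarrow> place v (\<xi> ^ n - 1) = c ^ n"
      by (rule place_power_minus_1[OF v(1) \<open>place v \<xi> \<noteq> 1\<close>]) (rule that)
    show ?thesis unfolding v(2)
    proof (intro exI[of _ c] conjI allI impI)
      show "c \<ge> 1" by (rule c(1))
      show "place v (\<xi> ^ n - 1) = c ^ n" if "n \<ge> 1" for n by (rule c(2)[OF that])
    qed
  qed
  then have "\<forall>P\<in>{P\<in>S. P \<xi> \<noteq> 1}. \<exists>c. c \<ge> 1 \<and> (\<forall>n\<ge>1. P (\<xi> ^ n - 1) = c ^ n)" by blast
  from bchoice[OF this] obtain c where c':
    "\<forall>P\<in>{P\<in>S. P \<xi> \<noteq> 1}. c P \<ge> 1 \<and> (\<forall>n\<ge>1. P (\<xi> ^ n - 1) = c P ^ n)" by (elim exE)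
  have c: "c P \<ge> 1" "n \<ge> 1 \<Longrightarrow> P (\<xi> ^ n - 1) = c P ^ n" if "P \<in> {P\<in>S. P \<xi> \<noteq> 1}" for P n
    using bspec[OF c' that] by simp_all
  define C where "C = (\<Prod>P\<in>{P\<in>S. P \<xi> \<noteq> 1}. c P)"
  have "C > 0" unfolding C_def
  proof (rule prod_pos)
    fix P assume P: "P \<in> {P\<in>S. P \<xi> \<noteq> 1}"
    show "c P > 0" using c(1)[OF P] by linarith
  qed
  have main: "complex_of_real (inverse (places_abs T (\<xi> ^ n - 1))) =
        complex_of_real (R * C) ^ n * (\<Prod>\<rho>\<in>Z. 1 - tau \<rho> ^ n) * complex_of_real (\<Prod>P\<in>{P\<in>S. P \<xi> = 1}. P (\<xi> ^ n - 1))"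
    if n: "n \<ge> 1" for n
  proof -
    have x: "\<xi> ^ n - 1 \<in> K" "\<xi> ^ n - 1 \<noteq> 0" using nru[OF n] K_diff[OF K_power[OF K_gen] K_1] by auto
    have "(\<Prod>P\<in>S. P (\<xi> ^ n - 1)) = (\<Prod>P\<in>{P\<in>S. P \<xi> \<noteq> 1}. P (\<xi> ^ n - 1)) * (\<Prod>P\<in>{P\<in>S. P \<xi> = 1}. P (\<xi> ^ n - 1))"
    proof -
      have "S = {P\<in>S. P \<xi> \<noteq> 1} \<union> {P\<in>S. P \<xi> = 1}" by blast
      moreover have "{P\<in>S. P \<xi> \<noteq> 1} \<inter> {P\<in>S. P \<xi> = 1} = {}" by blast
      ultimately show ?thesis using prod.union_disjoint[of "{P\<in>S. P \<xi> \<noteq> 1}" "{P\<in>S. P \<xi> = 1}" "\<lambda>P. P (\<xi> ^ n - 1)"] S(2) by simp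
    qed
    also have "(\<Prod>P\<in>{P\<in>S. P \<xi> \<noteq> 1}. P (\<xi> ^ n - 1)) = C ^ n"
      unfolding C_def prod_power_distrib by (intro prod.cong) (use c(2) n in auto)
    finally have "inverse (places_abs T (\<xi> ^ n - 1)) =
        cmod (\<Prod>\<rho>\<in>Z. \<sigma> \<rho> (\<xi> ^ n - 1)) * (C ^ n * (\<Prod>P\<in>{P\<in>S. P \<xi> = 1}. P (\<xi> ^ n - 1)))"
      using places_abs_split[OF x, of T S] T S KK by simp
    then show ?thesis using R(2)[OF n] by (simp add: power_mult_distrib mult_ac)
  qed
  show "\<exists>R Z \<tau>. R > 0 \<and> finite (Z :: complex set) \<and> (\<forall>\<rho>\<in>Z. cmod (\<tau> \<rho>) < 1) \<and>
      (\<forall>n\<ge>1. complex_of_real (inverse (places_abs T (\<xi> ^ n - 1))) =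
        complex_of_real R ^ n * (\<Prod>\<rho>\<in>Z. 1 - \<tau> \<rho> ^ n) * complex_of_real (\<Prod>P\<in>{P\<in>S. P \<xi> = 1}. P (\<xi> ^ n - 1)))"
  proof (intro exI[of _ "R * C"] exI[of _ Z] exI[of _ tau] conjI ballI allI impI)
    show "R * C > 0" using R(1) \<open>C > 0\<close> by simp
    show "finite Z" by (rule finite_Z)
    show "cmod (tau \<rho>) < 1" if "\<rho> \<in> Z" for \<rho> by (rule tau_less_1[OF that nu[OF that]])
  qed (rule main)
  show "\<exists>p m. ultrametric_seq p (\<lambda>n. P (\<xi> ^ n - 1)) m" if P: "P \<in> S" "P \<xi> = 1" for P
  proof -
    have "P \<in> finite_places K" using P S(1) KK by auto
    then obtain v where v: "v \<in> DV" "P = place v" by (elim place_finite)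
    have xi: "\<xi> \<noteq> 0" using P(2) v(2) place_0 by auto
    then have "v \<xi> = 0" using place_eq_1_iff[OF v(1) K_gen xi] P(2) v(2) by simp
    then show ?thesis using ultrametric_seq_place[OF v(1) xi _ nru] unfolding v(2) by blast
  qed
qed

section \<open>Abel means\<close>

text \<open>An average with the weights (1 - t) t ^ n of total weight 1, studied for t tending to 1
  from below. For u n = a n z ^ n it is 1 - t times the power series at t z, hence it tends to 0 if
  the series has a finite limit along the ray to z.\<close>

definition abel_mean :: "(nat \<Rightarrow> 'b::banach) \<Rightarrow> real \<Rightarrow> 'b" where
  "abel_mean u t = (1 - t) *\<^sub>R (suminf (\<lambda>n. t ^ n *\<^sub>R u n))"

lemma abel_summable:
  fixes u :: "nat \<Rightarrow> 'b::banach"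
  assumes "\<And>n. norm (u n) \<le> B" "0 < t" "t < 1"
  shows "summable (\<lambda>n. t ^ n *\<^sub>R u n)"
proof (rule summable_comparison_test')
  show "summable (\<lambda>n. t ^ n * B)" using assms by (intro summable_mult2 summable_geometric) auto
  show "norm (t ^ n *\<^sub>R u n) \<le> t ^ n * B" for n
    using assms by (simp add: mult_left_mono)
qed

lemma abel_mean_const:
  assumes "0 < t" "t < 1"
  shows "abel_mean (\<lambda>_. c::'b::banach) t = c"
proof -
  have "(suminf (\<lambda>n. t ^ n *\<^sub>R c)) = (suminf (\<lambda>n. t ^ n)) *\<^sub>R c"
    using assms by (intro suminf_scaleR_left[symmetric] summable_geometric) auto
  then show ?thesis unfolding abel_mean_def using assms by (simp add: suminf_geometric)
qed

lemma abel_mean_add: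
  fixes u v :: "nat \<Rightarrow> 'b::banach"
  assumes "\<And>n. norm (u n) \<le> B" "\<And>n. norm (v n) \<le> C" "0 < t" "t < 1"
  shows "abel_mean (\<lambda>n. u n + v n) t = abel_mean u t + abel_mean v t"
  unfolding abel_mean_def
  by (simp only: scaleR_add_right flip: suminf_add[OF abel_summable[of u, OF assms(1,3,4)] abel_summable[of v, OF assms(2,3,4)]])

lemma abel_mean_bounded_linear:
  fixes u :: "nat \<Rightarrow> 'b::banach"
  assumes "bounded_linear h" "\<And>n. norm (u n) \<le> B" "0 < t" "t < 1"
  shows "abel_mean (\<lambda>n. h (u n)) t = h (abel_mean u t)"
  unfolding abel_mean_def
  using bounded_linear.suminf[OF assms(1) abel_summable[OF assms(2-4)]] assms(1)
  by (simp add: linear_simps)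

lemma abel_mean_mono:
  fixes u v :: "nat \<Rightarrow> real"
  assumes "\<And>n. \<bar>u n\<bar> \<le> B" "\<And>n. \<bar>v n\<bar> \<le> C" "0 < t" "t < 1" "\<And>n. u n \<le> v n"
  shows "abel_mean u t \<le> abel_mean v t"
  unfolding abel_mean_def
proof -
  have "(suminf (\<lambda>n. t ^ n *\<^sub>R u n)) \<le> (suminf (\<lambda>n. t ^ n *\<^sub>R v n))"
    using abel_summable[of u B t] abel_summable[of v C t] assms
    by (intro suminf_le) (auto intro!: mult_left_mono)
  then show "(1 - t) *\<^sub>R (suminf (\<lambda>n. t ^ n *\<^sub>R u n)) \<le> (1 - t) *\<^sub>R (suminf (\<lambda>n. t ^ n *\<^sub>R v n))"
    using assms by (simp add: mult_left_mono)
qed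

lemma abel_mean_ge:
  fixes u :: "nat \<Rightarrow> real"
  assumes "\<And>n. \<bar>u n\<bar> \<le> B" "0 < t" "t < 1" "\<And>n. c \<le> u n"
  shows "c \<le> abel_mean u t"
  using abel_mean_mono[of "\<lambda>_. c" "\<bar>c\<bar>" u B t] abel_mean_const[of t c] assms by auto

lemma norm_abel_mean_le:
  fixes u :: "nat \<Rightarrow> 'b::banach"
  assumes "\<And>n. norm (u n) \<le> B" "0 < t" "t < 1"
  shows "norm (abel_mean u t) \<le> B"
proof -
  have s: "summable (\<lambda>n. t ^ n * B)" using assms by (intro summable_mult2 summable_geometric) auto
  have "norm (suminf (\<lambda>n. t ^ n *\<^sub>R u n)) \<le> (suminf (\<lambda>n. t ^ n * B))"
    using assms by (intro norm_suminf_le[OF _ s]) (auto intro!: mult_left_mono)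
  also have "\<dots> = B / (1 - t)"
    using assms by (subst suminf_mult2[symmetric]) (auto simp: suminf_geometric)
  finally have "(1 - t) * norm (suminf (\<lambda>n. t ^ n *\<^sub>R u n)) \<le> B"
    using assms by (simp add: pos_le_divide_eq mult.commute)
  then show ?thesis unfolding abel_mean_def norm_scaleR using assms by simp
qed

text \<open>In the limit the factor 1 - t removes the finitely many terms lost by the shift.\<close>

lemma abel_mean_shift:
  fixes u :: "nat \<Rightarrow> 'b::banach"
  assumes B: "\<And>n. norm (u n) \<le> B" and lim: "(abel_mean u \<longlongrightarrow> 0) (at_left 1)"
  shows "(abel_mean (\<lambda>n. u (n + W)) \<longlongrightarrow> 0) (at_left 1)"
proof -
  define S where "S t = (\<Sum>n<W. t ^ n *\<^sub>R u n)" for t :: real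
  have *: "abel_mean (\<lambda>n. u (n + W)) t = (1 / t ^ W) *\<^sub>R (abel_mean u t - (1 - t) *\<^sub>R S t)"
    if "0 < t" "t < 1" for t
  proof -
    have "(suminf (\<lambda>n. t ^ n *\<^sub>R u n)) = (suminf (\<lambda>n. t ^ (n + W) *\<^sub>R u (n + W))) + S t"
      unfolding S_def by (rule suminf_split_initial_segment[OF abel_summable[OF B that]])
    also have "(suminf (\<lambda>n. t ^ (n + W) *\<^sub>R u (n + W))) = (suminf (\<lambda>n. t ^ W *\<^sub>R (t ^ n *\<^sub>R u (n + W))))"
      by (simp add: power_add mult.commute)
    also have "\<dots> = t ^ W *\<^sub>R (suminf (\<lambda>n. t ^ n *\<^sub>R u (n + W)))"
      by (rule suminf_scaleR_right[symmetric], rule abel_summable[of _ B]) (use B that in auto)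
    finally show ?thesis unfolding abel_mean_def using that
      by (simp add: scaleR_add_right scaleR_diff_right mult.commute)
  qed
  have "((\<lambda>t. (1 / t ^ W) *\<^sub>R (abel_mean u t - (1 - t) *\<^sub>R S t)) \<longlongrightarrow> (1 / 1 ^ W) *\<^sub>R (0 - (1 - 1) *\<^sub>R S 1)) (at_left 1)"
    unfolding S_def by (intro tendsto_intros lim) auto
  moreover have "eventually (\<lambda>t::real. 0 < t \<and> t < 1) (at_left 1)"
    using eventually_at_left_real[of 0 1] by (auto elim: eventually_mono)
  then have "eventually (\<lambda>t. (1 / t ^ W) *\<^sub>R (abel_mean u t - (1 - t) *\<^sub>R S t) = abel_mean (\<lambda>n. u (n + W)) t) (at_left 1)"
    by (auto elim!: eventually_mono simp: *)
  ultimately show ?thesis by (simp add: filterlim_cong)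
qed

text \<open>By 1 - t ^ V \<le> V (1 - t), a progression with difference V carries at least about the
  fraction 1 / V of the total weight.\<close>

lemma abel_mean_progression:
  fixes u :: "nat \<Rightarrow> real"
  assumes B: "\<And>n. \<bar>u n\<bar> \<le> B" and nn: "\<And>n. 0 \<le> u n" and V: "V \<ge> 1" and c: "c \<ge> 0"
    and ge: "\<And>k. c \<le> u (M + k * V)" and t: "0 < t" "t < 1"
  shows "c * t ^ M / V \<le> abel_mean u t"
proof -
  have tV: "t ^ V < 1" "0 < t ^ V" using t V by (auto simp: power_less_one_iff)
  have 1: "(1 - t ^ V) / (1 - t) = (\<Sum>k<V. t ^ k)" using sum_gp_strict[of t V] t by simp
  have "(\<Sum>k<V. t ^ k) \<le> (\<Sum>k<V. 1)" using t by (intro sum_mono) (simp add: power_le_one)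
  then have "(1 - t ^ V) / (1 - t) \<le> V" using 1 by simp
  then have le: "1 - t ^ V \<le> V * (1 - t)" using t by (simp add: pos_divide_le_eq)
  have sm: "summable (\<lambda>n. t ^ n * u n)" using abel_summable[of u B t] B t by simp
  have "(suminf (\<lambda>k. c * t ^ M * (t ^ V) ^ k)) \<le> (suminf (\<lambda>k. t ^ (M + k * V) * u (M + k * V)))"
  proof (rule suminf_le)
    fix k
    have "c * t ^ (M + k * V) \<le> t ^ (M + k * V) * u (M + k * V)"
      using ge[of k] t by (simp add: mult.commute mult_right_mono)
    then show "c * t ^ M * (t ^ V) ^ k \<le> t ^ (M + k * V) * u (M + k * V)"
      by (simp add: power_add power_mult mult_ac flip: power_mult)
  next
    show "summable (\<lambda>k. c * t ^ M * (t ^ V) ^ k)" using tV by (intro summable_mult summable_geometric) simp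
    have "strict_mono (\<lambda>k. M + k * V)" using V by (intro strict_monoI) simp
    then have "inj (\<lambda>k. M + k * V)" by (rule strict_mono_imp_inj_on)
    moreover have "summable (\<lambda>n. norm (t ^ n * u n))" using sm nn t by (simp add: abs_mult)
    ultimately show "summable (\<lambda>k. t ^ (M + k * V) * u (M + k * V))"
      using summable_reindex[of "\<lambda>n. t ^ n * u n" "\<lambda>k. M + k * V"] sm nn t by (auto simp: o_def)
  qed
  also have "\<dots> \<le> (suminf (\<lambda>n. t ^ n * u n))"
    using suminf_reindex_mono[of "\<lambda>n. t ^ n * u n" "\<lambda>k. M + k * V"] sm nn t V
    by (auto simp: o_def inj_def)
  also have "(suminf (\<lambda>k. c * t ^ M * (t ^ V) ^ k)) = c * t ^ M / (1 - t ^ V)"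
    using tV by (simp add: suminf_mult suminf_geometric summable_geometric)
  finally have "(1 - t) * (c * t ^ M / (1 - t ^ V)) \<le> abel_mean u t"
    unfolding abel_mean_def real_scaleR_def using t by (intro mult_left_mono) auto
  moreover have "c * t ^ M / V \<le> (1 - t) * (c * t ^ M / (1 - t ^ V))"
  proof -
    have "c * t ^ M * (1 - t ^ V) \<le> c * t ^ M * (V * (1 - t))"
      using le c t by (intro mult_left_mono) auto
    then show ?thesis using tV t V by (simp add: field_simps)
  qed
  ultimately show ?thesis by linarith
qed

text \<open>If w is not real, the imaginary part bounds Y and then the real part bounds X. Otherwise
  w = -1, and X + Y is small while Y is almost nonnegative. The constant depends on w only.\<close>

lemma nonneg_combination_bound:
  fixes w :: complex
  assumes "norm w = 1" "w \<noteq> 1"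
  obtains C where "C \<ge> 0" "\<And>X Y \<epsilon>. X \<ge> - \<epsilon> \<Longrightarrow> Y \<ge> - \<epsilon> \<Longrightarrow> \<epsilon> \<ge> 0 \<Longrightarrow>
      norm (complex_of_real X - w * complex_of_real Y) \<le> \<epsilon> \<Longrightarrow> X \<le> C * \<epsilon>"
proof (cases "Im w = 0")
  case True
  have "Re w = -1 \<or> Re w = 1" using assms(1) True by (simp add: cmod_def abs_if split: if_splits)
  then have w: "w = -1" using True assms(2) by (auto simp: complex_eq_iff)
  show ?thesis
  proof (rule that[of 2])
    fix X Y \<epsilon> :: real
    assume *: "Y \<ge> - \<epsilon>" "norm (complex_of_real X - w * complex_of_real Y) \<le> \<epsilon>"
    have "norm (complex_of_real (X + Y)) \<le> \<epsilon>" using * w by simp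
    then have "\<bar>X + Y\<bar> \<le> \<epsilon>" by (simp only: norm_of_real)
    then show "X \<le> 2 * \<epsilon>" using * by linarith
  qed simp
next
  case False
  show ?thesis
  proof (rule that[of "1 + 1 / \<bar>Im w\<bar>"])
    fix X Y \<epsilon> :: real
    assume e: "\<epsilon> \<ge> 0" and *: "norm (complex_of_real X - w * complex_of_real Y) \<le> \<epsilon>"
    have "\<bar>Im (complex_of_real X - w * complex_of_real Y)\<bar> \<le> \<epsilon>"
      using abs_Im_le_cmod * order_trans by blast
    then have "\<bar>Im w\<bar> * \<bar>Y\<bar> \<le> \<epsilon>" by (simp add: abs_mult)
    then have Y: "\<bar>Y\<bar> \<le> \<epsilon> / \<bar>Im w\<bar>" using False by (simp add: field_simps)
    have "\<bar>Re (complex_of_real X - w * complex_of_real Y)\<bar> \<le> \<epsilon>"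
      using abs_Re_le_cmod * order_trans by blast
    then have "X \<le> \<epsilon> + \<bar>Re w * Y\<bar>" by simp
    also have "\<bar>Re w * Y\<bar> \<le> 1 * \<bar>Y\<bar>" unfolding abs_mult
      using abs_Re_le_cmod[of w] assms by (intro mult_right_mono) auto
    finally show "X \<le> (1 + 1 / \<bar>Im w\<bar>) * \<epsilon>" using Y by (simp add: field_simps)
  qed simp
qed

lemma eventually_at_left_1: "eventually (\<lambda>t::real. 0 < t \<and> t < 1) (at_left 1)"
  using eventually_at_left_real[of 0 1] by (auto elim: eventually_mono)

section \<open>Abel means twisted by roots of unity\<close>

context ultrametric_family
begin

lemma abel_mean_f_lower_bound:
  assumes "M \<ge> 1"
  obtains \<beta> where "\<beta> > 0" "eventually (\<lambda>t. \<beta> \<le> abel_mean (\<lambda>n. if M dvd n then f n else 0) t) (at_left 1)"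
proof -
  obtain V where V: "V \<ge> 1" "M dvd V" "\<And>t. f (M + t * V) \<ge> f M / 2"
    using f_lower_density[OF assms] by blast
  define c where "c = f M / 2"
  have c: "c > 0" unfolding c_def using f_pos assms by simp
  have "((\<lambda>t::real. c * t ^ M / V) \<longlongrightarrow> c * 1 ^ M / V) (at_left 1)"
    using V by (intro tendsto_intros) auto
  moreover have "c / (2 * V) < c * 1 ^ M / V" using c V by (simp add: field_simps)
  ultimately have "eventually (\<lambda>t::real. c / (2 * V) < c * t ^ M / V) (at_left 1)"
    by (rule order_tendstoD(1))
  then have "eventually (\<lambda>t. c / (2 * V) \<le> abel_mean (\<lambda>n. if M dvd n then f n else 0) t) (at_left 1)"
    using eventually_at_left_1
  proof eventually_elim
    case (elim t)
    have "c * t ^ M / V \<le> abel_mean (\<lambda>n. if M dvd n then f n else 0) t"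
      by (rule abel_mean_progression[where B = 1])
        (use f_nonneg f_le1 V(1,2) V(3)[folded c_def] c elim in auto)
    then show ?case using elim by linarith
  qed
  then show ?thesis using that[of "c / (2 * V)"] c V by simp
qed

text \<open>If the means tended to 0, so would those of \<Delta> n c ^ n with \<Delta> n = f (n + W)
  - f n. Up to \<epsilon> the latter are X - w Y, with X from the multiples of Q and Y from the
  class of - W, and \<open>nonneg_combination_bound\<close> would force X below the lower bound that
  \<beta> provides.\<close>

lemma abel_mean_twisted_nonzero:
  assumes i0: "i0 \<in> I" and q: "q = p i0"
    and D: "\<And>i. i \<in> I \<Longrightarrow> m i dvd q ^ e * D" "\<not> q dvd D"
      "\<And>i. i \<in> I \<Longrightarrow> p i \<noteq> q \<Longrightarrow> p i dvd D"
    and c: "c ^ (q ^ Suc e) = (1::complex)" "c ^ (q ^ e) \<noteq> 1"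
  shows "\<not> (abel_mean (\<lambda>n. complex_of_real (f n) * c ^ n) \<longlongrightarrow> 0) (at_left 1)"
proof
  assume lim: "(abel_mean (\<lambda>n. complex_of_real (f n) * c ^ n) \<longlongrightarrow> 0) (at_left 1)"
  have q_prime: "prime q" using seq[OF i0] q ultrametric_seq.p by blast
  then have q_pos: "q > 0" by (rule prime_gt_0_nat)
  define Q where "Q = q ^ Suc e"
  have Q: "Q > 0" unfolding Q_def using q_pos by simp
  have nc: "norm c = 1"
  proof -
    have "norm c ^ Q = 1" using c(1) unfolding Q_def by (metis norm_one norm_power)
    then show ?thesis using Q power_eq_imp_eq_base[of "norm c" Q 1] by simp
  qed
  have c0: "c \<noteq> 0" using nc by auto
  have cQ: "c ^ n = 1" if "Q dvd n" for n
    using that c(1) unfolding Q_def by (auto elim!: dvdE simp only: power_mult power_one)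
  define z where "z = c ^ (q ^ e)"
  have zq: "z ^ q = 1" unfolding z_def using c(1) by (simp add: power_mult[symmetric] mult.commute)
  have nz: "norm z = 1" unfolding z_def using nc by (simp add: norm_power)
  define w where "w = inverse z"
  have w: "norm w = 1" "w \<noteq> 1" unfolding w_def using nz c(2) z_def by (auto simp: norm_inverse)
  obtain C where C: "C \<ge> 0" "\<And>X Y \<epsilon>. X \<ge> - \<epsilon> \<Longrightarrow> Y \<ge> - \<epsilon> \<Longrightarrow> \<epsilon> \<ge> 0 \<Longrightarrow>
      norm (complex_of_real X - w * complex_of_real Y) \<le> \<epsilon> \<Longrightarrow> X \<le> C * \<epsilon>"
    using nonneg_combination_bound[OF w] by blast
  define M where "M = Q * m i0"
  have M: "M \<ge> 1" unfolding M_def using Q seq[OF i0] ultrametric_seq.m by (simp add: Suc_leI)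
  obtain \<beta> where \<beta>: "\<beta> > 0" "eventually (\<lambda>t. \<beta> \<le> abel_mean (\<lambda>n. if M dvd n then f n else 0) t) (at_left 1)"
    using abel_mean_f_lower_bound[OF M] by blast
  \<comment> \<open>The final estimate will be \<beta> \<le> (2 C + 1) \<epsilon>, which this choice
    contradicts.\<close>
  define \<epsilon> where "\<epsilon> = \<beta> / (4 * C + 4)"
  have eps: "\<epsilon> > 0" unfolding \<epsilon>_def using \<beta> C by simp
  \<comment> \<open>By Fermat \<open>D ^ (q - 1)\<close> is 1 modulo q, so that the twist by the shift does not depend on \<open>\<epsilon>\<close>.\<close>
  define D1 where "D1 = D ^ (q - 1)"
  have q1: "q - 1 = Suc (q - 2)" using prime_ge_2_nat[OF q_prime] by simp
  have D1D: "D1 = D * D ^ (q - 2)" unfolding D1_def by (subst q1) simp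
  have D1: "m i dvd q ^ e * D1" if "i \<in> I" for i
    using dvd_mult2[OF D(1)[OF that]] unfolding D1D by (simp add: mult.assoc)
  have D1': "\<not> q dvd D1" "\<And>i. i \<in> I \<Longrightarrow> p i \<noteq> q \<Longrightarrow> p i dvd D1"
    using D prime_dvd_power[OF q_prime] unfolding D1_def D1D[unfolded D1_def] by auto (metis D1D D1_def prime_dvd_power)
  have D1q: "[D1 = 1] (mod q)"
    unfolding D1_def using fermat_theorem[OF q_prime D(2)] .
  obtain K W where KW: "K \<ge> 1" "W = q ^ e * D1 ^ K"
    "\<And>n. \<not> q ^ Suc e dvd n \<Longrightarrow> \<not> q ^ Suc e dvd n + W \<Longrightarrow> \<bar>f (n + W) - f n\<bar> \<le> \<epsilon>"
    "\<And>n. q ^ Suc e dvd n \<Longrightarrow> f (n + W) - f n \<ge> - \<epsilon>"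
    "\<And>n. q ^ Suc e dvd n \<Longrightarrow> m i0 dvd n \<Longrightarrow> f (n + W) - f n \<ge> f n - \<epsilon>"
    "\<And>n. q ^ Suc e dvd n + W \<Longrightarrow> f (n + W) - f n \<le> \<epsilon>"
    using f_almost_period[OF i0 q D1 D1' eps] by metis
  have "[D1 ^ K = 1 ^ K] (mod q)" using D1q by (rule cong_pow)
  then have DK: "D1 ^ K mod q = 1 mod q" by (simp only: Cong.cong_def power_one)
  have zmod: "z ^ n = z ^ (n mod q)" for n
  proof -
    have "z ^ n = z ^ (q * (n div q) + n mod q)" by simp
    also have "\<dots> = z ^ (n mod q)" by (simp only: power_add power_mult zq power_one mult_1)
    finally show ?thesis .
  qed
  have cW: "c ^ W = z"
    using zmod[of "D1 ^ K"] zmod[of 1] DK unfolding KW(2) power_mult z_def[symmetric] by simp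
  have not_both: "\<not> Q dvd n + W" if "Q dvd n" for n
  proof
    assume "Q dvd n + W"
    then have "Q dvd W" using that by (simp add: dvd_add_right_iff)
    then have "z = 1" using cQ cW by metis
    then show False using c(2) z_def by simp
  qed
  define \<Delta> where "\<Delta> n = f (n + W) - f n" for n
  have \<Delta>1: "\<bar>\<Delta> n\<bar> \<le> 1" for n
    unfolding \<Delta>_def using f_nonneg[of n] f_le1[of n] f_nonneg[of "n+W"] f_le1[of "n+W"] by (simp add: abs_le_iff)
  \<comment> \<open>The sign in \<open>v\<close> makes both \<open>u\<close> and \<open>v\<close> at
    least - \<epsilon>; \<open>r\<close> collects the indices at which the increment is bounded by
    \<epsilon>.\<close>
  define u v r where "u n = (if Q dvd n then \<Delta> n else 0)"
    and "v n = (if Q dvd n + W then - \<Delta> n else 0)"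
    and "r n = (if Q dvd n \<or> Q dvd n + W then 0 else \<Delta> n)" for n
  have uB: "\<bar>u n\<bar> \<le> 1" "\<bar>v n\<bar> \<le> 1" "\<bar>r n\<bar> \<le> \<epsilon>" for n
    unfolding u_def v_def r_def using \<Delta>1[of n] KW(3)[of n] eps by (auto simp: Q_def \<Delta>_def abs_minus_commute)
  have un: "u n \<ge> - \<epsilon>" "v n \<ge> - \<epsilon>" for n
    unfolding u_def v_def \<Delta>_def using KW(4,6)[of n] eps by (auto simp: Q_def)
  have uM: "u n \<ge> (if M dvd n then f n else 0) - \<epsilon>" for n
  proof (cases "M dvd n")
    case True
    then have "Q dvd n" "m i0 dvd n" unfolding M_def using dvd_mult_left dvd_mult_right by blast+
    then show ?thesis unfolding u_def \<Delta>_def using KW(5)[of n] True by (simp add: Q_def)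
  next
    case False
    then show ?thesis using un(1)[of n] by simp
  qed
  have decomp: "complex_of_real (\<Delta> n) * c ^ n =
      (complex_of_real (u n) + (- w) * complex_of_real (v n)) + complex_of_real (r n) * c ^ n" for n
  proof (cases "Q dvd n + W")
    case True
    then have "c ^ n * z = 1" using cQ[OF True] cW by (simp add: power_add)
    then have "c ^ n = w" unfolding w_def using inverse_unique mult.commute by metis
    then show ?thesis using True not_both[of n] unfolding u_def v_def r_def by auto
  next
    case False
    then show ?thesis using cQ[of n] unfolding u_def v_def r_def by auto
  qed
  have nf: "norm (complex_of_real (f n) * c ^ n) \<le> 1" for n
    using f_nonneg[of n] f_le1[of n] nc by (simp add: norm_mult norm_power)
  have "(abel_mean (\<lambda>n. complex_of_real (f (n + W)) * c ^ (n + W)) \<longlongrightarrow> 0) (at_left 1)"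
    using abel_mean_shift[OF nf lim, of W] .
  \<comment> \<open>As c ^ W = z = 1 / w, the factor w undoes the twist that the shift
    introduces.\<close>
  then have lim2: "((\<lambda>t. w * abel_mean (\<lambda>n. complex_of_real (f (n + W)) * c ^ (n + W)) t
      + (-1) * abel_mean (\<lambda>n. complex_of_real (f n) * c ^ n) t) \<longlongrightarrow> w * 0 + (-1) * 0) (at_left 1)"
    by (intro tendsto_intros lim)
  have "eventually (\<lambda>t. w * abel_mean (\<lambda>n. complex_of_real (f (n + W)) * c ^ (n + W)) t
      + (-1) * abel_mean (\<lambda>n. complex_of_real (f n) * c ^ n) t
      = abel_mean (\<lambda>n. complex_of_real (\<Delta> n) * c ^ n) t) (at_left 1)"
    using eventually_at_left_1
  proof eventually_elim
    case (elim t)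
    have "abel_mean (\<lambda>n. complex_of_real (\<Delta> n) * c ^ n) t =
      abel_mean (\<lambda>n. w * (complex_of_real (f (n + W)) * c ^ (n + W)) + (-1) * (complex_of_real (f n) * c ^ n)) t"
    proof -
      have "w * z = 1" unfolding w_def using nz by (metis left_inverse norm_zero zero_neq_one)
      then have "complex_of_real (\<Delta> n) * c ^ n = w * (complex_of_real (f (n + W)) * c ^ (n + W)) + (-1) * (complex_of_real (f n) * c ^ n)" for n
        unfolding \<Delta>_def power_add cW by (simp add: algebra_simps)
      then show ?thesis by simp
    qed
    also have "\<dots> = abel_mean (\<lambda>n. w * (complex_of_real (f (n + W)) * c ^ (n + W))) t + abel_mean (\<lambda>n. (-1) * (complex_of_real (f n) * c ^ n)) t"
      by (rule abel_mean_add[where B = 1 and C = 1]) (use nf w elim in \<open>auto simp: norm_mult[of w]\<close>)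
    also have "abel_mean (\<lambda>n. w * (complex_of_real (f (n + W)) * c ^ (n + W))) t = w * abel_mean (\<lambda>n. complex_of_real (f (n + W)) * c ^ (n + W)) t"
      by (rule abel_mean_bounded_linear[where B = 1]) (use nf elim in \<open>auto intro: bounded_linear_mult_right\<close>)
    also have "abel_mean (\<lambda>n. (-1) * (complex_of_real (f n) * c ^ n)) t = (-1) * abel_mean (\<lambda>n. complex_of_real (f n) * c ^ n) t"
      by (rule abel_mean_bounded_linear[OF bounded_linear_mult_right, where B = 1]) (use nf elim in auto)
    finally show ?case by simp
  qed
  then have lim3: "(abel_mean (\<lambda>n. complex_of_real (\<Delta> n) * c ^ n) \<longlongrightarrow> 0) (at_left 1)"
    using lim2 by (simp cong: filterlim_cong)
  then have "eventually (\<lambda>t. norm (abel_mean (\<lambda>n. complex_of_real (\<Delta> n) * c ^ n) t) < \<epsilon>) (at_left 1)"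
    using eps by (auto dest!: tendstoD[of _ _ _ \<epsilon>] simp: dist_norm)
  then have "eventually (\<lambda>t::real. False) (at_left 1)"
    using eventually_at_left_1 \<beta>(2)
  proof eventually_elim
    case (elim t)
    define X where "X = abel_mean u t"
    define Y where "Y = abel_mean v t"
    define R where "R = abel_mean (\<lambda>n. complex_of_real (r n) * c ^ n) t"
    have t: "0 < t" "t < 1" using elim by auto
    have nR: "norm R \<le> \<epsilon>" unfolding R_def
      by (rule norm_abel_mean_le) (use uB nc t in \<open>auto simp: norm_mult norm_power\<close>)
    have uv2: "norm (complex_of_real (u n) + (- w) * complex_of_real (v n)) \<le> 2" for n
    proof -
      have "norm (complex_of_real (u n) + (- w) * complex_of_real (v n)) \<le> \<bar>u n\<bar> + \<bar>v n\<bar>"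
        using norm_triangle_ineq[of "complex_of_real (u n)" "(- w) * complex_of_real (v n)"] w
        by (simp add: norm_mult)
      then show ?thesis using uB(1)[of n] uB(2)[of n] by linarith
    qed
    have "abel_mean (\<lambda>n. complex_of_real (\<Delta> n) * c ^ n) t
      = abel_mean (\<lambda>n. complex_of_real (u n) + (- w) * complex_of_real (v n)) t + R"
      unfolding decomp R_def
      by (rule abel_mean_add[where C = \<epsilon>, OF uv2]) (use uB nc t in \<open>auto simp: norm_mult norm_power\<close>)
    also have "abel_mean (\<lambda>n. complex_of_real (u n) + (- w) * complex_of_real (v n)) t
      = abel_mean (\<lambda>n. complex_of_real (u n)) t + abel_mean (\<lambda>n. (- w) * complex_of_real (v n)) t"
      by (rule abel_mean_add[where B = 1 and C = 1]) (use uB t w in \<open>auto simp: norm_mult\<close>)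
    also have "abel_mean (\<lambda>n. complex_of_real (u n)) t = complex_of_real X" unfolding X_def
      by (rule abel_mean_bounded_linear[where B = 1]) (use uB t in \<open>auto intro: bounded_linear_of_real\<close>)
    also have "abel_mean (\<lambda>n. (- w) * complex_of_real (v n)) t = (- w) * complex_of_real Y"
    proof -
      have "abel_mean (\<lambda>n. (- w) * complex_of_real (v n)) t = (- w) * abel_mean (\<lambda>n. complex_of_real (v n)) t"
        by (rule abel_mean_bounded_linear[OF bounded_linear_mult_right, where B = 1]) (use uB t in auto)
      also have "abel_mean (\<lambda>n. complex_of_real (v n)) t = complex_of_real Y" unfolding Y_def
        by (rule abel_mean_bounded_linear[where B = 1]) (use uB t in \<open>auto intro: bounded_linear_of_real\<close>)
      finally show ?thesis .
    qed
    finally have "complex_of_real X - w * complex_of_real Y = abel_mean (\<lambda>n. complex_of_real (\<Delta> n) * c ^ n) t - R"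
      by simp
    then have nXY: "norm (complex_of_real X - w * complex_of_real Y) \<le> 2 * \<epsilon>"
      using nR elim norm_triangle_ineq4[of "abel_mean (\<lambda>n. complex_of_real (\<Delta> n) * c ^ n) t" R]
      by (simp only:)
    have X: "X \<ge> - \<epsilon>" unfolding X_def by (rule abel_mean_ge) (use uB un t in auto)
    have Y: "Y \<ge> - \<epsilon>" unfolding Y_def by (rule abel_mean_ge) (use uB un t in auto)
    have "X \<le> C * (2 * \<epsilon>)" by (rule C(2)[of "2 * \<epsilon>" X Y]) (use X Y eps nXY in auto)
    moreover have "abel_mean (\<lambda>n. (if M dvd n then f n else 0) + (- \<epsilon>)) t \<le> X" unfolding X_def
    proof (rule abel_mean_mono[where B = "1 + \<epsilon>" and C = 1])
      show "\<bar>(if M dvd n then f n else 0) + - \<epsilon>\<bar> \<le> 1 + \<epsilon>" for n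
        using f_nonneg[of n] f_le1[of n] eps by auto
      show "(if M dvd n then f n else 0) + - \<epsilon> \<le> u n" for n using uM[of n] by simp
    qed (use uB t in auto)
    moreover have "abel_mean (\<lambda>n. (if M dvd n then f n else 0) + (- \<epsilon>)) t
      = abel_mean (\<lambda>n. (if M dvd n then f n else 0)) t + abel_mean (\<lambda>n. - \<epsilon>) t"
      by (rule abel_mean_add[where B = 1 and C = \<epsilon>]) (use f_nonneg f_le1 eps t in auto)
    moreover have "abel_mean (\<lambda>n. - \<epsilon>) t = - \<epsilon>" by (rule abel_mean_const[OF t])
    ultimately have "\<beta> - \<epsilon> \<le> C * (2 * \<epsilon>)" using elim by linarith
    then have "\<beta> \<le> \<epsilon> * (2 * C + 1)" by (simp add: algebra_simps)
    also have "\<dots> < \<epsilon> * (4 * C + 4)" using eps C by (intro mult_strict_left_mono) auto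
    also have "\<dots> = \<beta>" unfolding \<epsilon>_def using C by simp
    finally show False by simp
  qed
  then show False by (simp add: trivial_limit_at_left_real)
qed

theorem abel_mean_twisted_nonzero_eventually:
  assumes i0: "i0 \<in> I" and q: "q = p i0"
  obtains E where "\<And>e c. e \<ge> E \<Longrightarrow> c ^ (q ^ Suc e) = (1::complex) \<Longrightarrow> c ^ (q ^ e) \<noteq> 1 \<Longrightarrow>
     \<not> (abel_mean (\<lambda>n. complex_of_real (f n) * c ^ n) \<longlongrightarrow> 0) (at_left 1)"
proof -
  have q_prime: "prime q" using seq[OF i0] q ultrametric_seq.p by blast
  have "\<exists>s k. m i = q ^ s * k \<and> \<not> q dvd k" if "i \<in> I" for i
  proof -
    have "m i \<noteq> 0" using seq[OF that] ultrametric_seq.m by fastforce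
    then show ?thesis using q_prime by (metis multiplicity_decompose' not_prime_unit)
  qed
  then obtain s k where sk: "\<And>i. i \<in> I \<Longrightarrow> m i = q ^ s i * k i" "\<And>i. i \<in> I \<Longrightarrow> \<not> q dvd k i"
    by metis
  \<comment> \<open>For e \<ge> E the power q ^ e contains the q-part of every m i; D collects their
    q-free parts and the other residue characteristics.\<close>
  define E where "E = (\<Sum>i\<in>I. s i)"
  define D where "D = (\<Prod>i\<in>I. k i * (if p i = q then 1 else p i))"
  have sE: "s i \<le> E" if "i \<in> I" for i unfolding E_def using fin that by (simp add: member_le_sum)
  have dD: "k i * (if p i = q then 1 else p i) dvd D" if "i \<in> I" for i
    unfolding D_def using fin that by (rule dvd_prodI)
  have "\<not> q dvd k i * (if p i = q then 1 else p i)" if "i \<in> I" for i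
  proof -
    have "prime (p i)" using seq[OF that] ultrametric_seq.p by blast
    then show ?thesis using sk(2)[OF that] q_prime
      by (auto simp: prime_dvd_mult_iff dest: primes_dvd_imp_eq split: if_splits)
  qed
  then have qD: "\<not> q dvd D" unfolding D_def using fin q_prime by (simp add: prime_dvd_prod_iff)
  show ?thesis
  proof (rule that[of E])
    fix e c assume e: "e \<ge> E" and c: "c ^ (q ^ Suc e) = (1::complex)" "c ^ (q ^ e) \<noteq> 1"
    show "\<not> (abel_mean (\<lambda>n. complex_of_real (f n) * c ^ n) \<longlongrightarrow> 0) (at_left 1)"
    proof (rule abel_mean_twisted_nonzero[OF i0 q _ qD _ c])
      fix i assume i: "i \<in> I"
      have "q ^ s i dvd q ^ e" using sE[OF i] e by (intro le_imp_power_dvd) simp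
      moreover have "k i dvd D" using dD[OF i] dvd_mult_left by blast
      ultimately show "m i dvd q ^ e * D" unfolding sk(1)[OF i] by (rule mult_dvd_mono)
      show "p i dvd D" if "p i \<noteq> q" using dD[OF i] dvd_mult_right that by (metis (full_types))
    qed
  qed
qed

end

section \<open>Zeta functions\<close>

definition zeta_fps :: "(nat \<Rightarrow> complex) \<Rightarrow> complex fps" where
  "zeta_fps F = fps_exp 1 oo Abs_fps (\<lambda>n. if n = 0 then 0 else F n / of_nat n)"

lemma zeta_fps_cong: "(\<And>n. n \<ge> 1 \<Longrightarrow> F n = G n) \<Longrightarrow> zeta_fps F = zeta_fps G"
  unfolding zeta_fps_def by (intro arg_cong2[where f = fps_compose] refl fps_ext) simp

lemma fps_nth_zeta_0: "fps_nth (zeta_fps F) 0 = 1"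
  unfolding zeta_fps_def by simp

lemma fps_deriv_zeta: "fps_deriv (zeta_fps F) = zeta_fps F * Abs_fps (\<lambda>n. F (Suc n))"
proof -
  have "fps_deriv (Abs_fps (\<lambda>n. if n = 0 then 0 else F n / of_nat n)) = Abs_fps (\<lambda>n. F (Suc n))"
    by (rule fps_ext) (simp add: field_simps del: of_nat_Suc)
  then show ?thesis unfolding zeta_fps_def by (simp add: fps_compose_deriv fps_exp_deriv)
qed

text \<open>A first-order linear differential equation determines the coefficients recursively. The
  next identity follows from it without manipulating exponentials.\<close>

lemma fps_deriv_mult_unique:
  fixes u v h :: "complex fps"
  assumes u: "fps_deriv u = u * h" "fps_nth u 0 = 1" and v: "fps_deriv v = v * h" "fps_nth v 0 = 1"
  shows "u = v"
proof -
  have "fps_nth u n = fps_nth v n" for n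
  proof (induction n rule: less_induct)
    case (less n)
    show ?case
    proof (cases n)
      case 0 then show ?thesis using u v by simp
    next
      case (Suc k)
      have "of_nat (Suc k) * fps_nth w (Suc k) = (\<Sum>i=0..k. fps_nth w i * fps_nth h (k - i))"
        if "fps_deriv w = w * h" for w
        using arg_cong[OF that, of "\<lambda>f. fps_nth f k"] by (simp add: fps_mult_nth del: of_nat_Suc)
      note this[OF u(1)] this[OF v(1)]
      moreover have "(\<Sum>i=0..k. fps_nth u i * fps_nth h (k - i)) = (\<Sum>i=0..k. fps_nth v i * fps_nth h (k - i))"
        by (rule sum.cong) (use less.IH Suc in auto)
      ultimately have "of_nat (Suc k) * fps_nth u (Suc k) = of_nat (Suc k) * fps_nth v (Suc k)" by simp
      then have "fps_nth u (Suc k) = fps_nth v (Suc k)" by (simp del: of_nat_Suc)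
      then show ?thesis unfolding Suc .
    qed
  qed
  then show ?thesis by (rule fps_ext)
qed

text \<open>Subtracting sequences means dividing their zeta functions, since logarithmic derivatives
  subtract.\<close>

lemma zeta_fps_diff: "zeta_fps (\<lambda>n. F n - G n) * zeta_fps G = zeta_fps F"
proof (rule fps_deriv_mult_unique[where h = "Abs_fps (\<lambda>n. F (Suc n))"])
  have "Abs_fps (\<lambda>n. F (Suc n)) = Abs_fps (\<lambda>n. F (Suc n) - G (Suc n)) + Abs_fps (\<lambda>n. G (Suc n))"
    by (rule fps_ext) simp
  then show "fps_deriv (zeta_fps (\<lambda>n. F n - G n) * zeta_fps G) =
      zeta_fps (\<lambda>n. F n - G n) * zeta_fps G * Abs_fps (\<lambda>n. F (Suc n))"
    by (simp add: fps_deriv_zeta algebra_simps)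
qed (simp_all add: fps_nth_zeta_0 fps_deriv_zeta)

lemma zeta_fps_power: "zeta_fps (\<lambda>n. w ^ n) * fps_of_poly [:1, - w:] = 1"
proof -
  let ?q = "1 - fps_const w * fps_X"
  have q: "fps_of_poly [:1, - w:] = ?q" by (simp add: fps_of_poly_pCons mult.commute)
  let ?A = "Abs_fps (\<lambda>n. w ^ Suc n)" and ?z = "zeta_fps (\<lambda>n. w ^ n)"
  have A: "?A * ?q = fps_const w"
  proof (rule fps_ext)
    fix n
    have "?A * ?q = ?A - fps_const w * (?A * fps_X)" by (simp only: right_diff_distrib mult_1_right mult.left_commute)
    then show "fps_nth (?A * ?q) n = fps_nth (fps_const w) n" by (cases n) simp_all
  qed
  have "fps_deriv (?z * ?q) = ?z * (?A * ?q) + ?z * fps_deriv ?q"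
    by (simp only: fps_deriv_mult fps_deriv_zeta mult.assoc add.commute)
  also have "fps_deriv ?q = - fps_const w" by simp
  also have "?z * (?A * ?q) + ?z * - fps_const w = 0" unfolding A by (simp only: mult_minus_right right_minus)
  finally have "fps_deriv (?z * ?q) = 0" .
  then show ?thesis unfolding q fps_deriv_eq_0_iff by (simp add: fps_nth_zeta_0)
qed

lemma rational_fps_quotient:
  assumes "rational_fps f" "rational_fps g" "g \<noteq> 0" "h * g = f"
  shows "rational_fps h"
proof -
  obtain p q where f: "q \<noteq> 0" "f * fps_of_poly q = fps_of_poly p" using assms(1) unfolding rational_fps_def by blast
  obtain r s where g: "s \<noteq> 0" "g * fps_of_poly s = fps_of_poly r" using assms(2) unfolding rational_fps_def by blast
  have "g * fps_of_poly s \<noteq> 0" using assms(3) g(1) by simp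
  then have "r \<noteq> 0" using g(2) by auto
  moreover have "h * fps_of_poly (r * q) = fps_of_poly (p * s)"
  proof -
    have "h * fps_of_poly (r * q) = h * (g * fps_of_poly s) * fps_of_poly q" by (simp add: fps_of_poly_mult g(2) mult.assoc)
    also have "\<dots> = (f * fps_of_poly q) * fps_of_poly s" by (simp add: assms(4)[symmetric] mult_ac)
    finally show ?thesis by (simp add: f(2) fps_of_poly_mult)
  qed
  ultimately show ?thesis unfolding rational_fps_def using f(1)
    by (intro exI[of _ "p * s"] exI[of _ "r * q"]) simp
qed

lemma rational_zeta_product:
  assumes "finite Z"
  shows "rational_fps (zeta_fps (\<lambda>n. w ^ n * (\<Prod>i\<in>Z. 1 - \<tau> i ^ n)))"
  using assms
proof (induction Z arbitrary: w rule: finite_induct)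
  case empty
  have "[:1, - w:] \<noteq> 0" by simp
  moreover have "zeta_fps (\<lambda>n. w ^ n) * fps_of_poly [:1, - w:] = fps_of_poly 1"
    unfolding zeta_fps_power by simp
  ultimately show ?case unfolding rational_fps_def
    by (intro exI[of _ 1] exI[of _ "[:1, - w:]"]) (simp del: pCons_eq_0_iff)
next
  case (insert i Z)
  let ?G = "\<lambda>w n. w ^ n * (\<Prod>i\<in>Z. 1 - \<tau> i ^ n)"
  \<comment> \<open>Splitting off the factor 1 - \<tau> i ^ n leaves a difference of two sequences
    of the same form, for w and for w (\<tau> i); hence the induction is for all w.\<close>
  have e: "(\<lambda>n. w ^ n * (\<Prod>i\<in>insert i Z. 1 - \<tau> i ^ n)) = (\<lambda>n. ?G w n - ?G (w * \<tau> i) n)"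
    using insert.hyps by (simp add: algebra_simps power_mult_distrib)
  show ?case unfolding e
  proof (rule rational_fps_quotient[OF insert.IH insert.IH _ zeta_fps_diff])
    show "zeta_fps (?G (w * \<tau> i)) \<noteq> 0" using fps_nth_zeta_0[of "?G (w * \<tau> i)"] by auto
  qed
qed

text \<open>The quotient p / q continues f to the complement of the finitely many zeros of q, and
  the series itself covers the zeros inside the disc. Together this is a connected open set larger
  than the disc.\<close>

lemma rational_fps_no_natural_boundary:
  assumes "rational_fps f" shows "\<not> has_natural_boundary f"
proof
  assume nb: "has_natural_boundary f"
  obtain p q where pq: "q \<noteq> 0" "f * fps_of_poly q = fps_of_poly p" using assms unfolding rational_fps_def by blast
  define r where "r = fps_conv_radius f"
  have r: "0 < r" "r < \<infinity>" using nb unfolding has_natural_boundary_def r_def by auto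
  define N where "N = {z. poly q z = 0}"
  have fN: "finite N" unfolding N_def using pq(1) by (rule poly_roots_finite)
  have oN: "open (- N)" using fN by (simp add: finite_imp_closed open_Compl)
  define g where "g z = (if z \<in> eball 0 r then eval_fps f z else poly p z / poly q z)" for z
  have eq: "eval_fps f z * poly q z = poly p z" if "z \<in> eball 0 r" for z
  proof -
    have "eval_fps (f * fps_of_poly q) z = eval_fps f z * eval_fps (fps_of_poly q) z"
      by (rule eval_fps_mult) (use that in \<open>auto simp: r_def in_eball_iff\<close>)
    then show ?thesis unfolding pq(2) by simp
  qed
  have g2: "g z = poly p z / poly q z" if "z \<in> - N" for z
    using that eq[of z] unfolding g_def N_def by (auto simp: field_simps)
  have "g holomorphic_on eball 0 r"
    by (rule holomorphic_transform[OF holomorphic_on_eval_fps[of "eball 0 r" f]]) (auto simp: g_def r_def)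
  moreover have "g holomorphic_on - N"
  proof (rule holomorphic_transform)
    show "(\<lambda>z. poly p z / poly q z) holomorphic_on - N" by (intro holomorphic_intros) (auto simp: N_def)
  qed (simp add: g2)
  ultimately have hol: "g holomorphic_on (eball 0 r \<union> - N)" using oN by (intro holomorphic_on_Un) auto
  have r': "eball (0::complex) r = ball 0 (real_of_ereal r)" and r0: "real_of_ereal r > 0"
    using r by (cases r; simp)+
  have "infinite (ball (0::complex) (real_of_ereal r))"
    using r0 by (metis centre_in_ball empty_iff finite_imp_not_open open_ball)
  then have "\<not> ball (0::complex) (real_of_ereal r) \<subseteq> N" using fN finite_subset by blast
  then have meet: "eball 0 r \<inter> - N \<noteq> {}" unfolding r' by blast
  have "connected (- N)" unfolding Compl_eq_Diff_UNIV
    by (rule connected_open_delete_finite) (use fN in auto)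
  then have conn: "connected (eball 0 r \<union> - N)" using meet unfolding r' by (intro connected_Un) auto
  have "eball 0 r \<noteq> eball 0 r \<union> - N"
  proof
    assume "eball 0 r = eball 0 r \<union> - N"
    then have "UNIV \<subseteq> ball 0 (real_of_ereal r) \<union> N" unfolding r' by blast
    moreover have "bounded (ball 0 (real_of_ereal r) \<union> N)" using fN finite_imp_bounded by auto
    ultimately show False using bounded_subset not_bounded_UNIV by blast
  qed
  then have "eball 0 r \<subset> eball 0 r \<union> - N" by blast
  moreover have "open (eball 0 r \<union> - N)" using oN by auto
  moreover have "\<forall>z\<in>eball 0 r. g z = eval_fps f z" unfolding g_def by simp
  ultimately show False using nb hol conn unfolding has_natural_boundary_def r_def[symmetric] by blast
qed

section \<open>Natural boundaries\<close>

lemma primitive_roots_dense: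
  fixes u :: complex
  assumes q: "prime q" and u: "norm u = 1" and eps: "\<epsilon> > 0"
  obtains E where "\<And>e. e \<ge> E \<Longrightarrow> \<exists>c. c ^ (q ^ Suc e) = 1 \<and> c ^ (q ^ e) \<noteq> 1 \<and> dist c u < \<epsilon>"
proof -
  have q2: "real q > 1" using prime_gt_1_nat[OF q] by simp
  define \<alpha> where "\<alpha> = Arg u"
  have u: "u = cis \<alpha>" unfolding \<alpha>_def using u cis_Arg[of u] by (cases "u = 0") (auto simp: sgn_div_norm)
  have "isCont (\<lambda>x. exp (\<i> * complex_of_real x)) \<alpha>" by (intro continuous_intros)
  then have "isCont cis \<alpha>" unfolding cis_conv_exp[symmetric] .
  then obtain \<delta> where \<delta>: "\<delta> > 0" "\<And>x. dist x \<alpha> < \<delta> \<Longrightarrow> dist (cis x) (cis \<alpha>) < \<epsilon>"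
    using eps unfolding continuous_at_eps_delta by (metis dist_commute)
  \<comment> \<open>The angle chosen below differs from \<alpha> by at most two steps of length 2
    \<pi> / N with N = q ^ (e + 1), so N has to exceed 4 \<pi> / \<delta>.\<close>
  obtain E where E: "4 * pi / \<delta> < real q ^ E" using real_arch_pow[OF q2] by blast
  have "\<exists>c. c ^ (q ^ Suc e) = 1 \<and> c ^ (q ^ e) \<noteq> 1 \<and> dist c u < \<epsilon>" if e: "e \<ge> E" for e
  proof -
    define N where "N = real q ^ Suc e"
    have "real q ^ E \<le> N" unfolding N_def using q2 e by (intro power_increasing) auto
    then have N: "4 * pi / \<delta> < N" using E by linarith
    then have N0: "N > 0" using \<delta>(1) by (smt (verit) divide_pos_pos pi_gt_zero)
    define b where "b = \<lfloor>\<alpha> * N / (2 * pi)\<rfloor>"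
    \<comment> \<open>One of two consecutive integers is prime to q, which makes the order of the
      root exactly q ^ (e + 1).\<close>
    obtain a where a: "a = b + 1 \<or> a = b + 2" "\<not> int q dvd a"
    proof (cases "int q dvd b + 1")
      case False then show ?thesis using that[of "b + 1"] by simp
    next
      case True
      have "\<not> int q dvd b + 2"
      proof
        assume "int q dvd b + 2"
        then have "int q dvd (b + 2) - (b + 1)" using True by (rule dvd_diff)
        then show False using prime_gt_1_nat[OF q] by simp
      qed
      then show ?thesis using that[of "b + 2"] by simp
    qed
    define x where "x = 2 * pi * of_int a / N"
    have "\<bar>of_int a - \<alpha> * N / (2 * pi)\<bar> \<le> 2" using a(1) unfolding b_def by linarith
    moreover have "x - \<alpha> = (2 * pi / N) * (of_int a - \<alpha> * N / (2 * pi))" unfolding x_def using N0 by (simp add: field_simps)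
    then have "\<bar>x - \<alpha>\<bar> = (2 * pi / N) * \<bar>of_int a - \<alpha> * N / (2 * pi)\<bar>" using N0 by (simp only: abs_mult) simp
    ultimately have "\<bar>x - \<alpha>\<bar> \<le> (2 * pi / N) * 2" using N0 mult_left_mono[of _ 2 "2 * pi / N"] by simp
    also have "\<dots> < \<delta>" using N N0 \<delta>(1) by (simp add: field_simps)
    finally have "dist (cis x) u < \<epsilon>" unfolding u by (intro \<delta>(2)) (simp add: dist_real_def)
    moreover have "cis x ^ (q ^ Suc e) = 1"
    proof -
      have "real (q ^ Suc e) * x = 2 * pi * of_int a" unfolding x_def N_def using q2 by simp
      then show ?thesis unfolding Complex.DeMoivre by (simp only: cis_multiple_2pi Ints_of_int)
    qed
    moreover have "cis x ^ (q ^ e) \<noteq> 1"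
    proof
      assume "cis x ^ (q ^ e) = 1"
      then have "cos (real (q ^ e) * x) = 1" unfolding Complex.DeMoivre by (metis cis.simps(1) one_complex.simps(1))
      then obtain n :: int where n: "real (q ^ e) * x = of_int n * 2 * pi" unfolding cos_one_2pi_int by blast
      have "real (q ^ e) * x = 2 * pi * of_int a / real q" unfolding x_def N_def using q2 by simp
      then have "of_int n * 2 * pi = 2 * pi * of_int a / real q" using n by (rule trans[OF sym, rotated])
      then have "(of_int a :: real) = of_int n * real q" using q2 by (simp add: field_simps)
      then have "a = n * int q" by (metis of_int_eq_iff of_int_mult of_int_of_nat_eq)
      then show False using a(2) by simp
    qed
    ultimately show ?thesis by blast
  qed
  then show ?thesis using that by blast
qed

lemma abel_mean_summable:
  fixes u :: "nat \<Rightarrow> 'b::banach"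
  assumes s: "summable (\<lambda>n. norm (u n))"
  shows "(abel_mean u \<longlongrightarrow> 0) (at_left 1)"
proof (rule Lim_null_comparison)
  show "((\<lambda>t. (1 - t) * (suminf (\<lambda>n. norm (u n)))) \<longlongrightarrow> 0) (at_left (1::real))"
    by (rule tendsto_eq_intros refl | simp)+
  show "eventually (\<lambda>t. norm (abel_mean u t) \<le> (1 - t) * (suminf (\<lambda>n. norm (u n)))) (at_left 1)"
    using eventually_at_left_1
  proof eventually_elim
    case (elim t)
    have "norm (suminf (\<lambda>n. t ^ n *\<^sub>R u n)) \<le> (suminf (\<lambda>n. norm (u n)))"
      by (rule norm_suminf_le[OF _ s]) (use elim in \<open>simp add: mult_left_le_one_le power_le_one\<close>)
    then show ?case unfolding abel_mean_def using elim by (simp add: mult_left_mono)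
  qed
qed

lemma norm_prod_one_minus_powers_le:
  assumes "finite Z" "\<And>i. i \<in> Z \<Longrightarrow> cmod (\<tau> i) < 1"
  shows "cmod (\<Prod>i\<in>Z. 1 - \<tau> i ^ n) \<le> 2 ^ card Z"
proof -
  have "cmod (1 - \<tau> i ^ n) \<le> 2" if "i \<in> Z" for i
    using norm_triangle_ineq4[of 1 "\<tau> i ^ n"] power_le_one[of "cmod (\<tau> i)" n] assms(2)[OF that] by (simp add: norm_power)
  then have "(\<Prod>i\<in>Z. cmod (1 - \<tau> i ^ n)) \<le> (\<Prod>i\<in>Z. 2)" by (intro prod_mono) auto
  then show ?thesis by (simp add: prod_norm)
qed

text \<open>Each further factor changes the product by a geometrically decaying amount. Therefore
  the archimedean factors do not influence limits of Abel means.\<close>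

lemma summable_prod_one_minus_powers:
  assumes "finite Z" "\<And>i. i \<in> Z \<Longrightarrow> cmod (\<tau> i) < 1"
  shows "summable (\<lambda>n. cmod ((\<Prod>i\<in>Z. 1 - \<tau> i ^ n) - 1))"
  using assms
proof (induction Z rule: finite_induct)
  case (insert j Z)
  let ?Q = "\<lambda>n. \<Prod>i\<in>Z. 1 - \<tau> i ^ n"
  have b: "cmod (?Q n) \<le> 2 ^ card Z" for n
    by (rule norm_prod_one_minus_powers_le) (use insert in auto)
  have "summable (\<lambda>n. cmod (?Q n - 1) + cmod (\<tau> j) ^ n * 2 ^ card Z)"
    using insert by (intro summable_add summable_mult2 summable_geometric) auto
  then show ?case
  proof (rule summable_comparison_test')
    fix n
    have "(\<Prod>i\<in>insert j Z. 1 - \<tau> i ^ n) - 1 = (?Q n - 1) - \<tau> j ^ n * ?Q n"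
      using insert.hyps by (simp add: algebra_simps)
    then have "cmod ((\<Prod>i\<in>insert j Z. 1 - \<tau> i ^ n) - 1) \<le> cmod (?Q n - 1) + cmod (\<tau> j ^ n * ?Q n)"
      using norm_triangle_ineq4[of "?Q n - 1" "\<tau> j ^ n * ?Q n"] by (simp only:)
    also have "cmod (\<tau> j ^ n * ?Q n) \<le> cmod (\<tau> j) ^ n * 2 ^ card Z"
      unfolding norm_mult norm_power using b by (intro mult_left_mono) auto
    finally show "norm (cmod ((\<Prod>i\<in>insert j Z. 1 - \<tau> i ^ n) - 1)) \<le> cmod (?Q n - 1) + cmod (\<tau> j) ^ n * 2 ^ card Z" by simp
  qed
qed simp

context ultrametric_family
begin

theorem zeta_natural_boundary:
  fixes \<tau> :: "'z \<Rightarrow> complex"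
  assumes i0: "i0 \<in> I" and R: "R > 0" and Z: "finite Z" "\<And>i. i \<in> Z \<Longrightarrow> cmod (\<tau> i) < 1"
  shows "has_natural_boundary
    (zeta_fps (\<lambda>n. complex_of_real R ^ n * (\<Prod>i\<in>Z. 1 - \<tau> i ^ n) * complex_of_real (f n)))"
proof -
  define Q where "Q n = (\<Prod>i\<in>Z. 1 - \<tau> i ^ n)" for n
  define F where "F n = complex_of_real R ^ n * Q n * complex_of_real (f n)" for n
  define C :: real where "C = 2 ^ card Z"
  have Qb: "cmod (Q n) \<le> C" for n unfolding Q_def C_def by (rule norm_prod_one_minus_powers_le[OF Z])
  have f0: "f 0 = 0"
    unfolding f_def using fin i0 ultrametric_seq.a0[OF seq[OF i0]] by auto
  then have F0: "F 0 = 0" unfolding F_def by simp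
  define q where "q = p i0"
  have q_prime: "prime q" unfolding q_def using seq[OF i0] ultrametric_seq.p by blast
  define r where "r = 1 / R"
  have r: "r > 0" "R * r = 1" unfolding r_def using R by auto
  have fn: "cmod (complex_of_real (f n)) \<le> 1" for n using f_nonneg[of n] f_le1[of n] by simp
  have Fb: "cmod (F n) \<le> R ^ n * C" for n
  proof -
    have "cmod (F n) \<le> R ^ n * C * 1" unfolding F_def norm_mult norm_power
      using Qb[of n] fn[of n] R order_trans[OF norm_ge_zero Qb[of n]] by (intro mult_mono) auto
    then show ?thesis by simp
  qed
  define L where "L = Abs_fps (\<lambda>n. if n = 0 then 0 else F n / of_nat n)"
  have z: "zeta_fps F = fps_exp 1 oo L" unfolding zeta_fps_def L_def ..
  have Lr: "ereal r \<le> fps_conv_radius L"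
    unfolding fps_conv_radius_def
  proof (rule conv_radius_geI_ex')
    fix s :: real assume s: "0 < s" "ereal s < ereal r"
    have "R * s < R * r" using s R by (intro mult_strict_left_mono) auto
    then have "summable (\<lambda>n. C * (R * s) ^ n)" using r s R by (intro summable_mult summable_geometric) auto
    then show "summable (\<lambda>n. fps_nth L n * of_real s ^ n)"
    proof (rule summable_comparison_test')
      fix n
      have "cmod (fps_nth L n) \<le> cmod (F n)"
        unfolding L_def by (auto simp: norm_divide divide_le_eq mult_le_cancel_left1 intro: order_trans[OF _ mult_left_mono[of 1]])
      then have "cmod (fps_nth L n) * s ^ n \<le> (R ^ n * C) * s ^ n"
        using Fb[of n] s by (intro mult_right_mono) auto
      then show "norm (fps_nth L n * of_real s ^ n) \<le> C * (R * s) ^ n"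
        using s by (simp add: norm_mult norm_power power_mult_distrib mult_ac)
    qed
  qed
  have inr: "ereal (norm w) < fps_conv_radius L" if "norm w < r" for w :: complex
    using that Lr by (metis ereal_less(2) less_ereal.simps(1) less_le_trans)
  \<comment> \<open>The zeta function as the exponential of its logarithm: holomorphic and without
    zeros on the disc of radius r.\<close>
  define h where "h w = exp (eval_fps L w)" for w
  have h_exp: "h has_fps_expansion zeta_fps F"
  proof -
    have "fps_conv_radius L > 0" using inr[of 0] r by (simp add: zero_ereal_def)
    then have "(exp \<circ> eval_fps L) has_fps_expansion (fps_exp 1 oo L)"
      by (intro has_fps_expansion_compose has_fps_expansion_exp1 eval_fps_has_fps_expansion) (simp_all add: L_def)
    then show ?thesis unfolding z h_def o_def .
  qed
  have L_hol: "eval_fps L holomorphic_on ball 0 r"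
    by (rule holomorphic_on_eval_fps) (use inr in auto)
  have h_hol: "h holomorphic_on ball 0 r" unfolding h_def by (intro holomorphic_intros L_hol)
  have cr: "ereal r \<le> fps_conv_radius (zeta_fps F)"
    by (rule holomorphic_on_imp_fps_conv_radius_ge[OF h_exp]) (simp add: h_hol)
  have eval_zeta: "eval_fps (zeta_fps F) w = h w" if "norm w < r" for w
    by (rule has_fps_expansion_imp_eval_fps_eq[OF h_exp that h_hol])
  have h_log: "w * deriv h w / h w = (suminf (\<lambda>n. F n * w ^ n))" if w: "norm w < r" for w
  proof -
    have dL: "fps_deriv L = Abs_fps (\<lambda>n. F (Suc n))"
      unfolding L_def by (rule fps_ext) (simp add: field_simps del: of_nat_Suc)
    have "(h has_field_derivative exp (eval_fps L w) * eval_fps (fps_deriv L) w) (at w)"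
      unfolding h_def by (rule DERIV_fun_exp, rule has_field_derivative_eval_fps, rule inr[OF w])
    then have "deriv h w / h w = eval_fps (fps_deriv L) w" by (simp add: DERIV_imp_deriv h_def)
    also have "\<dots> = (suminf (\<lambda>n. F (Suc n) * w ^ n))" unfolding dL eval_fps_def by simp
    finally have 1: "w * deriv h w / h w = w * (suminf (\<lambda>n. F (Suc n) * w ^ n))" by (metis times_divide_eq_right)
    have "ereal (norm w) < fps_conv_radius (fps_deriv L)" using inr[OF w] fps_conv_radius_deriv[of L] by (rule less_le_trans)
    then have s: "summable (\<lambda>n. F (Suc n) * w ^ n)" using summable_fps[of w "fps_deriv L"] unfolding dL by simp
    have "w * (suminf (\<lambda>n. F (Suc n) * w ^ n)) = (suminf (\<lambda>n. F (Suc n) * w ^ Suc n))"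
      by (subst suminf_mult[OF s, symmetric]) (simp add: mult_ac)
    also have "\<dots> = (suminf (\<lambda>n. F n * w ^ n))"
    proof -
      have "summable (\<lambda>n. F (Suc n) * w ^ Suc n)" using summable_mult[OF s, of w] by (simp add: mult_ac)
      then have "summable (\<lambda>n. F n * w ^ n)" using summable_Suc_iff[of "\<lambda>n. F n * w ^ n"] by blast
      from suminf_split_head[OF this] show ?thesis using F0 by simp
    qed
    finally show ?thesis using 1 by simp
  qed
  \<comment> \<open>Excludes every continuation beyond the disc of radius r. It is used twice: for
    the upper bound on the radius of convergence and for the boundary itself.\<close>
  have claim: False if U: "open U" "connected U" "ball 0 r \<subset> U" "g holomorphic_on U" and g: "\<And>w. norm w < r \<Longrightarrow> g w = h w" for U g
  proof -
    have "U \<inter> frontier (ball 0 r) \<noteq> {}"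
    proof (rule connected_Int_frontier[OF U(2)])
      have "0 \<in> ball (0::complex) r" using r by simp
      then show "U \<inter> ball 0 r \<noteq> {}" using U(3) by blast
      show "U - ball 0 r \<noteq> {}" using U(3) by blast
    qed
    then have "U \<inter> sphere 0 r \<noteq> {}" unfolding frontier_ball[OF r(1)] .
    then obtain z0 where "z0 \<in> U" "z0 \<in> sphere 0 r" by blast
    then have z0: "z0 \<in> U" "norm z0 = r" by simp_all
    have "0 \<in> ball (0::complex) r" using r by simp
    then have g0: "0 \<in> U" using U(3) by blast
    have g0': "g 0 \<noteq> 0" using g[of 0] r by (simp add: h_def)
    \<comment> \<open>Zeros of \<open>g\<close> are isolated because \<open>g 0\<close> is not 0, so
      near \<open>z0\<close> the logarithmic derivative is continuous except perhaps at
      \<open>z0\<close> itself.\<close>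
    obtain \<rho> where \<rho>: "\<rho> > 0" "\<And>w. w \<in> ball z0 \<rho> - {z0} \<Longrightarrow> w \<in> U \<and> g w \<noteq> 0"
    proof (cases "g z0 = 0")
      case True
      obtain \<rho> where \<rho>: "0 < \<rho>" "ball z0 \<rho> \<subseteq> U" "\<And>w. w \<in> ball z0 \<rho> - {z0} \<Longrightarrow> g w \<noteq> 0"
        using isolated_zeros[OF U(4,1,2) z0(1) True g0 g0'] by blast
      show ?thesis by (rule that[OF \<rho>(1)]) (use \<rho>(2,3) in blast)
    next
      case False
      have "isCont g z0"
        using holomorphic_on_imp_continuous_on[OF U(4)] z0(1) by (simp add: continuous_on_eq_continuous_at[OF U(1)])
      then have "eventually (\<lambda>w. g w \<noteq> 0) (at z0)" using False unfolding isCont_def by (rule tendsto_imp_eventually_ne)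
      then have "eventually (\<lambda>w. g w \<noteq> 0) (nhds z0)" using False by (simp add: eventually_nhds_conv_at)
      moreover have "eventually (\<lambda>w. w \<in> U) (nhds z0)" using U(1) z0(1) by (rule eventually_nhds_in_open)
      ultimately have "eventually (\<lambda>w. w \<in> U \<and> g w \<noteq> 0) (nhds z0)" by (simp add: eventually_conj)
      then obtain \<rho> where \<rho>: "\<rho> > 0" "\<And>w. dist w z0 < \<rho> \<Longrightarrow> w \<in> U \<and> g w \<noteq> 0"
        unfolding eventually_nhds_metric by blast
      show ?thesis by (rule that[OF \<rho>(1)]) (use \<rho>(2) in \<open>simp add: dist_commute\<close>)
    qed
    obtain E1 where E1: "\<And>e c. e \<ge> E1 \<Longrightarrow> c ^ (q ^ Suc e) = (1::complex) \<Longrightarrow> c ^ (q ^ e) \<noteq> 1 \<Longrightarrow>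
     \<not> (abel_mean (\<lambda>n. complex_of_real (f n) * c ^ n) \<longlongrightarrow> 0) (at_left 1)"
      using abel_mean_twisted_nonzero_eventually[OF i0 q_def] by blast
    define u where "u = z0 / of_real r"
    have z0u: "z0 = of_real r * u" unfolding u_def using r by simp
    have nu: "norm u = 1" unfolding u_def using z0(2) r by (simp add: norm_divide)
    obtain E2 where E2: "\<And>e. e \<ge> E2 \<Longrightarrow> \<exists>c. c ^ (q ^ Suc e) = 1 \<and> c ^ (q ^ e) \<noteq> 1 \<and> dist c u < \<rho> / r"
      using primitive_roots_dense[OF q_prime nu, of "\<rho> / r"] \<rho>(1) r by auto
    \<comment> \<open>c has to avoid the point u. If the root of order q ^ (e + 1) equals u, the one
      of order q ^ (e + 2) does not.\<close>
    obtain e c where c: "e \<ge> E1" "c ^ (q ^ Suc e) = 1" "c ^ (q ^ e) \<noteq> 1" "dist c u < \<rho> / r" "c \<noteq> u"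
    proof -
      define e where "e = max E1 E2"
      have E2': "E2 \<le> Suc e" unfolding e_def by simp
      obtain c where c: "c ^ (q ^ Suc e) = 1" "c ^ (q ^ e) \<noteq> 1" "dist c u < \<rho> / r" using E2[of e] unfolding e_def by auto
      obtain c' where c': "c' ^ (q ^ Suc (Suc e)) = 1" "c' ^ (q ^ Suc e) \<noteq> 1" "dist c' u < \<rho> / r"
        using E2[of "Suc e"] E2' by blast
      have "c \<noteq> c'" using c(1) c'(2) by metis
      then show ?thesis using that[of e c] that[of "Suc e" c'] c c' unfolding e_def by (cases "c = u") auto
    qed
    define z1 where "z1 = of_real r * c"
    have nc: "norm c = 1"
    proof -
      have "norm c ^ (q ^ Suc e) = 1" using c(2) by (metis norm_one norm_power)
      moreover have "q ^ Suc e > 0" using prime_gt_0_nat[OF q_prime] by simp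
      ultimately show ?thesis using power_eq_imp_eq_base[of "norm c" "q ^ Suc e" 1] by simp
    qed
    have "dist z0 z1 = r * dist c u" unfolding z0u z1_def using r by (simp add: dist_norm norm_mult norm_minus_commute flip: right_diff_distrib)
    also have "\<dots> < \<rho>" using c(4) r by (simp add: pos_less_divide_eq mult.commute)
    finally have "z1 \<in> ball z0 \<rho> - {z0}" using c(5) r unfolding z0u z1_def by auto
    then have z1: "z1 \<in> U" "g z1 \<noteq> 0" using \<rho>(2) by blast+
    define G where "G w = w * deriv g w / g w" for w
    have "isCont G z1"
    proof -
      have "isCont g z1" "isCont (deriv g) z1"
        using holomorphic_on_imp_continuous_on[OF U(4)] holomorphic_on_imp_continuous_on[OF holomorphic_deriv[OF U(4,1)]] U(1) z1(1)
        by (auto simp: continuous_on_eq_continuous_at)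
      then show ?thesis unfolding G_def using z1(2) by (intro continuous_intros)
    qed
    moreover have "((\<lambda>t. complex_of_real t * z1) \<longlongrightarrow> complex_of_real 1 * z1) (at_left 1)" by (intro tendsto_intros)
    ultimately have "((\<lambda>t. G (complex_of_real t * z1)) \<longlongrightarrow> G z1) (at_left 1)" using isCont_tendsto_compose[of z1 G] by simp
    then have "((\<lambda>t. complex_of_real (1 - t) * G (complex_of_real t * z1)) \<longlongrightarrow> complex_of_real (1 - 1) * G z1) (at_left 1)"
      by (intro tendsto_intros)
    \<comment> \<open>On the ray to \<open>z1\<close> the factors R ^ n and r ^ n cancel, since R r
      = 1.\<close>
    moreover have "eventually (\<lambda>t. complex_of_real (1 - t) * G (complex_of_real t * z1) = abel_mean (\<lambda>n. Q n * complex_of_real (f n) * c ^ n) t) (at_left 1)"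
      using eventually_at_left_1
    proof eventually_elim
      case (elim t)
      define w where "w = complex_of_real t * z1"
      have w: "norm w < r" unfolding w_def z1_def using elim r nc by (simp add: norm_mult)
      have "eventually (\<lambda>x. g x = h x) (nhds w)"
        using eventually_nhds_in_open[of "ball 0 r" w] w by (auto elim!: eventually_mono simp: g)
      then have "deriv g w = deriv h w" by (rule deriv_cong_ev) simp
      then have "G w = (suminf (\<lambda>n. F n * w ^ n))" unfolding G_def g[OF w] using h_log[OF w] by simp
      also have "(\<lambda>n. F n * w ^ n) = (\<lambda>n. t ^ n *\<^sub>R (Q n * complex_of_real (f n) * c ^ n))"
      proof
        fix n
        have "F n * w ^ n = complex_of_real ((R * r) ^ n) * (t ^ n *\<^sub>R (Q n * complex_of_real (f n) * c ^ n))"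
          unfolding F_def w_def z1_def by (simp add: power_mult_distrib scaleR_conv_of_real mult_ac)
        then show "F n * w ^ n = t ^ n *\<^sub>R (Q n * complex_of_real (f n) * c ^ n)" unfolding r(2) by simp
      qed
      finally have "G w = suminf (\<lambda>n. t ^ n *\<^sub>R (Q n * complex_of_real (f n) * c ^ n))" .
      then show ?case unfolding abel_mean_def w_def scaleR_conv_of_real by (simp only:)
    qed
    ultimately have "(abel_mean (\<lambda>n. Q n * complex_of_real (f n) * c ^ n) \<longlongrightarrow> complex_of_real (1 - 1) * G z1) (at_left 1)"
      by (rule Lim_transform_eventually)
    then have l1: "(abel_mean (\<lambda>n. Q n * complex_of_real (f n) * c ^ n) \<longlongrightarrow> 0) (at_left 1)" by simp
    \<comment> \<open>Replacing \<open>Q n\<close> by 1 costs a summable error, which disappears in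
      the limit of Abel means.\<close>
    define v where "v n = (1 - Q n) * complex_of_real (f n) * c ^ n" for n
    have nv: "norm (v n) \<le> cmod (Q n - 1)" for n
      unfolding v_def norm_mult norm_power nc using fn[of n] by (simp add: norm_minus_commute mult_left_le)
    have "summable (\<lambda>n. cmod (Q n - 1))" unfolding Q_def by (rule summable_prod_one_minus_powers[OF Z])
    then have sv: "summable (\<lambda>n. norm (v n))"
      by (rule summable_comparison_test'[where N = 0]) (use nv in simp)
    have "((\<lambda>t. abel_mean (\<lambda>n. Q n * complex_of_real (f n) * c ^ n) t + abel_mean v t) \<longlongrightarrow> 0 + 0) (at_left 1)"
      by (intro tendsto_add l1 abel_mean_summable[OF sv])
    moreover have "eventually (\<lambda>t. abel_mean (\<lambda>n. Q n * complex_of_real (f n) * c ^ n) t + abel_mean v t = abel_mean (\<lambda>n. complex_of_real (f n) * c ^ n) t) (at_left 1)"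
      using eventually_at_left_1
    proof eventually_elim
      case (elim t)
      have "abel_mean (\<lambda>n. complex_of_real (f n) * c ^ n) t = abel_mean (\<lambda>n. Q n * complex_of_real (f n) * c ^ n + v n) t"
        unfolding v_def by (simp add: algebra_simps)
      also have "\<dots> = abel_mean (\<lambda>n. Q n * complex_of_real (f n) * c ^ n) t + abel_mean v t"
      proof (rule abel_mean_add)
        show "norm (Q n * complex_of_real (f n) * c ^ n) \<le> C * 1 * 1" for n
          unfolding norm_mult norm_power nc using Qb[of n] fn[of n] order_trans[OF norm_ge_zero Qb[of n]] by (intro mult_mono) auto
        show "norm (v n) \<le> C + 1" for n
          using nv[of n] Qb[of n] norm_triangle_ineq4[of "Q n" 1] by simp
      qed (use elim in auto)
      finally show ?case by simp
    qed
    ultimately have "(abel_mean (\<lambda>n. complex_of_real (f n) * c ^ n) \<longlongrightarrow> 0) (at_left 1)"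
      by (simp cong: filterlim_cong)
    then show False using E1[OF c(1-3)] by blast
  qed
  \<comment> \<open>With a larger radius the series would be its own continuation.\<close>
  have crle: "fps_conv_radius (zeta_fps F) \<le> ereal r"
  proof (rule ccontr)
    assume gt: "\<not> fps_conv_radius (zeta_fps F) \<le> ereal r"
    show False
    proof (rule claim)
      show "open (eball 0 (fps_conv_radius (zeta_fps F)))" by simp
      show "connected (eball (0::complex) (fps_conv_radius (zeta_fps F)))" by (rule connected_eball)
      show "eval_fps (zeta_fps F) holomorphic_on eball 0 (fps_conv_radius (zeta_fps F))" by (rule holomorphic_on_eval_fps) simp
      have "complex_of_real r \<in> eball 0 (fps_conv_radius (zeta_fps F)) - ball 0 r" using gt r by simp
      moreover have "ball 0 r \<subseteq> eball 0 (fps_conv_radius (zeta_fps F))" by (rule ball_eball_mono[OF cr])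
      ultimately show "ball 0 r \<subset> eball (0::complex) (fps_conv_radius (zeta_fps F))" by blast
    qed (rule eval_zeta)
  qed
  with cr have cre: "fps_conv_radius (zeta_fps F) = ereal r" by (rule antisym[rotated])
  have "has_natural_boundary (zeta_fps F)"
    unfolding has_natural_boundary_def cre eball_ereal
  proof (intro conjI notI)
    show "0 < ereal r" "ereal r < \<infinity>" using r by (simp_all add: zero_ereal_def)
    assume "\<exists>U g. open U \<and> connected U \<and> ball 0 r \<subset> U \<and> g holomorphic_on U \<and> (\<forall>z\<in>ball 0 r. g z = eval_fps (zeta_fps F) z)"
    then obtain U g where U: "open U" "connected U" "ball 0 r \<subset> U" "g holomorphic_on U"
      and g: "\<forall>z\<in>ball 0 r. g z = eval_fps (zeta_fps F) z" by (elim exE conjE)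
    show False by (rule claim[OF U]) (use g eval_zeta in simp)
  qed
  then show ?thesis unfolding F_def Q_def .
qed

end

section \<open>The zeta function of the automorphism\<close>

theorem theorem15:
  fixes \<theta> :: "'a::{topological_ab_group_add, t2_space} \<Rightarrow> 'a"
    and \<mu> :: "'a measure"
    and d k :: nat
    and \<xi> :: "nat \<Rightarrow> 'k::field_char_0"
    and T S :: "nat \<Rightarrow> ('k \<Rightarrow> real) set"
  assumes "compact (UNIV :: 'a set)" and "connected (UNIV :: 'a set)"
    and "has_group_dim TYPE('a) d" and "d \<ge> 1"
    and "top_group_automorphism \<theta>"
    and "haar_prob_measure \<mu>" and "ergodic \<mu> \<theta>"
    and "attached_generators \<theta> k \<xi>"
    and "\<And>j n. j < k \<Longrightarrow> n \<ge> 1 \<Longrightarrow> \<xi> j ^ n \<noteq> 1"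
    and "\<And>j. j < k \<Longrightarrow> T j \<subseteq> finite_places (rat_adjoin (\<xi> j))"
    and "\<And>j v. j < k \<Longrightarrow> v \<in> T j \<Longrightarrow> v (\<xi> j) = 1"
    and "\<And>n. n \<ge> 1 \<Longrightarrow> finite (periodic_points \<theta> n)"
    and "\<And>n. n \<ge> 1 \<Longrightarrow>
           real (card (periodic_points \<theta> n)) = (\<Prod>j<k. inverse (places_abs (T j) (\<xi> j ^ n - 1)))"
    and "\<And>j. j < k \<Longrightarrow> S j = finite_places (rat_adjoin (\<xi> j)) - T j"
    and "\<And>j. j < k \<Longrightarrow> finite (S j)"
    and "\<And>j v. j < k \<Longrightarrow> v \<in> infinite_places (rat_adjoin (\<xi> j)) \<Longrightarrow> v (\<xi> j) \<noteq> 1"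
  shows "(rational_fps (dyn_zeta \<theta>) \<or> has_natural_boundary (dyn_zeta \<theta>)) \<and>
         (has_natural_boundary (dyn_zeta \<theta>) \<longleftrightarrow> (\<exists>j<k. \<exists>v\<in>S j. v (\<xi> j) = 1))"
proof -
  have alg: "algebraic (\<xi> j)" if "j < k" for j
    using assms(8) that unfolding attached_generators_def composition_factor_generators_def by blast
  note count = assms(13)
  define factor where "factor j R Z \<tau> \<longleftrightarrow> R > 0 \<and> finite (Z :: complex set) \<and> (\<forall>\<rho>\<in>Z. cmod (\<tau> \<rho>) < 1) \<and>
      (\<forall>n\<ge>1. complex_of_real (inverse (places_abs (T j) (\<xi> j ^ n - 1))) =
        complex_of_real R ^ n * (\<Prod>\<rho>\<in>Z. 1 - \<tau> \<rho> ^ n) *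
        complex_of_real (\<Prod>P\<in>{P\<in>S j. P (\<xi> j) = 1}. P (\<xi> j ^ n - 1)))" for j R Z \<tau>
  have ex: "\<exists>R Z \<tau>. factor j R Z \<tau>" if j: "j < k" for j
    unfolding factor_def
    by (rule factor_sequence(1)[where \<xi> = "\<xi> j" and T = "T j" and S = "S j",
        OF alg[OF j] _ assms(10)[OF j] assms(14)[OF j] assms(15)[OF j]])
      (use assms(9)[OF j] assms(16)[OF j] in blast)+
  \<comment> \<open>The three objects are packed into one tuple, so that a single choice over j
    suffices.\<close>
  have "\<forall>j. \<exists>x. j < k \<longrightarrow> factor j (fst x) (fst (snd x)) (snd (snd x))"
  proof
    fix j
    show "\<exists>x. j < k \<longrightarrow> factor j (fst x) (fst (snd x)) (snd (snd x))"
    proof (cases "j < k")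
      case True
      obtain R Z \<tau> where "factor j R Z \<tau>" using ex[OF True] by (elim exE)
      then show ?thesis by (intro exI[of _ "(R, Z, \<tau>)"]) simp
    qed simp
  qed
  from choice[OF this] obtain x where x: "\<And>j. j < k \<Longrightarrow> factor j (fst (x j)) (fst (snd (x j))) (snd (snd (x j)))"
    by (elim exE) blast
  define R where "R j = fst (x j)" for j
  define Z where "Z j = fst (snd (x j))" for j
  define \<tau> where "\<tau> j = snd (snd (x j))" for j
  have F: "factor j (R j) (Z j) (\<tau> j)" if "j < k" for j
    unfolding R_def Z_def \<tau>_def by (rule x[OF that])
  \<comment> \<open>Pairs count a place separately for each j, since composition factors may
    repeat.\<close>
  define I where "I = (SIGMA j:{..<k}. {v\<in>S j. v (\<xi> j) = 1})"
  define a where "a i n = snd i (\<xi> (fst i) ^ n - 1)" for i :: "nat \<times> ('k \<Rightarrow> real)" and n :: nat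
  have "\<forall>i\<in>I. \<exists>y. ultrametric_seq (fst y) (a i) (snd y)"
  proof
    fix i assume i: "i \<in> I"
    obtain j v where jv: "i = (j, v)" "j < k" "v \<in> S j" "v (\<xi> j) = 1" using i unfolding I_def by auto
    have "\<exists>p m. ultrametric_seq p (\<lambda>n. v (\<xi> j ^ n - 1)) m"
      by (rule factor_sequence(2)[where \<xi> = "\<xi> j" and T = "T j" and S = "S j",
        OF alg[OF jv(2)] _ assms(10)[OF jv(2)] assms(14)[OF jv(2)] assms(15)[OF jv(2)] _ jv(3,4)])
        (use assms(9)[OF jv(2)] assms(16)[OF jv(2)] in blast)+
    then obtain p m where "ultrametric_seq p (a i) m" unfolding a_def jv(1) by auto
    then show "\<exists>y. ultrametric_seq (fst y) (a i) (snd y)" by (intro exI[of _ "(p, m)"]) simp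
  qed
  from bchoice[OF this] obtain y where y: "\<forall>i\<in>I. ultrametric_seq (fst (y i)) (a i) (snd (y i))" by (elim exE)
  have finI: "finite I" unfolding I_def using assms(15) by (intro finite_SigmaI) auto
  interpret ultrametric_family I "\<lambda>i. fst (y i)" a "\<lambda>i. snd (y i)"
    by (rule ultrametric_family.intro[OF finI bspec[OF y]])
  define ZZ where "ZZ = (SIGMA j:{..<k}. Z j)"
  define \<tau>' where "\<tau>' i = \<tau> (fst i) (snd i)" for i
  define RR where "RR = (\<Prod>j<k. R j)"
  have RR: "RR > 0" unfolding RR_def using F unfolding factor_def by (intro prod_pos) auto
  have ZZ: "finite ZZ" unfolding ZZ_def using F unfolding factor_def by (intro finite_SigmaI) auto
  have tau: "cmod (\<tau>' i) < 1" if "i \<in> ZZ" for i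
    using that F[of "fst i"] unfolding factor_def ZZ_def \<tau>'_def by auto
  have main: "of_nat (card (periodic_points \<theta> n)) =
      complex_of_real RR ^ n * (\<Prod>i\<in>ZZ. 1 - \<tau>' i ^ n) * complex_of_real (f n)" if n: "n \<ge> 1" for n
  proof -
    have "complex_of_real (real (card (periodic_points \<theta> n))) =
        (\<Prod>j<k. complex_of_real (inverse (places_abs (T j) (\<xi> j ^ n - 1))))"
      unfolding count[OF n] by (rule of_real_prod)
    also have "\<dots> = (\<Prod>j<k. complex_of_real (R j) ^ n * (\<Prod>\<rho>\<in>Z j. 1 - \<tau> j \<rho> ^ n) *
        complex_of_real (\<Prod>v\<in>{v\<in>S j. v (\<xi> j) = 1}. v (\<xi> j ^ n - 1)))"
    proof (rule prod.cong[OF refl])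
      fix j assume "j \<in> {..<k}"
      then have "j < k" by simp
      then show "complex_of_real (inverse (places_abs (T j) (\<xi> j ^ n - 1))) =
        complex_of_real (R j) ^ n * (\<Prod>\<rho>\<in>Z j. 1 - \<tau> j \<rho> ^ n) *
        complex_of_real (\<Prod>v\<in>{v\<in>S j. v (\<xi> j) = 1}. v (\<xi> j ^ n - 1))"
        using F[of j] n unfolding factor_def by blast
    qed
    also have "\<dots> = (\<Prod>j<k. complex_of_real (R j)) ^ n * (\<Prod>j<k. \<Prod>\<rho>\<in>Z j. 1 - \<tau> j \<rho> ^ n) *
        complex_of_real (\<Prod>j<k. \<Prod>v\<in>{v\<in>S j. v (\<xi> j) = 1}. v (\<xi> j ^ n - 1))"
      by (simp only: prod.distrib prod_power_distrib of_real_prod)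
    also have "(\<Prod>j<k. complex_of_real (R j)) = complex_of_real RR" unfolding RR_def by simp
    also have "(\<Prod>j<k. \<Prod>\<rho>\<in>Z j. 1 - \<tau> j \<rho> ^ n) = (\<Prod>i\<in>ZZ. 1 - \<tau>' i ^ n)"
      unfolding ZZ_def \<tau>'_def by (subst prod.Sigma) (use F in \<open>auto simp: factor_def case_prod_beta\<close>)
    also have "(\<Prod>j<k. \<Prod>v\<in>{v\<in>S j. v (\<xi> j) = 1}. v (\<xi> j ^ n - 1)) = f n"
      unfolding f_def unfolding I_def a_def by (subst prod.Sigma) (use assms(15) in \<open>auto simp: case_prod_beta\<close>)
    finally show ?thesis by simp
  qed
  define G where "G n = complex_of_real RR ^ n * (\<Prod>i\<in>ZZ. 1 - \<tau>' i ^ n) * complex_of_real (f n)" for n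
  have zeta: "dyn_zeta \<theta> = zeta_fps G"
  proof -
    have "dyn_zeta \<theta> = zeta_fps (\<lambda>n. of_nat (card (periodic_points \<theta> n)))"
      unfolding dyn_zeta_def zeta_fps_def ..
    also have "\<dots> = zeta_fps G" by (rule zeta_fps_cong) (use main in \<open>simp add: G_def\<close>)
    finally show ?thesis .
  qed
  have I_empty: "(\<exists>j<k. \<exists>v\<in>S j. v (\<xi> j) = 1) \<longleftrightarrow> I \<noteq> {}" unfolding I_def by auto
  show ?thesis
  proof (cases "I = {}")
    case True
    then have "G = (\<lambda>n. complex_of_real RR ^ n * (\<Prod>i\<in>ZZ. 1 - \<tau>' i ^ n))" unfolding G_def f_def by simp
    then have "rational_fps (dyn_zeta \<theta>)" unfolding zeta using rational_zeta_product[OF ZZ] by simp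
    then show ?thesis using rational_fps_no_natural_boundary I_empty True by blast
  next
    case False
    then obtain i0 where "i0 \<in> I" by blast
    from zeta_natural_boundary[OF this RR ZZ tau] have "has_natural_boundary (dyn_zeta \<theta>)"
      unfolding zeta G_def by simp
    then show ?thesis using I_empty False by blast
  qed
qed

end
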